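(* Assume that $\lambda_j>0$ for every $j=1,2,\dots,n$. Then $$S^{(0)}=\frac{|\lambda_1|\cdots|\lambda_n|}{2\pi^{n+1}}\,n!\,I^{(0)}_{\varphi_-}\quad\text{on }L^2(H_{n+1}).$$
   Context: Let $n\ge1$, $\lambda_1,\dots,\lambda_n\in\mathbb R$. Coordinates on $H_{n+1}=\mathbb C^n\times\mathbb R$ are $x=(z,x_{2n+1})=(x_1,\dots,x_{2n+1})$, $z_j=x_{2j-1}+ix_{2j}$; a second point is written $y=(w,y_{2n+1})$. The CR structure $T^{1,0}H_{n+1}$ is spanned by $Z_j=\frac{\partial}{\partial z_j}-i\lambda_j\overline z_j\frac{\partial}{\partial x_{2n+1}}$, $j=1,\dots,n$, and $\overline Z_j=\frac{\partial}{\partial\overline z_j}+i\lambda_jz_j\frac{\partial}{\partial x_{2n+1}}$. The Hermitian metric is such that $T=-\frac{\partial}{\partial x_{2n+1}}$, $T^{1,0}H_{n+1}$, $T^{0,1}H_{n+1}$ are mutually orthogonal and the $Z_j$ (and the $\overline Z_j$) are orthonormal, so the forms $d\overline z^J$ are orthonormal. The volume form is $d\mu_{H_{n+1}}=2^n\,dx_1\cdots dx_{2n+1}$, and $L^2(H_{n+1})=L^2_{(0,0)}(H_{n+1})$, with inner product $(u|v)=\int u\overline v\,d\mu_{H_{n+1}}$. $\overline\partial_b u=\sum_j(\overline Z_ju)\,d\overline z_j$ on functions (with $\overline\partial_bu=\sum'_J\sum_j(\overline Z_ju_J)d\overline z_j\wedge d\overline z^J$ on forms), extended to $L^2$ with maximal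 domain $\{u\in L^2:\overline\partial_bu\in L^2\}$ (in the sense of distributions); $\overline\partial_b^*$ is its Hilbert space adjoint; $\Box^{(0)}_b=\overline\partial_b^*\overline\partial_b$ with domain $\{u\in\mathrm{Dom}\,\overline\partial_b:\overline\partial_bu\in\mathrm{Dom}\,\overline\partial_b^*\}$. The Szegő projection $S^{(0)}:L^2(H_{n+1})\to\mathrm{Ker}\,\Box^{(0)}_b$ is the orthogonal projection. Put $$\varphi_-(x,y)=-x_{2n+1}+y_{2n+1}+i\sum_{j=1}^n|\lambda_j||z_j-w_j|^2+i\sum_{j=1}^n\lambda_j(\overline z_jw_j-z_j\overline w_j).$$ For $u\in C^\infty_0(H_{n+1})$ define $$(I^{(0)}_{\varphi_-}u)(x)=\lim_{\varepsilon\to0^+}\int_{H_{n+1}}\frac{1}{\bigl(-i(\varphi_-(x,y)+i\varepsilon)\bigr)^{n+1}}u(y)\,d\mu_{H_{n+1}}(y),$$ where the limit exists for every $x$ and defines a smooth function. When all $\lambda_j\neq0$, the operator $I^{(0)}_{\varphi_-}$ satisfies $\|I^{(0)}_{\varphi_-}u\|\le C\|u\|$ on $C_0^\infty(H_{n+1})$ for some constant $C>0$, and $I^{(0)}_{\varphi_-}:L^2(H_{n+1})\to L^2(H_{n+1})$ denotes its unique continuous extension. *)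

theory Defs
  imports "HOL-Analysis.Analysis"
begin

text \<open>
  The space $H_{n+1} = C^n \times R$, with \<open>n = CARD('n)\<close>. A point is \<open>(z, t)\<close>, where \<open>t\<close> is the
  last coordinate $x_{2n+1}$ and \<open>z $ j\<close> is $x_{2j-1} + i x_{2j}$.
\<close>

type_synonym 'n heis = "(complex ^ 'n) \<times> real"

definition heis_vol :: "('n::finite) heis measure" where
  "heis_vol = density lborel (\<lambda>_. 2 ^ CARD('n))"


subsection \<open>Square-integrable functions and forms\<close>

text \<open>
  Elements of $L^2$ are represented by functions, and equality in $L^2$ is equality almost
  everywhere. A (0,1)-form $\sum_j f_j d\overline z_j$ is represented by the function with
  components \<open>f x $ j\<close>; as the $d\overline z_j$ are orthonormal, its pointwise norm is the
  Euclidean one.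
\<close>

definition L2 :: "(('n::finite) heis \<Rightarrow> 'b::euclidean_space) set" where
  "L2 = {u. u \<in> borel_measurable heis_vol \<and> integrable heis_vol (\<lambda>x. (norm (u x))\<^sup>2)}"

definition L2_inner :: "(('n::finite) heis \<Rightarrow> complex) \<Rightarrow> ('n heis \<Rightarrow> complex) \<Rightarrow> complex" where
  "L2_inner u v = (\<integral>x. u x * cnj (v x) \<partial>heis_vol)"

definition L2_form_inner ::
    "(('n::finite) heis \<Rightarrow> complex ^ 'n) \<Rightarrow> ('n heis \<Rightarrow> complex ^ 'n) \<Rightarrow> complex" where
  "L2_form_inner f g = (\<integral>x. (\<Sum>j\<in>UNIV. f x $ j * cnj (g x $ j)) \<partial>heis_vol)"

text \<open>Only meaningful for \<open>u \<in> L2\<close>: the Bochner integral of a non-integrable function is 0.\<close>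

definition L2_norm :: "(('n::finite) heis \<Rightarrow> complex) \<Rightarrow> real" where
  "L2_norm u = sqrt (\<integral>x. (norm (u x))\<^sup>2 \<partial>heis_vol)"

definition L2_tendsto :: "(nat \<Rightarrow> ('n::finite) heis \<Rightarrow> complex) \<Rightarrow> ('n heis \<Rightarrow> complex) \<Rightarrow> bool" where
  "L2_tendsto U u \<longleftrightarrow> (\<lambda>k. L2_norm (\<lambda>x. U k x - u x)) \<longlonglongrightarrow> 0"


subsection \<open>Test functions\<close>

primrec Ck :: "nat \<Rightarrow> ('a::euclidean_space \<Rightarrow> complex) \<Rightarrow> bool" where
  "Ck 0 f \<longleftrightarrow> continuous_on UNIV f"
| "Ck (Suc k) f \<longleftrightarrow>
     (\<forall>x. f differentiable (at x)) \<and> (\<forall>v. Ck k (\<lambda>x. frechet_derivative f (at x) v))"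

definition test_fun :: "('a::euclidean_space \<Rightarrow> complex) \<Rightarrow> bool" where
  "test_fun f \<longleftrightarrow> (\<forall>k. Ck k f) \<and> compact (closure {x. f x \<noteq> 0})"


subsection \<open>The tangential Cauchy-Riemann operator and the Kohn Laplacian\<close>

text \<open>
  $\overline Z_j = \partial/\partial\overline z_j + i \lambda_j z_j \partial/\partial x_{2n+1}$, with
  $\partial/\partial\overline z_j = (\partial/\partial x_{2j-1} + i \partial/\partial x_{2j})/2$.
\<close>

definition Zbar :: "(real ^ 'n::finite) \<Rightarrow> 'n \<Rightarrow> ('n heis \<Rightarrow> complex) \<Rightarrow> 'n heis \<Rightarrow> complex" where
  "Zbar lam j f x =
     (frechet_derivative f (at x) (axis j 1, 0)
        + \<i> * frechet_derivative f (at x) (axis j \<i>, 0)) / 2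
     + \<i> * of_real (lam $ j) * (fst x $ j) * frechet_derivative f (at x) (0, 1)"

text \<open>
  Unbounded operators on $L^2$ are given by their graphs, which are closed under changing functions
  on null sets. \<open>dbar_b lam u f\<close> says that \<open>u\<close> is in the maximal domain and
  $\overline\partial_b u = f$, i.e. $\overline Z_j u = f_j$ in the sense of distributions. The
  coefficient $z_j$ does not depend on $x_{2n+1}$, so the formal transpose of $\overline Z_j$ is
  $-\overline Z_j$.
\<close>

definition dbar_b ::
    "(real ^ 'n::finite) \<Rightarrow> ('n heis \<Rightarrow> complex) \<Rightarrow> ('n heis \<Rightarrow> complex ^ 'n) \<Rightarrow> bool" where
  "dbar_b lam u f \<longleftrightarrow> u \<in> L2 \<and> f \<in> L2 \<and>
     (\<forall>j. \<forall>\<phi>. test_fun \<phi> \<longrightarrow>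
        (\<integral>x. (f x $ j) * \<phi> x \<partial>heis_vol) = - (\<integral>x. u x * Zbar lam j \<phi> x \<partial>heis_vol))"

text \<open>\<open>f\<close> is in the domain of the Hilbert space adjoint of \<open>dbar_b lam\<close>, which maps it to \<open>v\<close>.\<close>

definition dbar_b_adj ::
    "(real ^ 'n::finite) \<Rightarrow> ('n heis \<Rightarrow> complex ^ 'n) \<Rightarrow> ('n heis \<Rightarrow> complex) \<Rightarrow> bool" where
  "dbar_b_adj lam f v \<longleftrightarrow> f \<in> L2 \<and> v \<in> L2 \<and>
     (\<forall>u g. dbar_b lam u g \<longrightarrow> L2_form_inner g f = L2_inner u v)"

definition box_b ::
    "(real ^ 'n::finite) \<Rightarrow> ('n heis \<Rightarrow> complex) \<Rightarrow> ('n heis \<Rightarrow> complex) \<Rightarrow> bool" where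
  "box_b lam u v \<longleftrightarrow> (\<exists>f. dbar_b lam u f \<and> dbar_b_adj lam f v)"

definition ker_box_b :: "(real ^ 'n::finite) \<Rightarrow> ('n heis \<Rightarrow> complex) set" where
  "ker_box_b lam = {u. box_b lam u (\<lambda>_. 0)}"


subsection \<open>The Szeg\H{o} projection\<close>

definition orth_projection ::
    "(('n::finite) heis \<Rightarrow> complex) set \<Rightarrow> (('n heis \<Rightarrow> complex) \<Rightarrow> ('n heis \<Rightarrow> complex)) \<Rightarrow> bool" where
  "orth_projection K P \<longleftrightarrow>
     (\<forall>u\<in>L2. P u \<in> K \<and> (\<forall>g\<in>K. L2_inner (\<lambda>x. u x - P u x) g = 0))"

text \<open>
  The projection is determined up to null sets, and only on \<open>L2\<close>; the choice fixes
  representatives.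
\<close>

definition szego :: "(real ^ 'n::finite) \<Rightarrow> ('n heis \<Rightarrow> complex) \<Rightarrow> ('n heis \<Rightarrow> complex)" where
  "szego lam = (SOME P. orth_projection (ker_box_b lam) P)"


subsection \<open>The operator with phase $\varphi_-$\<close>

definition phi_minus :: "(real ^ 'n::finite) \<Rightarrow> 'n heis \<Rightarrow> 'n heis \<Rightarrow> complex" where
  "phi_minus lam x y =
     of_real (- snd x + snd y)
     + \<i> * of_real (\<Sum>j\<in>UNIV. \<bar>lam $ j\<bar> * (norm (fst x $ j - fst y $ j))\<^sup>2)
     + \<i> * (\<Sum>j\<in>UNIV. of_real (lam $ j) *
          (cnj (fst x $ j) * (fst y $ j) - (fst x $ j) * cnj (fst y $ j)))"

definition I_phi_test :: "(real ^ 'n::finite) \<Rightarrow> ('n heis \<Rightarrow> complex) \<Rightarrow> ('n heis \<Rightarrow> complex)" where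
  "I_phi_test lam u x =
     Lim (at_right (0::real))
       (\<lambda>\<epsilon>. \<integral>y. 1 / (- \<i> * (phi_minus lam x y + \<i> * of_real \<epsilon>)) ^ (CARD('n) + 1) * u y \<partial>heis_vol)"

text \<open>
  \<open>A\<close> is a continuous operator on $L^2$ that extends \<open>A0\<close>, an operator on test functions.
  Continuity includes that \<open>A\<close> respects equality almost everywhere (take a constant sequence).
\<close>

definition L2_continuous_extension ::
    "((('n::finite) heis \<Rightarrow> complex) \<Rightarrow> ('n heis \<Rightarrow> complex)) \<Rightarrow>
     (('n heis \<Rightarrow> complex) \<Rightarrow> ('n heis \<Rightarrow> complex)) \<Rightarrow> bool" where
  "L2_continuous_extension A0 A \<longleftrightarrow>
     (\<forall>u\<in>L2. A u \<in> L2) \<and>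
     (\<forall>U. \<forall>u\<in>L2. (\<forall>k. U k \<in> L2) \<and> L2_tendsto U u \<longrightarrow> L2_tendsto (\<lambda>k. A (U k)) (A u)) \<and>
     (\<forall>u. test_fun u \<longrightarrow> (AE x in heis_vol. A u x = A0 u x))"

text \<open>As test functions are dense in $L^2$, the extension is unique up to null sets.\<close>

definition I_phi :: "(real ^ 'n::finite) \<Rightarrow> ('n heis \<Rightarrow> complex) \<Rightarrow> ('n heis \<Rightarrow> complex)" where
  "I_phi lam = (SOME A. L2_continuous_extension (I_phi_test lam) A)"

end

theory Submission
  imports Defs "HOL-Probability.Sinc_Integral" "HOL-Probability.Distributions"
begin

text \<open>
  The kernel of the Kohn Laplacian consists of the square integrable weak solutions of
  $\overline Z_j u = 0$. With \<open>q(w) = \<Sum>\<^sub>j \<lambda>\<^sub>j |w\<^sub>j|\<^sup>2\<close> and the group law for which the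
  $\overline Z_j$ are left invariant, the regularised operator is
  \<open>(I\<^sub>\<epsilon> u)(x) = \<integral> u(x y) / (\<epsilon> - i s + q(w))\<^sup>n\<^sup>+\<^sup>1 dy\<close>, where \<open>y = (w, s)\<close>. Pairing a CR function \<open>g\<close>
  with the left translates of a test function \<open>u\<close> gives a smooth bounded CR function
  \<open>G(y) = \<integral> u(x) g(x y) dx\<close>, so everything reduces to the evaluation of
  \<open>\<integral> G(y) / (\<epsilon> - i s + q(w))\<^sup>n\<^sup>+\<^sup>1 dy\<close>. The product of \<open>G\<close> with a holomorphic function of the CR function
  \<open>\<zeta> = q(w) + i s\<close>, integrated over \<open>s\<close>, is holomorphic along the complex lines
  through the origin of $C^n$, hence has the mean value property on the circles \<open>e\<^sup>i\<^sup>\<theta> w\<close>. On such a circle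
  \<open>\<epsilon> - i s + q(w) = \<epsilon> + 2 q(w) - \<zeta>\<close> is a function of \<open>\<zeta>\<close>, so \<open>G(w, s)\<close> may be replaced by
  \<open>G(0, s)\<close>, with \<open>2 q(w)\<close> in place of \<open>q(w)\<close>; the integral over \<open>w\<close> is then explicit and leaves
  \<open>\<integral> G(0, s) / (\<epsilon> - i s) ds\<close> up to a constant. Circles of growing radius show that
  \<open>\<integral> G(0, s) / (\<epsilon> + i s) ds = 0\<close>, and the two kernels add up to a Poisson kernel. Therefore the suitably
  normalised \<open>I\<^sub>\<epsilon> u\<close>, which lies in the kernel, has almost the same inner products with the kernel
  as \<open>u\<close>, and converges to the projection of \<open>u\<close>.
\<close>

text \<open>The bounded function \<open>G\<close> has no decay in \<open>s\<close>, the factor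
  \<open>1 / (\<epsilon> + i s)\<close> is not integrable, and the kernel decays exactly at the
  borderline rate. Therefore every identity is proved for \<open>G\<close> times
  \<open>1 / (1 + \<delta> \<zeta>)^2\<close>, which is a function of \<open>\<zeta>\<close> and so
  compatible with the circle means; afterwards \<open>\<delta>\<close> tends to 0. Weak information
  suffices for norm convergence because the regularised functions lie in the kernel of the Laplacian
  themselves: an error bound proportional to the norm of \<open>g\<close>, uniform in
  \<open>g\<close>, may be tested on their differences. Boundedness of a singular integral is never
  estimated: the Cauchy property yields the projection of a test function, density and contraction
  yield that of every element, and the scaled projection then serves as the continuous extension of
  the operator. The constant is the inverse of \<open>2^n * 2 pi * pi^n / (2^n n! prod lam)\<close>:
  the first \<open>2^n\<close> is the density of the volume, \<open>2 pi\<close> comes from the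
  Poisson kernel, and the rest is the integral over \<open>w\<close>.\<close>

section \<open>The Hilbert space of square integrable functions and its completeness\<close>

lemma sets_heis_vol [simp, measurable_cong]: "sets heis_vol = sets borel"
  and space_heis_vol [simp]: "space heis_vol = UNIV"
  by (simp_all add: heis_vol_def)

lemma heis_vol_ennreal: "heis_vol = density lborel (\<lambda>_::'n::finite heis. ennreal (2 ^ CARD('n)))"
  by (simp add: heis_vol_def flip: ennreal_power)

lemma nn_integral_heis_vol:
  fixes f :: "'n::finite heis \<Rightarrow> ennreal"
  assumes [measurable]: "f \<in> borel_measurable borel"
  shows "(\<integral>\<^sup>+x. f x \<partial>heis_vol) = ennreal (2 ^ CARD('n)) * (\<integral>\<^sup>+x. f x \<partial>lborel)"
  by (simp add: heis_vol_ennreal nn_integral_density nn_integral_cmult)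

lemma integral_heis_vol:
  fixes f :: "'n::finite heis \<Rightarrow> 'b::{banach, second_countable_topology}"
  assumes [measurable]: "f \<in> borel_measurable borel"
  shows "(\<integral>x. f x \<partial>heis_vol) = 2 ^ CARD('n) *\<^sub>R (\<integral>x. f x \<partial>lborel)"
  unfolding heis_vol_ennreal by (subst integral_density) auto

lemma integrable_heis_vol:
  fixes f :: "'n::finite heis \<Rightarrow> 'b::{banach, second_countable_topology}"
  assumes [measurable]: "f \<in> borel_measurable borel"
  shows "integrable heis_vol f \<longleftrightarrow> integrable lborel f"
  using integrable_scaleR_right[of "inverse (2 ^ CARD('n))" lborel "\<lambda>x. 2 ^ CARD('n) *\<^sub>R f x"]
  unfolding heis_vol_ennreal by (subst integrable_density) auto

lemma sigma_finite_heis_vol: "sigma_finite_measure (heis_vol :: 'n::finite heis measure)"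
  unfolding heis_vol_ennreal
  by (subst sigma_finite_measure.sigma_finite_iff_density_finite[OF sigma_finite_lborel]) auto

interpretation heis_vol: sigma_finite_measure heis_vol
  by (rule sigma_finite_heis_vol)

interpretation heis_vol2: pair_sigma_finite heis_vol heis_vol ..

lemma L2_measurable [measurable_dest]: "u \<in> L2 \<Longrightarrow> u \<in> borel_measurable borel"
  by (auto simp: L2_def)

lemma L2_integrable: "u \<in> L2 \<Longrightarrow> integrable heis_vol (\<lambda>x. (norm (u x))\<^sup>2)"
  by (simp add: L2_def)

lemma L2_I: "u \<in> borel_measurable borel \<Longrightarrow> integrable heis_vol (\<lambda>x. (norm (u x))\<^sup>2) \<Longrightarrow> u \<in> L2"
  by (simp add: L2_def)

lemma L2_norm_nonneg [simp]: "0 \<le> L2_norm u"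
  by (simp add: L2_norm_def)

lemma L2_norm_sq: "(L2_norm u)\<^sup>2 = (\<integral>x. (norm (u x))\<^sup>2 \<partial>heis_vol)"
  by (simp add: L2_norm_def)

lemma nn_integral_L2_norm_sq:
  assumes "u \<in> L2"
  shows "(\<integral>\<^sup>+x. (ennreal (norm (u x)))\<^sup>2 \<partial>heis_vol) = ennreal ((L2_norm u)\<^sup>2)"
  using nn_integral_eq_integral[OF L2_integrable[OF assms]]
  by (simp add: L2_norm_sq ennreal_power)

lemma L2_norm_cong_AE:
  assumes [measurable]: "u \<in> borel_measurable borel" "v \<in> borel_measurable borel"
    and "AE x in heis_vol. u x = v x"
  shows "L2_norm u = L2_norm v"
  unfolding L2_norm_def using assms(3)
  by (intro arg_cong[of _ _ sqrt] integral_cong_AE) auto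

lemma L2_bound:
  fixes u :: "'n::finite heis \<Rightarrow> 'b::euclidean_space" and v :: "'n heis \<Rightarrow> 'c::euclidean_space"
  assumes "v \<in> L2" "u \<in> borel_measurable borel" "\<And>x. norm (u x) \<le> C * norm (v x)"
  shows "u \<in> L2"
proof (rule L2_I)
  note [measurable] = assms(1,2)
  show "integrable heis_vol (\<lambda>x. (norm (u x))\<^sup>2)"
  proof (rule Bochner_Integration.integrable_bound)
    show "integrable heis_vol (\<lambda>x. C\<^sup>2 * (norm (v x))\<^sup>2)"
      using L2_integrable[OF assms(1)] by simp
    have "(norm (u x))\<^sup>2 \<le> C\<^sup>2 * (norm (v x))\<^sup>2" for x
      using power_mono[OF assms(3), of x 2] by (simp add: power_mult_distrib)
    then show "AE x in heis_vol. norm ((norm (u x))\<^sup>2) \<le> norm (C\<^sup>2 * (norm (v x))\<^sup>2)"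
      by simp
  qed measurable
qed (rule assms)

lemma L2_scale: "u \<in> L2 \<Longrightarrow> (\<lambda>x. c * u x) \<in> L2" for u :: "'n::finite heis \<Rightarrow> complex"
  by (rule L2_bound[of u _ "norm c"]) (auto simp: norm_mult L2_measurable)

lemma borel_measurable_cnj [measurable]: "cnj \<in> borel_measurable borel"
  by (intro borel_measurable_continuous_onI continuous_intros)

lemma L2_cnj: "u \<in> L2 \<Longrightarrow> (\<lambda>x. cnj (u x)) \<in> L2"
  by (rule L2_bound[of u _ 1]) (auto intro: measurable_compose[OF L2_measurable borel_measurable_cnj])

lemma L2_norm_cnj [simp]: "L2_norm (\<lambda>x. cnj (u x)) = L2_norm u"
  by (simp add: L2_norm_def)

lemma L2_norm_minus_commute: "L2_norm (\<lambda>x. u x - v x) = L2_norm (\<lambda>x. v x - u x)"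
  by (simp add: L2_norm_def norm_minus_commute)

lemma L2_zero [simp]: "(\<lambda>_. 0) \<in> L2"
  by (simp add: L2_def)

lemma L2_add:
  fixes u v :: "'n::finite heis \<Rightarrow> complex"
  assumes "u \<in> L2" "v \<in> L2" shows "(\<lambda>x. u x + v x) \<in> L2"
proof (rule L2_I)
  note [measurable] = assms
  show "integrable heis_vol (\<lambda>x. (norm (u x + v x))\<^sup>2)"
  proof (rule Bochner_Integration.integrable_bound)
    show "integrable heis_vol (\<lambda>x. 2 * (norm (u x))\<^sup>2 + 2 * (norm (v x))\<^sup>2)"
      using assms[THEN L2_integrable] by simp
    have "(norm (u x + v x))\<^sup>2 \<le> 2 * (norm (u x))\<^sup>2 + 2 * (norm (v x))\<^sup>2" for x
    proof -
      have "(norm (u x + v x))\<^sup>2 \<le> (norm (u x) + norm (v x))\<^sup>2"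
        by (intro power_mono norm_triangle_ineq) auto
      moreover have "0 \<le> (norm (u x) - norm (v x))\<^sup>2" by simp
      ultimately show ?thesis by (simp add: power2_eq_square algebra_simps)
    qed
    then show "AE x in heis_vol. norm ((norm (u x + v x))\<^sup>2) \<le> norm (2 * (norm (u x))\<^sup>2 + 2 * (norm (v x))\<^sup>2)"
      by simp
  qed measurable
qed (use assms in auto)

lemma L2_diff:
  fixes u v :: "'n::finite heis \<Rightarrow> complex"
  assumes "u \<in> L2" "v \<in> L2" shows "(\<lambda>x. u x - v x) \<in> L2"
  using L2_add[OF assms(1) L2_scale[OF assms(2), of "-1"]] by simp

lemma L2_sum:
  fixes u :: "'i \<Rightarrow> 'n::finite heis \<Rightarrow> complex"
  assumes "\<And>i. i \<in> I \<Longrightarrow> u i \<in> L2" shows "(\<lambda>x. \<Sum>i\<in>I. u i x) \<in> L2"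
  using assms by (induction I rule: infinite_finite_induct) (auto intro: L2_add)

lemma L2_mult_integrable:
  fixes u v :: "'n::finite heis \<Rightarrow> complex"
  assumes "u \<in> L2" "v \<in> L2" shows "integrable heis_vol (\<lambda>x. u x * v x)"
proof (rule Bochner_Integration.integrable_bound)
  note [measurable] = assms
  show "integrable heis_vol (\<lambda>x. (norm (u x))\<^sup>2 + (norm (v x))\<^sup>2)"
    using assms[THEN L2_integrable] by simp
  have "norm (u x * v x) \<le> (norm (u x))\<^sup>2 + (norm (v x))\<^sup>2" for x
    using sum_squares_bound[of "norm (u x)" "norm (v x)"] mult_nonneg_nonneg[OF norm_ge_zero[of "u x"] norm_ge_zero[of "v x"]]
    unfolding norm_mult by linarith
  then show "AE x in heis_vol. norm (u x * v x) \<le> norm ((norm (u x))\<^sup>2 + (norm (v x))\<^sup>2)"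
    by simp
  show "(\<lambda>x. u x * v x) \<in> borel_measurable heis_vol" by measurable
qed

lemma L2_inner_integrable:
  "u \<in> L2 \<Longrightarrow> v \<in> L2 \<Longrightarrow> integrable heis_vol (\<lambda>x. u x * cnj (v x))"
  by (rule L2_mult_integrable[OF _ L2_cnj])

lemma L2_Cauchy_Schwarz_norm:
  fixes u v :: "'n::finite heis \<Rightarrow> complex"
  assumes "u \<in> L2" "v \<in> L2"
  shows "(\<integral>x. norm (u x * v x) \<partial>heis_vol) \<le> L2_norm u * L2_norm v"
proof -
  note [measurable] = assms
  let ?I = "\<integral>x. norm (u x * v x) \<partial>heis_vol"
  have "ennreal (?I\<^sup>2) = (\<integral>\<^sup>+x. ennreal (norm (u x)) * ennreal (norm (v x)) \<partial>heis_vol)\<^sup>2"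
    using nn_integral_eq_integral[OF integrable_norm[OF L2_mult_integrable[OF assms]]]
    by (simp add: norm_mult ennreal_mult flip: ennreal_power)
  also have "\<dots> \<le> (\<integral>\<^sup>+x. (ennreal (norm (u x)))\<^sup>2 \<partial>heis_vol) * (\<integral>\<^sup>+x. (ennreal (norm (v x)))\<^sup>2 \<partial>heis_vol)"
    by (rule Cauchy_Schwarz_nn_integral) measurable
  also have "\<dots> = ennreal ((L2_norm u * L2_norm v)\<^sup>2)"
    by (simp add: nn_integral_L2_norm_sq assms power_mult_distrib ennreal_mult)
  finally have "?I\<^sup>2 \<le> (L2_norm u * L2_norm v)\<^sup>2" by simp
  then show ?thesis by (rule power2_le_imp_le) simp
qed

text \<open>Distributional pairings with test functions are bilinear, without a conjugate, so this
  form is used alongside the one for \<open>L2_inner\<close>.\<close>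

lemma L2_Cauchy_Schwarz_mult:
  fixes u v :: "'n::finite heis \<Rightarrow> complex"
  assumes "u \<in> L2" "v \<in> L2"
  shows "norm (\<integral>x. u x * v x \<partial>heis_vol) \<le> L2_norm u * L2_norm v"
  using integral_norm_bound[of heis_vol "\<lambda>x. u x * v x"] L2_Cauchy_Schwarz_norm[OF assms] by linarith

lemma L2_Cauchy_Schwarz:
  assumes "u \<in> L2" "v \<in> L2" shows "norm (L2_inner u v) \<le> L2_norm u * L2_norm v"
  unfolding L2_inner_def using L2_Cauchy_Schwarz_mult[OF assms(1) L2_cnj[OF assms(2)]] by simp

lemma L2_inner_self: "L2_inner u u = of_real ((L2_norm u)\<^sup>2)"
  by (simp add: L2_inner_def L2_norm_sq complex_norm_square[symmetric] del: of_real_power flip: integral_complex_of_real)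

lemma L2_inner_diff_left:
  assumes "u \<in> L2" "v \<in> L2" "g \<in> L2"
  shows "L2_inner (\<lambda>x. u x - v x) g = L2_inner u g - L2_inner v g"
  unfolding L2_inner_def using assms
  by (simp add: left_diff_distrib Bochner_Integration.integral_diff L2_inner_integrable)

lemma L2_norm_triangle:
  fixes u v :: "'n::finite heis \<Rightarrow> complex"
  assumes "u \<in> L2" "v \<in> L2"
  shows "L2_norm (\<lambda>x. u x + v x) \<le> L2_norm u + L2_norm v"
proof (rule power2_le_imp_le)
  note [measurable] = assms
  have int: "integrable heis_vol (\<lambda>x. (norm (u x))\<^sup>2)" "integrable heis_vol (\<lambda>x. (norm (v x))\<^sup>2)"
      "integrable heis_vol (\<lambda>x. norm (u x * v x))" "integrable heis_vol (\<lambda>x. (norm (u x + v x))\<^sup>2)"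
    using L2_integrable[OF L2_add[OF assms]] assms by (auto intro: L2_integrable L2_mult_integrable)
  have "(L2_norm (\<lambda>x. u x + v x))\<^sup>2 = (\<integral>x. (norm (u x + v x))\<^sup>2 \<partial>heis_vol)"
    by (rule L2_norm_sq)
  also have "\<dots> \<le> (\<integral>x. (norm (u x))\<^sup>2 + (norm (v x))\<^sup>2 + 2 * norm (u x * v x) \<partial>heis_vol)"
  proof (rule integral_mono)
    show "integrable heis_vol (\<lambda>x. (norm (u x))\<^sup>2 + (norm (v x))\<^sup>2 + 2 * norm (u x * v x))"
      using int by simp
    show "(norm (u x + v x))\<^sup>2 \<le> (norm (u x))\<^sup>2 + (norm (v x))\<^sup>2 + 2 * norm (u x * v x)" for x
      using power_mono[OF norm_triangle_ineq[of "u x" "v x"], of 2]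
      by (simp add: power2_sum norm_mult)
  qed (rule int)
  also have "\<dots> = (L2_norm u)\<^sup>2 + (L2_norm v)\<^sup>2 + 2 * (\<integral>x. norm (u x * v x) \<partial>heis_vol)"
    using int by (simp add: L2_norm_sq)
  also have "\<dots> \<le> (L2_norm u + L2_norm v)\<^sup>2"
    using L2_Cauchy_Schwarz_norm[OF assms] by (simp add: power2_sum)
  finally show "(L2_norm (\<lambda>x. u x + v x))\<^sup>2 \<le> (L2_norm u + L2_norm v)\<^sup>2" .
qed simp

lemma L2_norm_triangle_diff:
  fixes u v w :: "'n::finite heis \<Rightarrow> complex"
  assumes "u \<in> L2" "v \<in> L2" "w \<in> L2"
  shows "L2_norm (\<lambda>x. u x - w x) \<le> L2_norm (\<lambda>x. u x - v x) + L2_norm (\<lambda>x. v x - w x)"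
  using L2_norm_triangle[OF L2_diff[OF assms(1,2)] L2_diff[OF assms(2,3)]] by simp

lemma L2_norm_scale: "L2_norm (\<lambda>x. c * u x) = norm c * L2_norm u"
  by (simp add: L2_norm_def norm_mult power_mult_distrib real_sqrt_mult)

lemma L2_norm_eq_0_iff:
  assumes "u \<in> L2" shows "L2_norm u = 0 \<longleftrightarrow> (AE x in heis_vol. u x = 0)"
  unfolding L2_norm_def real_sqrt_eq_0_iff
  by (subst integral_nonneg_eq_0_iff_AE) (use L2_integrable[OF assms] in auto)

lemma L2_norm_mono:
  assumes "v \<in> L2" "u \<in> borel_measurable borel" "\<And>x. norm (u x) \<le> norm (v x)"
  shows "L2_norm u \<le> L2_norm v"
proof -
  have "u \<in> L2" by (rule L2_bound[of v u 1]) (use assms in auto)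
  then show ?thesis unfolding L2_norm_def
    by (intro real_sqrt_le_mono integral_mono L2_integrable assms power_mono) auto
qed

lemma L2_tendsto_unique:
  assumes "\<And>k. U k \<in> L2" "u \<in> L2" "v \<in> L2" "L2_tendsto U u" "L2_tendsto U v"
  shows "AE x in heis_vol. u x = v x"
proof -
  have "(\<lambda>k. L2_norm (\<lambda>x. U k x - u x) + L2_norm (\<lambda>x. U k x - v x)) \<longlonglongrightarrow> 0 + 0"
    using assms(4,5) unfolding L2_tendsto_def by (intro tendsto_add)
  moreover have "L2_norm (\<lambda>x. u x - v x) \<le> L2_norm (\<lambda>x. U k x - u x) + L2_norm (\<lambda>x. U k x - v x)" for k
    using L2_norm_triangle_diff[OF assms(2) assms(1) assms(3), of k]
    by (simp add: L2_norm_minus_commute[of u])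
  ultimately have "L2_norm (\<lambda>x. u x - v x) \<le> 0"
    by (intro LIMSEQ_le_const[of _ 0]) auto
  then have "L2_norm (\<lambda>x. u x - v x) = 0"
    using L2_norm_nonneg order_antisym by blast
  then show ?thesis
    using L2_norm_eq_0_iff[OF L2_diff[OF assms(2,3)]] by simp
qed

lemma L2_tendsto_dominated:
  fixes U :: "nat \<Rightarrow> 'n::finite heis \<Rightarrow> complex"
  assumes [measurable]: "\<And>k. U k \<in> borel_measurable borel" "u \<in> borel_measurable borel"
    and w: "w \<in> L2" and bd: "\<And>k x. norm (U k x - u x) \<le> norm (w x)"
    and lim: "\<And>x. (\<lambda>k. U k x) \<longlonglongrightarrow> u x"
  shows "L2_tendsto U u"
proof -
  have "(\<lambda>k. \<integral>x. (norm (U k x - u x))\<^sup>2 \<partial>heis_vol) \<longlonglongrightarrow> (\<integral>x. 0 \<partial>(heis_vol :: 'n heis measure))"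
  proof (rule integral_dominated_convergence)
    show "integrable heis_vol (\<lambda>x. (norm (w x))\<^sup>2)" by (rule L2_integrable[OF w])
    have "(\<lambda>k. (norm (U k x - u x))\<^sup>2) \<longlonglongrightarrow> (norm (u x - u x))\<^sup>2" for x
      by (intro tendsto_intros lim)
    then show "AE x in heis_vol. (\<lambda>k. (norm (U k x - u x))\<^sup>2) \<longlonglongrightarrow> 0" by simp
    show "AE x in heis_vol. norm ((norm (U k x - u x))\<^sup>2) \<le> (norm (w x))\<^sup>2" for k
      using bd by (simp add: power_mono)
  qed measurable
  then have "(\<lambda>k. sqrt (\<integral>x. (norm (U k x - u x))\<^sup>2 \<partial>heis_vol)) \<longlonglongrightarrow> sqrt 0"
    by (intro tendsto_real_sqrt) simp
  then show ?thesis by (simp add: L2_tendsto_def L2_norm_def)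
qed

text \<open>Fatou's lemma for the squared norms. That the limit is square integrable is part of the
  conclusion, which is how completeness obtains its limit; the bound is required only from index
  \<open>N\<close> on because Cauchy estimates hold only eventually.\<close>

lemma L2_Fatou:
  fixes V :: "nat \<Rightarrow> 'n::finite heis \<Rightarrow> complex"
  assumes "\<And>k. V k \<in> L2" "v \<in> borel_measurable borel" "AE x in heis_vol. (\<lambda>k. V k x) \<longlonglongrightarrow> v x"
    and le: "\<And>k. k \<ge> N \<Longrightarrow> L2_norm (V k) \<le> B"
  shows "v \<in> L2 \<and> L2_norm v \<le> B"
proof -
  note [measurable] = assms(1,2)
  have B: "0 \<le> B" using le[of N] L2_norm_nonneg[of "V N"] by linarith
  have "(\<integral>\<^sup>+x. (ennreal (norm (v x)))\<^sup>2 \<partial>heis_vol) = (\<integral>\<^sup>+x. liminf (\<lambda>k. (ennreal (norm (V k x)))\<^sup>2) \<partial>heis_vol)"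
  proof (rule nn_integral_cong_AE)
    show "AE x in heis_vol. (ennreal (norm (v x)))\<^sup>2 = liminf (\<lambda>k. (ennreal (norm (V k x)))\<^sup>2)"
      using assms(3)
    proof (rule AE_mp, intro AE_I2 impI)
      fix x assume "(\<lambda>k. V k x) \<longlonglongrightarrow> v x"
      then have "(\<lambda>k. ennreal ((norm (V k x))\<^sup>2)) \<longlonglongrightarrow> ennreal ((norm (v x))\<^sup>2)"
        by (intro tendsto_ennrealI tendsto_intros)
      then show "(ennreal (norm (v x)))\<^sup>2 = liminf (\<lambda>k. (ennreal (norm (V k x)))\<^sup>2)"
        by (simp add: ennreal_power lim_imp_Liminf[where ?f0.0 = "ennreal ((norm (v x))\<^sup>2)"])
    qed
  qed
  also have "\<dots> \<le> liminf (\<lambda>k. \<integral>\<^sup>+x. (ennreal (norm (V k x)))\<^sup>2 \<partial>heis_vol)"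
    by (rule nn_integral_liminf) measurable
  also have "\<dots> = liminf (\<lambda>k. ennreal ((L2_norm (V k))\<^sup>2))"
    by (simp add: nn_integral_L2_norm_sq assms(1))
  also have "\<dots> \<le> ennreal (B\<^sup>2)"
  proof -
    have "liminf (\<lambda>k. ennreal ((L2_norm (V k))\<^sup>2)) \<le> limsup (\<lambda>k. ennreal ((L2_norm (V k))\<^sup>2))"
      by (rule Liminf_le_Limsup) simp
    also have "\<dots> \<le> ennreal (B\<^sup>2)"
      using le by (intro Limsup_bounded eventually_sequentiallyI[of N] ennreal_leI power_mono) auto
    finally show ?thesis .
  qed
  finally have le2: "(\<integral>\<^sup>+x. (ennreal (norm (v x)))\<^sup>2 \<partial>heis_vol) \<le> ennreal (B\<^sup>2)" .
  have v: "v \<in> L2"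
  proof (rule L2_I)
    show "integrable heis_vol (\<lambda>x. (norm (v x))\<^sup>2)"
      using le_less_trans[OF le2 ennreal_less_top] by (intro integrableI_bounded) (simp_all add: ennreal_power)
  qed (rule assms)
  moreover have "L2_norm v \<le> B"
    using le2 B unfolding nn_integral_L2_norm_sq[OF v] by - (rule power2_le_imp_le, simp_all)
  ultimately show ?thesis by blast
qed

text \<open>Riesz--Fischer: a subsequence with summable increments converges almost everywhere, and
  Fatou's lemma turns this into convergence in norm.\<close>

lemma L2_complete:
  fixes U :: "nat \<Rightarrow> 'n::finite heis \<Rightarrow> complex"
  assumes U: "\<And>k. U k \<in> L2"
    and Cauchy: "\<And>e. e > 0 \<Longrightarrow> \<exists>N. \<forall>k\<ge>N. \<forall>l\<ge>N. L2_norm (\<lambda>x. U k x - U l x) < e"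
  obtains u r where "u \<in> L2" "L2_tendsto U u" "strict_mono r" "AE x in heis_vol. (\<lambda>k. U (r k) x) \<longlonglongrightarrow> u x"
proof -
  note [measurable] = U
  obtain N where N: "\<And>m k l. k \<ge> N m \<Longrightarrow> l \<ge> N m \<Longrightarrow> L2_norm (\<lambda>x. U k x - U l x) < (1/2)^m"
    using Cauchy[of "(1/2)^m" for m] by (metis zero_less_divide_1_iff zero_less_numeral zero_less_power)
  \<comment> \<open>\<open>r\<close> increases strictly and dominates the thresholds
    \<open>N\<close>, so consecutive terms of the subsequence differ by at most
    \<open>(1/2)^m\<close> in norm.\<close>
  define r where "r = rec_nat (N 0) (\<lambda>m y. max (Suc y) (N (Suc m)))"
  have r_Suc: "r (Suc m) = max (Suc (r m)) (N (Suc m))" for m by (simp add: r_def)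
  have "strict_mono r" by (auto simp: strict_mono_Suc_iff r_Suc intro: less_le_trans[OF lessI max.cobounded1])
  have rN: "r m \<ge> N m" for m by (cases m) (auto simp: r_Suc r_def)
  define D where "D m x = U (r (Suc m)) x - U (r m) x" for m x
  have D_L2: "D m \<in> L2" for m unfolding D_def by (intro L2_diff U)
  note [measurable] = D_L2
  have rSucN: "r (Suc m) \<ge> N m" for m
    using rN[of m] strict_mono_less_eq[OF \<open>strict_mono r\<close>, of m "Suc m"] by simp
  have D_le: "L2_norm (D m) \<le> (1/2)^m" for m
    unfolding D_def by (rule less_imp_le, rule N[OF rSucN rN])
  \<comment> \<open>Partial sums of the moduli of the increments, made complex valued so that the
    triangle inequality for \<open>L2_norm\<close> applies to them.\<close>
  define F where "F m x = complex_of_real (\<Sum>i<m. norm (D i x))" for m x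
  have D'_L2: "(\<lambda>x. complex_of_real (norm (D m x))) \<in> L2" for m
    by (rule L2_bound[OF D_L2[of m], of _ 1]) auto
  have F_L2: "F m \<in> L2" for m
    unfolding F_def of_real_sum by (intro L2_sum D'_L2)
  note [measurable] = F_L2
  have F_le: "L2_norm (F m) \<le> 2" for m
  proof -
    have "L2_norm (F m) \<le> (\<Sum>i<m. (1/2)^i)"
    proof (induction m)
      case 0 show ?case by (simp add: F_def L2_norm_def)
    next
      case (Suc m)
      have "L2_norm (F (Suc m)) \<le> L2_norm (F m) + L2_norm (\<lambda>x. complex_of_real (norm (D m x)))"
      proof -
        have "F (Suc m) = (\<lambda>x. F m x + complex_of_real (norm (D m x)))"
          by (simp add: F_def fun_eq_iff)
        then show ?thesis using L2_norm_triangle[OF F_L2[of m] D'_L2[of m]] by simp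
      qed
      also have "L2_norm (\<lambda>x. complex_of_real (norm (D m x))) = L2_norm (D m)"
        by (simp add: L2_norm_def)
      finally show ?case using Suc D_le[of m] by simp
    qed
    also have "\<dots> \<le> 2" by (simp add: sum_gp_strict)
    finally show ?thesis .
  qed
  \<comment> \<open>Total variation of the subsequence at \<open>x\<close>. As an
    \<open>ennreal\<close> it always exists; its finiteness almost everywhere, from the bound 2 on
    the norms of the partial sums, is what makes the subsequence converge.\<close>
  define S where "S x = (\<Sum>i. ennreal (norm (D i x)))" for x
  have [measurable]: "S \<in> borel_measurable borel" unfolding S_def by measurable
  have "(\<integral>\<^sup>+x. (S x)\<^sup>2 \<partial>heis_vol) \<le> ennreal 4"
  proof -
    have "(\<integral>\<^sup>+x. (S x)\<^sup>2 \<partial>heis_vol) = (\<integral>\<^sup>+x. liminf (\<lambda>m. (ennreal (norm (F m x)))\<^sup>2) \<partial>heis_vol)"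
    proof (rule nn_integral_cong)
      fix x
      have "(\<lambda>m. \<Sum>i<m. ennreal (norm (D i x))) \<longlonglongrightarrow> S x"
        unfolding S_def by (intro summable_LIMSEQ) simp
      moreover have "(\<Sum>i<m. ennreal (norm (D i x))) = ennreal (norm (F m x))" for m
        by (simp add: F_def sum_nonneg flip: of_real_sum)
      ultimately have "(\<lambda>m. ennreal (norm (F m x))) \<longlonglongrightarrow> S x" by simp
      then have "(\<lambda>m. (ennreal (norm (F m x)))\<^sup>2) \<longlonglongrightarrow> (S x)\<^sup>2"
        unfolding power2_eq_square by (intro tendsto_mult_ennreal) auto
      then show "(S x)\<^sup>2 = liminf (\<lambda>m. (ennreal (norm (F m x)))\<^sup>2)"
        by (simp add: lim_imp_Liminf[where ?f0.0 = "(S x)\<^sup>2"])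
    qed
    also have "\<dots> \<le> liminf (\<lambda>m. \<integral>\<^sup>+x. (ennreal (norm (F m x)))\<^sup>2 \<partial>heis_vol)"
      by (rule nn_integral_liminf) measurable
    also have "\<dots> = liminf (\<lambda>m. ennreal ((L2_norm (F m))\<^sup>2))"
      by (simp add: nn_integral_L2_norm_sq F_L2)
    also have "\<dots> \<le> limsup (\<lambda>m. ennreal ((L2_norm (F m))\<^sup>2))"
      by (rule Liminf_le_Limsup) simp
    also have "\<dots> \<le> ennreal (2\<^sup>2)"
      by (intro Limsup_bounded eventually_sequentiallyI[of 0] ennreal_leI power_mono F_le) auto
    finally show ?thesis by simp
  qed
  then have "AE x in heis_vol. (S x)\<^sup>2 \<noteq> \<infinity>"
    by (intro nn_integral_noteq_infinite) (auto simp: top_unique)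
  then have S_fin: "AE x in heis_vol. S x \<noteq> \<infinity>"
    by eventually_elim (auto simp: power2_eq_square)
  have conv: "(\<lambda>k. U (r k) x) \<longlonglongrightarrow> lim (\<lambda>k. U (r k) x)" if "S x \<noteq> \<infinity>" for x
  proof -
    have "summable (\<lambda>i. norm (D i x))"
      using that by (intro summable_suminf_not_top) (auto simp: S_def)
    then have "summable (\<lambda>i. D i x)" by (rule summable_norm_cancel)
    then have "convergent (\<lambda>m. (\<Sum>i<m. D i x))" by (simp add: summable_iff_convergent)
    then have "convergent (\<lambda>m. (\<Sum>i<m. D i x) + U (r 0) x)"
      by (rule convergent_add[OF _ convergent_const])
    moreover have "(\<Sum>i<m. D i x) + U (r 0) x = U (r m) x" for m
      unfolding D_def by (subst sum_lessThan_telescope) simp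
    ultimately have "convergent (\<lambda>k. U (r k) x)" by simp
    then show ?thesis by (simp add: convergent_LIMSEQ_iff)
  qed
  define u where "u x = lim (\<lambda>k. U (r k) x)" for x
  have u_meas [measurable]: "u \<in> borel_measurable borel"
    unfolding u_def by measurable
  have ae: "AE x in heis_vol. (\<lambda>k. U (r k) x) \<longlonglongrightarrow> u x"
    using S_fin unfolding u_def by (rule AE_mp) (intro AE_I2 impI conv)
  \<comment> \<open>Fatou with \<open>k\<close> fixed and \<open>l\<close> tending to infinity along
    \<open>r\<close>: the Cauchy estimate for the pair passes to the limit \<open>u\<close>.\<close>
  have key: "(\<lambda>x. U k x - u x) \<in> L2 \<and> L2_norm (\<lambda>x. U k x - u x) \<le> (1/2)^m" if "k \<ge> N m" for k m
  proof (rule L2_Fatou[where V = "\<lambda>l x. U k x - U (r l) x" and N = m])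
    show "(\<lambda>x. U k x - U (r l) x) \<in> L2" for l by (intro L2_diff U)
    show "AE x in heis_vol. (\<lambda>l. U k x - U (r l) x) \<longlonglongrightarrow> U k x - u x"
      using ae by eventually_elim (rule tendsto_diff[OF tendsto_const])
    show "L2_norm (\<lambda>x. U k x - U (r l) x) \<le> (1/2)^m" if "l \<ge> m" for l
    proof (rule less_imp_le, rule N[OF \<open>k \<ge> N m\<close>])
      show "N m \<le> r l"
        using rN[of m] strict_mono_less_eq[OF \<open>strict_mono r\<close>, of m l] that by simp
    qed
  qed measurable
  have "u \<in> L2"
    using L2_diff[OF U[of "N 0"] conjunct1[OF key[of 0 "N 0"]]] by simp
  moreover have "L2_tendsto U u" unfolding L2_tendsto_def
  proof (rule LIMSEQ_I)
    fix e :: real assume "e > 0"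
    then obtain m where m: "(1/2)^m < e" using real_arch_pow_inv[of e "1/2"] by auto
    show "\<exists>no. \<forall>k\<ge>no. norm (L2_norm (\<lambda>x. U k x - u x) - 0) < e"
      using key[of m] m by (intro exI[of _ "N m"]) (auto intro: le_less_trans)
  qed
  ultimately show ?thesis using that \<open>strict_mono r\<close> ae by blast
qed

subsection \<open>Smooth functions\<close>

lemma Ck_SucI:
  assumes "\<And>x. (f has_derivative f' x) (at x)" "\<And>v. Ck k (\<lambda>x. f' x v)"
  shows "Ck (Suc k) f"
  using assms frechet_derivative_at[OF assms(1), symmetric] differentiableI[OF assms(1)] by simp

lemma Ck_Suc_has_derivative:
  assumes "Ck (Suc k) f" shows "(f has_derivative frechet_derivative f (at x)) (at x)"
  using assms frechet_derivative_works by auto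

lemma Ck_imp_continuous: "Ck k f \<Longrightarrow> continuous_on UNIV f"
  by (cases k) (auto intro!: differentiable_imp_continuous_on simp: differentiable_on_def differentiable_at_withinI)

text \<open>\<open>Ck (Suc k)\<close> speaks only of directional derivatives. This descent is what
  the product rule needs, where one factor stays undifferentiated.\<close>

lemma Ck_Suc_imp_Ck: "Ck (Suc k) f \<Longrightarrow> Ck k f"
proof (induction k arbitrary: f)
  case 0 then show ?case using Ck_imp_continuous[of "Suc 0" f] by simp
qed simp

lemma Ck_const [simp]: "Ck k (\<lambda>x. c)"
proof (induction k arbitrary: c)
  case (Suc k) then show ?case by (intro Ck_SucI[where f' = "\<lambda>x v. 0"]) auto
qed simp

lemma Ck_add: "Ck k f \<Longrightarrow> Ck k g \<Longrightarrow> Ck k (\<lambda>x. f x + g x)"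
proof (induction k arbitrary: f g)
  case (Suc k)
  show ?case
    by (rule Ck_SucI, rule has_derivative_add[OF Suc.prems[THEN Ck_Suc_has_derivative]])
       (use Suc in auto)
qed (auto intro: continuous_intros)

lemma Ck_mult: "Ck k f \<Longrightarrow> Ck k g \<Longrightarrow> Ck k (\<lambda>x. f x * g x)"
proof (induction k arbitrary: f g)
  case (Suc k)
  show ?case
    by (rule Ck_SucI, rule has_derivative_mult[OF Suc.prems[THEN Ck_Suc_has_derivative]])
       (use Suc in \<open>auto intro!: Ck_add Suc.IH simp del: Ck.simps intro: Ck_Suc_imp_Ck simp: Ck.simps(2)[of k f] Ck.simps(2)[of k g]\<close>)
qed (auto intro: continuous_intros)

lemma Ck_cmult: "Ck k f \<Longrightarrow> Ck k (\<lambda>x. c * f x)"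
  by (intro Ck_mult) auto

lemma Ck_prod: "(\<And>i. i \<in> I \<Longrightarrow> Ck k (f i)) \<Longrightarrow> Ck k (\<lambda>x. \<Prod>i\<in>I. f i x)"
  by (induction I rule: infinite_finite_induct) (auto intro: Ck_mult)

lemma Ck_cnj: "Ck k f \<Longrightarrow> Ck k (\<lambda>x. cnj (f x))"
proof (induction k arbitrary: f)
  case (Suc k)
  show ?case
    by (rule Ck_SucI, rule has_derivative_cnj[OF Suc.prems(1)[THEN Ck_Suc_has_derivative]])
       (use Suc in auto)
qed (auto intro: continuous_intros)

lemma Ck_bounded_linear:
  assumes "bounded_linear f" shows "Ck k f"
proof (cases k)
  case 0 then show ?thesis using assms by (simp add: linear_continuous_on)
next
  case (Suc m)
  then show ?thesis using bounded_linear_imp_has_derivative[OF assms]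
    by (auto intro!: Ck_SucI simp del: Ck.simps)
qed

lemma Ck_compose_affine:
  assumes "bounded_linear L"
  shows "Ck k f \<Longrightarrow> Ck k (\<lambda>x. f (L x + c))"
proof (induction k arbitrary: f)
  case 0 then show ?case using linear_continuous_on[OF assms]
    by (auto intro!: continuous_on_compose2[of UNIV f] continuous_intros)
next
  case (Suc k)
  have L: "((\<lambda>x. L x + c) has_derivative L) (at x)" for x
    using bounded_linear_imp_has_derivative[OF assms] by (auto intro!: derivative_eq_intros)
  show ?case
    by (rule Ck_SucI, rule has_derivative_compose[OF L Suc.prems(1)[THEN Ck_Suc_has_derivative]])
       (use Suc in auto)
qed

section \<open>Flat functions on the line\<close>

definition flat_exp :: "real poly \<Rightarrow> real \<Rightarrow> real" where
  "flat_exp p t = (if t > 0 then poly p (1 / t) * exp (- (1 / t)) else 0)"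

lemma poly_mult_exp_minus_tendsto_0: "((\<lambda>y. poly p y * exp (- y)) \<longlongrightarrow> 0) (at_top :: real filter)"
proof -
  have "((\<lambda>y::real. \<Sum>i\<le>degree p. coeff p i * (y ^ i / exp y)) \<longlongrightarrow> (\<Sum>i\<le>degree p. coeff p i * 0)) at_top"
    by (intro tendsto_intros tendsto_power_div_exp_0)
  then show ?thesis
    by (simp add: poly_altdef sum_distrib_right exp_minus divide_inverse mult.assoc)
qed

text \<open>With \<open>y = 1 / t\<close>, the functions \<open>p(y) exp(-y)\<close> on
  \<open>t > 0\<close>, continued by 0, are stable under differentiation: \<open>p\<close> becomes
  \<open>y^2 (p - p')\<close>. Smoothness at 0 thus reduces to a first order statement for all
  \<open>p\<close> at once.\<close>

lemma DERIV_flat_exp: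
  "(flat_exp p has_real_derivative flat_exp (monom 1 2 * (p - pderiv p)) t) (at t)"
proof -
  consider "t > 0" | "t < 0" | "t = 0" by linarith
  then show ?thesis
  proof cases
    case 1
    have "((\<lambda>t. poly p (1 / t) * exp (- (1 / t))) has_real_derivative
        flat_exp (monom 1 2 * (p - pderiv p)) t) (at t)"
      using 1 unfolding flat_exp_def
      by (auto intro!: derivative_eq_intros DERIV_chain2[where f = "poly p", OF poly_DERIV]
           simp: field_simps power2_eq_square poly_monom)
    then show ?thesis
      by (rule has_field_derivative_transform_within_open[of _ _ _ "{0<..}"])
         (use 1 in \<open>auto simp: flat_exp_def\<close>)
  next
    case 2
    have "((\<lambda>t. 0) has_real_derivative flat_exp (monom 1 2 * (p - pderiv p)) t) (at t)"
      using 2 by (simp add: flat_exp_def)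
    then show ?thesis
      by (rule has_field_derivative_transform_within_open[of _ _ _ "{..<0}"])
         (use 2 in \<open>auto simp: flat_exp_def\<close>)
  next
    case 3
    have "((\<lambda>h. flat_exp p h / h) \<longlongrightarrow> 0) (at 0)"
      unfolding filterlim_at_split
    proof
      show "((\<lambda>h. flat_exp p h / h) \<longlongrightarrow> 0) (at_left 0)"
        by (rule tendsto_eventually) (auto simp: flat_exp_def eventually_at_left_field intro!: exI[of _ "-1"])
      \<comment> \<open>Division by \<open>h\<close> multiplies \<open>p(1/h)\<close> by
        \<open>1/h\<close>; the product is again a polynomial in \<open>1/h\<close>, namely
        \<open>pCons 0 p\<close>, and the exponential beats it.\<close>
      have "((\<lambda>h. poly (pCons 0 p) (inverse h) * exp (- inverse h)) \<longlongrightarrow> 0) (at_right (0::real))"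
        by (rule filterlim_compose[OF poly_mult_exp_minus_tendsto_0 filterlim_inverse_at_top_right])
      then show "((\<lambda>h. flat_exp p h / h) \<longlongrightarrow> 0) (at_right 0)"
        by (rule Lim_transform_eventually)
           (auto simp: flat_exp_def eventually_at_right_field field_simps intro!: exI[of _ 1])
    qed
    then show ?thesis using 3 by (simp add: DERIV_def flat_exp_def)
  qed
qed

lemma Ck_flat_exp: "Ck k (\<lambda>t. complex_of_real (flat_exp p t))"
proof (induction k arbitrary: p)
  case 0
  then show ?case
    using DERIV_flat_exp by (auto intro!: continuous_intros continuous_at_imp_continuous_on DERIV_isCont)
next
  case (Suc k)
  show ?case
  proof (rule Ck_SucI)
    show "((\<lambda>t. complex_of_real (flat_exp p t)) has_derivative
        (\<lambda>v. complex_of_real v * complex_of_real (flat_exp (monom 1 2 * (p - pderiv p)) t))) (at t)" for t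
      using has_derivative_of_real[OF DERIV_flat_exp[of p t, unfolded has_field_derivative_def]]
      by (simp add: mult.commute)
    show "Ck k (\<lambda>t. complex_of_real v * complex_of_real (flat_exp (monom 1 2 * (p - pderiv p)) t))" for v
      by (intro Ck_cmult Suc)
  qed
qed

subsection \<open>Test functions\<close>

lemma test_funI:
  assumes "\<And>k. Ck k f" "\<And>x. f x \<noteq> 0 \<Longrightarrow> norm x \<le> R" shows "test_fun f"
  using assms by (auto simp: test_fun_def compact_closure bounded_iff)

lemma test_fun_Ck: "test_fun f \<Longrightarrow> Ck k f"
  by (simp add: test_fun_def)

lemma test_fun_support:
  assumes "test_fun f" obtains R where "R > 0" "\<And>x. norm x > R \<Longrightarrow> f x = 0"
proof -
  have "bounded {x. f x \<noteq> 0}" using assms by (simp add: test_fun_def compact_closure)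
  then obtain R where "\<forall>x\<in>{x. f x \<noteq> 0}. norm x \<le> R" unfolding bounded_iff by blast
  then show ?thesis by (intro that[of "max 1 R"]) (auto simp: not_le[symmetric])
qed

lemma test_fun_continuous: "test_fun f \<Longrightarrow> continuous_on A f"
  using Ck_imp_continuous[OF test_fun_Ck[of f 0]] continuous_on_subset by blast

lemma test_fun_measurable [measurable_dest]: "test_fun f \<Longrightarrow> f \<in> borel_measurable borel"
  by (intro borel_measurable_continuous_onI test_fun_continuous)

lemma test_fun_has_derivative:
  "test_fun f \<Longrightarrow> (f has_derivative frechet_derivative f (at x)) (at x)"
  using Ck_Suc_has_derivative[OF test_fun_Ck[of f "Suc 0"]] by simp

lemma test_fun_mult_Ck:
  assumes "test_fun f" "\<And>k. Ck k g" shows "test_fun (\<lambda>x. g x * f x)"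
proof -
  obtain R where R: "\<And>x. norm x > R \<Longrightarrow> f x = 0" using test_fun_support[OF assms(1)] by blast
  show ?thesis
    by (rule test_funI[of _ R]) (use R assms in \<open>auto intro!: Ck_mult dest: test_fun_Ck simp: not_less[symmetric]\<close>)
qed

lemma test_fun_cmult: "test_fun f \<Longrightarrow> test_fun (\<lambda>x. c * f x)"
  by (rule test_fun_mult_Ck) auto

lemma test_fun_zero [simp]: "test_fun (\<lambda>_. 0)"
  by (rule test_funI[of _ 0]) auto

lemma test_fun_add:
  assumes "test_fun f" "test_fun g" shows "test_fun (\<lambda>x. f x + g x)"
proof -
  obtain R where R: "\<And>x. norm x > R \<Longrightarrow> f x = 0" using test_fun_support[OF assms(1)] by blast
  obtain R' where R': "\<And>x. norm x > R' \<Longrightarrow> g x = 0" using test_fun_support[OF assms(2)] by blast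
  show ?thesis
    by (rule test_funI[of _ "max R R'"])
       (use R R' assms in \<open>auto intro!: Ck_add dest: test_fun_Ck simp: not_less[symmetric]\<close>)
qed

lemma test_fun_cnj:
  assumes "test_fun f" shows "test_fun (\<lambda>x. cnj (f x))"
proof -
  obtain R where R: "\<And>x. norm x > R \<Longrightarrow> f x = 0" using test_fun_support[OF assms(1)] by blast
  show ?thesis
    by (rule test_funI[of _ R]) (use R assms in \<open>auto intro!: Ck_cnj dest: test_fun_Ck simp: not_less[symmetric]\<close>)
qed

lemma frechet_derivative_outside_support:
  fixes f :: "'a::euclidean_space \<Rightarrow> complex"
  assumes R: "\<And>x. norm x > R \<Longrightarrow> f x = 0" and "norm x > R"
  shows "frechet_derivative f (at x) v = 0"
proof -
  have "(f has_derivative (\<lambda>_. 0)) (at x)"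
  proof (rule has_derivative_transform_within_open)
    show "((\<lambda>_. 0) has_derivative (\<lambda>_. 0)) (at x)" by simp
    show "open {x::'a. norm x > R}" by (intro open_Collect_less continuous_intros)
  qed (use assms in auto)
  from frechet_derivative_at[OF this, symmetric] show ?thesis by simp
qed

lemma test_fun_derivative:
  assumes "test_fun f" shows "test_fun (\<lambda>x. frechet_derivative f (at x) v)"
proof -
  obtain R where R: "\<And>x. norm x > R \<Longrightarrow> f x = 0" using test_fun_support[OF assms] by blast
  show ?thesis
  proof (rule test_funI)
    show "Ck k (\<lambda>x. frechet_derivative f (at x) v)" for k
      using test_fun_Ck[OF assms, of "Suc k"] by simp
    show "norm x \<le> R" if "frechet_derivative f (at x) v \<noteq> 0" for x
      using frechet_derivative_outside_support[of R f x v, OF R] that by force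
  qed
qed

lemma test_fun_bounded:
  assumes "test_fun f" obtains B where "B > 0" "\<And>x. norm (f x) \<le> B"
proof -
  obtain R where R: "\<And>x. norm x > R \<Longrightarrow> f x = 0" using test_fun_support[OF assms] by blast
  have "bounded (f ` cball 0 R)"
    by (intro compact_imp_bounded compact_continuous_image test_fun_continuous assms) auto
  then obtain B where B: "B > 0" "\<And>x. x \<in> cball 0 R \<Longrightarrow> norm (f x) \<le> B"
    unfolding bounded_pos by auto
  show ?thesis
  proof (rule that[OF \<open>B > 0\<close>])
    show "norm (f x) \<le> B" for x
      using B R[of x] by (cases "norm x \<le> R") auto
  qed
qed

lemma test_fun_derivative_bound:
  assumes "test_fun f"
  obtains B where "B > 0" "\<And>x v. norm (frechet_derivative f (at x) v) \<le> B * norm v"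
proof -
  have "\<forall>b. \<exists>B>0. \<forall>x. norm (frechet_derivative f (at x) b) \<le> B"
    using test_fun_bounded[OF test_fun_derivative[OF assms]] by metis
  then obtain B where B: "\<And>b. B b > 0" "\<And>b x. norm (frechet_derivative f (at x) b) \<le> B b" by metis
  show ?thesis
  proof (rule that)
    show "0 < (\<Sum>b\<in>(Basis :: 'a set). B b)" by (intro sum_pos B) auto
    fix x v :: 'a
    interpret bounded_linear "frechet_derivative f (at x)"
      using test_fun_has_derivative[OF assms] has_derivative_bounded_linear by blast
    have "frechet_derivative f (at x) v = (\<Sum>b\<in>Basis. (v \<bullet> b) *\<^sub>R frechet_derivative f (at x) b)"
      by (subst (1) euclidean_representation[of v, symmetric]) (simp add: sum scaleR)
    also have "norm \<dots> \<le> (\<Sum>b\<in>Basis. norm v * B b)"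
      by (intro sum_norm_le) (auto intro!: mult_mono B Basis_le_norm)
    finally show "norm (frechet_derivative f (at x) v) \<le> (\<Sum>b\<in>Basis. B b) * norm v"
      by (simp add: sum_distrib_left mult.commute)
  qed
qed

lemma test_fun_Lipschitz:
  assumes "test_fun f" obtains B where "B > 0" "\<And>x y. norm (f x - f y) \<le> B * norm (x - y)"
proof -
  obtain B where B: "B > 0" "\<And>x v. norm (frechet_derivative f (at x) v) \<le> B * norm v"
    using test_fun_derivative_bound[OF assms] by metis
  show ?thesis
  proof (rule that[OF B(1)])
    show "norm (f x - f y) \<le> B * norm (x - y)" for x y
      by (rule differentiable_bound[of UNIV f "\<lambda>x. frechet_derivative f (at x)"])
         (use B test_fun_has_derivative[OF assms] in \<open>auto intro!: onorm_le\<close>)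
  qed
qed

lemma continuous_bounded_support_integrable:
  fixes f :: "'a::euclidean_space \<Rightarrow> 'b::{banach, second_countable_topology}"
  assumes "continuous_on UNIV f" "\<And>x. norm x > R \<Longrightarrow> f x = 0"
  shows "integrable lborel f"
proof -
  have "integrable lborel (\<lambda>x. indicator (cball 0 R) x *\<^sub>R f x)"
    by (rule borel_integrable_compact) (auto intro: continuous_on_subset[OF assms(1)])
  also have "(\<lambda>x. indicator (cball 0 R) x *\<^sub>R f x) = f"
    using assms(2) by (auto simp: fun_eq_iff indicator_def)
  finally show ?thesis .
qed

lemma test_fun_integrable:
  assumes "test_fun f" shows "integrable lborel f"
proof -
  obtain R where "\<And>x. norm x > R \<Longrightarrow> f x = 0" using test_fun_support[OF assms] by blast
  then show ?thesis by (rule continuous_bounded_support_integrable[OF test_fun_continuous[OF assms]])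
qed

lemma test_fun_L2:
  assumes "test_fun f" shows "f \<in> L2"
proof (rule L2_I)
  obtain R where R: "\<And>x. norm x > R \<Longrightarrow> f x = 0" using test_fun_support[OF assms] by blast
  have "integrable lborel (\<lambda>x. (norm (f x))\<^sup>2)"
  proof (rule continuous_bounded_support_integrable[where R = R])
    show "continuous_on UNIV (\<lambda>x. (norm (f x))\<^sup>2)"
      by (intro continuous_intros test_fun_continuous[OF assms])
  qed (simp add: R)
  then show "integrable heis_vol (\<lambda>x. (norm (f x))\<^sup>2)"
    using test_fun_measurable[OF assms] by (subst integrable_heis_vol) auto
qed (use assms in \<open>rule test_fun_measurable\<close>)

subsection \<open>Test functions are dense\<close>

text \<open>The closure of the test functions, kept as a set so that membership can be propagated
  through sums, multiples and limits: from boxes to bounded Borel sets to all of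
  \<open>L2\<close>.\<close>

definition L2_test_closure :: "('n::finite heis \<Rightarrow> complex) set" where
  "L2_test_closure = {u \<in> L2. \<forall>e>0. \<exists>\<phi>. test_fun \<phi> \<and> L2_norm (\<lambda>x. u x - \<phi> x) < e}"

lemma L2_test_closure_add:
  assumes "u \<in> L2_test_closure" "v \<in> L2_test_closure" shows "(\<lambda>x. u x + v x) \<in> L2_test_closure"
  unfolding L2_test_closure_def
proof (intro CollectI conjI allI impI)
  have uv: "u \<in> L2" "v \<in> L2" using assms by (auto simp: L2_test_closure_def)
  then show "(\<lambda>x. u x + v x) \<in> L2" by (rule L2_add)
  fix e :: real assume "e > 0"
  then obtain \<phi> \<psi> where \<phi>: "test_fun \<phi>" "L2_norm (\<lambda>x. u x - \<phi> x) < e / 2"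
      and \<psi>: "test_fun \<psi>" "L2_norm (\<lambda>x. v x - \<psi> x) < e / 2"
    using assms by (fastforce simp: L2_test_closure_def dest!: spec[of _ "e/2"])
  have "L2_norm (\<lambda>x. (u x - \<phi> x) + (v x - \<psi> x)) \<le> L2_norm (\<lambda>x. u x - \<phi> x) + L2_norm (\<lambda>x. v x - \<psi> x)"
    by (intro L2_norm_triangle L2_diff uv test_fun_L2 \<phi> \<psi>)
  then have "L2_norm (\<lambda>x. (u x + v x) - (\<phi> x + \<psi> x)) < e"
    using \<phi> \<psi> by (simp add: algebra_simps)
  then show "\<exists>\<phi>. test_fun \<phi> \<and> L2_norm (\<lambda>x. u x + v x - \<phi> x) < e"
    using test_fun_add[OF \<phi>(1) \<psi>(1)] by blast
qed

lemma L2_test_closure_cmult: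
  assumes "u \<in> L2_test_closure" shows "(\<lambda>x. c * u x) \<in> L2_test_closure"
  unfolding L2_test_closure_def
proof (intro CollectI conjI allI impI)
  have u: "u \<in> L2" using assms by (auto simp: L2_test_closure_def)
  then show "(\<lambda>x. c * u x) \<in> L2" by (rule L2_scale)
  fix e :: real assume "e > 0"
  then have "e / (norm c + 1) > 0" by (simp add: add_nonneg_pos)
  then obtain \<phi> where \<phi>: "test_fun \<phi>" "L2_norm (\<lambda>x. u x - \<phi> x) < e / (norm c + 1)"
    using assms by (auto simp: L2_test_closure_def)
  have "L2_norm (\<lambda>x. c * u x - c * \<phi> x) = norm c * L2_norm (\<lambda>x. u x - \<phi> x)"
    by (simp add: L2_norm_scale flip: right_diff_distrib)
  also have "\<dots> \<le> (norm c + 1) * L2_norm (\<lambda>x. u x - \<phi> x)" by (intro mult_right_mono) auto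
  also have "\<dots> < e" using \<phi>(2) pos_less_divide_eq[of "norm c + 1" _ e] by (simp add: add_nonneg_pos mult.commute)
  finally show "\<exists>\<phi>. test_fun \<phi> \<and> L2_norm (\<lambda>x. c * u x - \<phi> x) < e"
    using test_fun_cmult[OF \<phi>(1)] by blast
qed

lemma L2_test_closure_limit:
  assumes "\<And>k. U k \<in> L2_test_closure" "u \<in> L2" "L2_tendsto U u" shows "u \<in> L2_test_closure"
  unfolding L2_test_closure_def
proof (intro CollectI conjI allI impI assms)
  fix e :: real assume "e > 0"
  have U: "U k \<in> L2" for k using assms(1) by (auto simp: L2_test_closure_def)
  obtain k where k: "L2_norm (\<lambda>x. U k x - u x) < e / 2"
    using assms(3) \<open>e > 0\<close> unfolding L2_tendsto_def
    by (force dest!: LIMSEQ_D[where r = "e/2"])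
  obtain \<phi> where \<phi>: "test_fun \<phi>" "L2_norm (\<lambda>x. U k x - \<phi> x) < e / 2"
    using assms(1)[of k] \<open>e > 0\<close> by (fastforce simp: L2_test_closure_def dest!: spec[of _ "e/2"])
  have "L2_norm (\<lambda>x. u x - \<phi> x) \<le> L2_norm (\<lambda>x. u x - U k x) + L2_norm (\<lambda>x. U k x - \<phi> x)"
    by (intro L2_norm_triangle_diff assms U test_fun_L2 \<phi>)
  then show "\<exists>\<phi>. test_fun \<phi> \<and> L2_norm (\<lambda>x. u x - \<phi> x) < e"
    using k \<phi> by (intro exI[of _ \<phi>]) (simp add: L2_norm_minus_commute[of u])
qed

lemma L2_test_closure_test: "test_fun \<phi> \<Longrightarrow> \<phi> \<in> L2_test_closure"
  by (auto simp: L2_test_closure_def test_fun_L2 L2_norm_def intro!: exI[of _ \<phi>])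

lemma indicator_L2:
  assumes [measurable]: "A \<in> sets borel" and "bounded A"
  shows "(indicator A :: 'n::finite heis \<Rightarrow> complex) \<in> L2"
proof (rule L2_I)
  have "integrable lborel (indicator A :: 'n heis \<Rightarrow> real)"
    using emeasure_bounded_finite[OF assms(2)] by (simp add: integrable_indicator_iff)
  moreover have "(\<lambda>x. (norm (indicator A x :: complex))\<^sup>2) = (indicator A :: 'n heis \<Rightarrow> real)"
    by (auto simp: fun_eq_iff indicator_def)
  ultimately show "integrable heis_vol (\<lambda>x. (norm (indicator A x :: complex))\<^sup>2)"
    by (subst integrable_heis_vol) auto
qed measurable

text \<open>Each coordinate contributes two flat functions, one per face, that vanish beyond the
  face and tend to 1 inside as their arguments are stretched; their product over all coordinates is
  a test function.\<close>

lemma indicator_box_L2_test_closure: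
  "(indicator (box a b) :: 'n::finite heis \<Rightarrow> complex) \<in> L2_test_closure"
proof (rule L2_test_closure_limit)
  define f where "f = (\<lambda>t. complex_of_real (flat_exp 1 t))"
  have f: "f t = (if t > 0 then of_real (exp (- (1 / t))) else 0)" for t
    by (simp add: f_def flat_exp_def)
  have f_le: "norm (f t) \<le> 1" for t by (simp add: f)
  define \<phi> where "\<phi> k x = (\<Prod>i\<in>Basis. f (real (Suc k) * (x \<bullet> i - a \<bullet> i)) * f (real (Suc k) * (b \<bullet> i - x \<bullet> i)))"
    for k and x :: "'n heis"
  have \<phi>_0: "\<phi> k x = 0" if "x \<notin> box a b" for k x
  proof -
    from that obtain i where "i \<in> Basis" "\<not> (a \<bullet> i < x \<bullet> i \<and> x \<bullet> i < b \<bullet> i)"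
      by (auto simp: mem_box)
    then show ?thesis unfolding \<phi>_def
      by (intro prod_zero) (auto simp: f zero_less_mult_iff intro!: bexI[of _ i])
  qed
  have \<phi>_test: "test_fun (\<phi> k)" for k
  proof (rule test_funI)
    show "Ck m (\<phi> k)" for m
    proof -
      have "Ck m (\<lambda>x. f (real (Suc k) * (x \<bullet> i - a \<bullet> i)))" for i
        using Ck_compose_affine[of "\<lambda>x::'n heis. real (Suc k) * (x \<bullet> i)" m f "- real (Suc k) * (a \<bullet> i)"]
          Ck_flat_exp[of m 1]
        by (simp add: f_def right_diff_distrib bounded_linear_mult_const bounded_linear_const_mult[OF bounded_linear_inner_left] del: of_nat_Suc)
      moreover have "Ck m (\<lambda>x. f (real (Suc k) * (b \<bullet> i - x \<bullet> i)))" for i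
        using Ck_compose_affine[of "\<lambda>x::'n heis. - real (Suc k) * (x \<bullet> i)" m f "real (Suc k) * (b \<bullet> i)"]
          Ck_flat_exp[of m 1]
          bounded_linear_minus[OF bounded_linear_const_mult[OF bounded_linear_inner_left[of i], of "real (Suc k)"]]
        by (simp add: f_def right_diff_distrib del: of_nat_Suc)
      ultimately show ?thesis unfolding \<phi>_def by (intro Ck_prod Ck_mult)
    qed
    show "norm x \<le> (SOME R. \<forall>x\<in>box a b. norm x \<le> R)" if "\<phi> k x \<noteq> 0" for x
      using someI_ex[OF bounded_box[of a b, unfolded bounded_iff]] \<phi>_0[of x k] that by blast
  qed
  show "\<phi> k \<in> L2_test_closure" for k by (rule L2_test_closure_test[OF \<phi>_test])
  show ind: "(indicator (box a b) :: 'n heis \<Rightarrow> complex) \<in> L2"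
    by (intro indicator_L2) (auto simp: bounded_box)
  have \<phi>_le: "norm (\<phi> k x) \<le> 1" for k x
    unfolding \<phi>_def prod_norm[symmetric]
    by (intro prod_le_1) (auto simp: norm_mult intro!: mult_le_one f_le)
  show "L2_tendsto \<phi> (indicator (box a b))"
  proof (rule L2_tendsto_dominated)
    show "\<phi> k \<in> borel_measurable borel" for k by (rule test_fun_measurable[OF \<phi>_test])
    \<comment> \<open>Outside the box both functions vanish; inside, each has modulus at most
      1.\<close>
    show "(\<lambda>x. 2 * indicator (box a b) x :: complex) \<in> L2" by (rule L2_scale[OF ind])
    show "norm (\<phi> k x - indicator (box a b) x) \<le> norm (2 * indicator (box a b) x :: complex)" for k x
      using norm_triangle_ineq4[of "\<phi> k x" 1] \<phi>_le[of k x] \<phi>_0[of x k] by (cases "x \<in> box a b") auto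
    show "(\<lambda>k. \<phi> k x) \<longlonglongrightarrow> indicator (box a b) x" for x
    proof (cases "x \<in> box a b")
      case False then show ?thesis by (simp add: \<phi>_0)
    next
      case True
      have lim: "(\<lambda>k. f (real (Suc k) * c)) \<longlonglongrightarrow> 1" if "c > 0" for c
      proof -
        have "(\<lambda>k. 1 / c * inverse (real (Suc k))) \<longlonglongrightarrow> 1 / c * 0"
          by (intro tendsto_intros LIMSEQ_inverse_real_of_nat)
        then have "(\<lambda>k. complex_of_real (exp (- (1 / c * inverse (real (Suc k)))))) \<longlonglongrightarrow> of_real (exp (- 0))"
          by (intro tendsto_intros) simp
        moreover have "complex_of_real (exp (- (1 / c * inverse (real (Suc k))))) = f (real (Suc k) * c)" for k
          using that by (simp add: f zero_less_mult_iff field_simps add_pos_nonneg)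
        ultimately show ?thesis by simp
      qed
      have "(\<lambda>k. \<phi> k x) \<longlonglongrightarrow> (\<Prod>i\<in>(Basis :: 'n heis set). 1 * 1)"
        unfolding \<phi>_def using True by (intro tendsto_prod tendsto_mult lim) (auto simp: mem_box)
      then show ?thesis using True by simp
    qed
  qed measurable
qed

text \<open>A Dynkin system argument on the boxes. Intersecting with a fixed box keeps every
  indicator square integrable, in particular that of a complement.\<close>

lemma indicator_L2_test_closure:
  assumes "A \<in> sets borel"
  shows "(indicator (A \<inter> box c d) :: 'n::finite heis \<Rightarrow> complex) \<in> L2_test_closure"
proof -
  let ?E = "range (\<lambda>(a, b). box a b :: 'n heis set)"
  have bd: "bounded (A \<inter> box c d)" for A :: "'n heis set"
    using bounded_box by (rule bounded_subset) auto
  have "A \<in> sigma_sets UNIV ?E" using assms by (simp add: borel_eq_box)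
  then show ?thesis
  proof (rule sigma_sets_induct_disjoint[rotated 2, where \<Omega> = UNIV])
    show "Int_stable ?E" by (auto simp: Int_stable_def box_Int_box)
    show "(indicator (A \<inter> box c d) :: 'n heis \<Rightarrow> complex) \<in> L2_test_closure" if "A \<in> ?E" for A
    proof -
      from that obtain z where "A = (case z of (a, b) \<Rightarrow> box a b)" by blast
      then have "A = box (fst z) (snd z)" by (simp only: case_prod_unfold)
      then show ?thesis by (simp only: box_Int_box indicator_box_L2_test_closure)
    qed
    show "(indicator ({} \<inter> box c d) :: 'n heis \<Rightarrow> complex) \<in> L2_test_closure"
      using L2_test_closure_test[OF test_fun_zero] by (simp add: indicator_def[abs_def])
    show "(indicator ((UNIV - A) \<inter> box c d) :: 'n heis \<Rightarrow> complex) \<in> L2_test_closure"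
      if "(indicator (A \<inter> box c d) :: 'n heis \<Rightarrow> complex) \<in> L2_test_closure" for A
    proof -
      have "(indicator ((UNIV - A) \<inter> box c d) :: 'n heis \<Rightarrow> complex) =
          (\<lambda>x. indicator (box c d) x + (-1) * indicator (A \<inter> box c d) x)"
        by (auto simp: fun_eq_iff indicator_def)
      then show ?thesis
        using L2_test_closure_add[OF indicator_box_L2_test_closure[of c d] L2_test_closure_cmult[OF that, of "-1"]] by simp
    qed
    show "(indicator (\<Union> (range A) \<inter> box c d) :: 'n heis \<Rightarrow> complex) \<in> L2_test_closure"
      if A: "disjoint_family A" "range A \<subseteq> sigma_sets UNIV ?E"
        "\<And>i. (indicator (A i \<inter> box c d) :: 'n heis \<Rightarrow> complex) \<in> L2_test_closure" for A :: "nat \<Rightarrow> 'n heis set"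
    proof (rule L2_test_closure_limit)
      have [measurable]: "A i \<in> sets borel" for i using A(2) by (auto simp: borel_eq_box)
      define U where "U k x = (\<Sum>i<k. indicator (A i \<inter> box c d) x :: complex)" for k x
      have U_eq: "U k = indicator ((\<Union>i<k. A i) \<inter> box c d)" for k
        using disjoint_family_on_mono[OF subset_UNIV A(1), of "{..<k}"]
        by (auto simp: U_def fun_eq_iff indicator_UN_disjoint indicator_inter_arith sum_distrib_right)
      show "U k \<in> L2_test_closure" for k
      proof (induction k)
        case 0 show ?case using L2_test_closure_test[OF test_fun_zero] by (simp add: U_def[abs_def])
      next
        case (Suc k)
        have "U (Suc k) = (\<lambda>x. U k x + indicator (A k \<inter> box c d) x)"
          by (simp add: U_def fun_eq_iff)
        then show ?case using L2_test_closure_add[OF Suc A(3)] by simp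
      qed
      show "(indicator (\<Union> (range A) \<inter> box c d) :: 'n heis \<Rightarrow> complex) \<in> L2"
        by (intro indicator_L2 bd) measurable
      show "L2_tendsto U (indicator (\<Union> (range A) \<inter> box c d))"
      proof (rule L2_tendsto_dominated)
        show "(\<lambda>x. indicator (box c d) x :: complex) \<in> L2"
          by (intro indicator_L2) (auto simp: bounded_box)
        show "norm (U k x - indicator (\<Union> (range A) \<inter> box c d) x) \<le> norm (indicator (box c d) x :: complex)" for k x
          by (auto simp: U_eq indicator_def)
        show "(\<lambda>k. U k x) \<longlonglongrightarrow> indicator (\<Union> (range A) \<inter> box c d) x" for x
        proof (cases "\<exists>i. x \<in> A i")
          case True
          then obtain i where i: "x \<in> A i" by blast
          have "U k x = indicator (\<Union> (range A) \<inter> box c d) x" if "k > i" for k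
            using i that by (auto simp: U_eq indicator_def)
          then show ?thesis
            by (intro tendsto_eventually eventually_sequentiallyI[of "Suc i"]) auto
        qed (auto simp: U_eq indicator_def)
      qed (auto simp: U_eq)
    qed
  qed simp
qed

lemma L2_test_closure_eq: "(L2_test_closure :: ('n::finite heis \<Rightarrow> complex) set) = L2"
proof
  show "(L2_test_closure :: ('n heis \<Rightarrow> complex) set) \<subseteq> L2" by (auto simp: L2_test_closure_def)
  show "L2 \<subseteq> (L2_test_closure :: ('n heis \<Rightarrow> complex) set)"
  proof
    fix u :: "'n heis \<Rightarrow> complex" assume u: "u \<in> L2"
    note [measurable] = u
    from borel_measurable_implies_sequence_metric[OF L2_measurable[OF u], of 0, unfolded norm_conv_dist[symmetric]]
    obtain s where s: "\<And>i. simple_function borel (s i)" "\<And>x. (\<lambda>i. s i x) \<longlonglongrightarrow> u x"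
      "\<And>i x. norm (s i x) \<le> 2 * norm (u x)"
      by auto
    \<comment> \<open>A simple function need not be supported in a bounded set; the growing cubes
      cut it off and respect the bound \<open>2 * norm (u x)\<close>.\<close>
    define B where "B k = box (- (real k *\<^sub>R One)) (real k *\<^sub>R One :: 'n heis)" for k
    define U where "U k x = s k x * indicator (B k) x" for k x
    note [measurable] = borel_measurable_simple_function[OF s(1)]
    have [measurable]: "B k \<in> sets borel" for k by (simp add: B_def)
    show "u \<in> L2_test_closure"
    proof (rule L2_test_closure_limit[OF _ u])
      show "U k \<in> L2_test_closure" for k
      proof -
        have "U k x = (\<Sum>y\<in>s k ` UNIV. y * indicator (s k -` {y} \<inter> B k) x)" for x
        proof -
          have "(\<Sum>y\<in>s k ` UNIV. y * indicator (s k -` {y} \<inter> B k) x) = (\<Sum>y\<in>s k ` UNIV. if y = s k x then U k x else 0)"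
            by (intro sum.cong) (auto simp: U_def indicator_def)
          then show ?thesis using simple_functionD(1)[OF s(1)[of k]] by simp
        qed
        then have "U k = (\<lambda>x. \<Sum>y\<in>s k ` UNIV. y * indicator (s k -` {y} \<inter> B k) x)" by auto
        moreover have "(\<lambda>x. \<Sum>y\<in>Y. y * indicator (s k -` {y} \<inter> B k) x) \<in> L2_test_closure" if "finite Y" for Y
          using that
        proof induction
          case empty show ?case using L2_test_closure_test[OF test_fun_zero] by simp
        next
          case (insert y Y)
          have "(\<lambda>x. y * indicator (s k -` {y} \<inter> B k) x) \<in> L2_test_closure"
            unfolding B_def using measurable_sets_borel[OF borel_measurable_simple_function[OF s(1)], of "{y}" k]
            by (intro L2_test_closure_cmult indicator_L2_test_closure) auto
          from L2_test_closure_add[OF this insert.IH] show ?case by (simp only: sum.insert[OF insert.hyps])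
        qed
        ultimately show ?thesis using simple_functionD(1)[OF s(1)[of k]] by simp
      qed
      show "L2_tendsto U u"
      proof (rule L2_tendsto_dominated)
        \<comment> \<open>The factor is 2 from the bound on the simple functions plus 1 for
          \<open>u\<close> itself.\<close>
        show "(\<lambda>x. 3 * u x) \<in> L2" by (rule L2_scale[OF u])
        show "norm (U k x - u x) \<le> norm (3 * u x)" for k x
          using norm_triangle_ineq4[of "U k x" "u x"] s(3)[of k x]
          by (auto simp: U_def norm_mult indicator_def split: if_splits)
        show "(\<lambda>k. U k x) \<longlonglongrightarrow> u x" for x
        proof -
          have "x \<in> (\<Union>k. B k)" by (simp add: B_def UN_box_eq_UNIV)
          then obtain m where "x \<in> B m" by blast
          then have "x \<in> B k" if "k \<ge> m" for k
            using that unfolding B_def mem_box by (force intro: less_le_trans le_less_trans)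
          then have "eventually (\<lambda>k. s k x = U k x) sequentially"
            by (intro eventually_sequentiallyI[of m]) (simp add: U_def)
          then show ?thesis by (rule Lim_transform_eventually[OF s(2)])
        qed
        show "U k \<in> borel_measurable borel" for k unfolding U_def[abs_def] by measurable
      qed measurable
    qed
  qed
qed

lemma L2_test_dense:
  fixes u :: "'n::finite heis \<Rightarrow> complex"
  assumes "u \<in> L2" obtains \<phi> where "\<And>k. test_fun (\<phi> k)" "L2_tendsto \<phi> u"
proof -
  have "\<forall>k. \<exists>\<phi>. test_fun \<phi> \<and> L2_norm (\<lambda>x. u x - \<phi> x) < inverse (real (Suc k))"
    using assms unfolding L2_test_closure_eq[symmetric] by (simp add: L2_test_closure_def)
  then obtain \<phi> where \<phi>: "\<And>k. test_fun (\<phi> k)" "\<And>k. L2_norm (\<lambda>x. u x - \<phi> k x) < inverse (real (Suc k))"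
    by metis
  have "(\<lambda>k. L2_norm (\<lambda>x. \<phi> k x - u x)) \<longlonglongrightarrow> 0"
    by (rule tendsto_sandwich[OF _ _ tendsto_const LIMSEQ_inverse_real_of_nat])
       (use \<phi>(2) in \<open>auto simp: L2_norm_minus_commute[of "\<phi> _"] intro!: always_eventually less_imp_le\<close>)
  then show ?thesis using that \<phi>(1) by (auto simp: L2_tendsto_def)
qed

subsection \<open>Measure preserving maps\<close>

lemma distr_invariant_integral:
  fixes f :: "'a::euclidean_space \<Rightarrow> 'b::{banach, second_countable_topology}"
  assumes "distr M borel T = M" "T \<in> measurable borel borel" "sets M = sets borel" "f \<in> borel_measurable borel"
  shows "(\<integral>x. f (T x) \<partial>M) = (\<integral>x. f x \<partial>M)"
    and "integrable M (\<lambda>x. f (T x)) \<longleftrightarrow> integrable M f"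
proof -
  have T: "T \<in> measurable M borel" using assms(2,3) by (simp cong: measurable_cong_sets)
  show "(\<integral>x. f (T x) \<partial>M) = (\<integral>x. f x \<partial>M)"
    using integral_distr[OF T assms(4)] assms(1) by simp
  show "integrable M (\<lambda>x. f (T x)) \<longleftrightarrow> integrable M f"
    using integrable_distr_eq[OF T assms(4)] assms(1) by simp
qed

lemma nn_integral_lborel_translate:
  fixes f :: "'a::euclidean_space \<Rightarrow> ennreal"
  assumes [measurable]: "f \<in> borel_measurable borel"
  shows "(\<integral>\<^sup>+x. f (c + x) \<partial>lborel) = (\<integral>\<^sup>+x. f x \<partial>lborel)"
  by (subst (2) lborel_distr_plus[of c, symmetric]) (simp add: nn_integral_distr)

lemma nn_integral_lborel_reflect:
  fixes f :: "'a::euclidean_space \<Rightarrow> ennreal"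
  assumes [measurable]: "f \<in> borel_measurable borel"
  shows "(\<integral>\<^sup>+x. f (c - x) \<partial>lborel) = (\<integral>\<^sup>+x. f x \<partial>lborel)"
  by (subst (2) lborel_affine[of "-1" c]) (simp_all add: nn_integral_density nn_integral_distr)

lemma integral_lborel_translate:
  fixes f :: "'a::euclidean_space \<Rightarrow> 'b::{banach, second_countable_topology}"
  assumes "f \<in> borel_measurable borel"
  shows "(\<integral>x. f (c + x) \<partial>lborel) = (\<integral>x. f x \<partial>lborel)"
    and "integrable lborel (\<lambda>x. f (c + x)) \<longleftrightarrow> integrable lborel f"
  by (rule distr_invariant_integral[OF lborel_distr_plus _ _ assms]; simp)+

text \<open>Fubini: for a fixed first component the second one is merely translated. Left and right
  multiplication in the group are both shears of this kind.\<close>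

lemma lborel_distr_shear:
  fixes h :: "'a::euclidean_space \<Rightarrow> 'b::euclidean_space"
  assumes [measurable]: "h \<in> borel_measurable borel"
  shows "distr lborel borel (\<lambda>x. (a + fst x, h (fst x) + snd x)) = (lborel :: ('a \<times> 'b) measure)"
proof (rule measure_eqI)
  let ?T = "\<lambda>x::'a \<times> 'b. (a + fst x, h (fst x) + snd x)"
  have T [measurable]: "?T \<in> measurable borel borel"
    unfolding borel_prod[symmetric] by measurable
  fix A assume "A \<in> sets (distr lborel borel ?T)"
  then have [measurable]: "A \<in> sets borel" by simp
  then have [measurable]: "A \<in> sets (borel \<Otimes>\<^sub>M borel)" unfolding borel_prod .
  have "emeasure (distr lborel borel ?T) A = (\<integral>\<^sup>+x. indicator A x \<partial>distr lborel borel ?T)" by simp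
  also have "\<dots> = (\<integral>\<^sup>+x. indicator A (?T x) \<partial>(lborel \<Otimes>\<^sub>M lborel))"
    unfolding lborel_prod by (rule nn_integral_distr) simp_all
  also have "\<dots> = (\<integral>\<^sup>+w. \<integral>\<^sup>+s. indicator A (a + w, h w + s) \<partial>lborel \<partial>lborel)"
    by (subst lborel.nn_integral_fst[symmetric]) simp_all
  also have "\<dots> = (\<integral>\<^sup>+w. \<integral>\<^sup>+s. indicator A (a + w, s) \<partial>lborel \<partial>lborel)"
    by (intro nn_integral_cong nn_integral_lborel_translate) measurable
  also have "\<dots> = (\<integral>\<^sup>+w. \<integral>\<^sup>+s. indicator A (w, s) \<partial>lborel \<partial>lborel)"
    by (rule nn_integral_lborel_translate) measurable
  also have "\<dots> = (\<integral>\<^sup>+x. indicator A x \<partial>(lborel \<Otimes>\<^sub>M lborel))"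
    by (subst lborel.nn_integral_fst[symmetric]) simp_all
  also have "\<dots> = emeasure lborel A"
    by (simp add: lborel_prod)
  finally show "emeasure (distr lborel borel ?T) A = emeasure lborel A" .
qed simp

text \<open>The image measure is translation invariant, so by Fubini's theorem it is a multiple of the
  Lebesgue measure; the unit ball determines the factor.\<close>

lemma lborel_distr_linear_isometry:
  fixes T :: "'a::euclidean_space \<Rightarrow> 'a"
  assumes "linear T" and norm: "\<And>x. norm (T x) = norm x"
  shows "distr lborel borel T = lborel"
proof (rule measure_eqI)
  define M where "M = distr lborel borel T"
  have [measurable]: "T \<in> borel_measurable borel"
    using assms(1) by (intro borel_measurable_continuous_onI linear_continuous_on) (simp add: linear_conv_bounded_linear)
  interpret T: linear T by fact
  have "inj T" unfolding T.inj_iff_eq_0 using norm by (metis norm_eq_zero)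
  then have "surj T" using linear_injective_imp_surjective[OF assms(1)] by simp
  have [simp, measurable_cong]: "sets M = sets borel" and [simp]: "space M = UNIV" by (simp_all add: M_def)
  have nn_M: "(\<integral>\<^sup>+x. f x \<partial>M) = (\<integral>\<^sup>+x. f (T x) \<partial>lborel)" if "f \<in> borel_measurable borel" for f
    using that by (simp add: M_def nn_integral_distr)
  have trans: "(\<integral>\<^sup>+x. f (x - y) \<partial>M) = (\<integral>\<^sup>+x. f x \<partial>M)" if [measurable]: "f \<in> borel_measurable borel" for f y
  proof -
    obtain z where z: "T z = - y" using \<open>surj T\<close> by (metis surjD)
    have "(\<integral>\<^sup>+x. f (x - y) \<partial>M) = (\<integral>\<^sup>+x. f (T (z + x)) \<partial>lborel)"
      by (subst nn_M) (simp_all add: T.add z)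
    also have "\<dots> = (\<integral>\<^sup>+x. f (T x) \<partial>lborel)" by (rule nn_integral_lborel_translate) measurable
    also have "\<dots> = (\<integral>\<^sup>+x. f x \<partial>M)" by (simp add: nn_M)
    finally show ?thesis .
  qed
  define B where "B = (indicator (ball 0 1) :: 'a \<Rightarrow> ennreal)"
  have [measurable]: "B \<in> borel_measurable borel" unfolding B_def by (intro borel_measurable_indicator) simp
  have sf: "sigma_finite_measure M"
  proof
    show "\<exists>A. countable A \<and> A \<subseteq> sets M \<and> \<Union> A = space M \<and> (\<forall>a\<in>A. emeasure M a \<noteq> \<infinity>)"
    proof (intro exI[of _ "range (\<lambda>k::nat. ball 0 (real k))"] conjI ballI)
      show "\<Union> (range (\<lambda>k::nat. ball 0 (real k))) = space M"
        using reals_Archimedean2 by (auto simp: dist_norm)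
      fix a assume "a \<in> range (\<lambda>k::nat. ball (0::'a) (real k))"
      then obtain k where a: "a = ball 0 (real k)" by blast
      have "emeasure M a = emeasure lborel (ball (0::'a) (real k))"
        unfolding M_def a by (subst emeasure_distr) (auto simp: vimage_def norm intro!: arg_cong[of _ _ "emeasure lborel"])
      then show "emeasure M a \<noteq> \<infinity>" using emeasure_lborel_ball_finite[of "0::'a" "real k"] by simp
    qed auto
  qed
  interpret M: sigma_finite_measure M by (rule sf)
  interpret P: pair_sigma_finite M "lborel :: 'a measure" ..
  \<comment> \<open>The map preserves norms, so it leaves the unit ball invariant and both measures
    agree there.\<close>
  have MB: "(\<integral>\<^sup>+x. B x \<partial>M) = (\<integral>\<^sup>+x. B x \<partial>lborel)"
    by (simp add: nn_M) (simp add: B_def indicator_def norm)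
  fix A assume "A \<in> sets (distr lborel borel T)"
  then have [measurable]: "A \<in> sets borel" by simp
  let ?A = "indicator A :: 'a \<Rightarrow> ennreal"
  \<comment> \<open>The usual argument for uniqueness of Haar measure: the integral of
    \<open>1_A(x) B(x + y)\<close> over \<open>M\<close> times Lebesgue measure is computed in two
    ways. A translation in \<open>y\<close> leaves \<open>emeasure M A\<close>; the substitution
    \<open>x - y\<close> under \<open>M\<close> followed by a reflection in \<open>y\<close> leaves
    \<open>emeasure lborel A\<close>.\<close>
  have "emeasure M A * (\<integral>\<^sup>+x. B x \<partial>lborel) = (\<integral>\<^sup>+x. \<integral>\<^sup>+y. ?A x * B y \<partial>lborel \<partial>M)"
    by (simp add: nn_integral_cmult) (subst nn_integral_multc, simp_all)
  also have "\<dots> = (\<integral>\<^sup>+x. \<integral>\<^sup>+y. ?A x * B (x + y) \<partial>lborel \<partial>M)"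
    by (simp add: nn_integral_cmult nn_integral_lborel_translate[of B])
  also have "\<dots> = (\<integral>\<^sup>+y. \<integral>\<^sup>+x. ?A x * B (x + y) \<partial>M \<partial>lborel)"
    by (rule P.Fubini'[symmetric]) measurable
  also have "\<dots> = (\<integral>\<^sup>+y. \<integral>\<^sup>+x. ?A (x - y) * B x \<partial>M \<partial>lborel)"
  proof (rule nn_integral_cong)
    fix y
    show "(\<integral>\<^sup>+x. ?A x * B (x + y) \<partial>M) = (\<integral>\<^sup>+x. ?A (x - y) * B x \<partial>M)"
      using trans[of "\<lambda>x. ?A x * B (x + y)" y] by simp
  qed
  also have "\<dots> = (\<integral>\<^sup>+x. \<integral>\<^sup>+y. ?A (x - y) * B x \<partial>lborel \<partial>M)"
    by (rule P.Fubini') measurable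
  also have "\<dots> = emeasure lborel A * (\<integral>\<^sup>+x. B x \<partial>M)"
    by (simp add: nn_integral_multc nn_integral_cmult nn_integral_lborel_reflect[of ?A])
  finally have "emeasure M A * (\<integral>\<^sup>+x. B x \<partial>lborel) = emeasure lborel A * (\<integral>\<^sup>+x. B x \<partial>lborel)"
    by (simp add: MB)
  moreover have "(\<integral>\<^sup>+x. B x \<partial>lborel) \<noteq> 0"
    using content_ball_pos[of 1 "0::'a"] by (auto simp: B_def measure_def)
  moreover have "(\<integral>\<^sup>+x. B x \<partial>lborel) \<noteq> \<infinity>"
    using emeasure_lborel_ball_finite[of "0::'a" 1] by (simp add: B_def)
  ultimately show "emeasure (distr lborel borel T) A = emeasure lborel A"
    unfolding M_def using ennreal_mult_divide_eq infinity_ennreal_def by metis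
qed simp

lemma heis_vol_distr:
  fixes T :: "'n::finite heis \<Rightarrow> 'n heis"
  assumes "distr lborel borel T = lborel" and [measurable]: "T \<in> measurable borel borel"
  shows "distr heis_vol borel T = (heis_vol :: 'n heis measure)"
proof (rule measure_eqI)
  fix A :: "'n heis set" assume "A \<in> sets (distr heis_vol borel T)"
  then have [measurable]: "A \<in> sets borel" by simp
  have "emeasure (distr heis_vol borel T) A = 2 ^ CARD('n) * emeasure lborel (T -` A)"
    using measurable_sets_borel[OF assms(2), of A]
    by (simp add: emeasure_distr heis_vol_def emeasure_density_const)
  also have "emeasure lborel (T -` A) = emeasure (distr lborel borel T) A"
    by (simp add: emeasure_distr)
  finally show "emeasure (distr heis_vol borel T) A = emeasure heis_vol A"
    using assms by (simp add: heis_vol_def emeasure_density_const)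
qed simp

lemma L2_compose:
  fixes u :: "'n::finite heis \<Rightarrow> complex" and T :: "'n heis \<Rightarrow> 'n heis"
  assumes "distr lborel borel T = lborel" and [measurable]: "T \<in> measurable borel borel"
    and u: "u \<in> L2"
  shows "(\<lambda>x. u (T x)) \<in> L2" "L2_norm (\<lambda>x. u (T x)) = L2_norm u"
proof -
  note [measurable] = u
  note inv = distr_invariant_integral[OF heis_vol_distr[OF assms(1,2)] assms(2) sets_heis_vol, of "\<lambda>x. (norm (u x))\<^sup>2"]
  show "(\<lambda>x. u (T x)) \<in> L2"
    by (rule L2_I) (use inv(2) L2_integrable[OF u] measurable_compose[OF assms(2) L2_measurable[OF u]] in simp_all)
  show "L2_norm (\<lambda>x. u (T x)) = L2_norm u"
    using inv(1) by (simp add: L2_norm_def)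
qed

subsection \<open>Differentiation and integration\<close>

text \<open>The Lipschitz bound compares only with the value at \<open>y0\<close> and hence controls
  the difference quotients there; their limits give both the measurability of the derivative and the
  bound \<open>L x * norm h\<close>. Differentiability is tested on sequences so that dominated
  convergence applies.\<close>

lemma has_derivative_integral_dominated:
  fixes f :: "'a::real_normed_vector \<Rightarrow> 'x \<Rightarrow> 'b::{banach, second_countable_topology}"
  assumes der: "\<And>x. ((\<lambda>y. f y x) has_derivative f' x) (at y0)"
    and r: "r > 0" and int: "\<And>y. norm (y - y0) < r \<Longrightarrow> integrable M (f y)"
    and bd: "\<And>y x. norm (y - y0) < r \<Longrightarrow> norm (f y x - f y0 x) \<le> L x * norm (y - y0)"
    and L: "integrable M L"
  shows "integrable M (\<lambda>x. f' x h)"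
    and "((\<lambda>y. \<integral>x. f y x \<partial>M) has_derivative (\<lambda>h. \<integral>x. f' x h \<partial>M)) (at y0)"
proof -
  have [measurable]: "L \<in> borel_measurable M" using L by auto
  have f_meas: "f y \<in> borel_measurable M" if "norm (y - y0) < r" for y using int[OF that] by auto
  have lin: "bounded_linear (f' x)" for x using der has_derivative_bounded_linear by blast
  have lim0: "(\<lambda>k. norm (f (y0 + X k) x - f y0 x - f' x (X k)) / norm (X k)) \<longlonglongrightarrow> 0"
    if "X \<longlonglongrightarrow> 0" "\<And>k. X k \<noteq> 0" for X :: "nat \<Rightarrow> 'a" and x
    using der[of x] that unfolding has_derivative_at tendsto_at_iff_sequentially
    by (auto simp: o_def)
  \<comment> \<open>Positive scales tending to 0 that keep \<open>X k *\<^sub>R h\<close> within the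
    radius; the \<open>+ 1\<close> in the denominator covers \<open>h = 0\<close>.\<close>
  have lim1: "\<exists>X. X \<longlonglongrightarrow> 0 \<and> (\<forall>k. norm (X k *\<^sub>R h) < r \<and> X k > (0::real))" for h :: 'a
  proof -
    define X where "X k = min (r / (norm h + 1) / 2) (inverse (real (Suc k)))" for k
    have "r / (norm h + 1) / 2 > 0" using r by (simp add: add_nonneg_pos)
    then have pos: "X k > 0" for k by (simp add: X_def)
    have "X k * norm h < r" for k
    proof -
      have "X k * norm h \<le> r / (norm h + 1) / 2 * (norm h + 1)"
        using pos[of k] by (intro mult_mono) (auto simp: X_def)
      also have "\<dots> = r / 2"
      proof -
        have "r / q / 2 * q = r / 2" if "q > 0" for q :: real using that by simp
        from this[of "norm h + 1"] show ?thesis by (simp only: add_nonneg_pos[OF norm_ge_zero zero_less_one] if_True simp_thms)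
      qed
      also have "\<dots> < r" using r by simp
      finally show ?thesis .
    qed
    moreover have "X \<longlonglongrightarrow> 0"
      by (rule tendsto_sandwich[OF _ _ tendsto_const LIMSEQ_inverse_real_of_nat])
         (auto intro!: always_eventually less_imp_le[OF pos], simp add: X_def)
    ultimately show ?thesis using pos by (intro exI[of _ X]) (auto simp: abs_of_pos)
  qed
  have f'_meas [measurable]: "(\<lambda>x. f' x h) \<in> borel_measurable M"
    and f'_bd: "norm (f' x h) \<le> L x * norm h" for h x
  proof -
    obtain X where X: "X \<longlonglongrightarrow> 0" "\<And>k. norm (X k *\<^sub>R h) < r" "\<And>k. X k > 0" using lim1 by blast
    have lim: "(\<lambda>k. (f (y0 + X k *\<^sub>R h) x - f y0 x) /\<^sub>R X k) \<longlonglongrightarrow> f' x h" for x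
    proof (cases "h = 0")
      case True then show ?thesis using linear_simps(3)[OF lin] by simp
    next
      case False
      have "(\<lambda>k. norm (f (y0 + X k *\<^sub>R h) x - f y0 x - f' x (X k *\<^sub>R h)) / norm (X k *\<^sub>R h)) \<longlonglongrightarrow> 0"
        using X False by (intro lim0) (auto intro!: tendsto_eq_intros simp: less_imp_neq[THEN not_sym])
      then have "(\<lambda>k. norm h * (norm (f (y0 + X k *\<^sub>R h) x - f y0 x - f' x (X k *\<^sub>R h)) / norm (X k *\<^sub>R h))) \<longlonglongrightarrow> norm h * 0"
        by (intro tendsto_intros)
      moreover have "norm h * (norm (f (y0 + X k *\<^sub>R h) x - f y0 x - f' x (X k *\<^sub>R h)) / norm (X k *\<^sub>R h))
          = norm ((f (y0 + X k *\<^sub>R h) x - f y0 x) /\<^sub>R X k - f' x h)" for k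
      proof -
        have "(f (y0 + X k *\<^sub>R h) x - f y0 x) /\<^sub>R X k - f' x h = (f (y0 + X k *\<^sub>R h) x - f y0 x - f' x (X k *\<^sub>R h)) /\<^sub>R X k"
          using X(3)[of k] by (simp add: linear_simps(5)[OF lin] scaleR_diff_right)
        moreover have "norm h * (d / norm (X k *\<^sub>R h)) = norm (inverse (X k)) * d" for d
          using False X(3)[of k] by (simp add: divide_inverse)
        ultimately show ?thesis by (simp only: norm_scaleR real_norm_def)
      qed
      ultimately show ?thesis by (simp add: tendsto_norm_zero_iff LIM_zero_iff)
    qed
    show "(\<lambda>x. f' x h) \<in> borel_measurable M"
    proof (rule borel_measurable_LIMSEQ_metric[OF _ lim])
      have [measurable]: "f y0 \<in> borel_measurable M" "\<And>k. f (y0 + X k *\<^sub>R h) \<in> borel_measurable M"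
        using X(2) r by (auto intro!: f_meas)
      show "(\<lambda>x. (f (y0 + X k *\<^sub>R h) x - f y0 x) /\<^sub>R X k) \<in> borel_measurable M" for k by measurable
    qed
    show "norm (f' x h) \<le> L x * norm h"
    proof (rule LIMSEQ_le_const2[OF tendsto_norm[OF lim]])
      have "norm ((f (y0 + X k *\<^sub>R h) x - f y0 x) /\<^sub>R X k) \<le> L x * norm h" for k
      proof -
        have "inverse (X k) * norm (f (y0 + X k *\<^sub>R h) x - f y0 x) \<le> inverse (X k) * (L x * norm (X k *\<^sub>R h))"
          using bd[of "y0 + X k *\<^sub>R h" x] X(2)[of k] X(3)[of k] by (intro mult_left_mono) auto
        moreover have "inverse (X k) * (L x * norm (X k *\<^sub>R h)) = L x * norm h"
          using X(3)[of k] by simp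
        moreover have "\<bar>inverse (X k)\<bar> = inverse (X k)" using X(3)[of k] by simp
        ultimately show ?thesis by (simp only: norm_scaleR real_norm_def)
      qed
      then show "\<exists>N. \<forall>k\<ge>N. norm ((f (y0 + X k *\<^sub>R h) x - f y0 x) /\<^sub>R X k) \<le> L x * norm h"
        by blast
    qed
  qed
  show int': "integrable M (\<lambda>x. f' x h)" for h
    by (rule Bochner_Integration.integrable_bound[of M "\<lambda>x. L x * norm h"])
       (use L f'_bd in \<open>auto intro: order_trans[OF _ abs_ge_self]\<close>)
  have lin_int: "bounded_linear (\<lambda>h. \<integral>x. f' x h \<partial>M)"
  proof (rule bounded_linear_intro[where K = "\<integral>x. L x \<partial>M"])
    show "(\<integral>x. f' x (h + h') \<partial>M) = (\<integral>x. f' x h \<partial>M) + (\<integral>x. f' x h' \<partial>M)" for h h'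
      using int' by (simp add: linear_simps(1)[OF lin])
    show "(\<integral>x. f' x (c *\<^sub>R h) \<partial>M) = c *\<^sub>R (\<integral>x. f' x h \<partial>M)" for c h
      by (simp add: linear_simps(5)[OF lin])
    show "norm (\<integral>x. f' x h \<partial>M) \<le> norm h * (\<integral>x. L x \<partial>M)" for h
    proof -
      have "norm (\<integral>x. f' x h \<partial>M) \<le> (\<integral>x. L x * norm h \<partial>M)"
        using int' L f'_bd by (intro order_trans[OF integral_norm_bound] integral_mono) auto
      then show ?thesis by (simp add: mult.commute)
    qed
  qed
  show "((\<lambda>y. \<integral>x. f y x \<partial>M) has_derivative (\<lambda>h. \<integral>x. f' x h \<partial>M)) (at y0)"
    unfolding has_derivative_at tendsto_at_iff_sequentially o_def
  proof (intro conjI allI impI lin_int)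
    fix X :: "nat \<Rightarrow> 'a" assume X0: "\<forall>i. X i \<in> UNIV - {0}" and "X \<longlonglongrightarrow> 0"
    then obtain N where N: "\<And>k. k \<ge> N \<Longrightarrow> norm (X k) < r" using r by (metis LIMSEQ_D diff_zero)
    \<comment> \<open>Dropping the first \<open>N\<close> terms leaves only points at which
      \<open>f\<close> is known to be integrable.\<close>
    define Y where "Y k = X (k + N)" for k
    have Y: "Y \<longlonglongrightarrow> 0" "\<And>k. Y k \<noteq> 0" "\<And>k. norm (Y k) < r"
      using X0 N LIMSEQ_ignore_initial_segment[OF \<open>X \<longlonglongrightarrow> 0\<close>, of N] by (auto simp: Y_def[abs_def])
    define q where "q k x = norm (f (y0 + Y k) x - f y0 x - f' x (Y k)) / norm (Y k)" for k x
    have q_meas: "q k \<in> borel_measurable M" for k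
    proof -
      have [measurable]: "f y0 \<in> borel_measurable M" "f (y0 + Y k) \<in> borel_measurable M"
        using Y(3)[of k] r by (auto intro!: f_meas)
      show ?thesis unfolding q_def[abs_def] by measurable
    qed
    have q_le: "norm (q k x) \<le> 2 * L x" for k x
    proof -
      have "norm (f (y0 + Y k) x - f y0 x - f' x (Y k)) \<le> L x * norm (Y k) + L x * norm (Y k)"
        using bd[of "y0 + Y k" x] Y(3)[of k] f'_bd[of x "Y k"]
          norm_triangle_ineq4[of "f (y0 + Y k) x - f y0 x" "f' x (Y k)"] by simp
      then show ?thesis using Y(2)[of k] by (simp add: q_def field_simps)
    qed
    have "(\<lambda>k. \<integral>x. q k x \<partial>M) \<longlonglongrightarrow> (\<integral>x. 0 \<partial>M)"
    proof (rule integral_dominated_convergence)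
      show "integrable M (\<lambda>x. 2 * L x)" using L by simp
      show "AE x in M. (\<lambda>k. q k x) \<longlonglongrightarrow> 0" unfolding q_def using lim0[OF Y(1,2)] by simp
    qed (use q_meas q_le in auto)
    then have lim: "(\<lambda>k. \<integral>x. q k x \<partial>M) \<longlonglongrightarrow> 0" by simp
    have "(\<lambda>k. norm ((\<integral>x. f (y0 + Y k) x \<partial>M) - (\<integral>x. f y0 x \<partial>M) - (\<integral>x. f' x (Y k) \<partial>M)) / norm (Y k)) \<longlonglongrightarrow> 0"
    proof (rule tendsto_sandwich[OF _ _ tendsto_const lim])
      have "norm ((\<integral>x. f (y0 + Y k) x \<partial>M) - (\<integral>x. f y0 x \<partial>M) - (\<integral>x. f' x (Y k) \<partial>M)) / norm (Y k) \<le> (\<integral>x. q k x \<partial>M)" for k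
      proof -
        have i: "integrable M (f (y0 + Y k))" "integrable M (f y0)" using int Y(3)[of k] r by auto
        then have "(\<integral>x. f (y0 + Y k) x \<partial>M) - (\<integral>x. f y0 x \<partial>M) - (\<integral>x. f' x (Y k) \<partial>M)
            = (\<integral>x. f (y0 + Y k) x - f y0 x - f' x (Y k) \<partial>M)"
          using int' by simp
        then show ?thesis
          unfolding q_def by (auto intro!: divide_right_mono integral_norm_bound)
      qed
      then show "\<forall>\<^sub>F k in sequentially. norm ((\<integral>x. f (y0 + Y k) x \<partial>M) - (\<integral>x. f y0 x \<partial>M) - (\<integral>x. f' x (Y k) \<partial>M)) / norm (Y k) \<le> (\<integral>x. q k x \<partial>M)"
        by simp
    qed simp
    then show "(\<lambda>k. norm ((\<integral>x. f (y0 + X k) x \<partial>M) - (\<integral>x. f y0 x \<partial>M) - (\<integral>x. f' x (X k) \<partial>M)) / norm (X k)) \<longlonglongrightarrow> 0"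
      unfolding Y_def by (rule LIMSEQ_offset)
  qed
qed

text \<open>By translation invariance every difference quotient has integral 0, and the quotients
  converge dominatedly to the derivative. This serves as integration by parts in an arbitrary
  direction.\<close>

lemma integral_directional_derivative_eq_0:
  fixes f :: "'a::euclidean_space \<Rightarrow> 'b::euclidean_space"
  assumes der: "\<And>x. (f has_derivative f' x) (at x)" and cont: "continuous_on UNIV (\<lambda>x. f' x v)"
    and supp: "\<And>x. norm x > R \<Longrightarrow> f x = 0"
  shows "(\<integral>x. f' x v \<partial>lborel) = 0"
proof -
  have f_cont: "continuous_on UNIV f"
    using der by (auto intro!: continuous_at_imp_continuous_on has_derivative_continuous)
  have f_int: "integrable lborel f" by (rule continuous_bounded_support_integrable[OF f_cont supp])
  have [measurable]: "f \<in> borel_measurable borel" "(\<lambda>x. f' x v) \<in> borel_measurable borel"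
    using f_cont cont by (auto intro: borel_measurable_continuous_onI)
  \<comment> \<open>The steps have length at most 1: a point outside the ball of radius
    \<open>K\<close> stays outside the support after the shift, and a segment starting inside
    reaches radius at most \<open>K + norm v\<close>.\<close>
  define K where "K = R + norm v"
  have "bounded ((\<lambda>x. f' x v) ` cball 0 (K + norm v))"
    by (intro compact_imp_bounded compact_continuous_image continuous_on_subset[OF cont]) auto
  then obtain B where B: "B > 0" "\<And>x. norm x \<le> K + norm v \<Longrightarrow> norm (f' x v) \<le> B"
    unfolding bounded_pos by auto
  have lin: "bounded_linear (f' x)" for x using der has_derivative_bounded_linear by blast
  have bd: "norm (real (Suc k) *\<^sub>R (f (inverse (real (Suc k)) *\<^sub>R v + x) - f x)) \<le> B * indicator (cball 0 K) x" for k x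
  proof (cases "norm x \<le> K")
    case True
    define h where "h = inverse (real (Suc k))"
    have h: "0 < h" "h \<le> 1" by (auto simp: h_def field_simps)
    have "norm (f (x + h *\<^sub>R v) - f (x + 0 *\<^sub>R v)) \<le> B * norm (h - 0)"
    proof (rule differentiable_bound[of "{0..h}" "\<lambda>t. f (x + t *\<^sub>R v)" "\<lambda>t s. s *\<^sub>R f' (x + t *\<^sub>R v) v"])
      fix t assume t: "t \<in> {0..h}"
      have "((\<lambda>t. f (x + t *\<^sub>R v)) has_derivative (\<lambda>s. f' (x + t *\<^sub>R v) (s *\<^sub>R v))) (at t within {0..h})"
        by (rule has_derivative_compose[OF _ der]) (auto intro!: derivative_eq_intros)
      then show "((\<lambda>t. f (x + t *\<^sub>R v)) has_derivative (\<lambda>s. s *\<^sub>R f' (x + t *\<^sub>R v) v)) (at t within {0..h})"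
        by (simp add: linear_simps(5)[OF lin])
      have "norm (x + t *\<^sub>R v) \<le> norm x + \<bar>t\<bar> * norm v" using norm_triangle_ineq[of x "t *\<^sub>R v"] by simp
      also have "\<dots> \<le> K + 1 * norm v" using True t h by (intro add_mono mult_right_mono) auto
      finally show "onorm (\<lambda>s. s *\<^sub>R f' (x + t *\<^sub>R v) v) \<le> B"
        using B(2)[of "x + t *\<^sub>R v"] by (intro onorm_le) (simp add: mult.commute[of B] mult_left_mono)
    qed (use h in auto)
    then have "real (Suc k) * norm (f (h *\<^sub>R v + x) - f x) \<le> real (Suc k) * (B * h)"
      using h by (intro mult_left_mono) (simp_all add: add.commute)
    also have "\<dots> = B" by (simp add: h_def field_simps del: of_nat_Suc)
    finally show ?thesis using True unfolding h_def[symmetric] norm_scaleR by simp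
  next
    case False
    have "norm (inverse (real (Suc k)) *\<^sub>R v + x) \<ge> norm x - inverse (real (Suc k)) * norm v"
      using norm_triangle_ineq2[of x "- (inverse (real (Suc k)) *\<^sub>R v)"] by (simp add: add.commute)
    moreover have "inverse (real (Suc k)) * norm v \<le> 1 * norm v" by (intro mult_right_mono) (auto simp: field_simps)
    ultimately have "norm (inverse (real (Suc k)) *\<^sub>R v + x) > R" using False by (simp add: K_def)
    moreover have "norm x > R" using False norm_ge_zero[of v] unfolding K_def by linarith
    ultimately show ?thesis using supp False by simp
  qed
  have "(\<lambda>k. \<integral>x. real (Suc k) *\<^sub>R (f (inverse (real (Suc k)) *\<^sub>R v + x) - f x) \<partial>lborel) \<longlonglongrightarrow> (\<integral>x. f' x v \<partial>lborel)"
  proof (rule integral_dominated_convergence)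
    show "integrable lborel (\<lambda>x. B * indicator (cball (0::'a) K) x :: real)"
      using emeasure_lborel_cball_finite[of "0::'a" K] by simp
    show "AE x in lborel. (\<lambda>k. real (Suc k) *\<^sub>R (f (inverse (real (Suc k)) *\<^sub>R v + x) - f x)) \<longlonglongrightarrow> f' x v"
    proof (rule AE_I2)
      fix x
      have "((\<lambda>t. f (x + t *\<^sub>R v)) has_derivative (\<lambda>s. f' (x + 0 *\<^sub>R v) (s *\<^sub>R v))) (at 0)"
        by (rule has_derivative_compose[OF _ der]) (auto intro!: derivative_eq_intros)
      then have "((\<lambda>t. f (x + t *\<^sub>R v)) has_vector_derivative f' x v) (at 0)"
        by (simp add: has_vector_derivative_def linear_simps(5)[OF lin])
      then have "((\<lambda>t. norm (f (x + t *\<^sub>R v) - f x - t *\<^sub>R f' x v) / norm t) \<longlongrightarrow> 0) (at 0)"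
        by (simp add: has_vector_derivative_def has_derivative_at)
      then have "((\<lambda>t. norm ((f (x + t *\<^sub>R v) - f x) /\<^sub>R t - f' x v)) \<longlongrightarrow> 0) (at 0)"
      proof (rule Lim_transform_eventually)
        have "norm (f (x + t *\<^sub>R v) - f x - t *\<^sub>R f' x v) / norm t = norm ((f (x + t *\<^sub>R v) - f x) /\<^sub>R t - f' x v)"
          if "t \<noteq> 0" for t
        proof -
          have "(f (x + t *\<^sub>R v) - f x) /\<^sub>R t - f' x v = (f (x + t *\<^sub>R v) - f x - t *\<^sub>R f' x v) /\<^sub>R t"
            using that by (simp add: scaleR_diff_right)
          then show ?thesis by (simp only: norm_scaleR) (simp add: divide_inverse mult.commute)
        qed
        then show "\<forall>\<^sub>F t in at 0. norm (f (x + t *\<^sub>R v) - f x - t *\<^sub>R f' x v) / norm t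
            = norm ((f (x + t *\<^sub>R v) - f x) /\<^sub>R t - f' x v)"
          by (simp add: eventually_at_filter)
      qed
      then have "((\<lambda>t. (f (x + t *\<^sub>R v) - f x) /\<^sub>R t) \<longlongrightarrow> f' x v) (at 0)"
        by (simp add: tendsto_norm_zero_iff LIM_zero_iff)
      moreover have "filterlim (\<lambda>k. inverse (real (Suc k))) (at 0) sequentially"
        unfolding filterlim_at by (intro conjI always_eventually LIMSEQ_inverse_real_of_nat) auto
      ultimately have "(\<lambda>k. (f (x + inverse (real (Suc k)) *\<^sub>R v) - f x) /\<^sub>R inverse (real (Suc k))) \<longlonglongrightarrow> f' x v"
        by (rule filterlim_compose)
      then show "(\<lambda>k. real (Suc k) *\<^sub>R (f (inverse (real (Suc k)) *\<^sub>R v + x) - f x)) \<longlonglongrightarrow> f' x v"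
        by (simp add: add.commute)
    qed
  qed (use bd in auto)
  moreover have "(\<integral>x. real (Suc k) *\<^sub>R (f (inverse (real (Suc k)) *\<^sub>R v + x) - f x) \<partial>lborel) = 0" for k
    using f_int integral_lborel_translate[of f "inverse (real (Suc k)) *\<^sub>R v"] by simp
  ultimately show ?thesis using LIMSEQ_unique tendsto_const by (simp add: LIMSEQ_const_iff)
qed

subsection \<open>Explicit integrals\<close>

lemma integrable_power_mult_exp_Ici:
  fixes a :: real assumes "a > 0"
  shows "integrable lborel (\<lambda>x. indicator {0..} x * (x ^ k * exp (- (x * a))))"
proof -
  have "integrable lborel (\<lambda>x. x ^ k * exp (- x) * indicator {0..} x :: real)"
  proof (rule integrableI_nonneg)
    have "(\<integral>\<^sup>+x. ennreal (x ^ k * exp (- x) * indicator {0..} x) \<partial>lborel) = real_of_nat (fact k)"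
      unfolding nn_intergal_power_times_exp_Ici[symmetric]
      by (intro nn_integral_cong) (auto split: split_indicator)
    then show "(\<integral>\<^sup>+x. ennreal (x ^ k * exp (- x) * indicator {0..} x) \<partial>lborel) < \<infinity>"
      by (simp only: ennreal_less_top infinity_ennreal_def)
  qed (auto intro!: AE_I2 split: split_indicator)
  from lborel_integrable_real_affine[OF this, of a 0] assms
  have "integrable lborel (\<lambda>x. (1 / a ^ k) * ((a * x) ^ k * exp (- (a * x)) * indicator {0..} (a * x)))"
    by simp
  also have "(\<lambda>x. (1 / a ^ k) * ((a * x) ^ k * exp (- (a * x)) * indicator {0..} (a * x))) =
      (\<lambda>x. indicator {0..} x * (x ^ k * exp (- (x * a))))"
    using assms by (auto simp: fun_eq_iff power_mult_distrib zero_le_mult_iff mult.commute split: split_indicator)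
  finally show ?thesis .
qed

lemma power_mult_exp_tendsto_0:
  fixes a :: real assumes "a > 0"
  shows "((\<lambda>x. x ^ k * exp (- (x * a))) \<longlongrightarrow> 0) at_top"
proof -
  have "filterlim (\<lambda>x. a * x) at_top at_top"
    by (rule filterlim_tendsto_pos_mult_at_top[OF tendsto_const assms filterlim_ident])
  then have "((\<lambda>x. (a * x) ^ k / exp (a * x)) \<longlongrightarrow> 0) at_top"
    by (rule filterlim_compose[OF tendsto_power_div_exp_0])
  then have "((\<lambda>x. 1 / a ^ k * ((a * x) ^ k / exp (a * x))) \<longlongrightarrow> 1 / a ^ k * 0) at_top"
    by (intro tendsto_intros)
  moreover have "1 / a ^ k * ((a * x) ^ k / exp (a * x)) = x ^ k * exp (- (x * a))" for x
    using assms by (simp add: power_mult_distrib exp_minus field_simps)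
  ultimately show ?thesis by simp
qed

text \<open>Produced by repeated integration by parts. For complex \<open>A\<close> the Laplace
  integral is not a rescaling of the real one, so it is evaluated from an explicit
  antiderivative.\<close>

primrec Laplace_antiderivative :: "complex \<Rightarrow> nat \<Rightarrow> real \<Rightarrow> complex" where
  "Laplace_antiderivative A 0 x = - exp (- (of_real x * A)) / A"
| "Laplace_antiderivative A (Suc k) x =
     - (of_real x ^ Suc k * exp (- (of_real x * A))) / A + of_nat (Suc k) / A * Laplace_antiderivative A k x"

lemma Laplace_antiderivative_deriv:
  assumes "A \<noteq> 0"
  shows "(Laplace_antiderivative A k has_vector_derivative of_real x ^ k * exp (- (of_real x * A))) (at x within S)"
proof (induction k)
  case 0
  have "((\<lambda>x::real. - exp (- (of_real x * A)) / A) has_vector_derivative exp (- (of_real x * A))) (at x within S)"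
    using assms by (auto intro!: derivative_eq_intros has_vector_derivative_real_field[of _ _ x]
      simp: scaleR_conv_of_real) 
  then show ?case by (simp add: Laplace_antiderivative.simps(1)[abs_def])
next
  case (Suc k)
  have "((\<lambda>z. z ^ Suc k * exp (- (z * A))) has_field_derivative
      of_nat (Suc k) * of_real x ^ k * exp (- (of_real x * A)) - of_real x ^ Suc k * (A * exp (- (of_real x * A)))) (at (of_real x))"
    by (auto intro!: derivative_eq_intros simp del: power_Suc)
  note * = has_vector_derivative_real_field[OF this, of S]
  have "((\<lambda>x::real. - (of_real x ^ Suc k * exp (- (of_real x * A))) / A + of_nat (Suc k) / A * Laplace_antiderivative A k x)
      has_vector_derivative - (of_nat (Suc k) * of_real x ^ k * exp (- (of_real x * A)) - of_real x ^ Suc k * (A * exp (- (of_real x * A)))) / A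
        + of_nat (Suc k) / A * (of_real x ^ k * exp (- (of_real x * A)))) (at x within S)"
    by (intro has_vector_derivative_add has_vector_derivative_divide has_vector_derivative_minus
        has_vector_derivative_mult_right * Suc)
  moreover have "- (of_nat (Suc k) * of_real x ^ k * exp (- (of_real x * A)) - of_real x ^ Suc k * (A * exp (- (of_real x * A)))) / A
        + of_nat (Suc k) / A * (of_real x ^ k * exp (- (of_real x * A))) = of_real x ^ Suc k * exp (- (of_real x * A))"
    using assms by (simp add: divide_simps)
  ultimately show ?case by (simp add: Laplace_antiderivative.simps(2)[abs_def])
qed

lemma Laplace_antiderivative_0: "A \<noteq> 0 \<Longrightarrow> Laplace_antiderivative A k 0 = - (fact k / A ^ Suc k)"
proof (induction k)
  case (Suc k)
  then show ?case by (simp only: Laplace_antiderivative.simps Suc.IH[OF Suc.prems]) (simp add: divide_simps)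
qed simp

lemma norm_power_mult_exp:
  "norm (of_real x ^ k * exp (- (of_real x * A))) = \<bar>x\<bar> ^ k * exp (- (x * Re A))"
  by (simp add: norm_mult norm_power)

lemma Laplace_antiderivative_tendsto_0:
  assumes "Re A > 0"
  shows "(Laplace_antiderivative A k \<longlongrightarrow> 0) at_top"
proof -
  have *: "((\<lambda>x. of_real x ^ k * exp (- (of_real x * A))) \<longlongrightarrow> 0) at_top" for k
  proof (rule tendsto_norm_zero_cancel, rule Lim_transform_eventually[OF power_mult_exp_tendsto_0[OF assms, of k]])
    show "\<forall>\<^sub>F x in at_top. x ^ k * exp (- (x * Re A)) = norm (of_real x ^ k * exp (- (of_real x * A)))"
      using eventually_ge_at_top[of 0] by eventually_elim (simp add: norm_power_mult_exp)
  qed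
  show ?thesis
  proof (induction k)
    case 0
    show ?case using tendsto_divide[OF tendsto_minus[OF *[of 0]] tendsto_const[of A]] assms
      by (force simp: Laplace_antiderivative.simps(1)[abs_def])
  next
    case (Suc k)
    have "((\<lambda>x. - (of_real x ^ Suc k * exp (- (of_real x * A))) / A + of_nat (Suc k) / A * Laplace_antiderivative A k x)
        \<longlongrightarrow> - 0 / A + of_nat (Suc k) / A * 0) at_top"
      using assms by (intro tendsto_add tendsto_divide tendsto_minus tendsto_mult * Suc tendsto_const) auto
    then show ?case by (simp add: Laplace_antiderivative.simps(2)[abs_def])
  qed
qed

lemma Laplace_integral_power:
  assumes "Re A > 0"
  shows "integrable lborel (\<lambda>x. indicator {0..} x *\<^sub>R (of_real x ^ k * exp (- (of_real x * A))))"
    and "(\<integral>x. indicator {0..} x *\<^sub>R (of_real x ^ k * exp (- (of_real x * A))) \<partial>lborel) = fact k / A ^ Suc k"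
proof -
  have A: "A \<noteq> 0" using assms by auto
  let ?f = "\<lambda>x::real. of_real x ^ k * exp (- (of_real x * A))"
  have [measurable]: "?f \<in> borel_measurable borel"
    by (intro borel_measurable_continuous_onI continuous_intros)
  note real_int = integrable_power_mult_exp_Ici[OF assms, of k]
  have norm_eq: "norm (indicator {0..} x *\<^sub>R ?f x) = indicator {0..} x * (x ^ k * exp (- (x * Re A)))" for x
    using norm_power_mult_exp[of x k A] by (auto split: split_indicator)
  show int: "integrable lborel (\<lambda>x. indicator {0..} x *\<^sub>R ?f x)"
    by (rule Bochner_Integration.integrable_bound[OF real_int]) (simp_all only: norm_eq, simp_all)
  have "(\<lambda>m. \<integral>x. indicator {0..real m} x *\<^sub>R ?f x \<partial>lborel) \<longlonglongrightarrow> (\<integral>x. indicator {0..} x *\<^sub>R ?f x \<partial>lborel)"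
  proof (rule integral_dominated_convergence[OF _ _ real_int])
    show "AE x in lborel. (\<lambda>m. indicator {0..real m} x *\<^sub>R ?f x) \<longlonglongrightarrow> indicator {0..} x *\<^sub>R ?f x"
    proof (intro AE_I2 tendsto_eventually)
      fix x :: real
      obtain m where "x \<le> real m" using real_arch_simple by blast
      then show "\<forall>\<^sub>F m in sequentially. indicator {0..real m} x *\<^sub>R ?f x = indicator {0..} x *\<^sub>R ?f x"
        by (intro eventually_sequentiallyI[of m]) (auto split: split_indicator)
    qed
    show "AE x in lborel. norm (indicator {0..real m} x *\<^sub>R ?f x) \<le> indicator {0..} x * (x ^ k * exp (- (x * Re A)))" for m
      unfolding norm_eq[symmetric] by (auto split: split_indicator)
  qed measurable
  moreover have "(\<integral>x. indicator {0..real m} x *\<^sub>R ?f x \<partial>lborel) = Laplace_antiderivative A k (real m) - Laplace_antiderivative A k 0" for m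
    by (rule integral_FTC_Icc) (auto intro!: Laplace_antiderivative_deriv[OF A] continuous_intros)
  moreover have "(\<lambda>m. Laplace_antiderivative A k (real m) - Laplace_antiderivative A k 0) \<longlonglongrightarrow> 0 - Laplace_antiderivative A k 0"
    by (intro tendsto_intros filterlim_compose[OF Laplace_antiderivative_tendsto_0[OF assms] filterlim_real_sequentially])
  ultimately show "(\<integral>x. indicator {0..} x *\<^sub>R ?f x \<partial>lborel) = fact k / A ^ Suc k"
    using LIMSEQ_unique Laplace_antiderivative_0[OF A, of k] by fastforce
qed

section \<open>Gaussian integrals of the quadratic form\<close>

lemma nn_integral_Gaussian_real:
  assumes "c > 0" shows "(\<integral>\<^sup>+x. ennreal (exp (- (c * x\<^sup>2))) \<partial>lborel) = ennreal (sqrt (pi / c))"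
proof -
  \<comment> \<open>The deviation for which the normal density is
    \<open>exp (- (c * x^2)) / sqrt (pi / c)\<close>.\<close>
  define \<sigma> where "\<sigma> = sqrt (1 / (2 * c))"
  have \<sigma>: "\<sigma> > 0" "\<sigma>\<^sup>2 = 1 / (2 * c)" using assms by (auto simp: \<sigma>_def)
  interpret prob_space "density lborel (normal_density 0 \<sigma>)"
    by (rule prob_space_normal_density[OF \<sigma>(1)])
  have "1 = (\<integral>\<^sup>+x. ennreal (normal_density 0 \<sigma> x) \<partial>lborel)"
    using emeasure_space_1 by (simp add: emeasure_density)
  also have "\<dots> = (\<integral>\<^sup>+x. ennreal (1 / sqrt (pi / c)) * ennreal (exp (- (c * x\<^sup>2))) \<partial>lborel)"
    using assms by (intro nn_integral_cong) (simp add: normal_density_def \<sigma> ennreal_mult[symmetric] field_simps)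
  also have "\<dots> = ennreal (1 / sqrt (pi / c)) * (\<integral>\<^sup>+x. ennreal (exp (- (c * x\<^sup>2))) \<partial>lborel)"
    by (rule nn_integral_cmult) simp
  finally have "ennreal (sqrt (pi / c)) * 1 = ennreal (sqrt (pi / c)) * (ennreal (1 / sqrt (pi / c)) * (\<integral>\<^sup>+x. ennreal (exp (- (c * x\<^sup>2))) \<partial>lborel))"
    by simp
  also have "\<dots> = (\<integral>\<^sup>+x. ennreal (exp (- (c * x\<^sup>2))) \<partial>lborel)"
    using assms by (simp add: mult.assoc[symmetric] ennreal_mult[symmetric])
  finally show ?thesis by simp
qed

lemma prod_Basis_vec:
  fixes f :: "complex ^ 'n::finite \<Rightarrow> 'b::comm_monoid_mult"
  shows "(\<Prod>b\<in>Basis. f b) = (\<Prod>j\<in>UNIV. f (axis j 1) * f (axis j \<i>))"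
proof -
  have B: "Basis = (\<lambda>(j::'n, u::complex). axis j u) ` (UNIV \<times> {1, \<i>})"
    by (auto simp: Basis_vec_def Basis_complex_def)
  have inj: "inj_on (\<lambda>(j::'n, u::complex). axis j u) (UNIV \<times> {1, \<i>})"
    by (auto simp: inj_on_def axis_eq_axis)
  have "(\<Prod>b\<in>Basis. f b) = (\<Prod>(j, u)\<in>UNIV \<times> {1, \<i>}. f (axis j u))"
    unfolding B prod.reindex[OF inj] by (simp add: case_prod_unfold o_def)
  also have "\<dots> = (\<Prod>j\<in>UNIV. f (axis j 1) * f (axis j \<i>))"
    by (simp add: prod.cartesian_product[symmetric])
  finally show ?thesis .
qed

definition qform :: "real ^ 'n::finite \<Rightarrow> complex ^ 'n \<Rightarrow> real" where
  "qform lam w = (\<Sum>j\<in>UNIV. lam $ j * (norm (w $ j))\<^sup>2)"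

lemma qform_nonneg: "(\<And>j. lam $ j > 0) \<Longrightarrow> 0 \<le> qform lam w"
  unfolding qform_def by (intro sum_nonneg) (simp add: less_imp_le)

lemma qform_0 [simp]: "qform lam 0 = 0"
  by (simp add: qform_def)

lemma continuous_on_qform [continuous_intros]:
  "continuous_on S f \<Longrightarrow> continuous_on S (\<lambda>x. qform lam (f x))"
  unfolding qform_def by (intro continuous_intros)

lemma borel_measurable_qform [measurable]: "qform lam \<in> borel_measurable borel"
  by (intro borel_measurable_continuous_onI continuous_intros)

lemma nn_integral_Gaussian_qform:
  fixes lam :: "real ^ 'n::finite"
  assumes lam: "\<And>j. lam $ j > 0" and c: "c > 0"
  shows "(\<integral>\<^sup>+w. ennreal (exp (- (c * qform lam w))) \<partial>lborel) = ennreal (pi ^ CARD('n) / (c ^ CARD('n) * (\<Prod>j\<in>UNIV. lam $ j)))"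
proof -
  \<comment> \<open>The product formula for Lebesgue measure asks for one factor per basis vector
    \<open>b\<close>; the sum recovers \<open>lam $ j\<close> from \<open>b = axis j u\<close> with
    \<open>u\<close> of modulus 1.\<close>
  define f where "f b x = ennreal (exp (- (c * (\<Sum>j\<in>UNIV. lam $ j * norm (b $ j)) * x\<^sup>2)))" for b :: "complex ^ 'n" and x :: real
  have inner1: "w \<bullet> axis j 1 = Re (w $ j)" "w \<bullet> axis j \<i> = Im (w $ j)" for w :: "complex ^ 'n" and j
    by (simp_all add: inner_axis inner_complex_def)
  have f_axis: "f (axis j u) x = ennreal (exp (- (c * lam $ j * x\<^sup>2)))" if "norm u = 1" for j u x
  proof -
    have "(\<Sum>i\<in>UNIV. lam $ i * norm (axis j u $ i)) = (\<Sum>i\<in>UNIV. if i = j then lam $ j else 0)"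
      using that by (intro sum.cong) (auto simp: axis_def)
    then show ?thesis by (simp add: f_def)
  qed
  have "ennreal (exp (- (c * qform lam w))) = (\<Prod>b\<in>Basis. f b (w \<bullet> b))" for w
  proof -
    have "exp (- (c * qform lam w)) = (\<Prod>j\<in>UNIV. exp (- (c * lam $ j * (Re (w $ j))\<^sup>2)) * exp (- (c * lam $ j * (Im (w $ j))\<^sup>2)))"
    proof -
      have "- (c * qform lam w) = (\<Sum>j\<in>UNIV. - (c * lam $ j * (Re (w $ j))\<^sup>2) + - (c * lam $ j * (Im (w $ j))\<^sup>2))"
        unfolding qform_def sum_distrib_left sum_negf[symmetric]
        by (intro sum.cong) (simp_all add: cmod_power2 algebra_simps)
      then show ?thesis unfolding mult_exp_exp by (simp only: exp_sum[OF finite])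
    qed
    then show ?thesis
      by (simp add: prod_Basis_vec inner1 f_axis prod_ennreal[symmetric] ennreal_mult)
  qed
  then have "(\<integral>\<^sup>+w. ennreal (exp (- (c * qform lam w))) \<partial>lborel) = (\<integral>\<^sup>+w. (\<Prod>b\<in>Basis. f b (w \<bullet> b)) \<partial>lborel)"
    by simp
  also have "\<dots> = (\<Prod>b\<in>Basis. (\<integral>\<^sup>+x. f b x \<partial>lborel))"
    by (rule nn_integral_lborel_prod) (auto simp: f_def)
  also have "\<dots> = (\<Prod>j\<in>UNIV. ennreal (pi / (c * lam $ j)))"
  proof -
    have "(\<integral>\<^sup>+x. f (axis j u) x \<partial>lborel) = ennreal (sqrt (pi / (c * lam $ j)))" if "norm u = 1" for j u
      using nn_integral_Gaussian_real[of "c * lam $ j"] lam c by (simp add: f_axis that)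
    then show ?thesis
      using lam c by (simp add: prod_Basis_vec ennreal_mult[symmetric] less_imp_le)
  qed
  also have "\<dots> = ennreal (\<Prod>j\<in>UNIV. pi / (c * lam $ j))"
    using lam c by (intro prod_ennreal) (simp add: less_imp_le)
  also have "(\<Prod>j\<in>UNIV. pi / (c * lam $ j)) = pi ^ CARD('n) / (c ^ CARD('n) * (\<Prod>j\<in>UNIV. lam $ j))"
    by (simp add: prod_dividef prod.distrib)
  finally show ?thesis .
qed

lemma integral_Gaussian_qform:
  fixes lam :: "real ^ 'n::finite"
  assumes lam: "\<And>j. lam $ j > 0" and c: "c > 0"
  shows "has_bochner_integral lborel (\<lambda>w. exp (- (c * qform lam w))) (pi ^ CARD('n) / (c ^ CARD('n) * (\<Prod>j\<in>UNIV. lam $ j)))"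
  using nn_integral_Gaussian_qform[OF assms] assms
  by (intro has_bochner_integral_nn_integral) (auto simp: prod_nonneg less_imp_le)

text \<open>Both statements follow by writing the integrand as a Laplace transform and integrating the
  Gaussian first.\<close>

lemma integral_inverse_power_qform:
  fixes lam :: "real ^ 'n::finite"
  assumes lam: "\<And>j. lam $ j > 0" and a: "Re a > 0"
  shows "integrable lborel (\<lambda>w. 1 / (a + of_real (2 * qform lam w)) ^ Suc (CARD('n)))"
    and "(\<integral>w. 1 / (a + of_real (2 * qform lam w)) ^ Suc (CARD('n)) \<partial>lborel)
      = of_real (pi ^ CARD('n) / (2 ^ CARD('n) * fact CARD('n) * (\<Prod>j\<in>UNIV. lam $ j))) / a"
proof -
  let ?n = "CARD('n)"
  define C where "C = pi ^ ?n / (2 ^ ?n * (\<Prod>j\<in>UNIV. lam $ j))"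
  have prod_pos: "(\<Prod>j\<in>UNIV. lam $ j) > 0" using lam by (simp add: prod_pos)
  then have C: "C > 0" by (simp add: C_def)
  \<comment> \<open>\<open>x\<close> is the Laplace variable: integration over \<open>x\<close>
    gives \<open>n!\<close> times the inverse power, integration over \<open>w\<close> gives a
    Gaussian integral.\<close>
  define h where "h w x = indicator {0..} x *\<^sub>R (of_real x ^ ?n * exp (- (of_real x * (a + of_real (2 * qform lam w)))))"
    for w :: "complex ^ 'n" and x :: real
  have h_meas [measurable]: "(\<lambda>(w, x). h w x) \<in> borel_measurable (borel \<Otimes>\<^sub>M borel)"
  proof -
    have [measurable]: "(\<lambda>z::(complex^'n) \<times> real. of_real (snd z) ^ ?n * exp (- (of_real (snd z) * (a + of_real (2 * qform lam (fst z)))))) \<in> borel_measurable borel"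
      by (intro borel_measurable_continuous_onI continuous_intros)
    have [measurable]: "Measurable.pred borel (\<lambda>z::(complex^'n) \<times> real. 0 \<le> snd z)"
      unfolding borel_prod[symmetric] by measurable
    show ?thesis unfolding h_def borel_prod case_prod_unfold indicator_def atLeast_iff by measurable
  qed
  have norm_h: "norm (h w x) = indicator {0..} x * (x ^ ?n * exp (- (x * Re a))) * exp (- (2 * x * qform lam w))" for w x
    by (auto simp: h_def norm_mult norm_power exp_add[symmetric] algebra_simps split: split_indicator)
  have gauss: "has_bochner_integral lborel (\<lambda>w. exp (- (2 * x * qform lam w))) (C / x ^ ?n)" if "x > 0" for x
    using integral_Gaussian_qform[OF lam, of "2 * x"] that by (simp add: C_def power_mult_distrib field_simps)
  have gauss_nn: "(\<integral>\<^sup>+w. ennreal (exp (- (2 * x * qform lam w))) \<partial>lborel) = ennreal (C / x ^ ?n)" if "x > 0" for x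
    using nn_integral_Gaussian_qform[OF lam, of "2 * x"] that by (simp add: C_def power_mult_distrib field_simps)
  have h_int: "integrable (lborel \<Otimes>\<^sub>M lborel) (\<lambda>(w, x). h w x)"
  proof (rule integrableI_bounded)
    have "(\<integral>\<^sup>+z. ennreal (norm (case z of (w, x) \<Rightarrow> h w x)) \<partial>(lborel \<Otimes>\<^sub>M lborel)) = (\<integral>\<^sup>+x. \<integral>\<^sup>+w. ennreal (norm (h w x)) \<partial>lborel \<partial>lborel)"
      by (subst lborel_pair.nn_integral_snd[symmetric]) simp_all
    \<comment> \<open>The Gaussian formula needs \<open>x > 0\<close>; the point 0, where the two
      sides differ, is a null set.\<close>
    also have "\<dots> = (\<integral>\<^sup>+x. ennreal (indicator {0..} x * (C * (x ^ 0 * exp (- (x * Re a))))) \<partial>lborel)"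
    proof (rule nn_integral_cong_AE, use AE_lborel_singleton[of "0::real"] in eventually_elim)
      fix x :: real assume "x \<noteq> 0"
      show "(\<integral>\<^sup>+w. ennreal (norm (h w x)) \<partial>lborel) = ennreal (indicator {0..} x * (C * (x ^ 0 * exp (- (x * Re a)))))"
      proof (cases "x > 0")
        case True
        have "(\<integral>\<^sup>+w. ennreal (norm (h w x)) \<partial>lborel) = (\<integral>\<^sup>+w. ennreal (x ^ ?n * exp (- (x * Re a))) * ennreal (exp (- (2 * x * qform lam w))) \<partial>lborel)"
          using True by (simp add: norm_h ennreal_mult)
        also have "\<dots> = ennreal (x ^ ?n * exp (- (x * Re a))) * ennreal (C / x ^ ?n)"
          by (subst nn_integral_cmult) (simp_all add: gauss_nn[OF True])
        also have "\<dots> = ennreal (C * exp (- (x * Re a)))"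
          using True C by (simp add: ennreal_mult[symmetric])
        finally show ?thesis using True by simp
      next
        case False
        then show ?thesis using \<open>x \<noteq> 0\<close> by (simp add: h_def)
      qed
    qed
    also have "\<dots> < \<infinity>"
      using integrable_mult_right[OF integrable_power_mult_exp_Ici[OF a, of 0], of C] C
      by (subst nn_integral_eq_integral) (auto simp: algebra_simps intro!: AE_I2 split: split_indicator)
    finally show "(\<integral>\<^sup>+z. ennreal (norm (case z of (w, x) \<Rightarrow> h w x)) \<partial>(lborel \<Otimes>\<^sub>M lborel)) < \<infinity>" .
  qed measurable
  have Re: "Re (a + of_real (2 * qform lam w)) > 0" for w
    using a qform_nonneg[OF lam, of w] by simp
  have inner1: "(\<integral>x. h w x \<partial>lborel) = fact ?n * (1 / (a + of_real (2 * qform lam w)) ^ Suc ?n)" for w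
    unfolding h_def by (subst Laplace_integral_power(2)[OF Re]) simp
  have "integrable lborel (\<lambda>w. \<integral>x. h w x \<partial>lborel)"
    using lborel_pair.integrable_fst[OF h_int] by simp
  then have "integrable lborel (\<lambda>w. 1 / fact ?n * (\<integral>x. h w x \<partial>lborel))"
    by simp
  then show "integrable lborel (\<lambda>w. 1 / (a + of_real (2 * qform lam w)) ^ Suc ?n)"
    unfolding inner1 by simp
  have "fact ?n * (\<integral>w. 1 / (a + of_real (2 * qform lam w)) ^ Suc ?n \<partial>lborel) = (\<integral>w. \<integral>x. h w x \<partial>lborel \<partial>lborel)"
    by (simp only: inner1 integral_mult_right_zero)
  also have "\<dots> = (\<integral>x. \<integral>w. h w x \<partial>lborel \<partial>lborel)"
    by (rule lborel_pair.Fubini_integral[OF h_int, symmetric])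
  also have "\<dots> = (\<integral>x. indicator {0..} x *\<^sub>R (of_real x ^ 0 * exp (- (of_real x * a))) * of_real C \<partial>lborel)"
  proof (rule integral_cong_AE)
    show "AE x in lborel. (\<integral>w. h w x \<partial>lborel) = indicator {0..} x *\<^sub>R (of_real x ^ 0 * exp (- (of_real x * a))) * of_real C"
    proof (use AE_lborel_singleton[of "0::real"] in eventually_elim)
      fix x :: real assume "x \<noteq> 0"
      show "(\<integral>w. h w x \<partial>lborel) = indicator {0..} x *\<^sub>R (of_real x ^ 0 * exp (- (of_real x * a))) * of_real C"
      proof (cases "x > 0")
        case True
        have "h w x = (of_real x ^ ?n * exp (- (of_real x * a))) * of_real (exp (- (2 * x * qform lam w)))" for w
          using True by (simp add: h_def exp_of_real[symmetric] exp_add[symmetric] algebra_simps)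
        then have "(\<integral>w. h w x \<partial>lborel) = (of_real x ^ ?n * exp (- (of_real x * a))) * of_real (\<integral>w. exp (- (2 * x * qform lam w)) \<partial>lborel)"
          by simp
        also have "(\<integral>w. exp (- (2 * x * qform lam w)) \<partial>lborel) = C / x ^ ?n"
          by (rule has_bochner_integral_integral_eq[OF gauss[OF True]])
        finally show ?thesis using True by simp
      qed (use \<open>x \<noteq> 0\<close> in \<open>simp add: h_def\<close>)
    qed
  qed measurable
  also have "\<dots> = of_real C / a"
    using Laplace_integral_power(2)[OF a, of 0] by (simp only: integral_mult_left_zero) simp
  finally have *: "fact ?n * (\<integral>w. 1 / (a + of_real (2 * qform lam w)) ^ Suc ?n \<partial>lborel) = of_real C / a" .
  have "(\<integral>w. 1 / (a + of_real (2 * qform lam w)) ^ Suc ?n \<partial>lborel)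
      = fact ?n * (\<integral>w. 1 / (a + of_real (2 * qform lam w)) ^ Suc ?n \<partial>lborel) / fact ?n"
    by simp
  also have "\<dots> = of_real (pi ^ ?n / (2 ^ ?n * fact ?n * (\<Prod>j\<in>UNIV. lam $ j))) / a"
    unfolding * by (simp add: C_def)
  finally show "(\<integral>w. 1 / (a + of_real (2 * qform lam w)) ^ Suc ?n \<partial>lborel)
      = of_real (pi ^ ?n / (2 ^ ?n * fact ?n * (\<Prod>j\<in>UNIV. lam $ j))) / a" .
qed

lemma integrable_inverse_power_qform:
  fixes lam :: "real ^ 'n::finite"
  assumes lam: "\<And>j. lam $ j > 0" and "\<epsilon> > 0"
  shows "integrable lborel (\<lambda>w. 1 / (\<epsilon> + qform lam w) ^ Suc (CARD('n)))"
proof -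
  \<comment> \<open>Halving \<open>lam\<close> cancels the factor 2 in front of \<open>qform\<close>
    in the preceding lemma.\<close>
  have eq: "2 * qform (lam /\<^sub>R 2) w = qform lam w" for w
    by (simp add: qform_def sum_distrib_left)
  have "norm (1 / (complex_of_real \<epsilon> + of_real (qform lam w)) ^ Suc (CARD('n))) = 1 / (\<epsilon> + qform lam w) ^ Suc (CARD('n))" for w
    using assms(2) qform_nonneg[OF lam, of w] unfolding of_real_add[symmetric] norm_divide norm_power norm_of_real by simp
  then show ?thesis
    using integrable_norm[OF integral_inverse_power_qform(1)[of "lam /\<^sub>R 2" "of_real \<epsilon>"]] assms
    unfolding eq by simp
qed

section \<open>The Poisson kernel of the half-plane\<close>

lemma integral_inverse_1_plus_square:
  "integrable lborel (\<lambda>x::real. 1 / (1 + x\<^sup>2))" "(\<integral>x. 1 / (1 + x\<^sup>2) \<partial>(lborel :: real measure)) = pi"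
proof -
  have *: "einterval (-\<infinity>) \<infinity> = (UNIV :: real set)" by (auto simp: einterval_def)
  show "integrable lborel (\<lambda>x::real. 1 / (1 + x\<^sup>2))"
    using integrable_inverse_1_plus_square by (simp add: * set_integrable_def divide_inverse)
  show "(\<integral>x. 1 / (1 + x\<^sup>2) \<partial>(lborel :: real measure)) = pi"
    using LBINT_inverse_1_plus_square
    by (simp add: interval_lebesgue_integral_def * set_lebesgue_integral_def divide_inverse)
qed

text \<open>Normalised to total mass 1. It equals
  \<open>(1 / (\<epsilon> - i s) + 1 / (\<epsilon> + i s)) / (2 pi)\<close>, which is how it enters
  below.\<close>

definition Poisson_kernel :: "real \<Rightarrow> real \<Rightarrow> real" where
  "Poisson_kernel \<epsilon> s = \<epsilon> / (pi * (\<epsilon>\<^sup>2 + s\<^sup>2))"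

lemma borel_measurable_Poisson_kernel [measurable]: "Poisson_kernel \<epsilon> \<in> borel_measurable borel"
  unfolding Poisson_kernel_def[abs_def] by measurable

lemma Poisson_kernel_scale: "\<epsilon> > 0 \<Longrightarrow> \<epsilon> * Poisson_kernel \<epsilon> (\<epsilon> * s) = Poisson_kernel 1 s"
proof -
  have "\<epsilon>\<^sup>2 + (\<epsilon> * s)\<^sup>2 = \<epsilon>\<^sup>2 * (1 + s\<^sup>2)" by (simp add: power_mult_distrib algebra_simps)
  then show "\<epsilon> > 0 \<Longrightarrow> \<epsilon> * Poisson_kernel \<epsilon> (\<epsilon> * s) = Poisson_kernel 1 s"
    by (simp add: Poisson_kernel_def) (simp add: power2_eq_square)
qed

lemma Poisson_kernel_integral:
  assumes "\<epsilon> > 0"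
  shows "integrable lborel (Poisson_kernel \<epsilon>)" "(\<integral>s. Poisson_kernel \<epsilon> s \<partial>lborel) = 1"
proof -
  have 1: "integrable lborel (Poisson_kernel 1)" "(\<integral>s. Poisson_kernel 1 s \<partial>lborel) = 1"
    using integrable_mult_right[OF integral_inverse_1_plus_square(1), of "1 / pi"]
      integral_mult_right_zero[of lborel "1 / pi" "\<lambda>x. 1 / (1 + x\<^sup>2)"]
    by (simp_all add: Poisson_kernel_def[abs_def] integral_inverse_1_plus_square(2))
  have eq: "Poisson_kernel \<epsilon> (0 + \<epsilon> * s) = 1 / \<epsilon> * Poisson_kernel 1 s" for s
    using Poisson_kernel_scale[OF assms, of s] assms by (simp add: field_simps)
  have "integrable lborel (\<lambda>s. Poisson_kernel \<epsilon> (0 + \<epsilon> * s))" unfolding eq using 1 by simp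
  then show "integrable lborel (Poisson_kernel \<epsilon>)"
    using assms by (subst (asm) lborel_integrable_real_affine_iff) auto
  show "(\<integral>s. Poisson_kernel \<epsilon> s \<partial>lborel) = 1"
    using assms 1 by (subst lborel_integral_real_affine[of \<epsilon> _ 0]) (simp_all only: eq, simp_all)
qed

lemma integrable_prod_mult:
  fixes f :: "'a::euclidean_space \<Rightarrow> real" and g :: "'b::euclidean_space \<Rightarrow> real"
  assumes "integrable lborel f" "integrable lborel g"
  shows "integrable lborel (\<lambda>x. f (fst x) * g (snd x))"
proof -
  note [measurable] = borel_measurable_integrable[OF assms(1)] borel_measurable_integrable[OF assms(2)]
  have "integrable (lborel \<Otimes>\<^sub>M lborel) (\<lambda>x. f (fst x) * g (snd x))"
  proof (rule integrableI_bounded)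
    have "(\<integral>\<^sup>+x. ennreal (norm (f (fst x) * g (snd x))) \<partial>(lborel \<Otimes>\<^sub>M lborel)) = (\<integral>\<^sup>+x. \<integral>\<^sup>+y. ennreal (norm (f x)) * ennreal (norm (g y)) \<partial>lborel \<partial>lborel)"
      by (subst lborel.nn_integral_fst[symmetric]) (simp_all add: abs_mult ennreal_mult)
    also have "\<dots> = (\<integral>\<^sup>+x. ennreal (norm (f x)) \<partial>lborel) * (\<integral>\<^sup>+y. ennreal (norm (g y)) \<partial>lborel)"
      by (simp add: nn_integral_cmult nn_integral_multc)
    also have "\<dots> < \<infinity>"
      using assms by (simp add: integrable_iff_bounded ennreal_mult_less_top)
    finally show "(\<integral>\<^sup>+x. ennreal (norm (f (fst x) * g (snd x))) \<partial>(lborel \<Otimes>\<^sub>M lborel)) < \<infinity>" .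
  qed measurable
  then show ?thesis by (simp add: lborel_prod)
qed

subsection \<open>The group structure\<close>

text \<open>The cocycle of the group law: twice the imaginary part of the Hermitian form with
  weights \<open>lam\<close>. It is real bilinear and alternating, so \<open>- x\<close> is the
  inverse of \<open>x\<close> for the multiplication below.\<close>

definition heis_form :: "real ^ 'n::finite \<Rightarrow> complex ^ 'n \<Rightarrow> complex ^ 'n \<Rightarrow> real" where
  "heis_form lam z w = 2 * (\<Sum>j\<in>UNIV. lam $ j * Im (cnj (z $ j) * (w $ j)))"

definition heis_mult :: "real ^ 'n::finite \<Rightarrow> 'n heis \<Rightarrow> 'n heis \<Rightarrow> 'n heis" where
  "heis_mult lam x y = (fst x + fst y, snd x + snd y + heis_form lam (fst x) (fst y))"

lemma heis_form_simps [simp]: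
  "heis_form lam z z = 0" "heis_form lam 0 w = 0" "heis_form lam z 0 = 0"
  "heis_form lam (- z) w = - heis_form lam z w" "heis_form lam z (- w) = - heis_form lam z w"
  by (simp_all add: heis_form_def sum_distrib_left sum.neutral mult.commute algebra_simps flip: sum_negf)

lemma heis_form_add:
  "heis_form lam (z + z') w = heis_form lam z w + heis_form lam z' w"
  "heis_form lam z (w + w') = heis_form lam z w + heis_form lam z w'"
  by (simp_all add: heis_form_def algebra_simps sum.distrib sum_subtractf)

lemma heis_form_scaleR:
  "heis_form lam (c *\<^sub>R z) w = c * heis_form lam z w"
  "heis_form lam z (c *\<^sub>R w) = c * heis_form lam z w"
  by (simp_all add: heis_form_def algebra_simps sum_distrib_left sum_subtractf)

lemma heis_form_commute: "heis_form lam z w = - heis_form lam w z"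
  by (simp add: heis_form_def algebra_simps sum_negf[symmetric] sum_subtractf sum_distrib_left)

lemma continuous_on_heis_form [continuous_intros]:
  "continuous_on S f \<Longrightarrow> continuous_on S g \<Longrightarrow> continuous_on S (\<lambda>x. heis_form lam (f x) (g x))"
  unfolding heis_form_def by (intro continuous_intros)

lemma continuous_on_heis_mult [continuous_intros]:
  "continuous_on S f \<Longrightarrow> continuous_on S g \<Longrightarrow> continuous_on S (\<lambda>x. heis_mult lam (f x) (g x))"
  unfolding heis_mult_def by (intro continuous_intros)

lemma heis_mult_assoc: "heis_mult lam (heis_mult lam x y) z = heis_mult lam x (heis_mult lam y z)"
  by (simp add: heis_mult_def heis_form_add)

lemma heis_mult_inverse [simp]: "heis_mult lam x (- x) = 0" "heis_mult lam (- x) x = 0"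
  "heis_mult lam 0 x = x" "heis_mult lam x 0 = x"
  by (simp_all add: heis_mult_def zero_prod_def)

lemma heis_mult_cancel [simp]:
  "heis_mult lam (- x) (heis_mult lam x y) = y" "heis_mult lam x (heis_mult lam (- x) y) = y"
  "heis_mult lam (heis_mult lam x y) (- y) = x" "heis_mult lam (heis_mult lam x (- y)) y = x"
  by (simp_all flip: heis_mult_assoc) (simp_all add: heis_mult_assoc)

lemma uminus_heis_mult: "- heis_mult lam x y = heis_mult lam (- y) (- x)"
  using heis_form_commute[of lam "fst x" "fst y"] by (simp add: heis_mult_def)

lemma measurable_heis_mult [measurable]: "heis_mult lam x \<in> measurable borel borel"
    "(\<lambda>x. heis_mult lam x y) \<in> measurable borel borel"
  by (intro borel_measurable_continuous_onI continuous_intros)+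

lemma lborel_distr_heis_mult_left: "distr lborel borel (heis_mult lam x) = lborel"
  using lborel_distr_shear[of "\<lambda>w. snd x + heis_form lam (fst x) w" "fst x"]
  by (simp add: heis_mult_def[abs_def] borel_measurable_continuous_onI continuous_intros algebra_simps)

lemma lborel_distr_heis_mult_right: "distr lborel borel (\<lambda>x. heis_mult lam x y) = lborel"
  using lborel_distr_shear[of "\<lambda>z. snd y + heis_form lam z (fst y)" "fst y"]
  by (simp add: heis_mult_def[abs_def] borel_measurable_continuous_onI continuous_intros algebra_simps)

lemma heis_integral_left:
  fixes f :: "'n::finite heis \<Rightarrow> 'b::{banach, second_countable_topology}"
  assumes "f \<in> borel_measurable borel"
  shows "(\<integral>y. f (heis_mult lam x y) \<partial>heis_vol) = (\<integral>y. f y \<partial>heis_vol)"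
    and "integrable heis_vol (\<lambda>y. f (heis_mult lam x y)) \<longleftrightarrow> integrable heis_vol f"
  by (rule distr_invariant_integral[OF heis_vol_distr[OF lborel_distr_heis_mult_left]]; simp add: assms)+

lemma heis_integral_right:
  fixes f :: "'n::finite heis \<Rightarrow> 'b::{banach, second_countable_topology}"
  assumes "f \<in> borel_measurable borel"
  shows "(\<integral>x. f (heis_mult lam x y) \<partial>heis_vol) = (\<integral>x. f x \<partial>heis_vol)"
    and "integrable heis_vol (\<lambda>x. f (heis_mult lam x y)) \<longleftrightarrow> integrable heis_vol f"
  by (rule distr_invariant_integral[OF heis_vol_distr[OF lborel_distr_heis_mult_right]]; simp add: assms)+

subsection \<open>The kernel of the Kohn Laplacian\<close>

lemma test_fun_Zbar:
  assumes "test_fun \<phi>" shows "test_fun (Zbar lam j \<phi>)"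
proof -
  have "Ck k (\<lambda>x::'a heis. fst x $ j)" for k
    by (intro Ck_bounded_linear bounded_linear_compose[OF bounded_linear_vec_nth bounded_linear_fst])
  then have "test_fun (\<lambda>x. 1 / 2 * (frechet_derivative \<phi> (at x) (axis j 1, 0) + \<i> * frechet_derivative \<phi> (at x) (axis j \<i>, 0))
      + (\<i> * of_real (lam $ j) * fst x $ j) * frechet_derivative \<phi> (at x) (0, 1))"
    by (intro test_fun_add test_fun_cmult test_fun_derivative assms test_fun_mult_Ck Ck_cmult)
  then show ?thesis by (simp add: Zbar_def[abs_def])
qed

definition weakly_CR :: "(real ^ 'n::finite) \<Rightarrow> ('n heis \<Rightarrow> complex) set" where
  "weakly_CR lam = {u \<in> L2. \<forall>j \<phi>. test_fun \<phi> \<longrightarrow> (\<integral>x. u x * Zbar lam j \<phi> x \<partial>heis_vol) = 0}"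

text \<open>If the adjoint sends \<open>f\<close> to 0, pairing it with \<open>u\<close>, whose
  image is \<open>f\<close>, gives \<open>L2_form_inner f f = 0\<close>. Conversely, the zero form
  lies in the domain of the adjoint.\<close>

lemma ker_box_b_eq: "ker_box_b lam = weakly_CR lam"
proof (intro equalityI subsetI)
  fix u assume "u \<in> ker_box_b lam"
  then obtain f where f: "dbar_b lam u f" "dbar_b_adj lam f (\<lambda>_. 0)" by (auto simp: ker_box_b_def box_b_def)
  then have f_L2: "f \<in> L2" by (simp add: dbar_b_def)
  have "0 = L2_form_inner f f" using f by (auto simp: dbar_b_adj_def L2_inner_def)
  also have "L2_form_inner f f = (\<integral>x. of_real ((norm (f x))\<^sup>2) \<partial>heis_vol)"
    unfolding L2_form_inner_def norm_vec_def L2_set_def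
    by (intro Bochner_Integration.integral_cong) (simp_all add: sum_nonneg complex_norm_square del: of_real_power)
  also have "\<dots> = of_real (\<integral>x. (norm (f x))\<^sup>2 \<partial>heis_vol)" by (rule integral_complex_of_real)
  finally have "(\<integral>x. (norm (f x))\<^sup>2 \<partial>heis_vol) = 0" by (metis of_real_eq_0_iff)
  then have ae: "AE x in heis_vol. f x = 0"
    by (subst (asm) integral_nonneg_eq_0_iff_AE) (use L2_integrable[OF f_L2] in auto)
  have "(\<integral>x. u x * Zbar lam j \<phi> x \<partial>heis_vol) = 0" if "test_fun \<phi>" for j \<phi>
  proof -
    note [measurable] = f_L2 that
    have "(\<lambda>x. f x $ j) \<in> borel_measurable borel"
      by (rule measurable_compose[OF L2_measurable[OF f_L2]]) (intro borel_measurable_continuous_onI continuous_intros)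
    then have [measurable]: "(\<lambda>x. f x $ j) \<in> borel_measurable borel" .
    have "(\<integral>x. (f x $ j) * \<phi> x \<partial>heis_vol) = (\<integral>x. 0 \<partial>(heis_vol :: 'a heis measure))"
      using ae by (intro integral_cong_AE) auto
    moreover have "(\<integral>x. (f x $ j) * \<phi> x \<partial>heis_vol) = - (\<integral>x. u x * Zbar lam j \<phi> x \<partial>heis_vol)"
      using f(1) that by (auto simp: dbar_b_def)
    ultimately show ?thesis by simp
  qed
  then show "u \<in> weakly_CR lam" using f(1) by (auto simp: weakly_CR_def dbar_b_def)
next
  fix u assume "u \<in> weakly_CR lam"
  then have "dbar_b lam u (\<lambda>_. 0)" by (auto simp: weakly_CR_def dbar_b_def L2_def)
  moreover have "dbar_b_adj lam (\<lambda>_. 0) (\<lambda>_. 0)"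
    by (auto simp: dbar_b_adj_def L2_form_inner_def L2_inner_def L2_def)
  ultimately show "u \<in> ker_box_b lam" by (auto simp: ker_box_b_def box_b_def)
qed

lemma weakly_CR_L2: "u \<in> weakly_CR lam \<Longrightarrow> u \<in> L2"
  by (simp add: weakly_CR_def)

lemma weakly_CR_diff:
  assumes "u \<in> weakly_CR lam" "v \<in> weakly_CR lam" shows "(\<lambda>x. u x - v x) \<in> weakly_CR lam"
  unfolding weakly_CR_def
proof (intro CollectI conjI allI impI)
  show "(\<lambda>x. u x - v x) \<in> L2" using assms by (intro L2_diff weakly_CR_L2)
  fix j and \<phi> :: "'a heis \<Rightarrow> complex" assume \<phi>: "test_fun \<phi>"
  note Z = test_fun_L2[OF test_fun_Zbar[OF \<phi>, of lam j]]
  show "(\<integral>x. (u x - v x) * Zbar lam j \<phi> x \<partial>heis_vol) = 0"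
    using assms \<phi> L2_mult_integrable[OF weakly_CR_L2[OF assms(1)] Z] L2_mult_integrable[OF weakly_CR_L2[OF assms(2)] Z]
    by (simp add: left_diff_distrib weakly_CR_def)
qed

text \<open>For a fixed test function the pairing is continuous on \<open>L2\<close>, because
  \<open>Zbar lam j \<phi>\<close> is again a test function.\<close>

lemma weakly_CR_closed:
  assumes U: "\<And>k. U k \<in> weakly_CR lam" and u: "u \<in> L2" and lim: "L2_tendsto U u"
  shows "u \<in> weakly_CR lam"
  unfolding weakly_CR_def
proof (intro CollectI conjI allI impI u)
  fix j and \<phi> :: "'a heis \<Rightarrow> complex" assume \<phi>: "test_fun \<phi>"
  note Z = test_fun_L2[OF test_fun_Zbar[OF \<phi>, of lam j]]
  let ?I = "\<integral>x. u x * Zbar lam j \<phi> x \<partial>heis_vol"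
  have "norm ?I \<le> L2_norm (\<lambda>x. U k x - u x) * L2_norm (Zbar lam j \<phi>)" for k
  proof -
    have "(\<integral>x. (U k x - u x) * Zbar lam j \<phi> x \<partial>heis_vol) = - ?I"
      using U[of k] \<phi> L2_mult_integrable[OF weakly_CR_L2[OF U[of k]] Z] L2_mult_integrable[OF u Z]
      by (simp add: left_diff_distrib weakly_CR_def)
    then show ?thesis
      using L2_Cauchy_Schwarz_mult[OF L2_diff[OF weakly_CR_L2[OF U[of k]] u] Z] by simp
  qed
  moreover have "(\<lambda>k. L2_norm (\<lambda>x. U k x - u x) * L2_norm (Zbar lam j \<phi>)) \<longlonglongrightarrow> 0 * L2_norm (Zbar lam j \<phi>)"
    using lim unfolding L2_tendsto_def by (intro tendsto_intros)
  ultimately have "norm ?I \<le> 0" by (intro LIMSEQ_le_const[of _ 0 "norm ?I"]) auto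
  then show "?I = 0" by simp
qed

text \<open>The operator \<open>Zbar\<close> on a linear map \<open>D\<close> that is known to be
  the derivative at \<open>x\<close>. Derivatives obtained by composition can thus be inserted
  without passing through \<open>frechet_derivative\<close>.\<close>

definition Zbar_of_derivative :: "(real ^ 'n::finite) \<Rightarrow> 'n \<Rightarrow> 'n heis \<Rightarrow> ('n heis \<Rightarrow> complex) \<Rightarrow> complex" where
  "Zbar_of_derivative lam j x D = (D (axis j 1, 0) + \<i> * D (axis j \<i>, 0)) / 2 + \<i> * of_real (lam $ j) * (fst x $ j) * D (0, 1)"

lemma Zbar_eq:
  assumes "(f has_derivative D) (at x)" shows "Zbar lam j f x = Zbar_of_derivative lam j x D"
  by (simp add: Zbar_def Zbar_of_derivative_def frechet_derivative_at[OF assms, symmetric])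

text \<open>The coefficient \<open>z\<^sub>j\<close> does not depend on the last coordinate, so it may be moved inside the
  derivative.\<close>

lemma integral_classical_CR:
  fixes f :: "'n::finite heis \<Rightarrow> complex"
  assumes der: "\<And>x. (f has_derivative f' x) (at x)" and cont: "\<And>v. continuous_on UNIV (\<lambda>x. f' x v)"
    and CR: "\<And>x. Zbar_of_derivative lam j x (f' x) = 0" and \<phi>: "test_fun \<phi>"
  shows "(\<integral>x. f x * Zbar lam j \<phi> x \<partial>heis_vol) = 0"
proof -
  let ?\<phi>' = "\<lambda>x. frechet_derivative \<phi> (at x)"
  obtain R where R: "\<And>x. norm x > R \<Longrightarrow> \<phi> x = 0" using test_fun_support[OF \<phi>] by blast
  have f_cont: "continuous_on UNIV f"
    using der by (auto intro!: continuous_at_imp_continuous_on has_derivative_continuous)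
  have d1: "((\<lambda>x. f x * \<phi> x) has_derivative (\<lambda>h. f x * ?\<phi>' x h + f' x h * \<phi> x)) (at x)" for x
    by (rule has_derivative_mult[OF der test_fun_has_derivative[OF \<phi>]])
  have dz: "((\<lambda>x::'n heis. fst x $ j) has_derivative (\<lambda>h. fst h $ j)) (at x)" for x
    by (intro bounded_linear_imp_has_derivative bounded_linear_compose[OF bounded_linear_vec_nth bounded_linear_fst])
  have d2: "((\<lambda>x. fst x $ j * (f x * \<phi> x)) has_derivative
      (\<lambda>h. fst x $ j * (f x * ?\<phi>' x h + f' x h * \<phi> x) + fst h $ j * (f x * \<phi> x))) (at x)" for x
    by (rule has_derivative_mult[OF dz d1])
  have c1: "continuous_on UNIV (\<lambda>x. f x * ?\<phi>' x v + f' x v * \<phi> x)" for v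
    by (intro continuous_intros f_cont cont test_fun_continuous \<phi> test_fun_derivative)
  have c2: "continuous_on UNIV (\<lambda>x. fst x $ j * (f x * ?\<phi>' x v + f' x v * \<phi> x) + fst v $ j * (f x * \<phi> x))" for v
    by (intro continuous_intros f_cont cont test_fun_continuous \<phi> test_fun_derivative)
  have 0: "(\<integral>x. f x * ?\<phi>' x v + f' x v * \<phi> x \<partial>lborel) = 0" for v
    by (rule integral_directional_derivative_eq_0[OF d1 c1, of R]) (simp add: R)
  have 1: "(\<integral>x. fst x $ j * (f x * ?\<phi>' x (0, 1) + f' x (0, 1) * \<phi> x) + fst (0::complex^'n, 1::real) $ j * (f x * \<phi> x) \<partial>lborel) = 0"
    by (rule integral_directional_derivative_eq_0[OF d2 c2, of R]) (simp add: R)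
  have R': "f x * ?\<phi>' x v + f' x v * \<phi> x = 0" if "norm x > R" for x v
  proof -
    have "((\<lambda>x. f x * \<phi> x) has_derivative (\<lambda>_. 0)) (at x)"
    proof (rule has_derivative_transform_within_open)
      show "((\<lambda>_. 0) has_derivative (\<lambda>_. 0)) (at x)" by simp
      show "open {x::'n heis. norm x > R}" by (intro open_Collect_less continuous_intros)
    qed (use that R in auto)
    from fun_cong[OF has_derivative_unique[OF this d1], of v] show ?thesis by simp
  qed
  have i1: "integrable lborel (\<lambda>x. f x * ?\<phi>' x v + f' x v * \<phi> x)" for v
    by (rule continuous_bounded_support_integrable[OF c1 R'])
  have i2: "integrable lborel (\<lambda>x. fst x $ j * (f x * ?\<phi>' x v + f' x v * \<phi> x))" for v
    by (rule continuous_bounded_support_integrable[of _ R]) (auto simp: R' intro!: continuous_intros c1)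
  have "(\<integral>x. f x * Zbar lam j \<phi> x \<partial>lborel) =
      (\<integral>x. 1 / 2 * ((f x * ?\<phi>' x (axis j 1, 0) + f' x (axis j 1, 0) * \<phi> x) + \<i> * (f x * ?\<phi>' x (axis j \<i>, 0) + f' x (axis j \<i>, 0) * \<phi> x))
        + \<i> * of_real (lam $ j) * (fst x $ j * (f x * ?\<phi>' x (0, 1) + f' x (0, 1) * \<phi> x)) \<partial>lborel)"
  proof (rule Bochner_Integration.integral_cong[OF refl])
    fix x :: "'n heis"
    \<comment> \<open>By the Leibniz rule the total derivatives add up to
      \<open>f Zbar \<phi> + (Zbar f) \<phi>\<close>, whose second summand is 0 for a classical
      solution.\<close>
    have "1 / 2 * ((f x * ?\<phi>' x (axis j 1, 0) + f' x (axis j 1, 0) * \<phi> x) + \<i> * (f x * ?\<phi>' x (axis j \<i>, 0) + f' x (axis j \<i>, 0) * \<phi> x))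
        + \<i> * of_real (lam $ j) * (fst x $ j * (f x * ?\<phi>' x (0, 1) + f' x (0, 1) * \<phi> x))
        = f x * Zbar lam j \<phi> x + Zbar_of_derivative lam j x (f' x) * \<phi> x"
      by (simp add: Zbar_def Zbar_of_derivative_def field_simps)
    then show "f x * Zbar lam j \<phi> x = 1 / 2 * ((f x * ?\<phi>' x (axis j 1, 0) + f' x (axis j 1, 0) * \<phi> x) + \<i> * (f x * ?\<phi>' x (axis j \<i>, 0) + f' x (axis j \<i>, 0) * \<phi> x))
        + \<i> * of_real (lam $ j) * (fst x $ j * (f x * ?\<phi>' x (0, 1) + f' x (0, 1) * \<phi> x))"
      using CR by simp
  qed
  also have "\<dots> = 0"
    using 0 1 i1 i2 by simp
  finally show ?thesis
    using f_cont test_fun_continuous[OF test_fun_Zbar[OF \<phi>]]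
    by (subst integral_heis_vol) (auto intro!: borel_measurable_continuous_onI continuous_intros)
qed

subsection \<open>The mean value property of CR functions\<close>

lemma mult_cis_derivs:
  fixes v :: "complex ^ 'n::finite"
  shows "((\<lambda>r. ((of_real r * cis \<theta>) *s v, s)) has_derivative (\<lambda>h. h *\<^sub>R (cis \<theta> *s v, 0))) (at r within A)"
    and "((\<lambda>\<theta>. ((of_real r * cis \<theta>) *s v, s)) has_derivative (\<lambda>h. h *\<^sub>R ((of_real r * \<i> * cis \<theta>) *s v, 0))) (at \<theta> within B)"
    and "((\<lambda>s. ((of_real r * cis \<theta>) *s v, s)) has_derivative (\<lambda>h. h *\<^sub>R (0, 1))) (at s within C)"
proof -
  have bl: "bounded_linear (\<lambda>c. (c *s v, 0::real))"
    by (intro bounded_linear_Pair bounded_linear_zero linear_conv_bounded_linear[THEN iffD1])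
       (auto simp: linear_iff vec_eq_iff algebra_simps)
  have d: "((\<lambda>x. (c x *s v, s::real)) has_derivative (\<lambda>h. (c' h *s v, 0))) F"
    if "(c has_derivative c') F" for c c' and F :: "real filter" and s
    using has_derivative_add[OF bounded_linear.has_derivative[OF bl that] has_derivative_const[of "(0, s)"]] by simp
  have "((\<lambda>r. of_real r * cis \<theta>) has_derivative (\<lambda>h. of_real h * cis \<theta>)) (at r within A)"
    by (auto intro!: derivative_eq_intros)
  from d[OF this] show "((\<lambda>r. ((of_real r * cis \<theta>) *s v, s)) has_derivative (\<lambda>h. h *\<^sub>R (cis \<theta> *s v, 0))) (at r within A)"
    by (rule has_derivative_eq_rhs) (simp add: fun_eq_iff vec_eq_iff, simp add: scaleR_conv_of_real)
  have "((\<lambda>\<theta>. of_real r * cis \<theta>) has_derivative (\<lambda>h. of_real h * (of_real r * \<i> * cis \<theta>))) (at \<theta> within B)"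
  proof -
    have cis: "cis \<theta> = of_real (cos \<theta>) + \<i> * of_real (sin \<theta>)" for \<theta> by (simp add: complex_eq_iff)
    show ?thesis unfolding cis by (auto intro!: derivative_eq_intros simp: fun_eq_iff complex_eq_iff)
  qed
  from d[OF this] show "((\<lambda>\<theta>. ((of_real r * cis \<theta>) *s v, s)) has_derivative (\<lambda>h. h *\<^sub>R ((of_real r * \<i> * cis \<theta>) *s v, 0))) (at \<theta> within B)"
    by (rule has_derivative_eq_rhs) (simp add: fun_eq_iff vec_eq_iff, simp add: scaleR_conv_of_real)
  show "((\<lambda>s. ((of_real r * cis \<theta>) *s v, s)) has_derivative (\<lambda>h. h *\<^sub>R (0, 1))) (at s within C)"
    by (auto intro!: derivative_eq_intros)
qed

lemma integral_box_eq_lborel: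
  fixes f :: "real \<times> real \<Rightarrow> complex"
  assumes "continuous_on UNIV f"
  shows "integral (cbox a b) f = (\<integral>x. indicator (cbox a b) x *\<^sub>R f x \<partial>lborel)"
  using set_borel_integral_eq_integral(2)[of "cbox a b" f] borel_integrable_compact[of "cbox a b" f] continuous_on_subset[OF assms]
  by (simp add: set_lebesgue_integral_def set_integrable_def)

text \<open>The derivative in \<open>r\<close> of the integral over the circle of radius \<open>r\<close> and over \<open>{-S..S}\<close>
  is an integral of derivatives in the angle and in \<open>s\<close>: the first vanishes by periodicity, and the
  second consists of boundary terms at \<open>s = S\<close> and \<open>s = -S\<close>.\<close>

lemma CR_circle_mean:
  fixes G :: "'n::finite heis \<Rightarrow> complex"
  assumes der: "\<And>x. (G has_derivative G' x) (at x)" and cont: "\<And>v. continuous_on UNIV (\<lambda>x. G' x v)"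
    and CR: "\<And>x. G' x (fst x, 0) + \<i> * G' x (\<i> *s fst x, 0) + 2 * \<i> * of_real (qform lam (fst x)) * G' x (0, 1) = 0"
    and R: "R > 0" and \<mu>: "\<mu> = qform lam v" "\<mu> \<ge> 0"
    and d\<psi>: "\<And>z. 0 \<le> Re z \<Longrightarrow> Re z \<le> \<mu> * R\<^sup>2 \<Longrightarrow> (\<psi> has_field_derivative \<psi>' z) (at z)"
    and c\<psi>: "continuous_on {z. 0 \<le> Re z \<and> Re z \<le> \<mu> * R\<^sup>2} \<psi>'"
    and bd: "\<And>r \<theta> s. 0 \<le> r \<Longrightarrow> r \<le> R \<Longrightarrow>
        norm (G ((of_real r * cis \<theta>) *s v, s) * \<psi> (of_real (\<mu> * r\<^sup>2) + \<i> * of_real s)) \<le> C / (1 + s\<^sup>2)"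
  shows "(\<integral>x. indicator {0..2*pi} (fst x) *\<^sub>R (G ((of_real R * cis (fst x)) *s v, snd x) * \<psi> (of_real (\<mu> * R\<^sup>2) + \<i> * of_real (snd x))) \<partial>(lborel :: (real \<times> real) measure))
    = of_real (2 * pi) * (\<integral>s. G (0, s) * \<psi> (\<i> * of_real s) \<partial>lborel)"
proof -
  define D where "D = {z. 0 \<le> Re z \<and> Re z \<le> \<mu> * R\<^sup>2}"
  define y where "y r \<theta> s = ((of_real r * cis \<theta>) *s v, s)" for r \<theta> s :: real
  \<comment> \<open>The value of the CR function \<open>q(w) + i s\<close> at the point
    \<open>y r \<theta> s\<close>.\<close>
  define \<zeta> where "\<zeta> r s = of_real (\<mu> * r\<^sup>2) + \<i> * of_real s" for r s :: real
  define F where "F r \<theta> s = G (y r \<theta> s) * \<psi> (\<zeta> r s)" for r \<theta> s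
  have \<zeta>D: "\<zeta> r s \<in> D" if "r \<in> {0..R}" for r s
    using that \<mu>(2) by (auto simp: \<zeta>_def D_def intro!: mult_left_mono power_mono)
  have G'_lin: "bounded_linear (G' x)" for x using der has_derivative_bounded_linear by blast
  have G'_cis: "G' x (cis \<theta> *s v, 0) = of_real (cos \<theta>) * G' x (v, 0) + of_real (sin \<theta>) * G' x (\<i> *s v, 0)"
    "G' x ((of_real r * \<i> * cis \<theta>) *s v, 0) = of_real r * (- of_real (sin \<theta>) * G' x (v, 0) + of_real (cos \<theta>) * G' x (\<i> *s v, 0))"
    "G' x ((of_real r * cis \<theta>) *s v, 0) = of_real r * (of_real (cos \<theta>) * G' x (v, 0) + of_real (sin \<theta>) * G' x (\<i> *s v, 0))"
    "G' x (\<i> *s ((of_real r * cis \<theta>) *s v), 0) = of_real r * (- of_real (sin \<theta>) * G' x (v, 0) + of_real (cos \<theta>) * G' x (\<i> *s v, 0))"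
    for x r \<theta>
  proof -
    interpret bounded_linear "G' x" by (rule G'_lin)
    have *: "G' x (c *\<^sub>R (v, 0) + d *\<^sub>R (\<i> *s v, 0)) = of_real c * G' x (v, 0) + of_real d * G' x (\<i> *s v, 0)" for c d
      by (simp only: add scaleR) (simp add: scaleR_conv_of_real)
    have "(cis \<theta> *s v, 0::real) = cos \<theta> *\<^sub>R (v, 0) + sin \<theta> *\<^sub>R (\<i> *s v, 0)"
      by (simp add: vec_eq_iff cis.ctr complex_eq_iff algebra_simps)
    then show "G' x (cis \<theta> *s v, 0) = of_real (cos \<theta>) * G' x (v, 0) + of_real (sin \<theta>) * G' x (\<i> *s v, 0)"
      by (simp only: *)
    have e1: "((of_real r * \<i> * cis \<theta>) *s v, 0::real) = (- r * sin \<theta>) *\<^sub>R (v, 0) + (r * cos \<theta>) *\<^sub>R (\<i> *s v, 0)"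
      by (simp add: vec_eq_iff cis.ctr complex_eq_iff algebra_simps)
    show e2: "G' x ((of_real r * \<i> * cis \<theta>) *s v, 0) = of_real r * (- of_real (sin \<theta>) * G' x (v, 0) + of_real (cos \<theta>) * G' x (\<i> *s v, 0))"
      unfolding e1 * by (simp add: algebra_simps)
    have e3: "((of_real r * cis \<theta>) *s v, 0::real) = (r * cos \<theta>) *\<^sub>R (v, 0) + (r * sin \<theta>) *\<^sub>R (\<i> *s v, 0)"
      by (simp add: vec_eq_iff cis.ctr complex_eq_iff algebra_simps)
    show "G' x ((of_real r * cis \<theta>) *s v, 0) = of_real r * (of_real (cos \<theta>) * G' x (v, 0) + of_real (sin \<theta>) * G' x (\<i> *s v, 0))"
      unfolding e3 * by (simp add: algebra_simps)
    have e4: "\<i> *s ((of_real r * cis \<theta>) *s v) = (of_real r * \<i> * cis \<theta>) *s v"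
      by (simp add: vec_eq_iff algebra_simps)
    show "G' x (\<i> *s ((of_real r * cis \<theta>) *s v), 0) = of_real r * (- of_real (sin \<theta>) * G' x (v, 0) + of_real (cos \<theta>) * G' x (\<i> *s v, 0))"
      unfolding e4 by (rule e2)
  qed
  define Fr where "Fr r \<theta> s = (of_real (cos \<theta>) * G' (y r \<theta> s) (v, 0) + of_real (sin \<theta>) * G' (y r \<theta> s) (\<i> *s v, 0)) * \<psi> (\<zeta> r s)
      + G (y r \<theta> s) * (of_real (2 * \<mu> * r) * \<psi>' (\<zeta> r s))" for r \<theta> s
  define F\<theta> where "F\<theta> r \<theta> s = of_real r * (- of_real (sin \<theta>) * G' (y r \<theta> s) (v, 0) + of_real (cos \<theta>) * G' (y r \<theta> s) (\<i> *s v, 0)) * \<psi> (\<zeta> r s)" for r \<theta> s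
  define Fs where "Fs r \<theta> s = G' (y r \<theta> s) (0, 1) * \<psi> (\<zeta> r s) + G (y r \<theta> s) * (\<i> * \<psi>' (\<zeta> r s))" for r \<theta> s
  \<comment> \<open>The CR equation in polar coordinates. The factor \<open>\<psi>(\<zeta>)\<close>
    satisfies the same equation, since \<open>r d/dr\<close> and \<open>2 i \<mu> r^2 d/ds\<close>
    give opposite values on \<open>\<zeta>\<close>, hence so does the product with
    \<open>G\<close>.\<close>
  have CR': "of_real r * Fr r \<theta> s = - \<i> * F\<theta> r \<theta> s - 2 * \<i> * of_real (\<mu> * r\<^sup>2) * Fs r \<theta> s" for r \<theta> s
  proof -
    have q: "qform lam ((of_real r * cis \<theta>) *s v) = \<mu> * r\<^sup>2"
      by (simp add: \<mu>(1) qform_def norm_mult power_mult_distrib sum_distrib_left mult_ac)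
    have f: "fst (y r \<theta> s) = (of_real r * cis \<theta>) *s v" by (simp add: y_def)
    have *: "of_real r * (of_real (cos \<theta>) * G' (y r \<theta> s) (v, 0) + of_real (sin \<theta>) * G' (y r \<theta> s) (\<i> *s v, 0))
       = - (\<i> * (of_real r * (- of_real (sin \<theta>) * G' (y r \<theta> s) (v, 0) + of_real (cos \<theta>) * G' (y r \<theta> s) (\<i> *s v, 0))))
         - 2 * \<i> * of_real (\<mu> * r\<^sup>2) * G' (y r \<theta> s) (0, 1)"
      using CR[of "y r \<theta> s"] unfolding f q G'_cis by (simp add: add_eq_0_iff algebra_simps)
    have "of_real r * Fr r \<theta> s = (of_real r * (of_real (cos \<theta>) * G' (y r \<theta> s) (v, 0) + of_real (sin \<theta>) * G' (y r \<theta> s) (\<i> *s v, 0))) * \<psi> (\<zeta> r s)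
        + G (y r \<theta> s) * (of_real (2 * \<mu> * r\<^sup>2) * \<psi>' (\<zeta> r s))"
      by (simp add: Fr_def algebra_simps power2_eq_square)
    then show ?thesis unfolding * by (simp add: F\<theta>_def Fs_def algebra_simps)
  qed
  have d\<psi>': "(\<psi> has_derivative (\<lambda>h. h * \<psi>' (\<zeta> r s))) (at (\<zeta> r s))" if "r \<in> {0..R}" for r s
    using d\<psi>[of "\<zeta> r s"] \<zeta>D[OF that, of s] by (simp add: D_def has_field_derivative_def mult.commute[of _ "\<psi>' _"] mult_commute_abs)
  have dr: "((\<lambda>r. F r \<theta> s) has_vector_derivative Fr r \<theta> s) (at r within {0..R})" if "r \<in> {0..R}" for r \<theta> s
  proof -
    have 1: "((\<lambda>r. \<zeta> r s) has_derivative (\<lambda>h. h *\<^sub>R of_real (2 * \<mu> * r))) (at r within {0..R})"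
      unfolding \<zeta>_def by (auto intro!: derivative_eq_intros simp: scaleR_conv_of_real fun_eq_iff)
    have 2: "((\<lambda>r. y r \<theta> s) has_derivative (\<lambda>h. h *\<^sub>R (cis \<theta> *s v, 0))) (at r within {0..R})"
      unfolding y_def by (rule mult_cis_derivs)
    show ?thesis unfolding F_def has_vector_derivative_def
      by (rule has_derivative_eq_rhs[OF has_derivative_mult[OF has_derivative_compose[OF 2 der] has_derivative_compose[OF 1 d\<psi>'[OF that]]]])
         (simp only: linear_simps(5)[OF G'_lin] G'_cis(1), simp add: fun_eq_iff Fr_def scaleR_conv_of_real algebra_simps)
  qed
  have d\<theta>: "((\<lambda>\<theta>. F r \<theta> s) has_vector_derivative F\<theta> r \<theta> s) (at \<theta> within A)" if "r \<in> {0..R}" for r \<theta> s A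
  proof -
    have 2: "((\<lambda>\<theta>. y r \<theta> s) has_derivative (\<lambda>h. h *\<^sub>R ((of_real r * \<i> * cis \<theta>) *s v, 0))) (at \<theta> within A)"
      unfolding y_def by (rule mult_cis_derivs)
    show ?thesis unfolding F_def has_vector_derivative_def
      by (rule has_derivative_eq_rhs[OF has_derivative_mult_left[OF has_derivative_compose[OF 2 der]]])
         (simp only: linear_simps(5)[OF G'_lin] G'_cis(2), simp add: fun_eq_iff F\<theta>_def scaleR_conv_of_real algebra_simps)
  qed
  have ds: "((\<lambda>s. F r \<theta> s) has_vector_derivative Fs r \<theta> s) (at s within A)" if "r \<in> {0..R}" for r \<theta> s A
  proof -
    have 1: "((\<lambda>s. \<zeta> r s) has_derivative (\<lambda>h. h *\<^sub>R \<i>)) (at s within A)"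
      unfolding \<zeta>_def by (auto intro!: derivative_eq_intros simp: scaleR_conv_of_real fun_eq_iff)
    have 2: "((\<lambda>s. y r \<theta> s) has_derivative (\<lambda>h. h *\<^sub>R (0, 1))) (at s within A)"
      unfolding y_def by (rule mult_cis_derivs)
    show ?thesis unfolding F_def has_vector_derivative_def
      by (rule has_derivative_eq_rhs[OF has_derivative_mult[OF has_derivative_compose[OF 2 der] has_derivative_compose[OF 1 d\<psi>'[OF that]]]])
         (simp only: linear_simps(5)[OF G'_lin], simp add: fun_eq_iff Fs_def scaleR_conv_of_real algebra_simps)
  qed
  have G_cont: "continuous_on UNIV G"
    using der by (auto intro!: continuous_at_imp_continuous_on has_derivative_continuous)
  have \<psi>_cont: "continuous_on D \<psi>"
    using d\<psi> by (auto simp: D_def intro!: continuous_at_imp_continuous_on DERIV_isCont)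
  have y_cont: "continuous_on A (\<lambda>p. y (f p) (g p) (h p))"
    if "continuous_on A f" "continuous_on A g" "continuous_on A h" for A and f g h :: "'p::t2_space \<Rightarrow> real"
    using that unfolding y_def vector_scalar_mult_def by (intro continuous_intros) auto
  have \<zeta>_cont: "continuous_on A (\<lambda>p. \<zeta> (f p) (h p))"
    if "continuous_on A f" "continuous_on A h" for A and f h :: "'p::t2_space \<Rightarrow> real"
    using that unfolding \<zeta>_def by (intro continuous_intros)
  have c1: "continuous_on A (\<lambda>p. G (y (f p) (g p) (h p)))" "continuous_on A (\<lambda>p. G' (y (f p) (g p) (h p)) w)"
    if "continuous_on A f" "continuous_on A g" "continuous_on A h" for A and f g h :: "'p::t2_space \<Rightarrow> real" and w
    using continuous_on_compose2[OF G_cont y_cont[OF that]] continuous_on_compose2[OF cont y_cont[OF that]] by auto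
  have c2: "continuous_on A (\<lambda>p. \<psi> (\<zeta> (f p) (h p)))" "continuous_on A (\<lambda>p. \<psi>' (\<zeta> (f p) (h p)))"
    if "continuous_on A f" "continuous_on A h" "\<And>p. p \<in> A \<Longrightarrow> f p \<in> {0..R}" for A and f h :: "'p::t2_space \<Rightarrow> real"
    using continuous_on_compose2[OF \<psi>_cont \<zeta>_cont[OF that(1,2)]] continuous_on_compose2[OF c\<psi>[folded D_def] \<zeta>_cont[OF that(1,2)]] \<zeta>D that(3)
    by blast+
  have F_cont: "continuous_on A (\<lambda>p. F (f p) (g p) (h p))" and Fr_cont: "continuous_on A (\<lambda>p. Fr (f p) (g p) (h p))"
    and F\<theta>_cont: "continuous_on A (\<lambda>p. F\<theta> (f p) (g p) (h p))" and Fs_cont: "continuous_on A (\<lambda>p. Fs (f p) (g p) (h p))"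
    if "continuous_on A f" "continuous_on A g" "continuous_on A h" "\<And>p. p \<in> A \<Longrightarrow> f p \<in> {0..R}" for A and f g h :: "'p::t2_space \<Rightarrow> real"
  proof -
    note c = c1[OF that(1-3)] c2[OF that(1,3,4)] that(1-3)
    show "continuous_on A (\<lambda>p. F (f p) (g p) (h p))"
      unfolding F_def by (intro continuous_on_mult c)
    show "continuous_on A (\<lambda>p. Fr (f p) (g p) (h p))" unfolding Fr_def
      by (intro continuous_on_add continuous_on_mult continuous_on_of_real continuous_on_cos continuous_on_sin continuous_on_const c)
    show "continuous_on A (\<lambda>p. F\<theta> (f p) (g p) (h p))" unfolding F\<theta>_def
      by (intro continuous_on_add continuous_on_minus continuous_on_mult continuous_on_of_real continuous_on_cos continuous_on_sin continuous_on_const c)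
    show "continuous_on A (\<lambda>p. Fs (f p) (g p) (h p))" unfolding Fs_def
      by (intro continuous_on_add continuous_on_mult continuous_on_const c)
  qed
  define m where "m S r = integral (cbox (0, - S) (2 * pi, S)) (\<lambda>(\<theta>, s). F r \<theta> s)" for S r
  \<comment> \<open>A bound for the derivative of the mean \<open>m S\<close>: at most
    \<open>2 \<mu> R\<close> from the CR equation divided by \<open>r\<close>, times the length
    \<open>2 pi\<close> of the angular interval, times the bound for the two boundary values at
    \<open>s = S\<close> and \<open>s = - S\<close>.\<close>
  define K where "K S = 2 * \<mu> * R * (2 * pi * (2 * (C / (1 + S\<^sup>2))))" for S
  have F_bd: "norm (F r \<theta> s) \<le> C / (1 + s\<^sup>2)" if "r \<in> {0..R}" for r \<theta> s
    using bd[of r \<theta> s] that by (simp add: F_def y_def \<zeta>_def)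
  have m_diff: "norm (m S R - m S 0) \<le> K S * R" if "S > 0" for S
  proof -
    let ?B = "cbox (0, - S) (2 * pi, S)"
    define m' where "m' r = integral ?B (\<lambda>(\<theta>, s). Fr r \<theta> s)" for r
    have deriv: "(m S has_vector_derivative m' r) (at r within {0..R})" if "r \<in> {0..R}" for r
      unfolding m_def[abs_def] m'_def
    proof (rule leibniz_rule_vector_derivative[where U = "{0..R}"])
      show "((\<lambda>r. case t of (\<theta>, s) \<Rightarrow> F r \<theta> s) has_vector_derivative (case t of (\<theta>, s) \<Rightarrow> Fr r \<theta> s)) (at r within {0..R})"
        if "r \<in> {0..R}" for r t using dr[OF that] by (cases t) simp
      show "(\<lambda>(\<theta>, s). F r \<theta> s) integrable_on ?B" if "r \<in> {0..R}" for r
        using that by (intro integrable_continuous) (auto simp: case_prod_unfold intro!: F_cont continuous_intros)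
      show "continuous_on ({0..R} \<times> ?B) (\<lambda>(r, t). case t of (\<theta>, s) \<Rightarrow> Fr r \<theta> s)"
        by (auto simp: case_prod_unfold intro!: Fr_cont continuous_intros)
    qed (use that in auto)
    \<comment> \<open>The CR equation only gives access to \<open>r m'(r)\<close>, so
      \<open>r = 0\<close> is excluded; the mean value inequality used afterwards asks for the bound
      in the open interval only.\<close>
    have bound: "norm (m' r) \<le> K S" if r: "0 < r" "r < R" for r
    proof -
      have rR: "r \<in> {0..R}" using r by auto
      have I\<theta>: "integral ?B (\<lambda>(\<theta>, s). F\<theta> r \<theta> s) = 0"
      proof -
        have in0: "integral (cbox 0 (2 * pi)) (\<lambda>\<theta>. F\<theta> r \<theta> s) = 0" for s
        proof -
          have "((\<lambda>\<theta>. F\<theta> r \<theta> s) has_integral F r (2 * pi) s - F r 0 s) {0..2 * pi}"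
            by (rule fundamental_theorem_of_calculus) (use d\<theta>[OF rR] in auto)
          moreover have "F r (2 * pi) s = F r 0 s" by (simp add: F_def y_def)
          ultimately show ?thesis by (simp add: integral_unique)
        qed
        have c: "continuous_on ?B (\<lambda>(\<theta>, s). F\<theta> r \<theta> s)"
          using rR by (auto simp: case_prod_unfold intro!: F\<theta>_cont continuous_intros)
        have "integral ?B (\<lambda>(\<theta>, s). F\<theta> r \<theta> s) = integral (cbox 0 (2 * pi)) (\<lambda>\<theta>. integral (cbox (- S) S) (\<lambda>s. F\<theta> r \<theta> s))"
          using integral_prod_continuous[OF c] by simp
        also have "\<dots> = integral (cbox (- S) S) (\<lambda>s. integral (cbox 0 (2 * pi)) (\<lambda>\<theta>. F\<theta> r \<theta> s))"
          by (rule integral_swap_continuous[OF c])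
        also have "\<dots> = 0" unfolding in0 by simp
        finally show ?thesis .
      qed
      have Is: "norm (integral ?B (\<lambda>(\<theta>, s). Fs r \<theta> s)) \<le> 2 * pi * (2 * (C / (1 + S\<^sup>2)))"
      proof -
        have c: "continuous_on ?B (\<lambda>(\<theta>, s). Fs r \<theta> s)"
          using rR by (auto simp: case_prod_unfold intro!: Fs_cont continuous_intros)
        have "integral ?B (\<lambda>(\<theta>, s). Fs r \<theta> s) = integral (cbox 0 (2 * pi)) (\<lambda>\<theta>. integral (cbox (- S) S) (\<lambda>s. Fs r \<theta> s))"
          using integral_prod_continuous[OF c] by simp
        also have "\<dots> = integral (cbox 0 (2 * pi)) (\<lambda>\<theta>. F r \<theta> S - F r \<theta> (- S))"
        proof (rule arg_cong[where f = "integral _"], rule ext)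
          fix \<theta>
          have "((\<lambda>s. Fs r \<theta> s) has_integral F r \<theta> S - F r \<theta> (- S)) {- S..S}"
            by (rule fundamental_theorem_of_calculus) (use ds[OF rR] \<open>S > 0\<close> in auto)
          then show "integral (cbox (- S) S) (\<lambda>s. Fs r \<theta> s) = F r \<theta> S - F r \<theta> (- S)"
            by (simp add: integral_unique)
        qed
        also have "norm \<dots> \<le> 2 * (C / (1 + S\<^sup>2)) * measure lborel (cbox 0 (2 * pi))"
        proof (rule integrable_bound)
          have "norm (F r 0 S) \<le> C / (1 + S\<^sup>2)" using F_bd[OF rR] .
          then show "0 \<le> 2 * (C / (1 + S\<^sup>2))" using norm_ge_zero[of "F r 0 S"] by linarith
          show "(\<lambda>\<theta>. F r \<theta> S - F r \<theta> (- S)) integrable_on cbox 0 (2 * pi)"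
            using rR by (intro integrable_continuous continuous_intros F_cont) auto
          show "norm (F r \<theta> S - F r \<theta> (- S)) \<le> 2 * (C / (1 + S\<^sup>2))" for \<theta>
            using F_bd[OF rR, of \<theta> S] F_bd[OF rR, of \<theta> "- S"] norm_triangle_ineq4[of "F r \<theta> S" "F r \<theta> (- S)"] by simp
        qed
        finally show ?thesis by (simp add: mult.commute)
      qed
      have "of_real r * m' r = integral ?B (\<lambda>(\<theta>, s). of_real r * Fr r \<theta> s)"
        unfolding m'_def by (subst integral_mult_right[symmetric]) (simp add: case_prod_unfold)
      also have "\<dots> = integral ?B (\<lambda>(\<theta>, s). - \<i> * F\<theta> r \<theta> s - 2 * \<i> * of_real (\<mu> * r\<^sup>2) * Fs r \<theta> s)"
        by (simp only: CR')
      also have "\<dots> = - \<i> * integral ?B (\<lambda>(\<theta>, s). F\<theta> r \<theta> s) - 2 * \<i> * of_real (\<mu> * r\<^sup>2) * integral ?B (\<lambda>(\<theta>, s). Fs r \<theta> s)"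
      proof -
        have ab: "(\<lambda>x. F\<theta> r (fst x) (snd x)) integrable_on ?B" "(\<lambda>x. Fs r (fst x) (snd x)) integrable_on ?B"
          using rR by (auto intro!: integrable_continuous F\<theta>_cont Fs_cont continuous_intros)
        then show ?thesis
          unfolding case_prod_unfold
          by (simp only: Henstock_Kurzweil_Integration.integral_diff[OF integrable_on_mult_right[OF ab(1), of "- \<i>"] integrable_on_mult_right[OF ab(2)]]
              Henstock_Kurzweil_Integration.integral_mult_right)
      qed
      finally have "of_real r * m' r = - 2 * \<i> * of_real (\<mu> * r\<^sup>2) * integral ?B (\<lambda>(\<theta>, s). Fs r \<theta> s)"
        unfolding I\<theta> by simp
      then have "norm (of_real r * m' r) = norm (- 2 * \<i> * of_real (\<mu> * r\<^sup>2) * integral ?B (\<lambda>(\<theta>, s). Fs r \<theta> s))"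
        by (simp only:)
      then have "r * norm (m' r) = r * (2 * \<mu> * r * norm (integral ?B (\<lambda>(\<theta>, s). Fs r \<theta> s)))"
        using r \<mu>(2) by (simp add: norm_mult power2_eq_square abs_mult mult_ac)
      then have "norm (m' r) = 2 * \<mu> * r * norm (integral ?B (\<lambda>(\<theta>, s). Fs r \<theta> s))"
        using r by simp
      also have "\<dots> \<le> K S"
        unfolding K_def using r \<mu>(2) Is by (intro mult_mono) auto
      finally show ?thesis .
    qed
    have "norm (m S R - m S 0) \<le> K S * R - K S * 0"
    proof (rule differentiable_bound_general[OF R, where f' = m' and \<phi>' = "\<lambda>_. K S"])
      show "continuous_on {0..R} (m S)"
        unfolding continuous_on_eq_continuous_within using has_vector_derivative_continuous[OF deriv] by blast
      show "(m S has_vector_derivative m' r) (at r)" if "0 < r" "r < R" for r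
        using deriv[of r] that by (simp add: at_within_Icc_at)
    qed (use bound in \<open>auto intro!: continuous_intros derivative_eq_intros\<close>)
    then show ?thesis by simp
  qed
  define I where "I r = (\<integral>x. indicator {0..2*pi} (fst x) *\<^sub>R F r (fst x) (snd x) \<partial>(lborel :: (real \<times> real) measure))" for r
  have m_lim: "(\<lambda>k. m (real (Suc k)) r) \<longlonglongrightarrow> I r" if "r \<in> {0..R}" for r
  proof -
    have c: "continuous_on UNIV (\<lambda>(\<theta>, s). F r \<theta> s)"
      using that by (auto simp: case_prod_unfold intro!: F_cont continuous_intros)
    have [measurable]: "(\<lambda>x. F r (fst x) (snd x)) \<in> borel_measurable borel"
      using borel_measurable_continuous_onI[OF c] by (simp add: case_prod_unfold)
    have [measurable]: "(\<lambda>x::real\<times>real. indicator {0..2*pi} (fst x) :: real) \<in> borel_measurable borel"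
      unfolding borel_prod[symmetric] by measurable
    have [measurable]: "(indicator (cbox a b) :: real \<times> real \<Rightarrow> real) \<in> borel_measurable borel" for a b
      by (intro borel_measurable_indicator) simp
    have "(\<lambda>k. \<integral>x. indicator (cbox (0, - real (Suc k)) (2 * pi, real (Suc k))) x *\<^sub>R (case x of (\<theta>, s) \<Rightarrow> F r \<theta> s) \<partial>lborel) \<longlonglongrightarrow> I r"
      unfolding I_def
    proof (rule integral_dominated_convergence)
      show "integrable lborel (\<lambda>x. indicator {0..2*pi} (fst x) * (C * (1 / (1 + (snd x)\<^sup>2))) :: real)"
        by (rule integrable_prod_mult[OF _ integrable_mult_right[OF integral_inverse_1_plus_square(1)]]) (simp add: integrable_indicator_iff)
      show "AE x in lborel. (\<lambda>k. indicator (cbox (0, - real (Suc k)) (2 * pi, real (Suc k))) x *\<^sub>R (case x of (\<theta>, s) \<Rightarrow> F r \<theta> s))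
          \<longlonglongrightarrow> indicator {0..2*pi} (fst x) *\<^sub>R F r (fst x) (snd x)"
      proof (intro AE_I2 tendsto_eventually)
        fix x :: "real \<times> real"
        obtain N where N: "\<bar>snd x\<bar> \<le> real N" using real_arch_simple by blast
        then have "\<bar>snd x\<bar> \<le> real (Suc k)" if "k \<ge> N" for k using that by simp
        then have "x \<in> cbox (0, - real (Suc k)) (2 * pi, real (Suc k)) \<longleftrightarrow> fst x \<in> {0..2*pi}" if "k \<ge> N" for k
          using that by (cases x) (auto simp: cbox_Pair_eq abs_le_iff, force+)
        then show "\<forall>\<^sub>F k in sequentially. indicator (cbox (0, - real (Suc k)) (2 * pi, real (Suc k))) x *\<^sub>R (case x of (\<theta>, s) \<Rightarrow> F r \<theta> s)
            = indicator {0..2*pi} (fst x) *\<^sub>R F r (fst x) (snd x)"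
          by (intro eventually_sequentiallyI[of N]) (simp add: indicator_def case_prod_unfold)
      qed
      have "norm (F r (fst x) (snd x)) \<le> C * (1 / (1 + (snd x)\<^sup>2))" for x
        using F_bd[OF that, of "fst x" "snd x"] by simp
      moreover from order_trans[OF norm_ge_zero this] have "0 \<le> C * (1 / (1 + (snd x)\<^sup>2))" for x :: "real \<times> real" .
      ultimately show "AE x in lborel. norm (indicator (cbox (0, - real (Suc k)) (2 * pi, real (Suc k))) x *\<^sub>R (case x of (\<theta>, s) \<Rightarrow> F r \<theta> s))
          \<le> indicator {0..2*pi} (fst x) * (C * (1 / (1 + (snd x)\<^sup>2)))" for k
        by (auto simp: case_prod_unfold cbox_Pair_eq split: split_indicator)
    qed (auto simp: case_prod_unfold)
    then show ?thesis unfolding m_def integral_box_eq_lborel[OF c] .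
  qed
  \<comment> \<open>Here the decay in \<open>s\<close> enters: the boundary terms vanish as the
    interval \<open>{-S..S}\<close> grows.\<close>
  have "(\<lambda>k. K (real (Suc k)) * R) \<longlonglongrightarrow> 0" unfolding K_def by real_asymp
  moreover have "(\<lambda>k. norm (m (real (Suc k)) R - m (real (Suc k)) 0)) \<longlonglongrightarrow> norm (I R - I 0)"
    using R by (intro tendsto_intros m_lim) auto
  ultimately have "norm (I R - I 0) \<le> 0"
    using m_diff by (intro LIMSEQ_le[of _ _ _ 0]) auto
  then have "I R = I 0" by simp
  \<comment> \<open>For \<open>r = 0\<close> the integrand does not depend on the angle, whence the
    factor \<open>2 pi\<close>.\<close>
  also have "I 0 = of_real (2 * pi) * (\<integral>s. F 0 0 s \<partial>lborel)"
  proof -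
    define f where "f s = F 0 0 s" for s
    have F0: "F 0 \<theta> s = f s" for \<theta> s by (simp add: f_def F_def y_def)
    have "continuous_on UNIV f" unfolding f_def using R by (intro F_cont continuous_intros) auto
    then have [measurable]: "f \<in> borel_measurable borel" by (rule borel_measurable_continuous_onI)
    have 1: "integrable lborel (\<lambda>x. indicator {0..2*pi} (fst x) * (C * (1 / (1 + (snd x)\<^sup>2))) :: real)"
      by (rule integrable_prod_mult[OF _ integrable_mult_right[OF integral_inverse_1_plus_square(1)]]) (simp add: integrable_indicator_iff)
    have "integrable (lborel \<Otimes>\<^sub>M lborel) (\<lambda>x. indicator {0..2*pi} (fst x) *\<^sub>R f (snd x))"
    proof (rule Bochner_Integration.integrable_bound[OF 1[folded lborel_prod]])
      have le: "norm (f s) \<le> C / (1 + s\<^sup>2)" for s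
        using F_bd[of 0 0 s] R by (simp add: f_def)
      have "0 \<le> C" using order_trans[OF norm_ge_zero le[of 0]] by simp
      then show "AE x in lborel \<Otimes>\<^sub>M lborel. norm (indicator {0..2*pi} (fst x) *\<^sub>R f (snd x)) \<le> norm (indicator {0..2*pi} (fst x) * (C * (1 / (1 + (snd x)\<^sup>2))))"
        by (intro AE_I2) (auto simp: le split: split_indicator)
    qed measurable
    from lborel_pair.integral_fst'[OF this]
    have "I 0 = (\<integral>\<theta>. indicator {0..2*pi} \<theta> *\<^sub>R (\<integral>s. f s \<partial>lborel) \<partial>lborel)"
      unfolding I_def lborel_prod F0 by simp
    then show ?thesis by (simp add: scaleR_conv_of_real F0)
  qed
  finally show ?thesis by (simp add: I_def F_def y_def \<zeta>_def)
qed

text \<open>No measurability of \<open>f\<close> is assumed: a Bochner integral that does not exist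
  is 0 by convention, and 0 satisfies the bound.\<close>

lemma norm_integral_le_integral:
  fixes f :: "'a \<Rightarrow> 'b::{banach, second_countable_topology}"
  assumes g: "integrable M g" and le: "\<And>x. norm (f x) \<le> g x"
  shows "norm (\<integral>x. f x \<partial>M) \<le> (\<integral>x. g x \<partial>M)"
proof (cases "integrable M f")
  case True
  then show ?thesis using g le
    by (intro order_trans[OF integral_norm_bound] integral_mono) auto
next
  case False
  have "0 \<le> g x" for x using order_trans[OF norm_ge_zero le] .
  then show ?thesis using False by (simp add: not_integrable_integral_eq)
qed

text \<open>Evaluated at \<open>heis_mult lam (- x) y\<close>, the base of the power is
  \<open>- i (phi_minus lam x y + i \<epsilon>)\<close> for positive \<open>lam\<close>, so this is
  the convolution kernel of the regularised operator.\<close>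

definition heis_kernel :: "real ^ 'n::finite \<Rightarrow> real \<Rightarrow> 'n heis \<Rightarrow> complex" where
  "heis_kernel lam \<epsilon> y = 1 / (of_real (\<epsilon> + qform lam (fst y)) - \<i> * of_real (snd y)) ^ Suc CARD('n)"

lemma heis_kernel_denominator:
  assumes "\<And>j. lam $ j > 0" "\<epsilon> > 0"
  shows "of_real (\<epsilon> + qform lam w) - \<i> * of_real s \<noteq> 0"
    "\<epsilon> + qform lam w \<le> norm (of_real (\<epsilon> + qform lam w) - \<i> * of_real s)"
    "\<epsilon> \<le> norm (of_real (\<epsilon> + qform lam w) - \<i> * of_real s)"
proof -
  have q: "qform lam w \<ge> 0" by (rule qform_nonneg[OF assms(1)])
  show 1: "\<epsilon> + qform lam w \<le> norm (of_real (\<epsilon> + qform lam w) - \<i> * of_real s)"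
    using abs_Re_le_cmod[of "of_real (\<epsilon> + qform lam w) - \<i> * of_real s"] by simp
  then show "\<epsilon> \<le> norm (of_real (\<epsilon> + qform lam w) - \<i> * of_real s)" using q by linarith
  then show "of_real (\<epsilon> + qform lam w) - \<i> * of_real s \<noteq> 0" using assms(2) by (metis norm_zero not_le)
qed

lemma continuous_on_heis_kernel:
  assumes "\<And>j. lam $ j > 0" "\<epsilon> > 0" "continuous_on S f"
  shows "continuous_on S (\<lambda>x. heis_kernel lam \<epsilon> (f x))"
  unfolding heis_kernel_def using heis_kernel_denominator(1)[OF assms(1,2)] assms(3)
  by (intro continuous_intros) (auto simp del: of_real_add)

lemma borel_measurable_heis_kernel:
  assumes "\<And>j. lam $ j > 0" "\<epsilon> > 0"
  shows "heis_kernel lam \<epsilon> \<in> borel_measurable borel"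
  by (rule borel_measurable_continuous_onI[OF continuous_on_heis_kernel[OF assms continuous_on_id]])

lemma norm_heis_kernel_le:
  fixes lam :: "real ^ 'n::finite"
  assumes "\<And>j. lam $ j > 0" "\<epsilon> > 0"
  shows "norm (heis_kernel lam \<epsilon> y) \<le> 1 / \<epsilon> ^ Suc CARD('n)"
  unfolding heis_kernel_def norm_divide norm_power
  using heis_kernel_denominator(3)[OF assms, of "fst y" "snd y"] assms(2)
  by (intro frac_le power_mono zero_less_power) auto

section \<open>The damping factor\<close>

lemma norm_1_add_sq_ge:
  assumes "\<delta> > 0" "p \<ge> 0"
  shows "min 1 (\<delta>\<^sup>2) * (1 + s\<^sup>2) \<le> (norm (1 + of_real \<delta> * (of_real p + \<i> * of_real s)))\<^sup>2"
proof -
  have "min 1 (\<delta>\<^sup>2) * (1 + s\<^sup>2) \<le> 1 * 1 + \<delta>\<^sup>2 * s\<^sup>2"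
    unfolding distrib_left mult_1_right by (intro add_mono mult_right_mono) auto
  also have "\<dots> \<le> (1 + \<delta> * p)\<^sup>2 + (\<delta> * s)\<^sup>2"
    using assms by (intro add_mono) (auto simp: power_mult_distrib intro!: one_le_power)
  also have "\<dots> = (norm (1 + of_real \<delta> * (of_real p + \<i> * of_real s)))\<^sup>2"
    by (simp add: cmod_power2)
  finally show ?thesis .
qed

text \<open>\<open>1 / (1 + \<delta> \<zeta>)^2\<close> with \<open>\<zeta> = p + i s\<close> is
  holomorphic for \<open>Re \<zeta> \<ge> 0\<close>, so it can be absorbed into the function
  \<open>\<psi>\<close> of the circle means. For fixed \<open>\<delta>\<close> it supplies the decay
  \<open>1 / (1 + s^2)\<close>; the bound by 1 is uniform and permits \<open>\<delta>\<close> to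
  tend to 0.\<close>

lemma damping_bound:
  assumes "\<delta> > 0" "p \<ge> 0"
  shows "norm (1 / (1 + of_real \<delta> * (of_real p + \<i> * of_real s))\<^sup>2) \<le> (1 / min 1 (\<delta>\<^sup>2)) / (1 + s\<^sup>2)"
    and "norm (1 / (1 + of_real \<delta> * (of_real p + \<i> * of_real s))\<^sup>2) \<le> 1"
    and "1 + of_real \<delta> * (of_real p + \<i> * of_real s) \<noteq> 0"
proof -
  let ?z = "1 + of_real \<delta> * (of_real p + \<i> * of_real s) :: complex"
  have pos: "0 < min 1 (\<delta>\<^sup>2) * (1 + s\<^sup>2)" using assms by (intro mult_pos_pos) (auto simp: add_pos_nonneg)
  show "norm (1 / ?z\<^sup>2) \<le> (1 / min 1 (\<delta>\<^sup>2)) / (1 + s\<^sup>2)"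
    using norm_1_add_sq_ge[OF assms, of s] pos by (simp add: norm_divide norm_power frac_le)
  have "1 + \<delta> * p \<le> norm ?z" using abs_Re_le_cmod[of ?z] by simp
  moreover have "0 \<le> \<delta> * p" using assms by simp
  ultimately have 1: "1 \<le> norm ?z" by linarith
  then have "1 \<le> (norm ?z)\<^sup>2" by (rule one_le_power)
  then show "norm (1 / ?z\<^sup>2) \<le> 1" by (simp add: norm_divide norm_power divide_le_eq)
  show "?z \<noteq> 0" using 1 by (metis norm_zero not_one_le_zero)
qed

text \<open>\<open>CR\<close> says \<open>2 * sum_j cnj (z_j) Zbar_j G = 0\<close>: the CR equations
  combined along the complex line through the origin, which is all that the circle means use. The
  derivative \<open>G'\<close> is a parameter because in the application it is given by an
  integral.\<close>

locale classical_CR =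
  fixes lam :: "real ^ 'n::finite" and G :: "'n heis \<Rightarrow> complex" and G' :: "'n heis \<Rightarrow> 'n heis \<Rightarrow> complex" and M :: real
  assumes lam: "\<And>j. lam $ j > 0"
    and der: "\<And>x. (G has_derivative G' x) (at x)" and cont: "\<And>v. continuous_on UNIV (\<lambda>x. G' x v)"
    and CR: "\<And>x. G' x (fst x, 0) + \<i> * G' x (\<i> *s fst x, 0) + 2 * \<i> * of_real (qform lam (fst x)) * G' x (0, 1) = 0"
    and bounded: "\<And>x. norm (G x) \<le> M"
begin

lemma M_nonneg: "0 \<le> M"
  using order_trans[OF norm_ge_zero bounded] .

lemma G_continuous: "continuous_on A G"
  using der by (auto intro!: continuous_at_imp_continuous_on has_derivative_continuous)

lemma G_measurable [measurable]: "G \<in> borel_measurable borel"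
  by (rule borel_measurable_continuous_onI[OF G_continuous])

lemma G0_measurable [measurable]: "(\<lambda>s. G (0, s)) \<in> borel_measurable borel"
  by (rule borel_measurable_continuous_onI) (auto intro!: continuous_on_compose2[OF G_continuous[of UNIV]] continuous_intros)

text \<open>Negative frequencies: the mean over circles of growing radius tends to 0.\<close>

lemma negative_part:
  assumes \<delta>: "\<delta> > 0" and \<epsilon>: "\<epsilon> > 0"
  shows "(\<integral>s. G (0, s) * (1 / ((1 + of_real \<delta> * (\<i> * of_real s))\<^sup>2 * (of_real \<epsilon> + \<i> * of_real s))) \<partial>lborel) = 0"
proof -
  obtain j :: 'n where True by blast
  \<comment> \<open>A vector with \<open>\<mu> > 0\<close>: then
    \<open>Re \<zeta> = \<mu> R^2\<close> grows with the radius \<open>R\<close>.\<close>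
  define v where "v = (axis j 1 :: complex ^ 'n)"
  define \<mu> where "\<mu> = qform lam v"
  have \<mu>: "\<mu> > 0"
  proof -
    have "\<mu> = (\<Sum>i\<in>UNIV. if i = j then lam $ j else 0)"
      unfolding \<mu>_def v_def qform_def by (intro sum.cong) (auto simp: axis_def)
    then show ?thesis using lam by simp
  qed
  define \<psi> where "\<psi> z = 1 / ((1 + of_real \<delta> * z)\<^sup>2 * (of_real \<epsilon> + z))" for z :: complex
  define \<psi>' where "\<psi>' z = - (2 * of_real \<delta> * (1 + of_real \<delta> * z) * (of_real \<epsilon> + z) + (1 + of_real \<delta> * z)\<^sup>2) / ((1 + of_real \<delta> * z)\<^sup>2 * (of_real \<epsilon> + z))\<^sup>2" for z :: complex
  have nz: "1 + of_real \<delta> * z \<noteq> 0" "of_real \<epsilon> + z \<noteq> 0" if "0 \<le> Re z" for z :: complex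
  proof -
    have "Re (1 + of_real \<delta> * z) > 0" using that \<delta> by (simp add: add_pos_nonneg)
    then show "1 + of_real \<delta> * z \<noteq> 0" by (metis less_irrefl zero_complex.sel(1))
    have "Re (of_real \<epsilon> + z) > 0" using that \<epsilon> by simp
    then show "of_real \<epsilon> + z \<noteq> 0" by (metis less_irrefl zero_complex.sel(1))
  qed
  let ?C = "M / min 1 (\<delta>\<^sup>2)"
  \<comment> \<open>The factor \<open>1 / (\<epsilon> + p)\<close>, with
    \<open>p = \<mu> R^2\<close> on the circle of radius \<open>R\<close>, gives the decay in
    \<open>R\<close>; the damping gives integrability in \<open>s\<close>.\<close>
  have bd: "norm (G x * \<psi> (of_real p + \<i> * of_real s)) \<le> (?C / (\<epsilon> + p)) / (1 + s\<^sup>2)" if p: "p \<ge> 0" for x p s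
  proof -
    have "\<epsilon> + p \<le> norm (of_real \<epsilon> + (of_real p + \<i> * of_real s))"
      using abs_Re_le_cmod[of "of_real \<epsilon> + (of_real p + \<i> * of_real s)"] by simp
    then have "norm (1 / (of_real \<epsilon> + (of_real p + \<i> * of_real s))) \<le> 1 / (\<epsilon> + p)"
      unfolding norm_divide norm_one using p \<epsilon> by (intro frac_le) auto
    then have "norm (G x) * (norm (1 / (1 + of_real \<delta> * (of_real p + \<i> * of_real s))\<^sup>2) * norm (1 / (of_real \<epsilon> + (of_real p + \<i> * of_real s))))
        \<le> M * ((1 / min 1 (\<delta>\<^sup>2)) / (1 + s\<^sup>2) * (1 / (\<epsilon> + p)))"
      using p \<delta> \<epsilon> M_nonneg by (intro mult_mono bounded damping_bound) (auto simp: add_nonneg_nonneg)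
    then show ?thesis by (simp add: \<psi>_def norm_mult[symmetric] norm_divide norm_mult norm_power mult_ac)
  qed
  let ?I = "\<integral>s. G (0, s) * \<psi> (\<i> * of_real s) \<partial>lborel"
  have key: "norm ?I \<le> pi * (?C / (\<epsilon> + \<mu> * R\<^sup>2))" if R: "R > 0" for R
  proof -
    have eq: "(\<integral>x. indicator {0..2*pi} (fst x) *\<^sub>R (G ((of_real R * cis (fst x)) *s v, snd x) * \<psi> (of_real (\<mu> * R\<^sup>2) + \<i> * of_real (snd x))) \<partial>(lborel :: (real \<times> real) measure))
        = of_real (2 * pi) * ?I"
    proof (rule CR_circle_mean[OF der cont CR R \<mu>_def less_imp_le[OF \<mu>], where \<psi>' = \<psi>' and C = "?C / \<epsilon>"])
      show "(\<psi> has_field_derivative \<psi>' z) (at z)" if "0 \<le> Re z" for z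
      proof -
        have d: "((\<lambda>z. (1 + of_real \<delta> * z)\<^sup>2 * (of_real \<epsilon> + z)) has_field_derivative
            2 * of_real \<delta> * (1 + of_real \<delta> * z) * (of_real \<epsilon> + z) + (1 + of_real \<delta> * z)\<^sup>2) (at z)"
          by (auto intro!: derivative_eq_intros simp: power2_eq_square algebra_simps)
        show ?thesis unfolding \<psi>_def \<psi>'_def
          using DERIV_divide[OF DERIV_const[of 1] d] nz[OF that] by (simp add: power2_eq_square)
      qed
      show "continuous_on {z. 0 \<le> Re z \<and> Re z \<le> \<mu> * R\<^sup>2} \<psi>'"
        unfolding \<psi>'_def using nz by (intro continuous_intros) auto
      fix r \<theta> s :: real
      have "norm (G ((of_real r * cis \<theta>) *s v, s) * \<psi> (of_real (\<mu> * r\<^sup>2) + \<i> * of_real s)) \<le> (?C / (\<epsilon> + \<mu> * r\<^sup>2)) / (1 + s\<^sup>2)"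
        using \<mu> by (intro bd) auto
      also have "\<dots> \<le> (?C / \<epsilon>) / (1 + s\<^sup>2)"
        using \<mu> \<epsilon> M_nonneg by (intro divide_right_mono divide_left_mono) (auto simp: add_pos_nonneg)
      finally show "norm (G ((of_real r * cis \<theta>) *s v, s) * \<psi> (of_real (\<mu> * r\<^sup>2) + \<i> * of_real s)) \<le> (?C / \<epsilon>) / (1 + s\<^sup>2)" .
    qed
    have int: "integrable lborel (\<lambda>x. indicator {0..2*pi} (fst x) * ((?C / (\<epsilon> + \<mu> * R\<^sup>2)) * (1 / (1 + (snd x)\<^sup>2))) :: real)"
      by (rule integrable_prod_mult[OF _ integrable_mult_right[OF integral_inverse_1_plus_square(1)]]) (simp add: integrable_indicator_iff)
    have "2 * pi * norm ?I = norm (\<integral>x. indicator {0..2*pi} (fst x) *\<^sub>R (G ((of_real R * cis (fst x)) *s v, snd x) * \<psi> (of_real (\<mu> * R\<^sup>2) + \<i> * of_real (snd x))) \<partial>(lborel :: (real \<times> real) measure))"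
      unfolding eq by (simp add: norm_mult)
    also have "\<dots> \<le> (\<integral>x. indicator {0..2*pi} (fst x) * ((?C / (\<epsilon> + \<mu> * R\<^sup>2)) * (1 / (1 + (snd x)\<^sup>2))) \<partial>(lborel :: (real \<times> real) measure))"
    proof (rule norm_integral_le_integral[OF int])
      show "norm (indicator {0..2*pi} (fst x) *\<^sub>R (G ((of_real R * cis (fst x)) *s v, snd x) * \<psi> (of_real (\<mu> * R\<^sup>2) + \<i> * of_real (snd x))))
          \<le> indicator {0..2*pi} (fst x) * ((?C / (\<epsilon> + \<mu> * R\<^sup>2)) * (1 / (1 + (snd x)\<^sup>2)))" for x
        using bd[of "\<mu> * R\<^sup>2" "((of_real R * cis (fst x)) *s v, snd x)" "snd x"] \<mu> by (simp split: split_indicator)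
    qed
    also have "\<dots> = (\<integral>\<theta>. \<integral>s. indicator {0..2*pi} \<theta> * ((?C / (\<epsilon> + \<mu> * R\<^sup>2)) * (1 / (1 + s\<^sup>2))) \<partial>lborel \<partial>(lborel :: real measure))"
      using lborel_pair.integral_fst'[OF int[folded lborel_prod]] by (simp add: lborel_prod)
    also have "\<dots> = 2 * pi * (pi * (?C / (\<epsilon> + \<mu> * R\<^sup>2)))"
      by (simp only: integral_mult_right_zero integral_mult_left_zero integral_inverse_1_plus_square(2)) simp
    finally show ?thesis by (rule mult_left_le_imp_le) simp
  qed
  have "((\<lambda>R. pi * (?C / (\<epsilon> + \<mu> * R\<^sup>2))) \<longlongrightarrow> 0) at_top" using \<mu> by real_asymp
  then have "norm ?I \<le> 0"
    by (rule tendsto_lowerbound[OF _ eventually_mono[OF eventually_gt_at_top[of 0] key] trivial_limit_at_top_linorder])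
  then show ?thesis by (simp add: \<psi>_def)
qed

text \<open>The circle mean is taken with \<open>v = w\<close> and radius 1. The pointwise bound is
  recorded as well because it makes the integrals over the angle and \<open>s\<close> absolutely
  convergent for each fixed \<open>w\<close>, as the exchange of these two integrations
  requires.\<close>

lemma circle_mean_kernel:
  assumes \<delta>: "\<delta> > 0" and \<epsilon>: "\<epsilon> > 0"
  defines "H \<equiv> \<lambda>y. G y * (1 / (1 + of_real \<delta> * (of_real (qform lam (fst y)) + \<i> * of_real (snd y)))\<^sup>2) * heis_kernel lam \<epsilon> y"
  shows "(\<integral>x. indicator {0..2*pi} (fst x) *\<^sub>R H (cis (fst x) *s w, snd x) \<partial>(lborel :: (real \<times> real) measure))
    = of_real (2 * pi) * (\<integral>s. G (0, s) * (1 / (1 + of_real \<delta> * (\<i> * of_real s))\<^sup>2) * (1 / ((of_real \<epsilon> - \<i> * of_real s) + of_real (2 * qform lam w)) ^ Suc CARD('n)) \<partial>lborel)"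
    and "norm (H y) \<le> (M / min 1 (\<delta>\<^sup>2) / \<epsilon> ^ Suc CARD('n)) / (1 + (snd y)\<^sup>2)"
proof -
  let ?n = "Suc CARD('n)"
  define \<mu> where "\<mu> = qform lam w"
  have \<mu>: "\<mu> \<ge> 0" unfolding \<mu>_def by (rule qform_nonneg[OF lam])
  \<comment> \<open>The damped kernel on the circle through \<open>w\<close>, as a function of
    \<open>\<zeta>\<close>. In the strip \<open>0 \<le> Re \<zeta> \<le> \<mu>\<close> the base
    \<open>\<epsilon> + 2 \<mu> - \<zeta>\<close> has real part at least
    \<open>\<epsilon> + \<mu>\<close>, so no pole is met.\<close>
  define \<psi> where "\<psi> z = 1 / ((1 + of_real \<delta> * z)\<^sup>2 * (of_real (\<epsilon> + 2 * \<mu>) - z) ^ ?n)" for z :: complex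
  define \<psi>' where "\<psi>' z = - (2 * of_real \<delta> * (1 + of_real \<delta> * z) * (of_real (\<epsilon> + 2 * \<mu>) - z) ^ ?n
      - (1 + of_real \<delta> * z)\<^sup>2 * (of_nat ?n * (of_real (\<epsilon> + 2 * \<mu>) - z) ^ CARD('n))) / ((1 + of_real \<delta> * z)\<^sup>2 * (of_real (\<epsilon> + 2 * \<mu>) - z) ^ ?n)\<^sup>2" for z :: complex
  have nz: "1 + of_real \<delta> * z \<noteq> 0" "of_real (\<epsilon> + 2 * \<mu>) - z \<noteq> 0" if "0 \<le> Re z" "Re z \<le> \<mu> * 1\<^sup>2" for z :: complex
  proof -
    have "Re (1 + of_real \<delta> * z) > 0" using that \<delta> by (simp add: add_pos_nonneg)
    then show "1 + of_real \<delta> * z \<noteq> 0" by (metis less_irrefl zero_complex.sel(1))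
    have "Re (of_real (\<epsilon> + 2 * \<mu>) - z) > 0" using that \<epsilon> \<mu> by simp
    then show "of_real (\<epsilon> + 2 * \<mu>) - z \<noteq> 0" by (metis less_irrefl zero_complex.sel(1))
  qed
  let ?C = "M / min 1 (\<delta>\<^sup>2) / \<epsilon> ^ ?n"
  have bd: "norm (G x * ((1 / (1 + of_real \<delta> * (of_real p + \<i> * of_real s))\<^sup>2) * (1 / a ^ ?n))) \<le> ?C / (1 + s\<^sup>2)"
    if p: "p \<ge> 0" and a: "\<epsilon> \<le> norm a" for x p s and a :: complex
  proof -
    have "norm (1 / a ^ ?n) \<le> 1 / \<epsilon> ^ ?n"
      unfolding norm_divide norm_one norm_power using a \<epsilon> by (intro frac_le power_mono) auto
    then have "norm (G x) * (norm (1 / (1 + of_real \<delta> * (of_real p + \<i> * of_real s))\<^sup>2) * norm (1 / a ^ ?n))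
        \<le> M * ((1 / min 1 (\<delta>\<^sup>2)) / (1 + s\<^sup>2) * (1 / \<epsilon> ^ ?n))"
      using p \<delta> \<epsilon> M_nonneg by (intro mult_mono bounded damping_bound) (auto simp: add_nonneg_nonneg)
    then show ?thesis by (simp only: norm_mult) (simp add: mult_ac)
  qed
  have "(\<integral>x. indicator {0..2*pi} (fst x) *\<^sub>R (G ((of_real 1 * cis (fst x)) *s w, snd x) * \<psi> (of_real (\<mu> * 1\<^sup>2) + \<i> * of_real (snd x))) \<partial>(lborel :: (real \<times> real) measure))
      = of_real (2 * pi) * (\<integral>s. G (0, s) * \<psi> (\<i> * of_real s) \<partial>lborel)"
  proof (rule CR_circle_mean[OF der cont CR zero_less_one \<mu>_def \<mu>, where \<psi>' = \<psi>' and C = "?C"])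
    show "(\<psi> has_field_derivative \<psi>' z) (at z)" if "0 \<le> Re z" "Re z \<le> \<mu> * 1\<^sup>2" for z
      unfolding \<psi>_def \<psi>'_def using nz[OF that]
      by (auto intro!: derivative_eq_intros simp del: power_Suc simp: power2_eq_square)
    show "continuous_on {z. 0 \<le> Re z \<and> Re z \<le> \<mu> * 1\<^sup>2} \<psi>'"
      unfolding \<psi>'_def using nz by (intro continuous_intros) auto
    fix r \<theta> s :: real assume "0 \<le> r" "r \<le> 1"
    then have "\<mu> * r\<^sup>2 \<le> \<mu> * 1\<^sup>2" using \<mu> by (intro mult_left_mono power_mono)
    then have "\<epsilon> \<le> norm (of_real (\<epsilon> + 2 * \<mu>) - (of_real (\<mu> * r\<^sup>2) + \<i> * of_real s))"
      using abs_Re_le_cmod[of "of_real (\<epsilon> + 2 * \<mu>) - (of_real (\<mu> * r\<^sup>2) + \<i> * of_real s)"] \<mu> by simp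
    from bd[OF _ this, of "\<mu> * r\<^sup>2" "((of_real r * cis \<theta>) *s w, s)" s] \<mu>
    show "norm (G ((of_real r * cis \<theta>) *s w, s) * \<psi> (of_real (\<mu> * r\<^sup>2) + \<i> * of_real s)) \<le> ?C / (1 + s\<^sup>2)"
      by (simp add: \<psi>_def mult_ac)
  qed
  moreover have "H (cis \<theta> *s w, s) = G ((of_real 1 * cis \<theta>) *s w, s) * \<psi> (of_real (\<mu> * 1\<^sup>2) + \<i> * of_real s)" for \<theta> s
  proof -
    have "qform lam (cis \<theta> *s w) = \<mu>" by (simp add: \<mu>_def qform_def norm_mult)
    moreover have "of_real (\<epsilon> + 2 * \<mu>) - (of_real (\<mu> * 1\<^sup>2) + \<i> * of_real s) = (of_real (\<epsilon> + \<mu>) - \<i> * of_real s :: complex)" by simp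
    ultimately show ?thesis
      unfolding H_def \<psi>_def heis_kernel_def fst_conv snd_conv by (simp only:) simp
  qed
  moreover have "\<psi> (\<i> * of_real s) = (1 / (1 + of_real \<delta> * (\<i> * of_real s))\<^sup>2) * (1 / ((of_real \<epsilon> - \<i> * of_real s) + of_real (2 * qform lam w)) ^ ?n)" for s
  proof -
    have "of_real (\<epsilon> + 2 * \<mu>) - \<i> * of_real s = (of_real \<epsilon> - \<i> * of_real s) + of_real (2 * qform lam w)"
      by (simp add: \<mu>_def)
    then show ?thesis by (simp only: \<psi>_def) simp
  qed
  ultimately show "(\<integral>x. indicator {0..2*pi} (fst x) *\<^sub>R H (cis (fst x) *s w, snd x) \<partial>(lborel :: (real \<times> real) measure))
    = of_real (2 * pi) * (\<integral>s. G (0, s) * (1 / (1 + of_real \<delta> * (\<i> * of_real s))\<^sup>2) * (1 / ((of_real \<epsilon> - \<i> * of_real s) + of_real (2 * qform lam w)) ^ ?n) \<partial>lborel)"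
    by (simp only: mult.assoc)
  show "norm (H y) \<le> ?C / (1 + (snd y)\<^sup>2)"
    unfolding H_def heis_kernel_def mult.assoc
    by (rule bd[OF qform_nonneg[OF lam] heis_kernel_denominator(3)[OF lam \<epsilon>]])
qed

lemma Poisson_formula_damped:
  assumes \<delta>: "\<delta> > 0" and \<epsilon>: "\<epsilon> > 0" and int: "integrable lborel (\<lambda>y. G y * heis_kernel lam \<epsilon> y)"
  defines "d \<equiv> \<lambda>y :: 'n heis. 1 / (1 + of_real \<delta> * (of_real (qform lam (fst y)) + \<i> * of_real (snd y)))\<^sup>2"
  defines "C \<equiv> pi ^ CARD('n) / (2 ^ CARD('n) * fact CARD('n) * (\<Prod>j\<in>UNIV. lam $ j))"
  shows "(\<integral>y. G y * d y * heis_kernel lam \<epsilon> y \<partial>lborel) =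
    of_real (2 * pi * C) * (\<integral>s. of_real (Poisson_kernel \<epsilon> s) * (G (0, s) * d (0, s)) \<partial>lborel)"
proof -
  let ?n = "Suc CARD('n)"
  define H where "H y = G y * d y * heis_kernel lam \<epsilon> y" for y
  define J where "J = (\<integral>y. H y \<partial>lborel)"
  have d_eq: "d (0, s) = 1 / (1 + of_real \<delta> * (\<i> * of_real s))\<^sup>2" for s
    by (simp add: d_def)
  have d_cont: "continuous_on UNIV d"
    unfolding d_def using damping_bound(3)[OF \<delta> qform_nonneg[OF lam]] by (intro continuous_intros) auto
  have H_cont: "continuous_on UNIV H"
    unfolding H_def by (intro continuous_intros G_continuous d_cont continuous_on_heis_kernel lam \<epsilon>)
  have d_le: "norm (d y) \<le> 1" for y
    unfolding d_def by (rule damping_bound(2)[OF \<delta> qform_nonneg[OF lam]])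
  have H_meas [measurable]: "H \<in> borel_measurable borel" by (rule borel_measurable_continuous_onI[OF H_cont])
  have H_int: "integrable lborel H"
  proof (rule Bochner_Integration.integrable_bound[OF int])
    have "norm (H y) \<le> norm (G y * heis_kernel lam \<epsilon> y)" for y
      using mult_left_mono[OF d_le[of y], of "norm (G y * heis_kernel lam \<epsilon> y)"] by (simp add: H_def norm_mult mult_ac)
    then show "AE y in lborel. norm (H y) \<le> norm (G y * heis_kernel lam \<epsilon> y)" by simp
  qed simp
  \<comment> \<open>Rotations of the \<open>w\<close> component preserve Lebesgue measure and leave
    the integral \<open>J\<close> unchanged; averaging over \<open>\<theta>\<close> brings in the
    circle means.\<close>
  define T where "T \<theta> y = (cis \<theta> *s fst y, snd y)" for \<theta> and y :: "'n heis"
  have T_lin: "linear (T \<theta>)" for \<theta>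
    by (auto simp: T_def linear_iff vec_eq_iff algebra_simps)
  have T_norm: "norm (T \<theta> y) = norm y" for \<theta> y
    by (cases y) (simp add: T_def norm_prod_def norm_vec_def norm_mult)
  have T_distr: "distr lborel borel (T \<theta>) = lborel" for \<theta>
    by (rule lborel_distr_linear_isometry[OF T_lin T_norm])
  have T_meas: "T \<theta> \<in> measurable borel borel" for \<theta>
    using T_lin by (intro borel_measurable_continuous_onI linear_continuous_on) (simp add: linear_conv_bounded_linear)
  have HT: "(\<integral>y. H (T \<theta> y) \<partial>lborel) = J" "integrable lborel (\<lambda>y. H (T \<theta> y))" for \<theta>
    using distr_invariant_integral[OF T_distr T_meas sets_lborel H_meas] H_int by (auto simp: J_def)
  have nn_HT: "(\<integral>\<^sup>+y. ennreal (norm (H (T \<theta> y))) \<partial>lborel) = ennreal (\<integral>y. norm (H y) \<partial>lborel)" for \<theta>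
  proof -
    have "(\<integral>y. norm (H (T \<theta> y)) \<partial>lborel) = (\<integral>y. norm (H y) \<partial>lborel)"
      by (rule distr_invariant_integral(1)[OF T_distr T_meas sets_lborel]) measurable
    then show ?thesis using nn_integral_eq_integral[OF integrable_norm[OF HT(2)]] by simp
  qed
  define f where "f \<theta> y = indicator {0..2*pi} \<theta> *\<^sub>R H (T \<theta> y)" for \<theta> :: real and y
  have HT_meas: "(\<lambda>p. H (T (fst p) (snd p))) \<in> borel_measurable borel"
  proof (rule borel_measurable_continuous_onI)
    have cis: "cis \<theta> = of_real (cos \<theta>) + \<i> * of_real (sin \<theta>)" for \<theta> by (simp add: complex_eq_iff)
    have "continuous_on UNIV (\<lambda>p::real \<times> 'n heis. T (fst p) (snd p))"
      unfolding T_def vector_scalar_mult_def cis by (intro continuous_intros)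
    from continuous_on_compose2[OF H_cont this] show "continuous_on UNIV (\<lambda>p. H (T (fst p) (snd p)))" by simp
  qed
  have f_meas [measurable]: "(\<lambda>(\<theta>, y). f \<theta> y) \<in> borel_measurable (borel \<Otimes>\<^sub>M borel)"
  proof -
    have [measurable]: "(\<lambda>p. H (T (fst p) (snd p))) \<in> borel_measurable (borel \<Otimes>\<^sub>M borel)"
      using HT_meas by (simp add: borel_prod)
    show ?thesis unfolding f_def case_prod_unfold by measurable
  qed
  have f_int: "integrable (lborel \<Otimes>\<^sub>M lborel) (\<lambda>(\<theta>, y). f \<theta> y)"
  proof (rule integrableI_bounded)
    have "(\<integral>\<^sup>+p. ennreal (norm (case p of (\<theta>, y) \<Rightarrow> f \<theta> y)) \<partial>(lborel \<Otimes>\<^sub>M lborel)) = (\<integral>\<^sup>+\<theta>. \<integral>\<^sup>+y. ennreal (norm (f \<theta> y)) \<partial>lborel \<partial>lborel)"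
      by (subst lborel.nn_integral_fst[symmetric]) simp_all
    also have "\<dots> = (\<integral>\<^sup>+\<theta>. ennreal (\<integral>y. norm (H y) \<partial>lborel) * indicator {0..2*pi} \<theta> \<partial>lborel)"
      using nn_HT by (intro nn_integral_cong) (simp add: f_def split: split_indicator)
    also have "\<dots> < \<infinity>" by (simp add: nn_integral_cmult ennreal_mult_less_top)
    finally show "(\<integral>\<^sup>+p. ennreal (norm (case p of (\<theta>, y) \<Rightarrow> f \<theta> y)) \<partial>(lborel \<Otimes>\<^sub>M lborel)) < \<infinity>" .
  qed measurable
  have "of_real (2 * pi) * J = (\<integral>\<theta>. \<integral>y. f \<theta> y \<partial>lborel \<partial>lborel)"
    by (simp add: f_def HT scaleR_conv_of_real)
  also have "\<dots> = (\<integral>y. \<integral>\<theta>. f \<theta> y \<partial>lborel \<partial>lborel)"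
    by (rule lborel_pair.Fubini_integral[OF f_int, symmetric])
  also have "\<dots> = (\<integral>w. \<integral>s. \<integral>\<theta>. f \<theta> (w, s) \<partial>lborel \<partial>lborel \<partial>lborel)"
  proof -
    have "integrable (lborel \<Otimes>\<^sub>M lborel) (\<lambda>y. \<integral>\<theta>. f \<theta> y \<partial>lborel)"
      using lborel_pair.integrable_snd[OF f_int] by (simp add: lborel_prod)
    from lborel_pair.integral_fst'[OF this] show ?thesis by (simp add: lborel_prod)
  qed
  also have "\<dots> = (\<integral>w. of_real (2 * pi) * (\<integral>s. G (0, s) * d (0, s) * (1 / ((of_real \<epsilon> - \<i> * of_real s) + of_real (2 * qform lam w)) ^ ?n) \<partial>lborel) \<partial>lborel)"
  proof (rule Bochner_Integration.integral_cong[OF refl])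
    fix w
    have f_w_meas: "(\<lambda>x. f (fst x) (w, snd x)) \<in> borel_measurable (borel \<Otimes>\<^sub>M borel)"
    proof -
      have "(\<lambda>x::real \<times> real. (fst x, (w, snd x))) \<in> measurable (borel \<Otimes>\<^sub>M borel) (borel \<Otimes>\<^sub>M (borel :: 'n heis measure))"
        unfolding borel_prod by (intro borel_measurable_continuous_onI continuous_intros)
      from measurable_compose[OF this f_meas] show ?thesis by simp
    qed
    have "integrable (lborel \<Otimes>\<^sub>M lborel) (\<lambda>x. f (fst x) (w, snd x))"
    proof (rule Bochner_Integration.integrable_bound)
      show "integrable (lborel \<Otimes>\<^sub>M lborel) (\<lambda>x. indicator {0..2*pi} (fst x) * ((M / min 1 (\<delta>\<^sup>2) / \<epsilon> ^ ?n) * (1 / (1 + (snd x)\<^sup>2))) :: real)"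
        unfolding lborel_prod
        by (rule integrable_prod_mult[OF _ integrable_mult_right[OF integral_inverse_1_plus_square(1)]]) (simp add: integrable_indicator_iff)
      have "norm (H (T \<theta> (w, s))) \<le> (M / min 1 (\<delta>\<^sup>2) / \<epsilon> ^ ?n) * (1 / (1 + s\<^sup>2))" for \<theta> s
        using circle_mean_kernel(2)[OF \<delta> \<epsilon>, of "T \<theta> (w, s)"] by (simp add: H_def d_def T_def)
      then have "norm (f (fst x) (w, snd x)) \<le> indicator {0..2*pi} (fst x) * ((M / min 1 (\<delta>\<^sup>2) / \<epsilon> ^ ?n) * (1 / (1 + (snd x)\<^sup>2)))" for x
        by (simp add: f_def split: split_indicator)
      then show "AE x in lborel \<Otimes>\<^sub>M lborel. norm (f (fst x) (w, snd x)) \<le> norm (indicator {0..2*pi} (fst x) * ((M / min 1 (\<delta>\<^sup>2) / \<epsilon> ^ ?n) * (1 / (1 + (snd x)\<^sup>2))))"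
        unfolding real_norm_def by (intro AE_I2) (rule order_trans[OF _ abs_ge_self])
    qed (use f_w_meas in simp)
    then have "integrable (lborel \<Otimes>\<^sub>M lborel) (\<lambda>(\<theta>, s). f \<theta> (w, s))" by (simp add: case_prod_unfold)
    from lborel_pair.integral_snd[OF this]
    have "(\<integral>s. \<integral>\<theta>. f \<theta> (w, s) \<partial>lborel \<partial>lborel) = (\<integral>x. f (fst x) (w, snd x) \<partial>(lborel :: (real \<times> real) measure))"
      by (simp add: lborel_prod case_prod_unfold)
    also have "\<dots> = of_real (2 * pi) * (\<integral>s. G (0, s) * d (0, s) * (1 / ((of_real \<epsilon> - \<i> * of_real s) + of_real (2 * qform lam w)) ^ ?n) \<partial>lborel)"
      using circle_mean_kernel(1)[OF \<delta> \<epsilon>, of w] unfolding f_def T_def H_def d_eq by (simp add: d_def)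
    finally show "(\<integral>s. \<integral>\<theta>. f \<theta> (w, s) \<partial>lborel \<partial>lborel) = of_real (2 * pi) * (\<integral>s. G (0, s) * d (0, s) * (1 / ((of_real \<epsilon> - \<i> * of_real s) + of_real (2 * qform lam w)) ^ ?n) \<partial>lborel)" .
  qed
  finally have J1: "J = (\<integral>w. \<integral>s. G (0, s) * d (0, s) * (1 / ((of_real \<epsilon> - \<i> * of_real s) + of_real (2 * qform lam w)) ^ ?n) \<partial>lborel \<partial>lborel)"
    by simp
  \<comment> \<open>After the averaging, \<open>w\<close> occurs only in the inverse power; once the
    order of integration is exchanged, the integral over \<open>w\<close> is explicit.\<close>
  define g where "g w s = G (0, s) * d (0, s) * (1 / ((of_real \<epsilon> - \<i> * of_real s) + of_real (2 * qform lam w)) ^ ?n)" for w s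
  have a_ge: "\<epsilon> + qform lam w \<le> norm ((of_real \<epsilon> - \<i> * of_real s) + of_real (2 * qform lam w))" for w s
    using abs_Re_le_cmod[of "(of_real \<epsilon> - \<i> * of_real s) + of_real (2 * qform lam w)"] qform_nonneg[OF lam, of w] by simp
  have Gd_cont: "continuous_on UNIV (\<lambda>s. G (0, s) * d (0, s))"
    by (intro continuous_intros continuous_on_compose2[OF G_continuous[of UNIV]] continuous_on_compose2[OF d_cont]) auto
  have Gd_bd: "norm (G (0, s) * d (0, s)) \<le> (M / min 1 (\<delta>\<^sup>2)) * (1 / (1 + s\<^sup>2))" for s
    using mult_mono[OF bounded damping_bound(1)[OF \<delta> order_refl, of s] M_nonneg norm_ge_zero, of "(0, s)"]
    by (simp add: norm_mult norm_divide d_eq)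
  have g_int: "integrable (lborel \<Otimes>\<^sub>M lborel) (\<lambda>(w, s). g w s)"
  proof (rule Bochner_Integration.integrable_bound)
    show "integrable (lborel \<Otimes>\<^sub>M lborel) (\<lambda>x. (1 / (\<epsilon> + qform lam (fst x)) ^ ?n) * ((M / min 1 (\<delta>\<^sup>2)) * (1 / (1 + (snd x)\<^sup>2))))"
      unfolding lborel_prod
      by (rule integrable_prod_mult[OF integrable_inverse_power_qform[OF lam \<epsilon>] integrable_mult_right[OF integral_inverse_1_plus_square(1)]])
    have "continuous_on UNIV (\<lambda>x. g (fst x) (snd x))"
    proof -
      have "(of_real \<epsilon> - \<i> * of_real s) + of_real (2 * qform lam w) \<noteq> (0::complex)" for w s
        using a_ge[of w s] \<epsilon> qform_nonneg[OF lam, of w] by (metis add_pos_nonneg norm_zero not_le)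
      then show ?thesis unfolding g_def
        by (intro continuous_intros continuous_on_compose2[OF Gd_cont]) auto
    qed
    from borel_measurable_continuous_onI[OF this]
    show "(\<lambda>(w, s). g w s) \<in> borel_measurable (lborel \<Otimes>\<^sub>M lborel)"
      by (simp add: case_prod_unfold lborel_prod)
    have "norm (g w s) \<le> (1 / (\<epsilon> + qform lam w) ^ ?n) * ((M / min 1 (\<delta>\<^sup>2)) * (1 / (1 + s\<^sup>2)))" for w s
    proof -
      have "norm (1 / ((of_real \<epsilon> - \<i> * of_real s) + of_real (2 * qform lam w)) ^ ?n) \<le> 1 / (\<epsilon> + qform lam w) ^ ?n"
        unfolding norm_divide norm_one norm_power using a_ge[of w s] \<epsilon> qform_nonneg[OF lam, of w]
        by (intro frac_le power_mono) auto
      from mult_mono[OF this Gd_bd[of s]] show ?thesis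
        using \<epsilon> qform_nonneg[OF lam, of w] unfolding g_def by (simp only: norm_mult) (simp add: mult_ac)
    qed
    then show "AE x in lborel \<Otimes>\<^sub>M lborel. norm (case x of (w, s) \<Rightarrow> g w s) \<le> norm ((1 / (\<epsilon> + qform lam (fst x)) ^ ?n) * ((M / min 1 (\<delta>\<^sup>2)) * (1 / (1 + (snd x)\<^sup>2))))"
      unfolding case_prod_unfold real_norm_def by (intro AE_I2) (rule order_trans[OF _ abs_ge_self])
  qed
  have "J = (\<integral>s. \<integral>w. g w s \<partial>lborel \<partial>lborel)"
    using lborel_pair.Fubini_integral[OF g_int] J1 by (simp add: g_def)
  also have "\<dots> = (\<integral>s. of_real C * (G (0, s) * d (0, s) * (1 / (of_real \<epsilon> - \<i> * of_real s))) \<partial>lborel)"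
  proof (rule Bochner_Integration.integral_cong[OF refl])
    fix s
    show "(\<integral>w. g w s \<partial>lborel) = of_real C * (G (0, s) * d (0, s) * (1 / (of_real \<epsilon> - \<i> * of_real s)))"
      unfolding g_def integral_mult_right_zero C_def
      using integral_inverse_power_qform(2)[OF lam, of "of_real \<epsilon> - \<i> * of_real s"] \<epsilon>
      by (simp del: of_real_mult of_real_divide of_real_power of_real_prod power_Suc)
  qed
  also have "\<dots> = of_real C * (\<integral>s. G (0, s) * d (0, s) * (1 / (of_real \<epsilon> - \<i> * of_real s)) \<partial>lborel)"
    by (rule integral_mult_right_zero)
  \<comment> \<open>Adding the integral that vanishes by \<open>negative_part\<close> completes
    \<open>1 / (\<epsilon> - i s)\<close> to a multiple of the Poisson kernel.\<close>
  also have "\<dots> = of_real C * ((\<integral>s. G (0, s) * d (0, s) * (1 / (of_real \<epsilon> - \<i> * of_real s)) \<partial>lborel)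
      + (\<integral>s. G (0, s) * d (0, s) * (1 / (of_real \<epsilon> + \<i> * of_real s)) \<partial>lborel))"
    using negative_part[OF \<delta> \<epsilon>] by (simp add: d_eq mult.assoc)
  also have "\<dots> = of_real C * (\<integral>s. G (0, s) * d (0, s) * (1 / (of_real \<epsilon> - \<i> * of_real s)) + G (0, s) * d (0, s) * (1 / (of_real \<epsilon> + \<i> * of_real s)) \<partial>lborel)"
  proof -
    have i: "integrable lborel (\<lambda>s. G (0, s) * d (0, s) * (1 / a s))"
      if "continuous_on UNIV a" "\<And>s. \<epsilon> \<le> norm (a s)" for a :: "real \<Rightarrow> complex"
    proof (rule Bochner_Integration.integrable_bound)
      show "integrable lborel (\<lambda>s. (M / min 1 (\<delta>\<^sup>2) * (1 / \<epsilon>)) * (1 / (1 + s\<^sup>2)))"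
        by (rule integrable_mult_right[OF integral_inverse_1_plus_square(1)])
      have "a s \<noteq> 0" for s using that(2)[of s] \<epsilon> by auto
      then show "(\<lambda>s. G (0, s) * d (0, s) * (1 / a s)) \<in> borel_measurable lborel"
        using borel_measurable_continuous_onI[OF continuous_on_mult[OF Gd_cont continuous_on_divide[OF continuous_on_const that(1)]], of 1] by simp
      have "norm (G (0, s) * d (0, s) * (1 / a s)) \<le> (M / min 1 (\<delta>\<^sup>2) * (1 / \<epsilon>)) * (1 / (1 + s\<^sup>2))" for s
      proof -
        have "norm (1 / a s) \<le> 1 / \<epsilon>" unfolding norm_divide norm_one using that(2)[of s] \<epsilon> by (intro frac_le) auto
        from mult_mono[OF Gd_bd[of s] this] show ?thesis
          using order_trans[OF norm_ge_zero Gd_bd[of s]] by (simp only: norm_mult) (simp add: mult_ac)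
      qed
      then show "AE s in lborel. norm (G (0, s) * d (0, s) * (1 / a s)) \<le> norm ((M / min 1 (\<delta>\<^sup>2) * (1 / \<epsilon>)) * (1 / (1 + s\<^sup>2)))"
        unfolding real_norm_def by (intro AE_I2) (rule order_trans[OF _ abs_ge_self])
    qed
    have e: "\<epsilon> \<le> norm (of_real \<epsilon> - \<i> * of_real s)" "\<epsilon> \<le> norm (of_real \<epsilon> + \<i> * of_real s)" for s
      using abs_Re_le_cmod[of "of_real \<epsilon> - \<i> * of_real s"] abs_Re_le_cmod[of "of_real \<epsilon> + \<i> * of_real s"] by auto
    have c: "continuous_on UNIV (\<lambda>s. of_real \<epsilon> - \<i> * of_real s :: complex)" "continuous_on UNIV (\<lambda>s. of_real \<epsilon> + \<i> * of_real s :: complex)"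
      by (intro continuous_intros)+
    show ?thesis
      by (simp only: Bochner_Integration.integral_add[OF i[OF c(1) e(1)] i[OF c(2) e(2)]])
  qed
  also have "\<dots> = of_real C * (\<integral>s. of_real (2 * pi) * (of_real (Poisson_kernel \<epsilon> s) * (G (0, s) * d (0, s))) \<partial>lborel)"
  proof -
    have "G (0, s) * d (0, s) * (1 / (of_real \<epsilon> - \<i> * of_real s)) + G (0, s) * d (0, s) * (1 / (of_real \<epsilon> + \<i> * of_real s))
        = of_real (2 * pi) * (of_real (Poisson_kernel \<epsilon> s) * (G (0, s) * d (0, s)))" for s
    proof -
      have 1: "(of_real \<epsilon> - \<i> * of_real s) * (of_real \<epsilon> + \<i> * of_real s) = (of_real (\<epsilon>\<^sup>2 + s\<^sup>2) :: complex)"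
        by (simp add: algebra_simps power2_eq_square)
      have nz: "of_real (\<epsilon>\<^sup>2 + s\<^sup>2) \<noteq> (0::complex)"
        using \<epsilon> unfolding of_real_eq_0_iff by (metis add_pos_nonneg less_irrefl zero_le_power2 zero_less_power)
      then have nz': "of_real \<epsilon> - \<i> * of_real s \<noteq> (0::complex)" "of_real \<epsilon> + \<i> * of_real s \<noteq> (0::complex)"
        unfolding 1[symmetric] by auto
      have "1 / (of_real \<epsilon> - \<i> * of_real s) + 1 / (of_real \<epsilon> + \<i> * of_real s) = (2 * of_real \<epsilon>) / (of_real (\<epsilon>\<^sup>2 + s\<^sup>2) :: complex)"
        using nz' unfolding 1[symmetric] by (subst add_frac_eq) simp_all
      also have "\<dots> = of_real (2 * pi) * of_real (Poisson_kernel \<epsilon> s)"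
        by (simp add: Poisson_kernel_def)
      finally show ?thesis by (metis (no_types, lifting) distrib_left mult.assoc mult.commute)
    qed
    then show ?thesis by simp
  qed
  also have "\<dots> = of_real (2 * pi * C) * (\<integral>s. of_real (Poisson_kernel \<epsilon> s) * (G (0, s) * d (0, s)) \<partial>lborel)"
    by simp
  finally show ?thesis by (simp only: J_def H_def)
qed

text \<open>The kernel decays at the borderline rate and is not integrable, so boundedness of
  \<open>G\<close> does not suffice here. The assumed integrability of the product provides the
  dominating function as \<open>\<delta> = 1 / (k + 1)\<close> tends to 0.\<close>

lemma Poisson_formula:
  assumes \<epsilon>: "\<epsilon> > 0" and int: "integrable lborel (\<lambda>y. G y * heis_kernel lam \<epsilon> y)"
  shows "(\<integral>y. G y * heis_kernel lam \<epsilon> y \<partial>lborel) =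
    of_real (2 * pi * (pi ^ CARD('n) / (2 ^ CARD('n) * fact CARD('n) * (\<Prod>j\<in>UNIV. lam $ j)))) * (\<integral>s. of_real (Poisson_kernel \<epsilon> s) * G (0, s) \<partial>lborel)"
proof -
  define d where "d k y = 1 / (1 + of_real (inverse (real (Suc k))) * (of_real (qform lam (fst y)) + \<i> * of_real (snd y)))\<^sup>2"
    for k and y :: "'n heis"
  have pos: "inverse (real (Suc k)) > 0" for k by simp
  note db = damping_bound[OF pos qform_nonneg[OF lam]]
  have d_cont: "continuous_on UNIV (d k)" for k
    unfolding d_def using db(3) by (intro continuous_intros) auto
  have d_meas [measurable]: "d k \<in> borel_measurable borel" for k by (rule borel_measurable_continuous_onI[OF d_cont])
  have d0_meas [measurable]: "(\<lambda>s. d k (0, s)) \<in> borel_measurable borel" for k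
    by (rule borel_measurable_continuous_onI) (auto intro!: continuous_on_compose2[OF d_cont] continuous_intros)
  note [measurable] = borel_measurable_heis_kernel[OF lam \<epsilon>]
  have d_le: "norm (d k y) \<le> 1" for k y unfolding d_def by (rule db(2))
  have d_lim: "(\<lambda>k. d k y) \<longlonglongrightarrow> 1" for y
  proof -
    have "(\<lambda>k. 1 / (1 + complex_of_real (inverse (real (Suc k))) * (of_real (qform lam (fst y)) + \<i> * of_real (snd y)))\<^sup>2)
        \<longlonglongrightarrow> 1 / (1 + complex_of_real 0 * (of_real (qform lam (fst y)) + \<i> * of_real (snd y)))\<^sup>2"
      by (intro tendsto_intros LIMSEQ_inverse_real_of_nat) auto
    then show ?thesis by (simp add: d_def)
  qed
  have "(\<lambda>k. \<integral>y. G y * d k y * heis_kernel lam \<epsilon> y \<partial>lborel) \<longlonglongrightarrow> (\<integral>y. G y * heis_kernel lam \<epsilon> y \<partial>lborel)"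
  proof (rule integral_dominated_convergence[OF _ _ integrable_norm[OF int]])
    show "AE y in lborel. (\<lambda>k. G y * d k y * heis_kernel lam \<epsilon> y) \<longlonglongrightarrow> G y * heis_kernel lam \<epsilon> y"
      using tendsto_mult[OF tendsto_mult[OF tendsto_const d_lim] tendsto_const] by (intro AE_I2) fastforce
    show "AE y in lborel. norm (G y * d k y * heis_kernel lam \<epsilon> y) \<le> norm (G y * heis_kernel lam \<epsilon> y)" for k
      using mult_left_mono[OF d_le, of "norm (G _ * heis_kernel lam \<epsilon> _)"] by (intro AE_I2) (simp add: norm_mult mult_ac)
  qed measurable
  moreover have "(\<lambda>k. \<integral>s. of_real (Poisson_kernel \<epsilon> s) * (G (0, s) * d k (0, s)) \<partial>lborel) \<longlonglongrightarrow> (\<integral>s. of_real (Poisson_kernel \<epsilon> s) * G (0, s) \<partial>lborel)"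
  proof (rule integral_dominated_convergence)
    show "integrable lborel (\<lambda>s. M * Poisson_kernel \<epsilon> s)" using Poisson_kernel_integral(1)[OF \<epsilon>] by simp
    show "AE s in lborel. (\<lambda>k. of_real (Poisson_kernel \<epsilon> s) * (G (0, s) * d k (0, s))) \<longlonglongrightarrow> of_real (Poisson_kernel \<epsilon> s) * G (0, s)"
      using tendsto_mult[OF tendsto_const tendsto_mult[OF tendsto_const d_lim]] by (intro AE_I2) fastforce
    have P0: "0 \<le> Poisson_kernel \<epsilon> s" for s using \<epsilon> by (simp add: Poisson_kernel_def)
    have "norm (G (0, s) * d k (0, s)) \<le> M" for k s
      using mult_mono[OF bounded[of "(0, s)"] d_le[of k "(0, s)"] M_nonneg norm_ge_zero] by (simp add: norm_mult)
    then show "AE s in lborel. norm (of_real (Poisson_kernel \<epsilon> s) * (G (0, s) * d k (0, s))) \<le> M * Poisson_kernel \<epsilon> s" for k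
      using P0 by (intro AE_I2) (simp add: norm_mult mult.commute[of M] mult_left_mono)
  qed measurable
  then have "(\<lambda>k. of_real (2 * pi * (pi ^ CARD('n) / (2 ^ CARD('n) * fact CARD('n) * (\<Prod>j\<in>UNIV. lam $ j)))) *
      (\<integral>s. of_real (Poisson_kernel \<epsilon> s) * (G (0, s) * d k (0, s)) \<partial>lborel))
    \<longlonglongrightarrow> of_real (2 * pi * (pi ^ CARD('n) / (2 ^ CARD('n) * fact CARD('n) * (\<Prod>j\<in>UNIV. lam $ j)))) * (\<integral>s. of_real (Poisson_kernel \<epsilon> s) * G (0, s) \<partial>lborel)"
    by (rule tendsto_mult[OF tendsto_const])
  ultimately show ?thesis
    using Poisson_formula_damped[OF pos \<epsilon> int] unfolding d_def by (intro LIMSEQ_unique) simp_all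
qed

end

subsection \<open>Pairing a CR function with translates of a test function\<close>

lemma heis_form_bound: "\<bar>heis_form lam z w\<bar> \<le> (2 * (\<Sum>j\<in>UNIV. \<bar>lam $ j\<bar>)) * norm z * norm w"
proof -
  have "\<bar>\<Sum>j\<in>UNIV. lam $ j * Im (cnj (z $ j) * (w $ j))\<bar> \<le> (\<Sum>j\<in>UNIV. \<bar>lam $ j\<bar> * (norm z * norm w))"
  proof (rule order_trans[OF sum_abs sum_mono])
    fix j
    have "\<bar>Im (cnj (z $ j) * (w $ j))\<bar> \<le> norm (z $ j) * norm (w $ j)"
      using abs_Im_le_cmod[of "cnj (z $ j) * (w $ j)"] by (simp add: norm_mult)
    also have "\<dots> \<le> norm z * norm w" by (intro mult_mono Finite_Cartesian_Product.norm_nth_le) auto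
    finally show "\<bar>lam $ j * Im (cnj (z $ j) * (w $ j))\<bar> \<le> \<bar>lam $ j\<bar> * (norm z * norm w)"
      unfolding abs_mult by (rule mult_left_mono) simp
  qed
  then show ?thesis by (simp add: heis_form_def abs_mult sum_distrib_right mult.assoc)
qed

lemma norm_fst_snd_le: "norm (fst x) \<le> norm x" "norm (snd x) \<le> norm x"
  for x :: "'a::real_normed_vector \<times> 'b::real_normed_vector"
  by (metis norm_fst_le prod.collapse) (metis norm_snd_le prod.collapse)

lemma heis_mult_norm_le:
  fixes x y :: "'n::finite heis"
  assumes "norm x \<le> a" "norm y \<le> b"
  shows "norm (heis_mult lam x y) \<le> a + b + (2 * (\<Sum>j\<in>UNIV. \<bar>lam $ j\<bar>)) * a * b"
proof -
  let ?L = "2 * (\<Sum>j\<in>UNIV. \<bar>lam $ j\<bar>)"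
  have L: "?L \<ge> 0" by (intro mult_nonneg_nonneg sum_nonneg) auto
  have ab: "0 \<le> a" "0 \<le> b" using assms norm_ge_zero order_trans by blast+
  have "heis_mult lam x y = (x + y) + (0, heis_form lam (fst x) (fst y))"
    by (simp add: heis_mult_def prod_eq_iff)
  then have "norm (heis_mult lam x y) \<le> norm x + norm y + \<bar>heis_form lam (fst x) (fst y)\<bar>"
    using norm_triangle_ineq[of "x + y" "(0, heis_form lam (fst x) (fst y))"] norm_triangle_ineq[of x y] by simp
  also have "\<bar>heis_form lam (fst x) (fst y)\<bar> \<le> ?L * norm (fst x) * norm (fst y)" by (rule heis_form_bound)
  also have "\<dots> \<le> ?L * a * b"
    using L ab order_trans[OF norm_fst_snd_le(1) assms(1)] order_trans[OF norm_fst_snd_le(1) assms(2)] by (intro mult_mono) auto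
  finally show ?thesis using assms by linarith
qed

text \<open>For fixed \<open>x\<close> the map \<open>y\<close> to
  \<open>heis_mult lam x (- y)\<close> is affine, since the form is bilinear; the direction in which
  \<open>u\<close> is differentiated depends on \<open>x\<close> only through
  \<open>heis_form lam (fst x) (fst h)\<close>.\<close>

lemma translate_derivative_left:
  fixes u :: "'n::finite heis \<Rightarrow> complex"
  assumes "test_fun u"
  shows "((\<lambda>y. u (heis_mult lam x (- y))) has_derivative
      (\<lambda>h. frechet_derivative u (at (heis_mult lam x (- y))) (- fst h, - snd h - heis_form lam (fst x) (fst h)))) (at y)"
proof -
  have "bounded_linear (\<lambda>h::'n heis. (- fst h, - snd h - heis_form lam (fst x) (fst h)))"
    by (intro linear_conv_bounded_linear[THEN iffD1])
       (auto simp: linear_iff heis_form_add heis_form_scaleR algebra_simps)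
  from has_derivative_add[OF bounded_linear_imp_has_derivative[OF this] has_derivative_const[of x]]
  have "((\<lambda>y. heis_mult lam x (- y)) has_derivative (\<lambda>h. (- fst h, - snd h - heis_form lam (fst x) (fst h)))) (at y)"
    by (simp add: heis_mult_def plus_prod_def algebra_simps)
  from has_derivative_compose[OF this test_fun_has_derivative[OF assms]] show ?thesis .
qed

lemma translate_test_fun:
  fixes u :: "'n::finite heis \<Rightarrow> complex"
  assumes u: "test_fun u"
  shows "test_fun (\<lambda>x. u (heis_mult lam x y))"
    and "((\<lambda>x. u (heis_mult lam x y)) has_derivative
      (\<lambda>h. frechet_derivative u (at (heis_mult lam x y)) (fst h, snd h + heis_form lam (fst h) (fst y)))) (at x)"
proof -
  have L: "bounded_linear (\<lambda>h::'n heis. (fst h, snd h + heis_form lam (fst h) (fst y)))"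
    by (intro linear_conv_bounded_linear[THEN iffD1])
       (auto simp: linear_iff heis_form_add heis_form_scaleR algebra_simps)
  have eq: "heis_mult lam x y = (fst x, snd x + heis_form lam (fst x) (fst y)) + y" for x
    by (simp add: heis_mult_def plus_prod_def algebra_simps)
  obtain R where R: "R > 0" "\<And>x. norm x > R \<Longrightarrow> u x = 0" using test_fun_support[OF u] by blast
  show "test_fun (\<lambda>x. u (heis_mult lam x y))"
  proof (rule test_funI)
    show "Ck k (\<lambda>x. u (heis_mult lam x y))" for k
      unfolding eq by (rule Ck_compose_affine[OF L test_fun_Ck[OF u]])
    fix x assume "u (heis_mult lam x y) \<noteq> 0"
    then have "norm (heis_mult lam x y) \<le> R" using R(2) by (meson not_le)
    from heis_mult_norm_le[OF this order_refl[of "norm (- y)"], of lam]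
    show "norm x \<le> R + norm y + (2 * (\<Sum>j\<in>UNIV. \<bar>lam $ j\<bar>)) * R * norm y" by simp
  qed
  have "((\<lambda>x. heis_mult lam x y) has_derivative (\<lambda>h. (fst h, snd h + heis_form lam (fst h) (fst y)))) (at x)"
    unfolding eq using has_derivative_add[OF bounded_linear_imp_has_derivative[OF L] has_derivative_const[of y]] by simp
  from has_derivative_compose[OF this test_fun_has_derivative[OF u]]
  show "((\<lambda>x. u (heis_mult lam x y)) has_derivative
      (\<lambda>h. frechet_derivative u (at (heis_mult lam x y)) (fst h, snd h + heis_form lam (fst h) (fst y)))) (at x)" .
qed

text \<open>Without conjugation, so that the CR property of \<open>g\<close> passes to the result;
  for inner products \<open>u\<close> is replaced by its conjugate.\<close>

definition CR_pairing :: "(real ^ 'n::finite) \<Rightarrow> ('n heis \<Rightarrow> complex) \<Rightarrow> ('n heis \<Rightarrow> complex) \<Rightarrow> 'n heis \<Rightarrow> complex" where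
  "CR_pairing lam u g y = (\<integral>x. u x * g (heis_mult lam x y) \<partial>heis_vol)"

text \<open>The element \<open>g\<close> is only square integrable. Invariance of the measure moves
  the dependence on \<open>y\<close> to the smooth function \<open>u\<close>.\<close>

lemma CR_pairing_eq:
  assumes "u \<in> borel_measurable borel" "g \<in> borel_measurable borel"
  shows "CR_pairing lam u g y = (\<integral>x. u (heis_mult lam x (- y)) * g x \<partial>heis_vol)"
proof -
  have "(\<lambda>x. u (heis_mult lam x (- y)) * g x) \<in> borel_measurable borel"
    by (intro borel_measurable_times measurable_compose[OF measurable_heis_mult(2)] assms)
  from heis_integral_right(1)[OF this, of lam y] show ?thesis by (simp add: CR_pairing_def)
qed

text \<open>Both sides are twice the conjugate-linear part of \<open>D\<close> at
  \<open>w\<close>.\<close>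

lemma sum_real_linear_Zbar:
  fixes D :: "complex ^ 'n::finite \<Rightarrow> complex"
  assumes "bounded_linear D"
  shows "(\<Sum>j\<in>UNIV. cnj (w $ j) * (D (axis j 1) + \<i> * D (axis j \<i>))) = D w + \<i> * D (\<i> *s w)"
proof -
  interpret bounded_linear D by fact
  have expand: "D v = (\<Sum>j\<in>UNIV. of_real (Re (v $ j)) * D (axis j 1) + of_real (Im (v $ j)) * D (axis j \<i>))" for v
  proof -
    have "v = (\<Sum>j\<in>UNIV. Re (v $ j) *\<^sub>R axis j 1 + Im (v $ j) *\<^sub>R axis j \<i>)"
      by (simp add: vec_eq_iff axis_def complex_eq_iff if_distrib cong: if_cong)
    then have "D v = D (\<Sum>j\<in>UNIV. Re (v $ j) *\<^sub>R axis j 1 + Im (v $ j) *\<^sub>R axis j \<i>)" by simp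
    also have "\<dots> = (\<Sum>j\<in>UNIV. Re (v $ j) *\<^sub>R D (axis j 1) + Im (v $ j) *\<^sub>R D (axis j \<i>))"
      by (simp only: sum add scaleR)
    finally show ?thesis by (simp add: scaleR_conv_of_real)
  qed
  have "cnj (w $ j) * (D (axis j 1) + \<i> * D (axis j \<i>)) =
      (of_real (Re (w $ j)) * D (axis j 1) + of_real (Im (w $ j)) * D (axis j \<i>))
      + \<i> * (of_real (Re ((\<i> *s w) $ j)) * D (axis j 1) + of_real (Im ((\<i> *s w) $ j)) * D (axis j \<i>))" for j
  proof -
    have cnj: "cnj (w $ j) = of_real (Re (w $ j)) - \<i> * of_real (Im (w $ j))" by (simp add: complex_eq_iff)
    show ?thesis unfolding cnj by (simp add: algebra_simps)
  qed
  then show ?thesis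
    by (simp only: expand[of w] expand[of "\<i> *s w"] sum.distrib sum_distrib_left distrib_left)
qed

text \<open>Differentiation under the integral falls on \<open>u\<close>. The derivatives in
  \<open>y\<close> of the translate \<open>u(x y^-1)\<close> that make up the CR equation at
  \<open>y\<close> combine into \<open>Zbar\<close> derivatives in \<open>x\<close> of the same
  translate, and these integrate to 0 against \<open>g\<close>.\<close>

lemma classical_CR_pairing:
  fixes lam :: "real ^ 'n::finite"
  assumes lam: "\<And>j. lam $ j > 0" and u: "test_fun u" and g: "g \<in> weakly_CR lam"
  shows "classical_CR lam (CR_pairing lam u g)
    (\<lambda>y h. \<integral>x. frechet_derivative u (at (heis_mult lam x (- y))) (- fst h, - snd h - heis_form lam (fst x) (fst h)) * g x \<partial>heis_vol)
    (L2_norm u * L2_norm g)"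
proof -
  note gL2 = weakly_CR_L2[OF g] and uL2 = test_fun_L2[OF u]
  note [measurable] = gL2 u
  define u' where "u' p = frechet_derivative u (at p)" for p
  have u'_lin: "bounded_linear (u' p)" for p
    using has_derivative_bounded_linear[OF test_fun_has_derivative[OF u]] by (simp add: u'_def)
  have u'_cont: "continuous_on A (\<lambda>p. u' p v)" for A v
    unfolding u'_def by (rule test_fun_continuous[OF test_fun_derivative[OF u]])
  obtain R where R: "R > 0" "\<And>x. norm x > R \<Longrightarrow> u x = 0" using test_fun_support[OF u] by blast
  have R': "u' p v = 0" if "norm p > R" for p v
    unfolding u'_def by (rule frechet_derivative_outside_support[OF R(2) that])
  obtain B where B: "B > 0" "\<And>p v. norm (u' p v) \<le> B * norm v"
    using test_fun_derivative_bound[OF u] unfolding u'_def by blast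
  obtain Bl where Bl: "Bl > 0" "\<And>x y. norm (u x - u y) \<le> Bl * norm (x - y)"
    using test_fun_Lipschitz[OF u] by blast
  let ?L = "2 * (\<Sum>j\<in>UNIV. \<bar>lam $ j\<bar>)"
  have L0: "?L \<ge> 0" by (intro mult_nonneg_nonneg sum_nonneg) auto
  \<comment> \<open>For \<open>norm y \<le> Y\<close> the functions \<open>u(x y^-1)\<close> of
    \<open>x\<close> are all supported in the ball of radius \<open>\<rho> Y\<close>.\<close>
  define \<rho> where "\<rho> Y = R + Y + ?L * R * Y" for Y
  have supp: "norm (heis_mult lam x (- y)) > R" if "norm x > \<rho> Y" "norm y \<le> Y" for x y :: "'n heis" and Y
  proof (rule ccontr)
    assume "\<not> norm (heis_mult lam x (- y)) > R"
    then have "norm (heis_mult lam x (- y)) \<le> R" by simp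
    from heis_mult_norm_le[OF this that(2), of lam] that(1) show False by (simp add: \<rho>_def)
  qed
  have dir: "norm (- fst h, - snd h - heis_form lam (fst x) (fst h)) \<le> (2 + ?L * \<rho> Y) * norm h"
    if "norm x \<le> \<rho> Y" for x h :: "'n heis" and Y
  proof -
    have "norm (- fst h, - snd h - heis_form lam (fst x) (fst h)) \<le> norm (fst h) + \<bar>- snd h - heis_form lam (fst x) (fst h)\<bar>"
      using norm_Pair_le[of "- fst h"] by (metis norm_minus_cancel real_norm_def)
    also have "\<dots> \<le> norm (fst h) + (norm (snd h) + \<bar>heis_form lam (fst x) (fst h)\<bar>)"
      by (intro add_left_mono) (rule order_trans[OF abs_triangle_ineq4], simp)
    also have "\<bar>heis_form lam (fst x) (fst h)\<bar> \<le> ?L * norm (fst x) * norm (fst h)" by (rule heis_form_bound)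
    also have "\<dots> \<le> ?L * \<rho> Y * norm h"
      using L0 order_trans[OF norm_fst_snd_le(1) that] norm_fst_snd_le(1)[of h] order_trans[OF norm_ge_zero that]
      by (intro mult_mono) auto
    finally show ?thesis using norm_fst_snd_le[of h] by (simp add: algebra_simps)
  qed
  \<comment> \<open>The dominating functions: on a ball the square integrable \<open>g\<close> is
    integrable.\<close>
  define w where "w Y C x = C * (indicator (cball 0 (\<rho> Y)) x * norm (g x))" for Y C :: real and x
  have w_int: "integrable heis_vol (w Y C)" for Y C
  proof -
    have ind: "(indicator (cball 0 (\<rho> Y)) :: 'n heis \<Rightarrow> complex) \<in> L2"
      by (rule indicator_L2) auto
    have norm_ind: "norm (indicator A x :: complex) = indicator A x" for A and x :: "'n heis"
      by (auto split: split_indicator)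
    from integrable_norm[OF L2_mult_integrable[OF ind gL2]]
    have "integrable heis_vol (\<lambda>x. indicator (cball 0 (\<rho> Y)) x * norm (g x))"
      by (simp only: norm_mult norm_ind)
    then show ?thesis unfolding w_def by simp
  qed
  have int: "integrable heis_vol (\<lambda>x. u (heis_mult lam x (- y)) * g x)" for y
    by (rule L2_mult_integrable[OF test_fun_L2[OF translate_test_fun(1)[OF u]] gL2])
  have G_eq: "CR_pairing lam u g = (\<lambda>y. \<integral>x. u (heis_mult lam x (- y)) * g x \<partial>heis_vol)"
    by (rule ext, rule CR_pairing_eq) measurable
  define G' where "G' y h = (\<integral>x. u' (heis_mult lam x (- y)) (- fst h, - snd h - heis_form lam (fst x) (fst h)) * g x \<partial>heis_vol)"
    for y h
  have deriv: "integrable heis_vol (\<lambda>x. u' (heis_mult lam x (- y0)) (- fst h, - snd h - heis_form lam (fst x) (fst h)) * g x)"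
    "(CR_pairing lam u g has_derivative G' y0) (at y0)" for y0 h
  proof -
    let ?w = "w (norm y0 + 1) (Bl * (2 + ?L * \<rho> (norm y0 + 1)))"
    have d: "((\<lambda>y. u (heis_mult lam x (- y)) * g x) has_derivative
        (\<lambda>h. u' (heis_mult lam x (- y0)) (- fst h, - snd h - heis_form lam (fst x) (fst h)) * g x)) (at y0)" for x
      unfolding u'_def by (rule has_derivative_mult_left[OF translate_derivative_left[OF u]])
    have bd: "norm (u (heis_mult lam x (- y)) * g x - u (heis_mult lam x (- y0)) * g x) \<le> ?w x * norm (y - y0)"
      if "norm (y - y0) < 1" for y x
    proof (cases "norm x \<le> \<rho> (norm y0 + 1)")
      case True
      have eq: "heis_mult lam x (- y) - heis_mult lam x (- y0) = (- fst (y - y0), - snd (y - y0) - heis_form lam (fst x) (fst (y - y0)))"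
        using heis_form_add(2)[of lam "fst x" "fst y" "- fst y0"] by (simp add: heis_mult_def prod_eq_iff)
      have "norm (u (heis_mult lam x (- y)) - u (heis_mult lam x (- y0))) \<le> Bl * ((2 + ?L * \<rho> (norm y0 + 1)) * norm (y - y0))"
        by (rule order_trans[OF Bl(2)], unfold eq) (rule mult_left_mono[OF dir[OF True] less_imp_le[OF Bl(1)]])
      then have "norm (u (heis_mult lam x (- y)) - u (heis_mult lam x (- y0))) * norm (g x) \<le> Bl * ((2 + ?L * \<rho> (norm y0 + 1)) * norm (y - y0)) * norm (g x)"
        by (rule mult_right_mono) simp
      then have "norm ((u (heis_mult lam x (- y)) - u (heis_mult lam x (- y0))) * g x) \<le> ?w x * norm (y - y0)"
        using True by (simp add: w_def norm_mult mult_ac)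
      then show ?thesis by (simp only: left_diff_distrib)
    next
      case False
      have "norm y \<le> norm y0 + 1" using that norm_triangle_sub[of y y0] by simp
      then have "u (heis_mult lam x (- y)) = 0" using False by (intro R(2) supp[of "norm y0 + 1"]) auto
      moreover have "u (heis_mult lam x (- y0)) = 0" using False by (intro R(2) supp[of "norm y0 + 1"]) auto
      ultimately show ?thesis using False by (simp add: w_def)
    qed
    note * = has_derivative_integral_dominated[of "\<lambda>y x. u (heis_mult lam x (- y)) * g x", OF d zero_less_one int bd w_int]
    show "integrable heis_vol (\<lambda>x. u' (heis_mult lam x (- y0)) (- fst h, - snd h - heis_form lam (fst x) (fst h)) * g x)"
      by (rule *(1))
    show "(CR_pairing lam u g has_derivative G' y0) (at y0)"
      unfolding G_eq G'_def[abs_def] by (rule *(2))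
  qed
  have "classical_CR lam (CR_pairing lam u g) G' (L2_norm u * L2_norm g)"
  proof
    show "(CR_pairing lam u g has_derivative G' y) (at y)" for y by (rule deriv(2))
    show "norm (CR_pairing lam u g y) \<le> L2_norm u * L2_norm g" for y
    proof -
      have "norm (\<integral>x. u x * g (heis_mult lam x y) \<partial>heis_vol) \<le> L2_norm u * L2_norm (\<lambda>x. g (heis_mult lam x y))"
        by (rule L2_Cauchy_Schwarz_mult[OF uL2 L2_compose(1)[OF lborel_distr_heis_mult_right measurable_heis_mult(2) gL2]])
      then show ?thesis
        unfolding CR_pairing_def L2_compose(2)[OF lborel_distr_heis_mult_right measurable_heis_mult(2) gL2] .
    qed
    show "continuous_on UNIV (\<lambda>y. G' y h)" for h
    proof (rule continuous_on_sequentiallyI)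
      fix Y :: "nat \<Rightarrow> 'n heis" and y assume Y: "Y \<longlonglongrightarrow> y"
      then have "bounded (range Y)" by (rule convergent_imp_bounded)
      then obtain K where K: "\<And>k. norm (Y k) \<le> K" unfolding bounded_iff by auto
      show "(\<lambda>k. G' (Y k) h) \<longlonglongrightarrow> G' y h" unfolding G'_def
      proof (rule integral_dominated_convergence[OF _ _ w_int])
        have eq: "u' p (- fst h, - snd h - heis_form lam (fst x) (fst h)) = u' p (- h) - of_real (heis_form lam (fst x) (fst h)) * u' p (0, 1)" for p x
        proof -
          have "(- fst h, - snd h - heis_form lam (fst x) (fst h)) = - h - heis_form lam (fst x) (fst h) *\<^sub>R (0, 1)"
            by (simp add: prod_eq_iff)
          then show ?thesis by (simp only: linear_simps[OF u'_lin]) (simp add: scaleR_conv_of_real)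
        qed
        show "AE x in heis_vol. (\<lambda>k. u' (heis_mult lam x (- Y k)) (- fst h, - snd h - heis_form lam (fst x) (fst h)) * g x)
            \<longlonglongrightarrow> u' (heis_mult lam x (- y)) (- fst h, - snd h - heis_form lam (fst x) (fst h)) * g x"
        proof (intro AE_I2 tendsto_mult tendsto_const)
          fix x
          have "(\<lambda>k. heis_mult lam x (- Y k)) \<longlonglongrightarrow> heis_mult lam x (- y)"
            using continuous_on_tendsto_compose[OF continuous_on_heis_mult[OF continuous_on_const continuous_on_minus[OF continuous_on_id]] Y, of UNIV] by simp
          then have "(\<lambda>k. u' (heis_mult lam x (- Y k)) v) \<longlonglongrightarrow> u' (heis_mult lam x (- y)) v" for v
            using continuous_on_tendsto_compose[OF u'_cont[of UNIV]] by simp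
          then show "(\<lambda>k. u' (heis_mult lam x (- Y k)) (- fst h, - snd h - heis_form lam (fst x) (fst h)))
            \<longlonglongrightarrow> u' (heis_mult lam x (- y)) (- fst h, - snd h - heis_form lam (fst x) (fst h))" by this
        qed
        show "AE x in heis_vol. norm (u' (heis_mult lam x (- Y k)) (- fst h, - snd h - heis_form lam (fst x) (fst h)) * g x)
            \<le> w K (B * ((2 + ?L * \<rho> K) * norm h)) x" for k
        proof (rule AE_I2)
          fix x :: "'n heis"
          show "norm (u' (heis_mult lam x (- Y k)) (- fst h, - snd h - heis_form lam (fst x) (fst h)) * g x) \<le> w K (B * ((2 + ?L * \<rho> K) * norm h)) x"
          proof (cases "norm x \<le> \<rho> K")
            case True
            have "norm (u' (heis_mult lam x (- Y k)) (- fst h, - snd h - heis_form lam (fst x) (fst h))) \<le> B * ((2 + ?L * \<rho> K) * norm h)"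
              using B(2) mult_left_mono[OF dir[OF True, of h] less_imp_le[OF B(1)]] order_trans by blast
            then show ?thesis using True by (simp add: w_def norm_mult mult_right_mono)
          next
            case False
            then show ?thesis using R'[OF supp[OF _ K]] by (simp add: w_def)
          qed
        qed
      qed (use deriv(1) in auto)
    qed
    show "G' y (fst y, 0) + \<i> * G' y (\<i> *s fst y, 0) + 2 * \<i> * of_real (qform lam (fst y)) * G' y (0, 1) = 0" for y
    proof -
      obtain w s where y: "y = (w, s)" by (cases y)
      define \<phi> where "\<phi> = (\<lambda>x. u (heis_mult lam x (- y)))"
      have \<phi>: "test_fun \<phi>" unfolding \<phi>_def by (rule translate_test_fun(1)[OF u])
      define V where "V h x = u' (heis_mult lam x (- y)) (- fst h, - snd h - heis_form lam (fst x) (fst h))" for h x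
      \<comment> \<open>The coefficients \<open>2 cnj (w_j)\<close> depend on \<open>y\<close> alone
        and therefore come out of the integral over \<open>x\<close>.\<close>
      have pt: "V (w, 0) x + \<i> * V (\<i> *s w, 0) x + 2 * \<i> * of_real (qform lam w) * V (0, 1) x
          = - (\<Sum>j\<in>UNIV. 2 * cnj (w $ j) * Zbar lam j \<phi> x)" for x
      proof -
        define p where "p = heis_mult lam x (- y)"
        define D where "D h = u' p (h, - heis_form lam h w)" for h
        have D_lin: "bounded_linear D" unfolding D_def
        proof (rule bounded_linear_compose[OF u'_lin])
          show "bounded_linear (\<lambda>h. (h, - heis_form lam h w))"
            by (intro linear_conv_bounded_linear[THEN iffD1])
               (auto simp: linear_iff heis_form_add heis_form_scaleR algebra_simps)
        qed
        have lin2: "u' p (h, c) = u' p (h, 0) + of_real c * u' p (0, 1)" for h c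
        proof -
          have "(h, c) = (h, 0) + c *\<^sub>R (0, 1)" by simp
          then have "u' p (h, c) = u' p (h, 0) + c *\<^sub>R u' p (0, 1)"
            by (simp only: linear_simps(1)[OF u'_lin] linear_simps(5)[OF u'_lin])
          then show ?thesis by (simp add: scaleR_conv_of_real)
        qed
        have neg: "u' p (- h, c) = - u' p (h, - c)" for h c
          using linear_simps(4)[OF u'_lin, of p "(h, - c)"] by simp
        have Z: "Zbar lam j \<phi> x = (D (axis j 1) + \<i> * D (axis j \<i>)) / 2 + \<i> * of_real (lam $ j) * (fst x $ j) * u' p (0, 1)" for j
          unfolding \<phi>_def using Zbar_eq[OF translate_test_fun(2)[OF u], of lam j lam "- y" x]
          by (simp add: Zbar_of_derivative_def D_def u'_def p_def y)
        have "(\<Sum>j\<in>UNIV. 2 * cnj (w $ j) * Zbar lam j \<phi> x) = (\<Sum>j\<in>UNIV. cnj (w $ j) * (D (axis j 1) + \<i> * D (axis j \<i>)))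
            + 2 * \<i> * (\<Sum>j\<in>UNIV. of_real (lam $ j) * cnj (w $ j) * fst x $ j) * u' p (0, 1)"
          unfolding Z sum_distrib_left sum_distrib_right sum.distrib[symmetric]
          by (intro sum.cong refl) (simp add: field_simps)
        also have "\<dots> = D w + \<i> * D (\<i> *s w) + 2 * \<i> * (\<Sum>j\<in>UNIV. of_real (lam $ j) * cnj (w $ j) * fst x $ j) * u' p (0, 1)"
          by (simp only: sum_real_linear_Zbar[OF D_lin])
        also have "D w = u' p (w, 0)" by (simp add: D_def)
        \<comment> \<open>\<open>heis_form lam (i w) w = - 2 q(w)\<close> is the source of the term
          with \<open>qform\<close> in the CR equation.\<close>
        also have "D (\<i> *s w) = u' p (\<i> *s w, 0) + 2 * of_real (qform lam w) * u' p (0, 1)"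
        proof -
          have "heis_form lam (\<i> *s w) w = - 2 * qform lam w"
            unfolding heis_form_def qform_def cmod_power2 sum_distrib_left
            by (intro sum.cong refl) (simp add: power2_eq_square algebra_simps)
          then show ?thesis unfolding D_def by (subst lin2) simp
        qed
        finally have rhs: "(\<Sum>j\<in>UNIV. 2 * cnj (w $ j) * Zbar lam j \<phi> x) = u' p (w, 0) + \<i> * (u' p (\<i> *s w, 0) + 2 * of_real (qform lam w) * u' p (0, 1))
            + 2 * \<i> * (\<Sum>j\<in>UNIV. of_real (lam $ j) * cnj (w $ j) * fst x $ j) * u' p (0, 1)" .
        have form: "of_real (heis_form lam (fst x) w) + \<i> * of_real (heis_form lam (fst x) (\<i> *s w))
            = 2 * \<i> * (\<Sum>j\<in>UNIV. of_real (lam $ j) * cnj (w $ j) * fst x $ j)"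
          unfolding heis_form_def of_real_mult of_real_sum sum_distrib_left sum.distrib[symmetric]
          by (intro sum.cong) (auto simp: complex_eq_iff algebra_simps)
        have V: "V (w, 0) x = - (u' p (w, 0) + of_real (heis_form lam (fst x) w) * u' p (0, 1))"
          "V (\<i> *s w, 0) x = - (u' p (\<i> *s w, 0) + of_real (heis_form lam (fst x) (\<i> *s w)) * u' p (0, 1))"
          "V (0, 1) x = - u' p (0, 1)"
          using neg[of 0 "-1"] by (simp_all add: V_def p_def[symmetric] neg lin2[of _ "heis_form _ _ _"])
        have "V (w, 0) x + \<i> * V (\<i> *s w, 0) x + 2 * \<i> * of_real (qform lam w) * V (0, 1) x
          = - (u' p (w, 0) + \<i> * (u' p (\<i> *s w, 0) + 2 * of_real (qform lam w) * u' p (0, 1))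
             + (of_real (heis_form lam (fst x) w) + \<i> * of_real (heis_form lam (fst x) (\<i> *s w))) * u' p (0, 1))"
          unfolding V by (simp add: algebra_simps)
        then show ?thesis unfolding form rhs .
      qed
      have i: "integrable heis_vol (\<lambda>x. V h x * g x)" for h unfolding V_def by (rule deriv(1))
      have iZ: "integrable heis_vol (\<lambda>x. g x * Zbar lam j \<phi> x)" for j
        by (rule L2_mult_integrable[OF gL2 test_fun_L2[OF test_fun_Zbar[OF \<phi>]]])
      have "G' y (fst y, 0) + \<i> * G' y (\<i> *s fst y, 0) + 2 * \<i> * of_real (qform lam (fst y)) * G' y (0, 1)
        = (\<integral>x. V (w, 0) x * g x \<partial>heis_vol) + \<i> * (\<integral>x. V (\<i> *s w, 0) x * g x \<partial>heis_vol) + 2 * \<i> * of_real (qform lam w) * (\<integral>x. V (0, 1) x * g x \<partial>heis_vol)"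
        by (simp add: G'_def V_def y)
      also have "\<dots> = (\<integral>x. V (w, 0) x * g x + \<i> * (V (\<i> *s w, 0) x * g x) + 2 * \<i> * of_real (qform lam w) * (V (0, 1) x * g x) \<partial>heis_vol)"
        using i by (simp add: Bochner_Integration.integral_add)
      also have "\<dots> = (\<integral>x. (V (w, 0) x + \<i> * V (\<i> *s w, 0) x + 2 * \<i> * of_real (qform lam w) * V (0, 1) x) * g x \<partial>heis_vol)"
        by (simp add: algebra_simps)
      also have "\<dots> = (\<integral>x. - (\<Sum>j\<in>UNIV. 2 * cnj (w $ j) * (g x * Zbar lam j \<phi> x)) \<partial>heis_vol)"
        unfolding pt by (intro Bochner_Integration.integral_cong refl) (simp add: sum_distrib_left sum_distrib_right mult_ac)
      also have "\<dots> = - (\<Sum>j\<in>UNIV. 2 * cnj (w $ j) * (\<integral>x. g x * Zbar lam j \<phi> x \<partial>heis_vol))"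
        using iZ by (simp add: Bochner_Integration.integral_sum)
      also have "\<dots> = 0" using g \<phi> by (simp add: weakly_CR_def)
      finally show ?thesis .
    qed
  qed (rule lam)
  then show ?thesis by (simp add: G'_def[abs_def] u'_def)
qed

subsection \<open>The regularised operator\<close>

lemma heis_kernel_uminus: "heis_kernel lam \<epsilon> (- y) = cnj (heis_kernel lam \<epsilon> y)"
  by (simp add: heis_kernel_def qform_def)

text \<open>The kernel is Hermitian, so the regularised operators are formally self-adjoint.\<close>

lemma heis_kernel_swap: "heis_kernel lam \<epsilon> (heis_mult lam (- y) x) = cnj (heis_kernel lam \<epsilon> (heis_mult lam (- x) y))"
  using uminus_heis_mult[of lam "- x" y] heis_kernel_uminus[of lam \<epsilon> "heis_mult lam (- x) y"] by simp

text \<open>The kernel is square integrable although not integrable: of the \<open>2 n + 2\<close>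
  powers of the modulus, \<open>n + 1\<close> serve for \<open>w\<close>, two for \<open>s\<close>,
  and the remaining \<open>n - 1\<close> are bounded below by powers of
  \<open>\<epsilon>\<close>.\<close>

lemma heis_kernel_L2:
  fixes lam :: "real ^ 'n::finite"
  assumes lam: "\<And>j. lam $ j > 0" and \<epsilon>: "\<epsilon> > 0"
  shows "heis_kernel lam \<epsilon> \<in> L2"
proof (rule L2_I)
  let ?n = "CARD('n)"
  note [measurable] = borel_measurable_heis_kernel[OF lam \<epsilon>]
  show "heis_kernel lam \<epsilon> \<in> borel_measurable borel" by measurable
  have n: "?n \<ge> 1" by simp
  have bd: "(norm (heis_kernel lam \<epsilon> y))\<^sup>2 \<le> (1 / (\<epsilon> + qform lam (fst y)) ^ Suc ?n) * ((1 / \<epsilon> ^ (?n - 1)) * (pi / \<epsilon> * Poisson_kernel \<epsilon> (snd y)))" for y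
  proof -
    let ?q = "\<epsilon> + qform lam (fst y)" and ?a = "of_real (\<epsilon> + qform lam (fst y)) - \<i> * of_real (snd y) :: complex"
    have q: "?q \<ge> \<epsilon>" using qform_nonneg[OF lam] by simp
    have "?q ^ Suc ?n * (\<epsilon> ^ (?n - 1) * (\<epsilon>\<^sup>2 + (snd y)\<^sup>2)) \<le> ?q ^ Suc ?n * (?q ^ (?n - 1) * (?q\<^sup>2 + (snd y)\<^sup>2))"
    proof (intro mult_left_mono mult_mono power_mono)
      show "\<epsilon>\<^sup>2 + (snd y)\<^sup>2 \<le> ?q\<^sup>2 + (snd y)\<^sup>2" using power_mono[OF q, of 2] \<epsilon> by simp
    qed (use q \<epsilon> in auto)
    also have "\<dots> = (?q ^ ?n)\<^sup>2 * (norm ?a)\<^sup>2"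
    proof -
      obtain m where m: "?n = Suc m" using n by (cases ?n) auto
      have "?q ^ Suc ?n * ?q ^ (?n - 1) = (?q ^ ?n)\<^sup>2" unfolding m by (simp add: power2_eq_square)
      moreover have "(norm ?a)\<^sup>2 = ?q\<^sup>2 + (snd y)\<^sup>2" by (simp add: cmod_power2)
      ultimately show ?thesis by (simp only: mult.assoc[symmetric])
    qed
    also have "\<dots> \<le> ((norm ?a) ^ ?n)\<^sup>2 * (norm ?a)\<^sup>2"
      using heis_kernel_denominator(2)[OF lam \<epsilon>, of "fst y" "snd y"] q \<epsilon> by (intro mult_right_mono power_mono) auto
    also have "\<dots> = (norm ?a ^ Suc ?n)\<^sup>2" by (simp add: power_mult_distrib)
    finally have le: "?q ^ Suc ?n * (\<epsilon> ^ (?n - 1) * (\<epsilon>\<^sup>2 + (snd y)\<^sup>2)) \<le> (norm ?a ^ Suc ?n)\<^sup>2" .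
    have pos: "0 < ?q ^ Suc ?n * (\<epsilon> ^ (?n - 1) * (\<epsilon>\<^sup>2 + (snd y)\<^sup>2))"
      using q \<epsilon> by (intro mult_pos_pos zero_less_power add_pos_nonneg) auto
    have "(norm (heis_kernel lam \<epsilon> y))\<^sup>2 = 1 / (norm ?a ^ Suc ?n)\<^sup>2"
      unfolding heis_kernel_def norm_divide norm_power norm_one power_divide by simp
    also have "\<dots> \<le> 1 / (?q ^ Suc ?n * (\<epsilon> ^ (?n - 1) * (\<epsilon>\<^sup>2 + (snd y)\<^sup>2)))"
      using le pos by (intro frac_le) auto
    also have "\<dots> = (1 / ?q ^ Suc ?n) * ((1 / \<epsilon> ^ (?n - 1)) * (pi / \<epsilon> * Poisson_kernel \<epsilon> (snd y)))"
      using \<epsilon> by (simp add: Poisson_kernel_def)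
    finally show ?thesis .
  qed
  have "integrable lborel (\<lambda>y. (1 / (\<epsilon> + qform lam (fst y)) ^ Suc ?n) * ((1 / \<epsilon> ^ (?n - 1)) * (pi / \<epsilon> * Poisson_kernel \<epsilon> (snd y))))"
    using Poisson_kernel_integral(1)[OF \<epsilon>]
    by (intro integrable_prod_mult integrable_inverse_power_qform lam \<epsilon> integrable_mult_right)
  then have "integrable lborel (\<lambda>y. (norm (heis_kernel lam \<epsilon> y))\<^sup>2)"
  proof (rule Bochner_Integration.integrable_bound)
    show "AE y in lborel. norm ((norm (heis_kernel lam \<epsilon> y))\<^sup>2) \<le> norm ((1 / (\<epsilon> + qform lam (fst y)) ^ Suc ?n) * ((1 / \<epsilon> ^ (?n - 1)) * (pi / \<epsilon> * Poisson_kernel \<epsilon> (snd y))))"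
      using order_trans[OF bd abs_ge_self] by (intro AE_I2) (simp only: real_norm_def abs_power2 abs_norm_cancel power2_abs)
  qed simp
  then show "integrable heis_vol (\<lambda>y. (norm (heis_kernel lam \<epsilon> y))\<^sup>2)"
    by (subst integrable_heis_vol) auto
qed

definition heis_op :: "real ^ 'n::finite \<Rightarrow> real \<Rightarrow> ('n heis \<Rightarrow> complex) \<Rightarrow> 'n heis \<Rightarrow> complex" where
  "heis_op lam \<epsilon> u x = (\<integral>y. heis_kernel lam \<epsilon> (heis_mult lam (- x) y) * u y \<partial>heis_vol)"

lemma continuous_on_heis_mult_pair: "continuous_on UNIV (\<lambda>p. heis_mult lam (fst p) (snd p))"
    "continuous_on UNIV (\<lambda>p. heis_mult lam (- fst p) (snd p))"
  by (intro continuous_intros)+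

lemma heis_kernel_pair_measurable:
  assumes "\<And>j. lam $ j > 0" "\<epsilon> > 0"
  shows "(\<lambda>(x, y). heis_kernel lam \<epsilon> (heis_mult lam (- x) y)) \<in> borel_measurable (borel \<Otimes>\<^sub>M borel)"
proof -
  have "(\<lambda>p. heis_kernel lam \<epsilon> (heis_mult lam (- fst p) (snd p))) \<in> borel_measurable borel"
    by (intro borel_measurable_continuous_onI continuous_on_heis_kernel assms continuous_on_heis_mult_pair)
  then show ?thesis by (simp add: borel_prod case_prod_unfold)
qed

lemma heis_mult_pair_measurable [measurable]:
  "(\<lambda>p. heis_mult lam (fst p) (snd p)) \<in> measurable (borel \<Otimes>\<^sub>M borel) borel"
  using borel_measurable_continuous_onI[OF continuous_on_heis_mult_pair(1)] by (simp add: borel_prod)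

lemma heis_op_measurable:
  fixes lam :: "real ^ 'n::finite"
  assumes lam: "\<And>j. lam $ j > 0" and \<epsilon>: "\<epsilon> > 0" and u: "test_fun u"
  shows "heis_op lam \<epsilon> u \<in> borel_measurable borel"
proof -
  note [measurable] = heis_kernel_pair_measurable[OF lam \<epsilon>] test_fun_measurable[OF u]
  have "(\<lambda>(x, y). heis_kernel lam \<epsilon> (heis_mult lam (- x) y) * u y) \<in> borel_measurable (borel \<Otimes>\<^sub>M borel)"
    by measurable
  then have "(\<lambda>(x, y). heis_kernel lam \<epsilon> (heis_mult lam (- x) y) * u y) \<in> borel_measurable (borel \<Otimes>\<^sub>M heis_vol)"
    by measurable
  from heis_vol.borel_measurable_lebesgue_integral[OF this] show ?thesis
    unfolding heis_op_def[abs_def] by simp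
qed

text \<open>By the Cauchy--Schwarz inequality on the support of \<open>u\<close>, and because the modulus of the
  kernel is symmetric, the square of the operator is bounded by an integral of squared kernels.\<close>

lemma heis_op_L2:
  fixes lam :: "real ^ 'n::finite"
  assumes lam: "\<And>j. lam $ j > 0" and \<epsilon>: "\<epsilon> > 0" and u: "test_fun u"
  shows "heis_op lam \<epsilon> u \<in> L2"
proof (rule L2_I[OF heis_op_measurable[OF assms]])
  obtain R where R: "\<And>x. norm x > R \<Longrightarrow> u x = 0" using test_fun_support[OF u] by blast
  let ?S = "cball (0::'n heis) R"
  let ?k = "\<lambda>x y. heis_kernel lam \<epsilon> (heis_mult lam (- x) y)"
  note kL2 = heis_kernel_L2[OF lam \<epsilon>]
  note [measurable] = heis_kernel_pair_measurable[OF lam \<epsilon>] heis_op_measurable[OF assms] borel_measurable_heis_kernel[OF lam \<epsilon>]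
  have [measurable]: "?S \<in> sets borel" by simp
  have pt: "ennreal ((norm (heis_op lam \<epsilon> u x))\<^sup>2) \<le> ennreal ((L2_norm u)\<^sup>2) * (\<integral>\<^sup>+y. ennreal ((norm (?k x y))\<^sup>2) * indicator ?S y \<partial>heis_vol)" for x
  proof -
    define f where "f y = ?k x y * indicator ?S y" for y
    have f_L2: "f \<in> L2"
    proof (rule L2_bound[of "?k x" _ 1])
      show "?k x \<in> L2" by (rule L2_compose(1)[OF lborel_distr_heis_mult_left measurable_heis_mult(1) kL2])
      then have [measurable]: "?k x \<in> borel_measurable borel" by (rule L2_measurable)
      show "f \<in> borel_measurable borel" unfolding f_def by measurable
    qed (auto simp: f_def indicator_def)
    have "heis_op lam \<epsilon> u x = (\<integral>y. f y * u y \<partial>heis_vol)"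
      unfolding heis_op_def by (intro Bochner_Integration.integral_cong) (auto simp: f_def indicator_def R)
    then have "norm (heis_op lam \<epsilon> u x) \<le> L2_norm u * L2_norm f"
      using L2_Cauchy_Schwarz_mult[OF f_L2 test_fun_L2[OF u]] by (simp add: mult.commute)
    then have "(norm (heis_op lam \<epsilon> u x))\<^sup>2 \<le> (L2_norm u)\<^sup>2 * (L2_norm f)\<^sup>2"
      by (simp add: power_mono power_mult_distrib[symmetric])
    then have "ennreal ((norm (heis_op lam \<epsilon> u x))\<^sup>2) \<le> ennreal ((L2_norm u)\<^sup>2) * ennreal ((L2_norm f)\<^sup>2)"
      by (simp add: ennreal_mult[symmetric])
    also have "ennreal ((L2_norm f)\<^sup>2) = (\<integral>\<^sup>+y. ennreal ((norm (?k x y))\<^sup>2) * indicator ?S y \<partial>heis_vol)"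
      unfolding nn_integral_L2_norm_sq[OF f_L2, symmetric]
      by (intro nn_integral_cong) (auto simp: f_def ennreal_power split: split_indicator)
    finally show ?thesis .
  qed
  have "(\<integral>\<^sup>+x. ennreal ((norm (heis_op lam \<epsilon> u x))\<^sup>2) \<partial>heis_vol) \<le> (\<integral>\<^sup>+x. ennreal ((L2_norm u)\<^sup>2) * (\<integral>\<^sup>+y. ennreal ((norm (?k x y))\<^sup>2) * indicator ?S y \<partial>heis_vol) \<partial>heis_vol)"
    by (intro nn_integral_mono pt)
  also have "\<dots> = ennreal ((L2_norm u)\<^sup>2) * (\<integral>\<^sup>+x. \<integral>\<^sup>+y. ennreal ((norm (?k x y))\<^sup>2) * indicator ?S y \<partial>heis_vol \<partial>heis_vol)"
    by (rule nn_integral_cmult) measurable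
  also have "(\<integral>\<^sup>+x. \<integral>\<^sup>+y. ennreal ((norm (?k x y))\<^sup>2) * indicator ?S y \<partial>heis_vol \<partial>heis_vol) = (\<integral>\<^sup>+y. \<integral>\<^sup>+x. ennreal ((norm (?k x y))\<^sup>2) * indicator ?S y \<partial>heis_vol \<partial>heis_vol)"
    by (rule heis_vol2.Fubini'[symmetric]) measurable
  also have "\<dots> = (\<integral>\<^sup>+y. ennreal ((L2_norm (heis_kernel lam \<epsilon>))\<^sup>2) * indicator ?S y \<partial>heis_vol)"
  proof (rule nn_integral_cong)
    fix y
    have k_L2: "(\<lambda>x. heis_kernel lam \<epsilon> (heis_mult lam (- y) x)) \<in> L2"
      "L2_norm (\<lambda>x. heis_kernel lam \<epsilon> (heis_mult lam (- y) x)) = L2_norm (heis_kernel lam \<epsilon>)"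
      by (rule L2_compose[OF lborel_distr_heis_mult_left measurable_heis_mult(1) kL2])+
    have "(\<integral>\<^sup>+x. ennreal ((norm (?k x y))\<^sup>2) \<partial>heis_vol) = (\<integral>\<^sup>+x. (ennreal (norm (heis_kernel lam \<epsilon> (heis_mult lam (- y) x))))\<^sup>2 \<partial>heis_vol)"
      unfolding heis_kernel_swap[of lam \<epsilon> y] by (simp add: ennreal_power)
    also have "\<dots> = ennreal ((L2_norm (heis_kernel lam \<epsilon>))\<^sup>2)"
      unfolding nn_integral_L2_norm_sq[OF k_L2(1)] k_L2(2) ..
    finally have e: "(\<integral>\<^sup>+x. ennreal ((norm (?k x y))\<^sup>2) \<partial>heis_vol) = ennreal ((L2_norm (heis_kernel lam \<epsilon>))\<^sup>2)" .
    have "(\<lambda>x. ennreal ((norm (?k x y))\<^sup>2)) \<in> borel_measurable heis_vol" by measurable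
    from nn_integral_multc[OF this, of "indicator ?S y"]
    show "(\<integral>\<^sup>+x. ennreal ((norm (?k x y))\<^sup>2) * indicator ?S y \<partial>heis_vol) = ennreal ((L2_norm (heis_kernel lam \<epsilon>))\<^sup>2) * indicator ?S y"
      unfolding e .
  qed
  also have "\<dots> = ennreal ((L2_norm (heis_kernel lam \<epsilon>))\<^sup>2) * emeasure heis_vol ?S"
    by (simp add: nn_integral_cmult)
  also have "ennreal ((L2_norm u)\<^sup>2) * (ennreal ((L2_norm (heis_kernel lam \<epsilon>))\<^sup>2) * emeasure heis_vol ?S) < \<infinity>"
  proof -
    have "emeasure heis_vol ?S = ennreal (2 ^ CARD('n)) * emeasure lborel ?S"
      using nn_integral_heis_vol[of "indicator ?S"] by simp
    also have "\<dots> < \<infinity>" using emeasure_lborel_cball_finite[of "0::'n heis" R] by (simp add: ennreal_mult_less_top)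
    finally show ?thesis by (simp add: ennreal_mult_less_top)
  qed
  finally show "integrable heis_vol (\<lambda>x. (norm (heis_op lam \<epsilon> u x))\<^sup>2)"
    by (intro integrableI_bounded) simp_all
qed

text \<open>As a function of \<open>x = (z, t)\<close> the denominator is a constant plus
  \<open>i t\<close> plus terms of which only \<open>lam_j |z_j|^2\<close> is not holomorphic in
  \<open>z\<close>. From the latter \<open>Zbar_j\<close> yields \<open>lam_j z_j\<close>, from
  \<open>i t\<close> it yields \<open>- lam_j z_j\<close>.\<close>

lemma heis_denominator_derivative:
  fixes lam :: "real ^ 'n::finite"
  defines "A \<equiv> \<lambda>\<epsilon> y x. of_real (\<epsilon> + qform lam (fst (heis_mult lam (- x) y))) - \<i> * of_real (snd (heis_mult lam (- x) y)) :: complex"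
    and "A' \<equiv> \<lambda>y x h. \<i> * of_real (snd h) + (\<Sum>j\<in>UNIV. of_real (lam $ j) * (fst h $ j * cnj (fst x $ j) + fst x $ j * cnj (fst h $ j) - 2 * fst h $ j * cnj (fst y $ j))) :: complex"
  shows "(A \<epsilon> y has_derivative A' y x) (at x)"
    and "Zbar_of_derivative lam j x (A' y x) = 0"
proof -
  define P where "P z = (\<Sum>j\<in>UNIV. of_real (lam $ j) * (z $ j * cnj (z $ j) - 2 * z $ j * cnj (fst y $ j)))" for z :: "complex ^ 'n"
  have A_eq: "A \<epsilon> y x = of_real \<epsilon> + of_real (qform lam (fst y)) - \<i> * of_real (snd y) + \<i> * of_real (snd x) + P (fst x)" for x
  proof -
    have 1: "of_real (qform lam (fst y - fst x)) + \<i> * of_real (heis_form lam (fst x) (fst y)) = of_real (qform lam (fst y)) + P (fst x)"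
      unfolding qform_def heis_form_def P_def sum_distrib_left of_real_sum sum.distrib[symmetric] cmod_power2
      by (intro sum.cong refl) (simp add: cmod_power2 complex_eq_iff power2_eq_square algebra_simps)
    have "A \<epsilon> y x = of_real \<epsilon> - \<i> * of_real (snd y) + \<i> * of_real (snd x) + (of_real (qform lam (fst y - fst x)) + \<i> * of_real (heis_form lam (fst x) (fst y)))"
      by (simp add: A_def heis_mult_def algebra_simps)
    then show ?thesis unfolding 1 by simp
  qed
  have dz: "((\<lambda>x::'n heis. fst x $ j) has_derivative (\<lambda>h. fst h $ j)) (at x)" for x j
    by (intro bounded_linear_imp_has_derivative bounded_linear_compose[OF bounded_linear_vec_nth bounded_linear_fst])
  have dP: "((\<lambda>x. P (fst x)) has_derivative (\<lambda>h. \<Sum>j\<in>UNIV. of_real (lam $ j) * (fst h $ j * cnj (fst x $ j) + fst x $ j * cnj (fst h $ j) - 2 * fst h $ j * cnj (fst y $ j)))) (at x)" for x :: "'n heis"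
    unfolding P_def
  proof (rule has_derivative_sum)
    fix j
    have "((\<lambda>x::'n heis. of_real (lam $ j) * (fst x $ j * cnj (fst x $ j) - 2 * fst x $ j * cnj (fst y $ j))) has_derivative
      (\<lambda>h. of_real (lam $ j) * ((fst x $ j * cnj (fst h $ j) + fst h $ j * cnj (fst x $ j)) - 2 * fst h $ j * cnj (fst y $ j)))) (at x)"
      by (intro has_derivative_mult_right has_derivative_diff has_derivative_mult has_derivative_cnj has_derivative_mult_left dz)
    then show "((\<lambda>x::'n heis. of_real (lam $ j) * (fst x $ j * cnj (fst x $ j) - 2 * fst x $ j * cnj (fst y $ j))) has_derivative
      (\<lambda>h. of_real (lam $ j) * (fst h $ j * cnj (fst x $ j) + fst x $ j * cnj (fst h $ j) - 2 * fst h $ j * cnj (fst y $ j)))) (at x)"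
      by (simp add: add.commute)
  qed
  have dt: "((\<lambda>x::'n heis. \<i> * of_real (snd x)) has_derivative (\<lambda>h. \<i> * of_real (snd h))) (at x)" for x
    by (intro has_derivative_mult_right has_derivative_of_real bounded_linear_imp_has_derivative bounded_linear_snd)
  show "(A \<epsilon> y has_derivative A' y x) (at x)"
    unfolding A_eq[abs_def] A'_def
    by (rule has_derivative_eq_rhs[OF has_derivative_add[OF has_derivative_add[OF has_derivative_const dt] dP]]) simp
  have S: "(\<Sum>i\<in>UNIV. of_real (lam $ i) * (axis j u $ i * cnj (fst x $ i) + fst x $ i * cnj (axis j u $ i) - 2 * axis j u $ i * cnj (fst y $ i)))
      = of_real (lam $ j) * (u * cnj (fst x $ j) + fst x $ j * cnj u - 2 * u * cnj (fst y $ j))" for u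
  proof -
    have "(\<Sum>i\<in>UNIV. of_real (lam $ i) * (axis j u $ i * cnj (fst x $ i) + fst x $ i * cnj (axis j u $ i) - 2 * axis j u $ i * cnj (fst y $ i)))
      = (\<Sum>i\<in>UNIV. if i = j then of_real (lam $ j) * (u * cnj (fst x $ j) + fst x $ j * cnj u - 2 * u * cnj (fst y $ j)) else 0)"
      by (intro sum.cong) (auto simp: axis_def)
    then show ?thesis by simp
  qed
  show "Zbar_of_derivative lam j x (A' y x) = 0"
    unfolding Zbar_of_derivative_def A'_def fst_conv snd_conv S by (simp add: algebra_simps)
qed

text \<open>In \<open>x\<close> the kernel is an inverse power of a CR function without zeros, hence
  a classical solution, and Fubini reduces the claim to it. For fixed \<open>\<epsilon>\<close> the
  kernel is bounded, which gives absolute integrability.\<close>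

lemma heis_op_weakly_CR:
  fixes lam :: "real ^ 'n::finite"
  assumes lam: "\<And>j. lam $ j > 0" and \<epsilon>: "\<epsilon> > 0" and u: "test_fun u"
  shows "heis_op lam \<epsilon> u \<in> weakly_CR lam"
  unfolding weakly_CR_def
proof (intro CollectI conjI allI impI heis_op_L2[OF assms])
  fix j and \<phi> :: "'n heis \<Rightarrow> complex" assume \<phi>: "test_fun \<phi>"
  let ?k = "\<lambda>x y. heis_kernel lam \<epsilon> (heis_mult lam (- x) y)"
  let ?n = "CARD('n)"
  note Z = test_fun_Zbar[OF \<phi>, of lam j]
  note [measurable] = heis_kernel_pair_measurable[OF lam \<epsilon>] test_fun_measurable[OF u] test_fun_measurable[OF Z]
  have inner: "(\<integral>x. ?k x y * Zbar lam j \<phi> x \<partial>heis_vol) = 0" for y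
  proof -
    define A where "A x = (of_real (\<epsilon> + qform lam (fst (heis_mult lam (- x) y))) - \<i> * of_real (snd (heis_mult lam (- x) y)) :: complex)" for x
    define A' where "A' x h = \<i> * of_real (snd h) + (\<Sum>j\<in>UNIV. of_real (lam $ j) * (fst h $ j * cnj (fst x $ j) + fst x $ j * cnj (fst h $ j) - 2 * fst h $ j * cnj (fst y $ j)))" for x h :: "'n heis"
    note A = heis_denominator_derivative(1)[where lam = lam and \<epsilon> = \<epsilon> and y = y]
      heis_denominator_derivative(2)[where lam = lam and y = y]
    have A0: "A x \<noteq> 0" for x unfolding A_def by (rule heis_kernel_denominator(1)[OF lam \<epsilon>])
    have dA: "(A has_derivative A' x) (at x)" for x using A(1) by (simp add: A_def[abs_def] A'_def[abs_def])
    have Zb: "Zbar_of_derivative lam j x (A' x) = 0" for x using A(2) by (simp add: A'_def[abs_def])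
    define c where "c x = - of_nat (Suc ?n) / A x ^ Suc (Suc ?n)" for x
    have "((\<lambda>z. 1 / z ^ Suc ?n) has_field_derivative - of_nat (Suc ?n) / z ^ Suc (Suc ?n)) (at z)" if "z \<noteq> 0" for z :: complex
      using DERIV_divide[OF DERIV_const[of 1] DERIV_power[OF DERIV_ident, where n = "Suc ?n" and x = z and s = UNIV]] that
      by (simp add: field_simps del: of_nat_Suc)
    from has_derivative_compose[OF dA this[unfolded has_field_derivative_def], OF A0]
    have d: "((\<lambda>x. ?k x y) has_derivative (\<lambda>h. c x * A' x h)) (at x)" for x
      by (simp only: heis_kernel_def A_def[symmetric] c_def)
    show ?thesis
    proof (rule integral_classical_CR[OF d _ _ \<phi>])
      have A_cont: "continuous_on UNIV A"
        using dA by (auto intro!: continuous_at_imp_continuous_on has_derivative_continuous)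
      show "continuous_on UNIV (\<lambda>x. c x * A' x v)" for v
        unfolding c_def A'_def using A0 by (intro continuous_intros A_cont) auto
      show "Zbar_of_derivative lam j x (\<lambda>h. c x * A' x h) = 0" for x
      proof -
        have "Zbar_of_derivative lam j x (\<lambda>h. c x * A' x h) = c x * Zbar_of_derivative lam j x (A' x)"
          by (simp add: Zbar_of_derivative_def field_simps)
        then show ?thesis by (simp add: Zb)
      qed
    qed
  qed
  have int: "integrable (heis_vol \<Otimes>\<^sub>M heis_vol) (\<lambda>(x, y). ?k x y * u y * Zbar lam j \<phi> x)"
  proof (rule integrableI_bounded)
    have ui: "integrable heis_vol u" and Zi: "integrable heis_vol (Zbar lam j \<phi>)"
      using test_fun_integrable[OF u] test_fun_integrable[OF Z] by (simp_all add: integrable_heis_vol)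
    have "(\<integral>\<^sup>+p. ennreal (norm (case p of (x, y) \<Rightarrow> ?k x y * u y * Zbar lam j \<phi> x)) \<partial>(heis_vol \<Otimes>\<^sub>M heis_vol))
        \<le> (\<integral>\<^sup>+p. ennreal (1 / \<epsilon> ^ Suc ?n) * (ennreal (norm (Zbar lam j \<phi> (fst p))) * ennreal (norm (u (snd p)))) \<partial>(heis_vol \<Otimes>\<^sub>M heis_vol))"
    proof (rule nn_integral_mono)
      fix p :: "'n heis \<times> 'n heis"
      have "norm (?k (fst p) (snd p) * u (snd p) * Zbar lam j \<phi> (fst p)) \<le> 1 / \<epsilon> ^ Suc ?n * (norm (Zbar lam j \<phi> (fst p)) * norm (u (snd p)))"
        using mult_right_mono[OF norm_heis_kernel_le[OF lam \<epsilon>, of "heis_mult lam (- fst p) (snd p)"], of "norm (Zbar lam j \<phi> (fst p)) * norm (u (snd p))"]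
        by (simp only: norm_mult mult_ac) simp
      then show "ennreal (norm (case p of (x, y) \<Rightarrow> ?k x y * u y * Zbar lam j \<phi> x)) \<le> ennreal (1 / \<epsilon> ^ Suc ?n) * (ennreal (norm (Zbar lam j \<phi> (fst p))) * ennreal (norm (u (snd p))))"
        using \<epsilon> by (simp add: case_prod_unfold ennreal_mult[symmetric])
    qed
    also have "\<dots> = ennreal (1 / \<epsilon> ^ Suc ?n) * ((\<integral>\<^sup>+x. ennreal (norm (Zbar lam j \<phi> x)) \<partial>heis_vol) * (\<integral>\<^sup>+y. ennreal (norm (u y)) \<partial>heis_vol))"
      by (subst nn_integral_cmult) (auto simp: heis_vol.nn_integral_fst[symmetric] nn_integral_cmult nn_integral_multc)
    also have "\<dots> < \<infinity>" using ui Zi by (simp add: integrable_iff_bounded ennreal_mult_less_top)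
    finally show "(\<integral>\<^sup>+p. ennreal (norm (case p of (x, y) \<Rightarrow> ?k x y * u y * Zbar lam j \<phi> x)) \<partial>(heis_vol \<Otimes>\<^sub>M heis_vol)) < \<infinity>" .
  qed measurable
  have "(\<integral>x. heis_op lam \<epsilon> u x * Zbar lam j \<phi> x \<partial>heis_vol) = (\<integral>x. \<integral>y. ?k x y * u y * Zbar lam j \<phi> x \<partial>heis_vol \<partial>heis_vol)"
    by (simp add: heis_op_def)
  also have "\<dots> = (\<integral>y. \<integral>x. ?k x y * u y * Zbar lam j \<phi> x \<partial>heis_vol \<partial>heis_vol)"
    by (rule heis_vol2.Fubini_integral[OF int, symmetric])
  also have "\<dots> = (\<integral>y. u y * (\<integral>x. ?k x y * Zbar lam j \<phi> x \<partial>heis_vol) \<partial>heis_vol)"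
    by (simp only: integral_mult_right_zero[symmetric] mult_ac)
  also have "\<dots> = 0" by (simp add: inner)
  finally show "(\<integral>x. heis_op lam \<epsilon> u x * Zbar lam j \<phi> x \<partial>heis_vol) = 0" .
qed

subsection \<open>The operator reproduces CR functions in the limit\<close>

lemma nn_integral_L2_mult_le:
  fixes u v :: "'n::finite heis \<Rightarrow> complex"
  assumes "u \<in> L2" "v \<in> L2"
  shows "(\<integral>\<^sup>+x. ennreal (norm (u x * v x)) \<partial>heis_vol) \<le> ennreal (L2_norm u * L2_norm v)"
  using nn_integral_eq_integral[OF integrable_norm[OF L2_mult_integrable[OF assms]]] L2_Cauchy_Schwarz_norm[OF assms]
  by (simp add: ennreal_leI)

text \<open>Fubini, left translation by \<open>y\<close>, and Fubini again turn the convolution into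
  the pairing \<open>G\<close>. Absolute convergence holds because \<open>u\<close> is integrable
  and the inner integrals pair two square integrable functions whose norms do not depend on
  \<open>y\<close>.\<close>

lemma heis_op_inner:
  fixes lam :: "real ^ 'n::finite"
  assumes lam: "\<And>j. lam $ j > 0" and \<epsilon>: "\<epsilon> > 0" and u: "test_fun u" and g: "g \<in> weakly_CR lam"
  defines "G \<equiv> CR_pairing lam (\<lambda>x. cnj (u x)) g"
  shows "integrable heis_vol (\<lambda>x. G x * heis_kernel lam \<epsilon> x)"
    and "L2_inner (heis_op lam \<epsilon> u) g = cnj (\<integral>x. G x * heis_kernel lam \<epsilon> x \<partial>heis_vol)"
proof -
  let ?k = "heis_kernel lam \<epsilon>"
  note gL2 = weakly_CR_L2[OF g] and kL2 = heis_kernel_L2[OF lam \<epsilon>]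
  note [measurable] = L2_measurable[OF gL2] L2_measurable[OF kL2] test_fun_measurable[OF u] heis_kernel_pair_measurable[OF lam \<epsilon>]
  have gT: "(\<lambda>x. g (heis_mult lam y x)) \<in> L2" "L2_norm (\<lambda>x. g (heis_mult lam y x)) = L2_norm g"
    and kT: "(\<lambda>x. ?k (heis_mult lam y x)) \<in> L2" "L2_norm (\<lambda>x. ?k (heis_mult lam y x)) = L2_norm ?k" for y
    by (rule L2_compose[OF lborel_distr_heis_mult_left measurable_heis_mult(1)], fact)+
  have ui: "integrable heis_vol u"
    using test_fun_integrable[OF u] by (simp add: integrable_heis_vol)
  \<comment> \<open>Common to the two applications of Fubini, before and after the
    translation.\<close>
  have int: "integrable (heis_vol \<Otimes>\<^sub>M heis_vol) (\<lambda>(y, x). cnj (u y) * h y x)"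
    if [measurable]: "(\<lambda>(y, x). h y x) \<in> borel_measurable (borel \<Otimes>\<^sub>M borel)"
      and le: "\<And>y. (\<integral>\<^sup>+x. ennreal (norm (h y x)) \<partial>heis_vol) \<le> ennreal (L2_norm ?k * L2_norm g)"
    for h :: "'n heis \<Rightarrow> 'n heis \<Rightarrow> complex"
  proof (rule integrableI_bounded)
    have "(\<integral>\<^sup>+p. ennreal (norm (case p of (y, x) \<Rightarrow> cnj (u y) * h y x)) \<partial>(heis_vol \<Otimes>\<^sub>M heis_vol))
        = (\<integral>\<^sup>+y. \<integral>\<^sup>+x. ennreal (norm (u y)) * ennreal (norm (h y x)) \<partial>heis_vol \<partial>heis_vol)"
      by (subst heis_vol.nn_integral_fst[symmetric]) (simp_all add: norm_mult ennreal_mult)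
    also have "\<dots> = (\<integral>\<^sup>+y. ennreal (norm (u y)) * (\<integral>\<^sup>+x. ennreal (norm (h y x)) \<partial>heis_vol) \<partial>heis_vol)"
      by (intro nn_integral_cong nn_integral_cmult) measurable
    also have "\<dots> \<le> (\<integral>\<^sup>+y. ennreal (norm (u y)) * ennreal (L2_norm ?k * L2_norm g) \<partial>heis_vol)"
      by (intro nn_integral_mono mult_left_mono le) simp
    also have "\<dots> = (\<integral>\<^sup>+y. ennreal (norm (u y)) \<partial>heis_vol) * ennreal (L2_norm ?k * L2_norm g)"
      by (rule nn_integral_multc) measurable
    also have "\<dots> < \<infinity>"
      using ui by (simp add: integrable_iff_bounded ennreal_mult_less_top)
    finally show "(\<integral>\<^sup>+p. ennreal (norm (case p of (y, x) \<Rightarrow> cnj (u y) * h y x)) \<partial>(heis_vol \<Otimes>\<^sub>M heis_vol)) < \<infinity>" .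
  qed measurable
  have F1: "integrable (heis_vol \<Otimes>\<^sub>M heis_vol) (\<lambda>(y, x). cnj (u y) * (?k x * g (heis_mult lam y x)))"
  proof (rule int)
    show "(\<lambda>(y, x). ?k x * g (heis_mult lam y x)) \<in> borel_measurable (borel \<Otimes>\<^sub>M borel)"
      unfolding case_prod_unfold by measurable
    show "(\<integral>\<^sup>+x. ennreal (norm (?k x * g (heis_mult lam y x))) \<partial>heis_vol) \<le> ennreal (L2_norm ?k * L2_norm g)" for y
      using nn_integral_L2_mult_le[OF kL2 gT(1)[of y]] by (simp only: gT(2))
  qed
  have F2: "integrable (heis_vol \<Otimes>\<^sub>M heis_vol) (\<lambda>(y, x). cnj (u y) * (?k (heis_mult lam (- y) x) * g x))"
  proof (rule int)
    show "(\<lambda>(y, x). ?k (heis_mult lam (- y) x) * g x) \<in> borel_measurable (borel \<Otimes>\<^sub>M borel)"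
      by measurable
    show "(\<integral>\<^sup>+x. ennreal (norm (?k (heis_mult lam (- y) x) * g x)) \<partial>heis_vol) \<le> ennreal (L2_norm ?k * L2_norm g)" for y
      using nn_integral_L2_mult_le[OF kT(1)[of "- y"] gL2] by (simp only: kT(2))
  qed
  have G_eq: "G x * ?k x = (\<integral>y. cnj (u y) * (?k x * g (heis_mult lam y x)) \<partial>heis_vol)" for x
  proof -
    have "(\<integral>y. cnj (u y) * (?k x * g (heis_mult lam y x)) \<partial>heis_vol) = (\<integral>y. ?k x * (cnj (u y) * g (heis_mult lam y x)) \<partial>heis_vol)"
      by (simp only: mult_ac)
    then show ?thesis by (simp add: G_def CR_pairing_def)
  qed
  show "integrable heis_vol (\<lambda>x. G x * ?k x)"
    unfolding G_eq using heis_vol2.integrable_snd[OF F1] by simp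
  have "cnj (L2_inner (heis_op lam \<epsilon> u) g) = (\<integral>x. cnj (heis_op lam \<epsilon> u x) * g x \<partial>heis_vol)"
    unfolding L2_inner_def by (subst Bochner_Integration.integral_cnj[symmetric]) simp
  also have "\<dots> = (\<integral>x. \<integral>y. cnj (u y) * (?k (heis_mult lam (- y) x) * g x) \<partial>heis_vol \<partial>heis_vol)"
  proof (rule Bochner_Integration.integral_cong[OF refl])
    fix x
    have "cnj (heis_op lam \<epsilon> u x) = (\<integral>y. ?k (heis_mult lam (- y) x) * cnj (u y) \<partial>heis_vol)"
      unfolding heis_op_def heis_kernel_swap[of lam \<epsilon> _ x] by (subst Bochner_Integration.integral_cnj[symmetric]) simp
    then have "cnj (heis_op lam \<epsilon> u x) * g x = (\<integral>y. ?k (heis_mult lam (- y) x) * cnj (u y) * g x \<partial>heis_vol)"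
      by simp
    then show "cnj (heis_op lam \<epsilon> u x) * g x = (\<integral>y. cnj (u y) * (?k (heis_mult lam (- y) x) * g x) \<partial>heis_vol)"
      by (simp only: mult_ac)
  qed
  also have "\<dots> = (\<integral>y. \<integral>x. cnj (u y) * (?k (heis_mult lam (- y) x) * g x) \<partial>heis_vol \<partial>heis_vol)"
    by (rule heis_vol2.Fubini_integral[OF F2])
  also have "\<dots> = (\<integral>y. \<integral>x. cnj (u y) * (?k x * g (heis_mult lam y x)) \<partial>heis_vol \<partial>heis_vol)"
  proof (rule Bochner_Integration.integral_cong[OF refl])
    fix y
    have "(\<lambda>x. cnj (u y) * (?k (heis_mult lam (- y) x) * g x)) \<in> borel_measurable borel"
      using kT(1)[of "- y", THEN L2_measurable] by measurable
    from heis_integral_left(1)[OF this, of lam y]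
    show "(\<integral>x. cnj (u y) * (?k (heis_mult lam (- y) x) * g x) \<partial>heis_vol) = (\<integral>x. cnj (u y) * (?k x * g (heis_mult lam y x)) \<partial>heis_vol)"
      by (simp only: heis_mult_cancel)
  qed
  also have "\<dots> = (\<integral>x. \<integral>y. cnj (u y) * (?k x * g (heis_mult lam y x)) \<partial>heis_vol \<partial>heis_vol)"
    by (rule heis_vol2.Fubini_integral[OF F1, symmetric])
  also have "\<dots> = (\<integral>x. G x * ?k x \<partial>heis_vol)" by (simp only: G_eq)
  finally show "L2_inner (heis_op lam \<epsilon> u) g = cnj (\<integral>x. G x * ?k x \<partial>heis_vol)"
    by (metis complex_cnj_cnj)
qed

definition szego_const :: "real ^ 'n::finite \<Rightarrow> real" where
  "szego_const lam = (\<Prod>j\<in>UNIV. \<bar>lam $ j\<bar>) / (2 * pi ^ (CARD('n) + 1)) * fact CARD('n)"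

lemma szego_const_pos: "(\<And>j. lam $ j > 0) \<Longrightarrow> szego_const lam > 0"
  unfolding szego_const_def by (intro mult_pos_pos divide_pos_pos prod_pos) (auto simp: less_imp_neq[THEN not_sym])

lemma heis_op_inner_Poisson:
  fixes lam :: "real ^ 'n::finite"
  assumes lam: "\<And>j. lam $ j > 0" and \<epsilon>: "\<epsilon> > 0" and u: "test_fun u" and g: "g \<in> weakly_CR lam"
  defines "G \<equiv> CR_pairing lam (\<lambda>x. cnj (u x)) g"
  shows "of_real (szego_const lam) * L2_inner (heis_op lam \<epsilon> u) g = cnj (\<integral>s. of_real (Poisson_kernel \<epsilon> s) * G (0, s) \<partial>lborel)"
proof -
  interpret classical_CR lam G "\<lambda>y h. \<integral>x. frechet_derivative (\<lambda>x. cnj (u x)) (at (heis_mult lam x (- y))) (- fst h, - snd h - heis_form lam (fst x) (fst h)) * g x \<partial>heis_vol"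
      "L2_norm (\<lambda>x. cnj (u x)) * L2_norm g"
    unfolding G_def by (rule classical_CR_pairing[OF lam test_fun_cnj[OF u] g])
  note [measurable] = borel_measurable_heis_kernel[OF lam \<epsilon>]
  let ?C = "pi ^ CARD('n) / (2 ^ CARD('n) * fact CARD('n) * (\<Prod>j\<in>UNIV. lam $ j))"
  have i: "integrable lborel (\<lambda>x. G x * heis_kernel lam \<epsilon> x)"
    using heis_op_inner(1)[OF lam \<epsilon> u g] by (subst (asm) integrable_heis_vol) (auto simp: G_def[symmetric])
  have "(\<integral>x. G x * heis_kernel lam \<epsilon> x \<partial>heis_vol) = 2 ^ CARD('n) *\<^sub>R (of_real (2 * pi * ?C) * (\<integral>s. of_real (Poisson_kernel \<epsilon> s) * G (0, s) \<partial>lborel))"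
    by (subst integral_heis_vol) (auto simp: Poisson_formula[OF \<epsilon> i])
  \<comment> \<open>The factor \<open>2 ^ CARD('n)\<close> is the density of \<open>heis_vol\<close>
    and cancels the one in \<open>?C\<close>; what remains to be inverted is
    \<open>2 pi^(n+1) / (n! prod lam)\<close>.\<close>
  moreover have "szego_const lam * (2 ^ CARD('n) * (2 * pi * ?C)) = 1"
  proof -
    have "(\<Prod>j\<in>UNIV. lam $ j) > 0" using lam by (simp add: prod_pos)
    moreover have "(\<Prod>j\<in>UNIV. \<bar>lam $ j\<bar>) = (\<Prod>j\<in>UNIV. lam $ j)"
      using lam by (intro prod.cong) (auto simp: less_imp_le)
    moreover have "\<forall>a. lam $ a \<noteq> 0" using lam by (metis less_irrefl)
    ultimately show ?thesis by (simp add: szego_const_def field_simps)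
  qed
  ultimately have "of_real (szego_const lam) * (\<integral>x. G x * heis_kernel lam \<epsilon> x \<partial>heis_vol) = (\<integral>s. of_real (Poisson_kernel \<epsilon> s) * G (0, s) \<partial>lborel)"
    by (simp only: scaleR_conv_of_real mult.assoc[symmetric] of_real_mult[symmetric] of_real_1 mult_1_left)
  from arg_cong[OF this, of cnj] show ?thesis
    unfolding heis_op_inner(2)[OF lam \<epsilon> u g] by (simp add: G_def)
qed

text \<open>\<open>min 1 |s|\<close> combines a Lipschitz bound for small \<open>s\<close> with the
  trivial bound for large \<open>s\<close>; \<open>|s|\<close> alone is not integrable against the
  Poisson kernel.\<close>

definition Poisson_error :: "real \<Rightarrow> real" where
  "Poisson_error \<epsilon> = (\<integral>s. Poisson_kernel \<epsilon> s * min 1 \<bar>s\<bar> \<partial>lborel)"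

lemma Poisson_kernel_nonneg: "\<epsilon> > 0 \<Longrightarrow> 0 \<le> Poisson_kernel \<epsilon> s"
  by (simp add: Poisson_kernel_def)

lemma Poisson_error_integrable:
  assumes "\<epsilon> > 0" shows "integrable lborel (\<lambda>s. Poisson_kernel \<epsilon> s * min 1 \<bar>s\<bar>)"
proof (rule Bochner_Integration.integrable_bound[OF Poisson_kernel_integral(1)[OF assms]])
  show "AE s in lborel. norm (Poisson_kernel \<epsilon> s * min 1 \<bar>s\<bar>) \<le> norm (Poisson_kernel \<epsilon> s)"
    using Poisson_kernel_nonneg[OF assms] by (intro AE_I2) (simp add: abs_mult mult_left_le)
qed measurable

text \<open>Rescaling \<open>s\<close> moves the parameter from the kernel into the bounded factor,
  after which the fixed kernel dominates.\<close>

lemma Poisson_error_tendsto_0: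
  assumes "\<And>k. \<epsilon> k > 0" "\<epsilon> \<longlonglongrightarrow> 0"
  shows "(\<lambda>k. Poisson_error (\<epsilon> k)) \<longlonglongrightarrow> 0"
proof -
  have eq: "Poisson_error (\<epsilon> k) = (\<integral>s. Poisson_kernel 1 s * min 1 \<bar>\<epsilon> k * s\<bar> \<partial>lborel)" for k
  proof -
    have "Poisson_error (\<epsilon> k) = \<bar>\<epsilon> k\<bar> *\<^sub>R (\<integral>s. Poisson_kernel (\<epsilon> k) (0 + \<epsilon> k * s) * min 1 \<bar>0 + \<epsilon> k * s\<bar> \<partial>lborel)"
      unfolding Poisson_error_def using assms(1)[of k] by (intro lborel_integral_real_affine) auto
    also have "\<dots> = (\<integral>s. \<epsilon> k * Poisson_kernel (\<epsilon> k) (\<epsilon> k * s) * min 1 \<bar>\<epsilon> k * s\<bar> \<partial>lborel)"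
      using assms(1)[of k] by (simp add: mult.assoc)
    finally show ?thesis by (simp only: Poisson_kernel_scale[OF assms(1)])
  qed
  have "(\<lambda>k. \<integral>s. Poisson_kernel 1 s * min 1 \<bar>\<epsilon> k * s\<bar> \<partial>lborel) \<longlonglongrightarrow> (\<integral>s. 0 \<partial>(lborel :: real measure))"
  proof (rule integral_dominated_convergence)
    show "integrable lborel (Poisson_kernel 1)" by (rule Poisson_kernel_integral) simp
    show "AE s in lborel. (\<lambda>k. Poisson_kernel 1 s * min 1 \<bar>\<epsilon> k * s\<bar>) \<longlonglongrightarrow> 0"
    proof (rule AE_I2)
      fix s
      have "(\<lambda>k. Poisson_kernel 1 s * min 1 \<bar>\<epsilon> k * s\<bar>) \<longlonglongrightarrow> Poisson_kernel 1 s * min 1 \<bar>0 * s\<bar>"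
        by (intro tendsto_intros assms)
      then show "(\<lambda>k. Poisson_kernel 1 s * min 1 \<bar>\<epsilon> k * s\<bar>) \<longlonglongrightarrow> 0" by simp
    qed
    show "AE s in lborel. norm (Poisson_kernel 1 s * min 1 \<bar>\<epsilon> k * s\<bar>) \<le> Poisson_kernel 1 s" for k
      using Poisson_kernel_nonneg[of 1] by (intro AE_I2) (simp add: abs_mult mult_left_le)
  qed measurable
  then show ?thesis by (simp add: eq)
qed

text \<open>The points \<open>(0, - s)\<close> are central and the form vanishes on them, so the
  shift is an ordinary translation and \<open>C\<close> does not depend on
  \<open>lam\<close>.\<close>

lemma vertical_translate_bound:
  fixes u :: "'n::finite heis \<Rightarrow> complex"
  assumes u: "test_fun u"
  obtains C where "C \<ge> 0" "\<And>lam s. L2_norm (\<lambda>x. u (heis_mult lam x (0, - s)) - u x) \<le> C * min 1 \<bar>s\<bar>"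
proof -
  obtain R where R: "R > 0" "\<And>x. norm x > R \<Longrightarrow> u x = 0" using test_fun_support[OF u] by blast
  obtain B where B: "B > 0" "\<And>x y. norm (u x - u y) \<le> B * norm (x - y)" using test_fun_Lipschitz[OF u] by blast
  let ?I = "indicator (cball (0::'n heis) (R + 1)) :: 'n heis \<Rightarrow> complex"
  have I: "?I \<in> L2" by (rule indicator_L2) auto
  \<comment> \<open>The first bound serves for \<open>|s| > 1\<close>; the second, a Lipschitz
    constant on a support enlarged by 1, serves for \<open>|s| \<le> 1\<close>.\<close>
  define C where "C = max (2 * L2_norm u) (B * L2_norm ?I)"
  show ?thesis
  proof (rule that[of C])
    show "C \<ge> 0" by (simp add: C_def le_max_iff_disj)
    fix lam :: "real ^ 'n" and s :: real
    have T: "(\<lambda>x. u (heis_mult lam x (0, - s))) \<in> L2" "L2_norm (\<lambda>x. u (heis_mult lam x (0, - s))) = L2_norm u"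
      by (rule L2_compose[OF lborel_distr_heis_mult_right measurable_heis_mult(2) test_fun_L2[OF u]])+
    show "L2_norm (\<lambda>x. u (heis_mult lam x (0, - s)) - u x) \<le> C * min 1 \<bar>s\<bar>"
    proof (cases "\<bar>s\<bar> \<le> 1")
      case False
      have "L2_norm (\<lambda>x. u (heis_mult lam x (0, - s)) - u x) \<le> L2_norm u + L2_norm u"
        using L2_norm_triangle[OF T(1) L2_scale[OF test_fun_L2[OF u], of "-1"]] by (simp add: T(2) L2_norm_def)
      then show ?thesis using False by (simp add: C_def)
    next
      case True
      have "L2_norm (\<lambda>x. u (heis_mult lam x (0, - s)) - u x) \<le> L2_norm (\<lambda>x. of_real (B * \<bar>s\<bar>) * ?I x)"
      proof (rule L2_norm_mono[OF L2_scale[OF I]])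
        show "(\<lambda>x. u (heis_mult lam x (0, - s)) - u x) \<in> borel_measurable borel"
          by (intro borel_measurable_diff L2_measurable[OF T(1)] test_fun_measurable[OF u])
        fix x :: "'n heis"
        have eq: "heis_mult lam x (0, - s) = x - (0, s)" by (simp add: heis_mult_def prod_eq_iff)
        show "norm (u (heis_mult lam x (0, - s)) - u x) \<le> norm (of_real (B * \<bar>s\<bar>) * ?I x)"
        proof (cases "norm x \<le> R + 1")
          case in_ball: True
          have "norm (u (x - (0, s)) - u x) \<le> B * norm (x - (0, s) - x)" by (rule B(2))
          then show ?thesis using in_ball B(1) by (simp add: eq norm_mult abs_mult)
        next
          case out: False
          then have "norm (x - (0, s)) > R" using norm_triangle_ineq2[of x "(0, s)"] True by simp
          then show ?thesis using out R(2) by (simp add: eq)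
        qed
      qed
      also have "\<dots> = \<bar>s\<bar> * (B * L2_norm ?I)" using B(1) by (simp add: L2_norm_scale norm_mult)
      also have "\<dots> \<le> \<bar>s\<bar> * C" by (intro mult_left_mono) (auto simp: C_def)
      finally show ?thesis using True by (simp add: mult.commute)
    qed
  qed
qed

text \<open>The difference is the conjugate of a Poisson mean of \<open>G(0, s) - G(0, 0)\<close>,
  as \<open>G(0, 0)\<close> is the conjugate of \<open>L2_inner u g\<close>. The constant depends
  neither on \<open>\<epsilon>\<close> nor on \<open>g\<close>, which enters through its norm only;
  this is what yields estimates in norm later.\<close>

lemma heis_op_inner_estimate:
  fixes lam :: "real ^ 'n::finite"
  assumes lam: "\<And>j. lam $ j > 0" and u: "test_fun u"
  obtains C where "C \<ge> 0" "\<And>\<epsilon> g. \<epsilon> > 0 \<Longrightarrow> g \<in> weakly_CR lam \<Longrightarrow>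
    norm (of_real (szego_const lam) * L2_inner (heis_op lam \<epsilon> u) g - L2_inner u g) \<le> C * Poisson_error \<epsilon> * L2_norm g"
proof -
  let ?u = "\<lambda>x. cnj (u x)"
  have cu: "test_fun ?u" by (rule test_fun_cnj[OF u])
  obtain C where C: "C \<ge> 0" "\<And>lam s. L2_norm (\<lambda>x. ?u (heis_mult lam x (0, - s)) - ?u x) \<le> C * min 1 \<bar>s\<bar>"
    using vertical_translate_bound[OF cu] by blast
  show ?thesis
  proof (rule that[OF C(1)])
    fix \<epsilon> :: real and g assume \<epsilon>: "\<epsilon> > 0" and g: "g \<in> weakly_CR lam"
    note gL2 = weakly_CR_L2[OF g]
    define G where "G = CR_pairing lam ?u g"
    interpret classical_CR lam G "\<lambda>y h. \<integral>x. frechet_derivative (\<lambda>x. cnj (u x)) (at (heis_mult lam x (- y))) (- fst h, - snd h - heis_form lam (fst x) (fst h)) * g x \<partial>heis_vol"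
        "L2_norm (\<lambda>x. cnj (u x)) * L2_norm g"
      unfolding G_def by (rule classical_CR_pairing[OF lam cu g])
    have G_eq: "G (0, s) = (\<integral>x. ?u (heis_mult lam x (0, - s)) * g x \<partial>heis_vol)" for s
      unfolding G_def using CR_pairing_eq[OF test_fun_measurable[OF cu] L2_measurable[OF gL2], of lam "(0, s)"] by simp
    have G0: "G (0, 0) = cnj (L2_inner u g)"
      unfolding L2_inner_def G_eq by (subst Bochner_Integration.integral_cnj[symmetric]) (simp add: zero_prod_def[symmetric])
    have T: "(\<lambda>x. ?u (heis_mult lam x (0, - s))) \<in> L2" for s
      by (rule L2_compose[OF lborel_distr_heis_mult_right measurable_heis_mult(2) test_fun_L2[OF cu]])
    have diff: "norm (G (0, s) - G (0, 0)) \<le> C * min 1 \<bar>s\<bar> * L2_norm g" for s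
    proof -
      have "G (0, s) - G (0, 0) = (\<integral>x. (?u (heis_mult lam x (0, - s)) - ?u x) * g x \<partial>heis_vol)"
        unfolding G_eq using L2_mult_integrable[OF T gL2, of s] L2_mult_integrable[OF test_fun_L2[OF cu] gL2]
        by (simp add: left_diff_distrib zero_prod_def[symmetric])
      also have "norm \<dots> \<le> L2_norm (\<lambda>x. ?u (heis_mult lam x (0, - s)) - ?u x) * L2_norm g"
        by (rule L2_Cauchy_Schwarz_mult[OF L2_diff[OF T test_fun_L2[OF cu]] gL2])
      also have "\<dots> \<le> C * min 1 \<bar>s\<bar> * L2_norm g" by (intro mult_right_mono C) simp
      finally show ?thesis .
    qed
    have iG: "integrable lborel (\<lambda>s. of_real (Poisson_kernel \<epsilon> s) * G (0, s))"
    proof (rule Bochner_Integration.integrable_bound)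
      show "integrable lborel (\<lambda>s. (L2_norm ?u * L2_norm g) * Poisson_kernel \<epsilon> s)"
        using Poisson_kernel_integral(1)[OF \<epsilon>] by simp
      show "AE s in lborel. norm (of_real (Poisson_kernel \<epsilon> s) * G (0, s)) \<le> norm ((L2_norm ?u * L2_norm g) * Poisson_kernel \<epsilon> s)"
        using bounded Poisson_kernel_nonneg[OF \<epsilon>] by (intro AE_I2) (simp add: norm_mult abs_mult mult.commute mult_left_mono)
    qed measurable
    have iP: "integrable lborel (\<lambda>s. of_real (Poisson_kernel \<epsilon> s) * G (0, 0))"
      using Poisson_kernel_integral(1)[OF \<epsilon>] by simp
    have "of_real (szego_const lam) * L2_inner (heis_op lam \<epsilon> u) g - L2_inner u g
        = cnj ((\<integral>s. of_real (Poisson_kernel \<epsilon> s) * G (0, s) \<partial>lborel) - G (0, 0))"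
      using G0 by (simp add: heis_op_inner_Poisson[OF lam \<epsilon> u g] G_def[symmetric])
    also have "G (0, 0) = (\<integral>s. of_real (Poisson_kernel \<epsilon> s) * G (0, 0) \<partial>lborel)"
      using Poisson_kernel_integral(2)[OF \<epsilon>] by simp
    also have "norm (cnj ((\<integral>s. of_real (Poisson_kernel \<epsilon> s) * G (0, s) \<partial>lborel) - (\<integral>s. of_real (Poisson_kernel \<epsilon> s) * G (0, 0) \<partial>lborel)))
        = norm (\<integral>s. of_real (Poisson_kernel \<epsilon> s) * (G (0, s) - G (0, 0)) \<partial>lborel)"
      unfolding complex_mod_cnj right_diff_distrib Bochner_Integration.integral_diff[OF iG iP] ..
    also have "\<dots> \<le> (\<integral>s. C * L2_norm g * (Poisson_kernel \<epsilon> s * min 1 \<bar>s\<bar>) \<partial>lborel)"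
    proof (rule norm_integral_le_integral)
      show "integrable lborel (\<lambda>s. C * L2_norm g * (Poisson_kernel \<epsilon> s * min 1 \<bar>s\<bar>))"
        using Poisson_error_integrable[OF \<epsilon>] by simp
      show "norm (of_real (Poisson_kernel \<epsilon> s) * (G (0, s) - G (0, 0))) \<le> C * L2_norm g * (Poisson_kernel \<epsilon> s * min 1 \<bar>s\<bar>)" for s
        using mult_left_mono[OF diff Poisson_kernel_nonneg[OF \<epsilon>]] Poisson_kernel_nonneg[OF \<epsilon>, of s]
        by (simp add: norm_mult mult_ac)
    qed
    also have "\<dots> = C * Poisson_error \<epsilon> * L2_norm g" by (simp add: Poisson_error_def)
    finally show "norm (of_real (szego_const lam) * L2_inner (heis_op lam \<epsilon> u) g - L2_inner u g) \<le> C * Poisson_error \<epsilon> * L2_norm g" .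
  qed
qed

subsection \<open>The pointwise limit\<close>

text \<open>The base of the power in the kernel, as a function of both points. The value at
  \<open>\<epsilon> = 0\<close> is used on its own, since the Laplace representation splits off the
  parameter.\<close>

definition heis_denominator :: "real ^ 'n::finite \<Rightarrow> real \<Rightarrow> 'n heis \<Rightarrow> 'n heis \<Rightarrow> complex" where
  "heis_denominator lam \<epsilon> x y = of_real (\<epsilon> + qform lam (fst (heis_mult lam (- x) y))) - \<i> * of_real (snd (heis_mult lam (- x) y))"

lemma heis_denominator_swap: "heis_denominator lam \<epsilon> x y = cnj (heis_denominator lam \<epsilon> y x)"
  using uminus_heis_mult[of lam "- x" y] by (simp add: heis_denominator_def prod_eq_iff heis_mult_def qform_def norm_minus_commute algebra_simps heis_form_commute[of lam "fst x" "fst y"])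

lemma heis_denominator_add: "heis_denominator lam \<epsilon> x y = of_real \<epsilon> + heis_denominator lam 0 x y"
  by (simp add: heis_denominator_def)

lemma continuous_on_heis_denominator [continuous_intros]:
  "continuous_on S f \<Longrightarrow> continuous_on S (\<lambda>p. heis_denominator lam \<epsilon> x (f p))"
  unfolding heis_denominator_def by (intro continuous_intros)

lemma Re_heis_denominator:
  assumes "\<And>j. lam $ j > 0" shows "\<epsilon> \<le> Re (heis_denominator lam \<epsilon> x y)"
  using qform_nonneg[OF assms] by (simp add: heis_denominator_def)

text \<open>Conjugate symmetry turns the known derivative in the first point into one in the
  second.\<close>

lemma heis_denominator_deriv_snd:
  obtains D where "(heis_denominator lam \<epsilon> x has_derivative D) (at y)" "D (0, 1) = - \<i>"
proof -
  have eq: "heis_denominator lam \<epsilon> x = (\<lambda>y. cnj (heis_denominator lam \<epsilon> y x))"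
    by (rule ext) (rule heis_denominator_swap)
  show ?thesis
    by (rule that[unfolded eq, OF has_derivative_cnj[OF heis_denominator_derivative(1)[where lam = lam and \<epsilon> = \<epsilon> and y = x and x = y, folded heis_denominator_def]]])
       simp
qed

text \<open>The variable \<open>\<eta>\<close> acts as a frequency in the last coordinate:
  \<open>n! / A^(n+1)\<close> is the integral of \<open>\<eta>^n exp (- \<eta> A)\<close> over the
  half-line, and \<open>\<epsilon>\<close> contributes only the factor
  \<open>exp (- \<eta> \<epsilon>)\<close>.\<close>

definition heis_Laplace :: "real ^ 'n::finite \<Rightarrow> ('n heis \<Rightarrow> complex) \<Rightarrow> 'n heis \<Rightarrow> real \<Rightarrow> complex" where
  "heis_Laplace lam u x \<eta> = (\<integral>y. exp (- (of_real \<eta> * heis_denominator lam 0 x y)) * u y \<partial>lborel)"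

lemma heis_Laplace_integrand:
  fixes lam :: "real ^ 'n::finite"
  assumes lam: "\<And>j. lam $ j > 0" and u: "test_fun u"
  shows "\<eta> \<ge> 0 \<Longrightarrow> norm (exp (- (of_real \<eta> * heis_denominator lam 0 x y)) * u y) \<le> norm (u y)"
    and "continuous_on UNIV (\<lambda>y. exp (- (of_real \<eta> * heis_denominator lam 0 x y)) * u y)"
    and "\<eta> \<ge> 0 \<Longrightarrow> norm (heis_Laplace lam u x \<eta>) \<le> (\<integral>y. norm (u y) \<partial>lborel)"
proof -
  show *: "norm (exp (- (of_real \<eta> * heis_denominator lam 0 x y)) * u y) \<le> norm (u y)" if "\<eta> \<ge> 0" for y
  proof -
    have "0 \<le> \<eta> * Re (heis_denominator lam 0 x y)"
      using that Re_heis_denominator[OF lam, of 0 x y] by (intro mult_nonneg_nonneg)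
    then show ?thesis by (simp add: norm_mult mult_left_le_one_le)
  qed
  show "continuous_on UNIV (\<lambda>y. exp (- (of_real \<eta> * heis_denominator lam 0 x y)) * u y)"
    by (intro continuous_intros test_fun_continuous[OF u])
  show "norm (heis_Laplace lam u x \<eta>) \<le> (\<integral>y. norm (u y) \<partial>lborel)" if "\<eta> \<ge> 0"
    unfolding heis_Laplace_def
    by (rule norm_integral_le_integral[OF integrable_norm[OF test_fun_integrable[OF u]] *[OF that]])
qed

text \<open>The denominator has vertical derivative \<open>- i\<close>, so that of the exponential
  is \<open>i \<eta>\<close> times itself; integration by parts moves it to
  \<open>u\<close>.\<close>

lemma heis_Laplace_parts:
  fixes lam :: "real ^ 'n::finite"
  assumes u: "test_fun u"
  shows "heis_Laplace lam (\<lambda>y. frechet_derivative u (at y) (0, 1)) x \<eta> = - (\<i> * of_real \<eta>) * heis_Laplace lam u x \<eta>"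
proof -
  let ?e = "\<lambda>y. exp (- (of_real \<eta> * heis_denominator lam 0 x y))"
  let ?u' = "\<lambda>y. frechet_derivative u (at y)"
  obtain D where D: "\<And>y. (heis_denominator lam 0 x has_derivative D y) (at y)" "\<And>y. D y (0, 1) = - \<i>"
  proof -
    have "\<forall>y. \<exists>D. (heis_denominator lam 0 x has_derivative D) (at y) \<and> D (0, 1) = - \<i>"
      using heis_denominator_deriv_snd by metis
    from choice[OF this] show ?thesis using that by blast
  qed
  obtain R where R: "\<And>y. norm y > R \<Longrightarrow> u y = 0" using test_fun_support[OF u] by blast
  have de: "(?e has_derivative (\<lambda>h. ?e y * - (of_real \<eta> * D y h))) (at y)" for y
    using has_derivative_compose[OF has_derivative_minus[OF has_derivative_mult_right[OF D(1)]] DERIV_exp[unfolded has_field_derivative_def]]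
    by simp
  have d: "((\<lambda>y. ?e y * u y) has_derivative (\<lambda>h. ?e y * ?u' y h + ?e y * - (of_real \<eta> * D y h) * u y)) (at y)" for y
    by (rule has_derivative_mult[OF de test_fun_has_derivative[OF u]])
  have eq: "?e y * ?u' y (0, 1) + ?e y * - (of_real \<eta> * D y (0, 1)) * u y = ?e y * ?u' y (0, 1) + \<i> * of_real \<eta> * (?e y * u y)" for y
    by (simp add: D(2))
  have c1: "continuous_on UNIV (\<lambda>y. ?e y * ?u' y (0, 1))" and c2: "continuous_on UNIV (\<lambda>y. ?e y * u y)"
    by (intro continuous_intros test_fun_continuous u test_fun_derivative)+
  have "(\<integral>y. ?e y * ?u' y (0, 1) + ?e y * - (of_real \<eta> * D y (0, 1)) * u y \<partial>lborel) = 0"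
  proof (rule integral_directional_derivative_eq_0[OF d])
    show "continuous_on UNIV (\<lambda>y. ?e y * ?u' y (0, 1) + ?e y * - (of_real \<eta> * D y (0, 1)) * u y)"
      unfolding eq by (intro continuous_intros c1 c2)
    show "?e y * u y = 0" if "norm y > R" for y using R[OF that] by simp
  qed
  moreover have "integrable lborel (\<lambda>y. ?e y * ?u' y (0, 1))" "integrable lborel (\<lambda>y. ?e y * u y)"
    using continuous_bounded_support_integrable[OF c1, of R] continuous_bounded_support_integrable[OF c2, of R] R
      frechet_derivative_outside_support[of R u, OF R] by auto
  ultimately have "(\<integral>y. ?e y * ?u' y (0, 1) \<partial>lborel) + \<i> * of_real \<eta> * (\<integral>y. ?e y * u y \<partial>lborel) = 0"
    unfolding eq by simp
  then show ?thesis by (simp add: heis_Laplace_def add_eq_0_iff)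
qed

text \<open>Each power of \<open>\<eta>\<close> costs one vertical derivative of \<open>u\<close>;
  hence the induction ranges over all test functions.\<close>

lemma heis_Laplace_decay:
  fixes lam :: "real ^ 'n::finite"
  assumes lam: "\<And>j. lam $ j > 0"
  shows "test_fun u \<Longrightarrow> \<exists>C. \<forall>\<eta>\<ge>0. norm (of_real \<eta> ^ N * heis_Laplace lam u x \<eta>) \<le> C"
proof (induction N arbitrary: u)
  case 0
  show ?case
    by (rule exI[of _ "\<integral>y. norm (u y) \<partial>lborel"]) (use heis_Laplace_integrand(3)[OF lam 0] in simp)
next
  case (Suc N)
  obtain C where C: "\<And>\<eta>. \<eta> \<ge> 0 \<Longrightarrow> norm (of_real \<eta> ^ N * heis_Laplace lam (\<lambda>y. frechet_derivative u (at y) (0, 1)) x \<eta>) \<le> C"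
    using Suc.IH[OF test_fun_derivative[OF Suc.prems]] by blast
  have "norm (of_real \<eta> ^ Suc N * heis_Laplace lam u x \<eta>) \<le> C" if "\<eta> \<ge> 0" for \<eta>
    using C[OF that] unfolding heis_Laplace_parts[OF Suc.prems] by (simp add: norm_mult mult_ac)
  then show ?case by blast
qed

lemma heis_op_Laplace:
  fixes lam :: "real ^ 'n::finite"
  assumes lam: "\<And>j. lam $ j > 0" and u: "test_fun u" and \<epsilon>: "\<epsilon> > 0"
  shows "fact CARD('n) * heis_op lam \<epsilon> u x =
    2 ^ CARD('n) * (\<integral>\<eta>. indicator {0..} \<eta> *\<^sub>R (of_real \<eta> ^ CARD('n) * exp (- (of_real \<eta> * of_real \<epsilon>)) * heis_Laplace lam u x \<eta>) \<partial>lborel)"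
proof -
  let ?n = "CARD('n)" and ?A = "heis_denominator lam 0 x"
  define h where "h y \<eta> = indicator {0..} \<eta> *\<^sub>R (of_real \<eta> ^ ?n * exp (- (of_real \<eta> * heis_denominator lam \<epsilon> x y)) * u y)" for y and \<eta> :: real
  have h_eq: "h y \<eta> = indicator {0..} \<eta> *\<^sub>R (of_real \<eta> ^ ?n * exp (- (of_real \<eta> * of_real \<epsilon>)) * (exp (- (of_real \<eta> * ?A y)) * u y))" for y \<eta>
    by (simp add: h_def heis_denominator_add[of lam \<epsilon>] distrib_left exp_add[symmetric] mult.assoc[symmetric] mult_exp_exp)
  note [measurable] = test_fun_measurable[OF u]
  have h_meas [measurable]: "(\<lambda>(y, \<eta>). h y \<eta>) \<in> borel_measurable (borel \<Otimes>\<^sub>M borel)"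
  proof -
    have [measurable]: "(\<lambda>p::'n heis \<times> real. of_real (snd p) ^ ?n * exp (- (of_real (snd p) * heis_denominator lam \<epsilon> x (fst p)))) \<in> borel_measurable (borel \<Otimes>\<^sub>M borel)"
      unfolding borel_prod by (intro borel_measurable_continuous_onI continuous_intros)
    show ?thesis unfolding h_def case_prod_unfold by measurable
  qed
  have h_int: "integrable (lborel \<Otimes>\<^sub>M lborel) (\<lambda>(y, \<eta>). h y \<eta>)"
  proof (rule Bochner_Integration.integrable_bound)
    show "integrable (lborel \<Otimes>\<^sub>M lborel) (\<lambda>p. norm (u (fst p)) * (indicator {0..} (snd p) * (snd p ^ ?n * exp (- (snd p * \<epsilon>)))))"
      unfolding lborel_prod by (rule integrable_prod_mult[OF integrable_norm[OF test_fun_integrable[OF u]] integrable_power_mult_exp_Ici[OF \<epsilon>]])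
    have "norm (h y \<eta>) \<le> norm (u y) * (indicator {0..} \<eta> * (\<eta> ^ ?n * exp (- (\<eta> * \<epsilon>))))" for y \<eta>
    proof (cases "\<eta> \<ge> 0")
      case True
      have "norm (of_real \<eta> ^ ?n * exp (- (of_real \<eta> * of_real \<epsilon>)) :: complex) = \<eta> ^ ?n * exp (- (\<eta> * \<epsilon>))"
        using norm_power_mult_exp[of \<eta> ?n "of_real \<epsilon>"] True by simp
      then have "norm (h y \<eta>) = (\<eta> ^ ?n * exp (- (\<eta> * \<epsilon>))) * norm (exp (- (of_real \<eta> * ?A y)) * u y)"
        unfolding h_eq using True by (simp add: norm_mult)
      also have "\<dots> \<le> (\<eta> ^ ?n * exp (- (\<eta> * \<epsilon>))) * norm (u y)"
        using True by (intro mult_left_mono heis_Laplace_integrand(1)[OF lam u]) auto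
      finally show ?thesis using True by (simp add: mult.commute)
    qed (simp add: h_def)
    then show "AE p in lborel \<Otimes>\<^sub>M lborel. norm (case p of (y, \<eta>) \<Rightarrow> h y \<eta>) \<le> norm (norm (u (fst p)) * (indicator {0..} (snd p) * (snd p ^ ?n * exp (- (snd p * \<epsilon>)))))"
      unfolding case_prod_unfold real_norm_def by (intro AE_I2) (rule order_trans[OF _ abs_ge_self])
  qed measurable
  have "fact ?n * heis_op lam \<epsilon> u x = 2 ^ ?n * (\<integral>y. fact ?n * (heis_kernel lam \<epsilon> (heis_mult lam (- x) y) * u y) \<partial>lborel)"
  proof -
    have [measurable]: "(\<lambda>y. heis_kernel lam \<epsilon> (heis_mult lam (- x) y)) \<in> borel_measurable borel"
      by (rule measurable_compose[OF measurable_heis_mult(1) borel_measurable_heis_kernel[OF lam \<epsilon>]])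
    show ?thesis unfolding heis_op_def by (subst integral_heis_vol) (auto simp: scaleR_conv_of_real)
  qed
  also have "(\<integral>y. fact ?n * (heis_kernel lam \<epsilon> (heis_mult lam (- x) y) * u y) \<partial>lborel) = (\<integral>y. \<integral>\<eta>. h y \<eta> \<partial>lborel \<partial>lborel)"
  proof (rule Bochner_Integration.integral_cong[OF refl])
    fix y
    have R: "Re (heis_denominator lam \<epsilon> x y) > 0" using Re_heis_denominator[OF lam, of \<epsilon> x y] \<epsilon> by linarith
    have "(\<integral>\<eta>. h y \<eta> \<partial>lborel) = (\<integral>\<eta>. indicator {0..} \<eta> *\<^sub>R (of_real \<eta> ^ ?n * exp (- (of_real \<eta> * heis_denominator lam \<epsilon> x y))) * u y \<partial>lborel)"
      by (simp add: h_def)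
    also have "\<dots> = fact ?n / heis_denominator lam \<epsilon> x y ^ Suc ?n * u y"
      by (simp only: integral_mult_left_zero Laplace_integral_power(2)[OF R])
    finally show "fact ?n * (heis_kernel lam \<epsilon> (heis_mult lam (- x) y) * u y) = (\<integral>\<eta>. h y \<eta> \<partial>lborel)"
      by (simp add: heis_kernel_def heis_denominator_def)
  qed
  also have "\<dots> = (\<integral>\<eta>. \<integral>y. h y \<eta> \<partial>lborel \<partial>lborel)"
    by (rule lborel_pair.Fubini_integral[OF h_int, symmetric])
  also have "\<dots> = (\<integral>\<eta>. indicator {0..} \<eta> *\<^sub>R (of_real \<eta> ^ ?n * exp (- (of_real \<eta> * of_real \<epsilon>)) * heis_Laplace lam u x \<eta>) \<partial>lborel)"
    unfolding h_eq heis_Laplace_def by simp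
  finally show ?thesis .
qed

text \<open>The limit cannot be taken inside the integral over \<open>y\<close>, since at
  \<open>\<epsilon> = 0\<close> the kernel is singular at \<open>y = x\<close> and not integrable
  there. In the Laplace representation the singularity becomes behaviour at large
  \<open>\<eta>\<close>, where the decay is rapid.\<close>

lemma heis_op_convergent:
  fixes lam :: "real ^ 'n::finite"
  assumes lam: "\<And>j. lam $ j > 0" and u: "test_fun u"
  obtains l where "((\<lambda>\<epsilon>. heis_op lam \<epsilon> u x) \<longlongrightarrow> l) (at_right 0)"
proof -
  let ?n = "CARD('n)"
  define \<Phi> where "\<Phi> \<eta> = indicator {0..} \<eta> *\<^sub>R (of_real \<eta> ^ ?n * heis_Laplace lam u x \<eta>)" for \<eta>
  define F where "F \<epsilon> = (\<integral>\<eta>. exp (- (of_real \<eta> * of_real \<epsilon>)) * \<Phi> \<eta> \<partial>lborel)" for \<epsilon> :: real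
  obtain C1 where C1: "\<And>\<eta>. \<eta> \<ge> 0 \<Longrightarrow> norm (of_real \<eta> ^ ?n * heis_Laplace lam u x \<eta>) \<le> C1"
    using heis_Laplace_decay[OF lam u] by blast
  \<comment> \<open>Two powers more than in the first bound: together they dominate by a multiple of
    \<open>1 / (1 + \<eta>^2)\<close>.\<close>
  obtain C2 where C2: "\<And>\<eta>. \<eta> \<ge> 0 \<Longrightarrow> norm (of_real \<eta> ^ (?n + 2) * heis_Laplace lam u x \<eta>) \<le> C2"
    using heis_Laplace_decay[OF lam u] by blast
  have C: "C1 \<ge> 0" "C2 \<ge> 0" using order_trans[OF norm_ge_zero C1[of 0]] order_trans[OF norm_ge_zero C2[of 0]] by auto
  have \<Phi>_le: "norm (\<Phi> \<eta>) \<le> (C1 + C2) * (1 / (1 + \<eta>\<^sup>2))" for \<eta>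
  proof (cases "\<eta> \<ge> 0")
    case True
    let ?a = "norm (of_real \<eta> ^ ?n * heis_Laplace lam u x \<eta>)"
    have "?a * \<eta>\<^sup>2 \<le> C2" using C2[OF True] True by (simp add: norm_mult power_add mult_ac power2_eq_square norm_power)
    then have "?a * (1 + \<eta>\<^sup>2) \<le> C1 + C2" using C1[OF True] by (simp add: distrib_left)
    moreover have "1 + \<eta>\<^sup>2 > 0" by (simp add: add_pos_nonneg)
    ultimately show ?thesis using True by (simp add: \<Phi>_def pos_le_divide_eq)
  next
    case False
    then show ?thesis using C by (simp add: \<Phi>_def add_nonneg_nonneg)
  qed
  have \<Phi>_meas [measurable]: "\<Phi> \<in> borel_measurable borel"
  proof -
    note [measurable] = test_fun_measurable[OF u]
    have [measurable]: "(\<lambda>p::real \<times> 'n heis. exp (- (of_real (fst p) * heis_denominator lam 0 x (snd p)))) \<in> borel_measurable (borel \<Otimes>\<^sub>M borel)"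
      unfolding borel_prod by (intro borel_measurable_continuous_onI continuous_intros)
    have "(\<lambda>(\<eta>, y). exp (- (of_real \<eta> * heis_denominator lam 0 x y)) * u y) \<in> borel_measurable (borel \<Otimes>\<^sub>M lborel)"
      unfolding case_prod_unfold by measurable
    from lborel.borel_measurable_lebesgue_integral[OF this]
    have [measurable]: "heis_Laplace lam u x \<in> borel_measurable borel" unfolding heis_Laplace_def[abs_def] by simp
    show ?thesis unfolding \<Phi>_def by measurable
  qed
  have int: "integrable lborel (\<lambda>\<eta>. (C1 + C2) * (1 / (1 + \<eta>\<^sup>2)))"
    by (rule integrable_mult_right[OF integral_inverse_1_plus_square(1)])
  have lim: "(F \<longlongrightarrow> F 0) (at_right 0)"
    unfolding tendsto_at_iff_sequentially
  proof (intro allI impI)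
    fix X :: "nat \<Rightarrow> real" assume X: "\<forall>i. X i \<in> {0<..} - {0}" "X \<longlonglongrightarrow> 0"
    show "(F \<circ> X) \<longlonglongrightarrow> F 0" unfolding o_def F_def
    proof (rule integral_dominated_convergence[OF _ _ int])
      show "AE \<eta> in lborel. (\<lambda>i. exp (- (of_real \<eta> * of_real (X i))) * \<Phi> \<eta>) \<longlonglongrightarrow> exp (- (of_real \<eta> * of_real 0)) * \<Phi> \<eta>"
        by (intro AE_I2 tendsto_intros X)
      show "AE \<eta> in lborel. norm (exp (- (of_real \<eta> * of_real (X i))) * \<Phi> \<eta>) \<le> (C1 + C2) * (1 / (1 + \<eta>\<^sup>2))" for i
      proof (rule AE_I2)
        fix \<eta> :: real
        have "norm (exp (- (of_real \<eta> * of_real (X i))) * \<Phi> \<eta>) \<le> 1 * norm (\<Phi> \<eta>)"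
        proof (cases "\<eta> \<ge> 0")
          case True
          then have "0 \<le> \<eta> * X i" using X(1) by (intro mult_nonneg_nonneg) (auto simp: less_imp_le)
          then show ?thesis unfolding norm_mult by (intro mult_right_mono) auto
        qed (simp add: \<Phi>_def)
        then show "norm (exp (- (of_real \<eta> * of_real (X i))) * \<Phi> \<eta>) \<le> (C1 + C2) * (1 / (1 + \<eta>\<^sup>2))"
          using \<Phi>_le[of \<eta>] by linarith
      qed
    qed measurable
  qed
  have eq: "heis_op lam \<epsilon> u x = 2 ^ ?n / fact ?n * F \<epsilon>" if "\<epsilon> > 0" for \<epsilon>
  proof -
    have "fact ?n * heis_op lam \<epsilon> u x = 2 ^ ?n * F \<epsilon>"
      unfolding heis_op_Laplace[OF lam u that] F_def \<Phi>_def
      by (intro arg_cong[where f = "(*) (2 ^ ?n)"] Bochner_Integration.integral_cong refl) (simp add: mult_ac)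
    then show ?thesis by (simp add: field_simps)
  qed
  have "((\<lambda>\<epsilon>. 2 ^ ?n / fact ?n * F \<epsilon>) \<longlongrightarrow> 2 ^ ?n / fact ?n * F 0) (at_right 0)"
    by (intro tendsto_intros lim)
  then have "((\<lambda>\<epsilon>. heis_op lam \<epsilon> u x) \<longlongrightarrow> 2 ^ ?n / fact ?n * F 0) (at_right 0)"
    by (rule Lim_transform_eventually) (auto simp: eq eventually_at_right_field intro!: exI[of _ 1])
  then show ?thesis by (rule that)
qed

text \<open>\<open>Lim\<close> carries information only once the limit exists, which
  \<open>heis_op_convergent\<close> provides. Positivity of \<open>lam\<close> removes the absolute
  values in the phase and identifies it with the denominator.\<close>

lemma I_phi_test_eq_limit:
  fixes lam :: "real ^ 'n::finite"
  assumes lam: "\<And>j. lam $ j > 0" and u: "test_fun u"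
  shows "((\<lambda>\<epsilon>. heis_op lam \<epsilon> u x) \<longlongrightarrow> I_phi_test lam u x) (at_right 0)"
proof -
  have eq: "- \<i> * (phi_minus lam x y + \<i> * of_real \<epsilon>) = heis_denominator lam \<epsilon> x y" for \<epsilon> y
  proof -
    have q: "(\<Sum>j\<in>UNIV. \<bar>lam $ j\<bar> * (norm (fst x $ j - fst y $ j))\<^sup>2) = qform lam (fst y - fst x)"
      unfolding qform_def using lam by (intro sum.cong) (auto simp: norm_minus_commute less_imp_le)
    have s: "(\<Sum>j\<in>UNIV. of_real (lam $ j) * (cnj (fst x $ j) * (fst y $ j) - (fst x $ j) * cnj (fst y $ j))) = \<i> * of_real (heis_form lam (fst x) (fst y))"
      unfolding heis_form_def sum_distrib_left of_real_sum
      by (intro sum.cong refl) (simp add: complex_eq_iff algebra_simps)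
    show ?thesis unfolding phi_minus_def q s
      by (simp add: heis_denominator_def heis_mult_def algebra_simps)
  qed
  have op: "(\<integral>y. 1 / (- \<i> * (phi_minus lam x y + \<i> * of_real \<epsilon>)) ^ (CARD('n) + 1) * u y \<partial>heis_vol) = heis_op lam \<epsilon> u x" for \<epsilon>
    unfolding eq heis_op_def heis_kernel_def heis_denominator_def by simp
  obtain l where l: "((\<lambda>\<epsilon>. heis_op lam \<epsilon> u x) \<longlongrightarrow> l) (at_right 0)"
    using heis_op_convergent[OF lam u] by blast
  then have "I_phi_test lam u x = l"
    unfolding I_phi_test_def op by (intro tendsto_Lim) auto
  then show ?thesis using l by simp
qed

subsection \<open>The orthogonal projection\<close>

lemma L2_inner_scale_left: "L2_inner (\<lambda>x. c * u x) g = c * L2_inner u g"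
  by (simp add: L2_inner_def mult.assoc)

lemma weakly_CR_scale: "u \<in> weakly_CR lam \<Longrightarrow> (\<lambda>x. c * u x) \<in> weakly_CR lam"
  by (auto simp: weakly_CR_def L2_scale mult.assoc)

lemma L2_tendsto_inner:
  assumes "\<And>k. U k \<in> L2" "v \<in> L2" "g \<in> L2" "L2_tendsto U v"
  shows "(\<lambda>k. L2_inner (U k) g) \<longlonglongrightarrow> L2_inner v g"
proof -
  have "(\<lambda>k. L2_norm (\<lambda>x. U k x - v x) * L2_norm g) \<longlonglongrightarrow> 0 * L2_norm g"
    using assms(4) unfolding L2_tendsto_def by (intro tendsto_intros)
  then have lim: "(\<lambda>k. L2_norm (\<lambda>x. U k x - v x) * L2_norm g) \<longlonglongrightarrow> 0" by simp
  have "norm (L2_inner (U k) g - L2_inner v g) \<le> L2_norm (\<lambda>x. U k x - v x) * L2_norm g" for k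
    using L2_Cauchy_Schwarz[OF L2_diff[OF assms(1,2)] assms(3)] by (simp only: L2_inner_diff_left[OF assms(1,2,3)])
  then have "(\<lambda>k. L2_inner (U k) g - L2_inner v g) \<longlonglongrightarrow> 0"
    by (intro Lim_null_comparison[OF always_eventually lim] allI)
  then show ?thesis by (simp add: LIM_zero_iff)
qed

lemma L2_tendsto_Cauchy:
  assumes "\<And>k. U k \<in> L2" "u \<in> L2" "L2_tendsto U u" "e > 0"
  shows "\<exists>N. \<forall>k\<ge>N. \<forall>l\<ge>N. L2_norm (\<lambda>x. U k x - U l x) < e"
proof -
  obtain N where N: "\<And>k. k \<ge> N \<Longrightarrow> L2_norm (\<lambda>x. U k x - u x) < e / 2"
    using LIMSEQ_D[OF assms(3)[unfolded L2_tendsto_def], of "e / 2"] assms(4) by auto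
  have "L2_norm (\<lambda>x. U k x - U l x) < e" if "k \<ge> N" "l \<ge> N" for k l
    using L2_norm_triangle_diff[OF assms(1)[of k] assms(2) assms(1)[of l]] N[OF that(1)] N[OF that(2)]
    by (simp add: L2_norm_minus_commute[of u])
  then show ?thesis by blast
qed

text \<open>Take \<open>g = v\<close>: for an element of the kernel, pairings within the kernel
  already control the norm.\<close>

lemma weakly_CR_norm_le:
  assumes "v \<in> weakly_CR lam" "B \<ge> 0" and le: "\<And>g. g \<in> weakly_CR lam \<Longrightarrow> norm (L2_inner v g) \<le> B * L2_norm g"
  shows "L2_norm v \<le> B"
proof (cases "L2_norm v = 0")
  case False
  then have pos: "L2_norm v > 0" using L2_norm_nonneg[of v] by linarith
  have "(L2_norm v)\<^sup>2 \<le> B * L2_norm v"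
    using le[OF assms(1)] unfolding L2_inner_self norm_of_real by simp
  then show ?thesis using pos by (simp add: power2_eq_square)
qed (use assms in simp)

text \<open>A relation rather than a function, because projections are first available for test
  functions only and are determined up to null sets.\<close>

definition is_projection :: "real ^ 'n::finite \<Rightarrow> ('n heis \<Rightarrow> complex) \<Rightarrow> ('n heis \<Rightarrow> complex) \<Rightarrow> bool" where
  "is_projection lam u v \<longleftrightarrow> v \<in> weakly_CR lam \<and> (\<forall>g\<in>weakly_CR lam. L2_inner u g = L2_inner v g)"

text \<open>The difference of the projections lies in the kernel, so its norm can be read off from
  pairings with kernel elements, where it acts like \<open>u - u'\<close>.\<close>

lemma is_projection_contraction:
  assumes "u \<in> L2" "u' \<in> L2" "is_projection lam u v" "is_projection lam u' v'"
  shows "L2_norm (\<lambda>x. v x - v' x) \<le> L2_norm (\<lambda>x. u x - u' x)"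
proof (rule weakly_CR_norm_le)
  have v: "v \<in> weakly_CR lam" "v' \<in> weakly_CR lam" using assms by (auto simp: is_projection_def)
  then show "(\<lambda>x. v x - v' x) \<in> weakly_CR lam" by (rule weakly_CR_diff)
  fix g assume g: "g \<in> weakly_CR lam"
  have "L2_inner (\<lambda>x. v x - v' x) g = L2_inner (\<lambda>x. u x - u' x) g"
    using assms g v by (simp add: L2_inner_diff_left weakly_CR_L2 is_projection_def)
  then show "norm (L2_inner (\<lambda>x. v x - v' x) g) \<le> L2_norm (\<lambda>x. u x - u' x) * L2_norm g"
    using L2_Cauchy_Schwarz[OF L2_diff[OF assms(1,2)] weakly_CR_L2[OF g]] by simp
qed simp

lemma is_projection_unique:
  assumes "u \<in> L2" "is_projection lam u v" "is_projection lam u v'"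
  shows "AE x in heis_vol. v x = v' x"
proof -
  have "L2_norm (\<lambda>x. v x - v' x) \<le> 0"
    using is_projection_contraction[OF assms(1,1,2,3)] by (simp add: L2_norm_def)
  then have "L2_norm (\<lambda>x. v x - v' x) = 0" using L2_norm_nonneg order_antisym by blast
  moreover have "(\<lambda>x. v x - v' x) \<in> L2"
    using assms by (intro L2_diff weakly_CR_L2) (auto simp: is_projection_def)
  ultimately show ?thesis by (simp add: L2_norm_eq_0_iff)
qed

text \<open>Differences of the scaled regularised functions lie in the kernel and have small
  pairings there, so the sequence is Cauchy. The limit has the same inner products with the kernel
  as \<open>u\<close>, and an almost everywhere convergent subsequence identifies it with the
  pointwise limit.\<close>

lemma projection_test_fun:
  fixes lam :: "real ^ 'n::finite"
  assumes lam: "\<And>j. lam $ j > 0" and u: "test_fun u"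
  obtains v where "is_projection lam u v" "AE x in heis_vol. v x = of_real (szego_const lam) * I_phi_test lam u x"
proof -
  define \<epsilon> where "\<epsilon> k = inverse (real (Suc k))" for k
  have \<epsilon>: "\<epsilon> k > 0" "\<epsilon> \<longlonglongrightarrow> 0" for k
    unfolding \<epsilon>_def[abs_def] using LIMSEQ_inverse_real_of_nat by auto
  define U where "U k x = of_real (szego_const lam) * heis_op lam (\<epsilon> k) u x" for k x
  have U: "U k \<in> weakly_CR lam" for k
    unfolding U_def by (intro weakly_CR_scale heis_op_weakly_CR lam \<epsilon> u)
  have U_L2: "U k \<in> L2" for k by (rule weakly_CR_L2[OF U])
  obtain C where C: "C \<ge> 0" "\<And>\<epsilon> g. \<epsilon> > 0 \<Longrightarrow> g \<in> weakly_CR lam \<Longrightarrow>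
      norm (of_real (szego_const lam) * L2_inner (heis_op lam \<epsilon> u) g - L2_inner u g) \<le> C * Poisson_error \<epsilon> * L2_norm g"
    using heis_op_inner_estimate[OF lam u] by blast
  define E where "E k = C * Poisson_error (\<epsilon> k)" for k
  have E_lim: "E \<longlonglongrightarrow> 0"
    unfolding E_def[abs_def] using tendsto_mult[OF tendsto_const[of C] Poisson_error_tendsto_0[OF \<epsilon>]] by simp
  have E_nonneg: "E k \<ge> 0" for k
    unfolding E_def Poisson_error_def using C(1) Poisson_kernel_nonneg[OF \<epsilon>(1)]
    by (intro mult_nonneg_nonneg integral_nonneg) auto
  have est: "norm (L2_inner (U k) g - L2_inner u g) \<le> E k * L2_norm g" if "g \<in> weakly_CR lam" for k g
    using C(2)[OF \<epsilon>(1) that, of k] by (simp add: U_def[abs_def] L2_inner_scale_left E_def)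
  have diff: "L2_norm (\<lambda>x. U k x - U l x) \<le> E k + E l" for k l
  proof (rule weakly_CR_norm_le[OF weakly_CR_diff[OF U U]])
    fix g assume g: "g \<in> weakly_CR lam"
    \<comment> \<open>Both pairings are compared with \<open>L2_inner u g\<close>, which
      cancels.\<close>
    have "L2_inner (\<lambda>x. U k x - U l x) g = (L2_inner (U k) g - L2_inner u g) - (L2_inner (U l) g - L2_inner u g)"
      by (simp add: L2_inner_diff_left U_L2 weakly_CR_L2[OF g])
    also have "norm \<dots> \<le> E k * L2_norm g + E l * L2_norm g"
      by (intro order_trans[OF norm_triangle_ineq4] add_mono est g)
    finally show "norm (L2_inner (\<lambda>x. U k x - U l x) g) \<le> (E k + E l) * L2_norm g" by (simp add: distrib_right)
  qed (simp add: E_nonneg)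
  have "\<exists>N. \<forall>k\<ge>N. \<forall>l\<ge>N. L2_norm (\<lambda>x. U k x - U l x) < e" if e: "e > 0" for e
  proof -
    obtain N where N: "\<And>k. k \<ge> N \<Longrightarrow> norm (E k) < e / 2"
      using LIMSEQ_D[OF E_lim half_gt_zero[OF e]] unfolding diff_0_right by blast
    have "L2_norm (\<lambda>x. U k x - U l x) < e" if "k \<ge> N" "l \<ge> N" for k l
      using diff[of k l] N[OF that(1)] N[OF that(2)] by simp
    then show ?thesis by blast
  qed
  from L2_complete[of U, OF U_L2 this]
  obtain v r where v: "v \<in> L2" "L2_tendsto U v" "strict_mono r" "AE x in heis_vol. (\<lambda>k. U (r k) x) \<longlonglongrightarrow> v x" by blast
  show ?thesis
  proof (rule that)
    have "L2_inner u g = L2_inner v g" if g: "g \<in> weakly_CR lam" for g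
    proof (rule LIMSEQ_unique)
      show "(\<lambda>k. L2_inner (U k) g) \<longlonglongrightarrow> L2_inner v g"
        by (rule L2_tendsto_inner[OF U_L2 v(1) weakly_CR_L2[OF g] v(2)])
      have lim: "(\<lambda>k. E k * L2_norm g) \<longlonglongrightarrow> 0"
        using tendsto_mult[OF E_lim tendsto_const[of "L2_norm g"]] by simp
      have "(\<lambda>k. L2_inner (U k) g - L2_inner u g) \<longlonglongrightarrow> 0"
        by (rule Lim_null_comparison[OF always_eventually lim]) (rule allI, rule est[OF g])
      then show "(\<lambda>k. L2_inner (U k) g) \<longlonglongrightarrow> L2_inner u g" by (simp add: LIM_zero_iff)
    qed
    then show "is_projection lam u v"
      using weakly_CR_closed[OF U v(1,2)] by (simp add: is_projection_def)
    show "AE x in heis_vol. v x = of_real (szego_const lam) * I_phi_test lam u x"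
      using v(4)
    proof eventually_elim
      fix x assume x: "(\<lambda>k. U (r k) x) \<longlonglongrightarrow> v x"
      have "filterlim \<epsilon> (at_right 0) sequentially"
        using \<epsilon> by (auto simp: filterlim_at intro!: always_eventually less_imp_neq[THEN not_sym])
      then have "filterlim (\<lambda>k. \<epsilon> (r k)) (at_right 0) sequentially"
        by (rule filterlim_compose[OF _ filterlim_subseq[OF v(3)]])
      from filterlim_compose[OF I_phi_test_eq_limit[OF lam u] this]
      have "(\<lambda>k. U (r k) x) \<longlonglongrightarrow> of_real (szego_const lam) * I_phi_test lam u x"
        unfolding U_def by (intro tendsto_intros)
      then show "v x = of_real (szego_const lam) * I_phi_test lam u x" by (rule LIMSEQ_unique[OF x])
    qed
  qed
qed

text \<open>By contraction, the projections of approximating test functions form a Cauchy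
  sequence.\<close>

lemma projection_exists:
  fixes lam :: "real ^ 'n::finite"
  assumes lam: "\<And>j. lam $ j > 0" and u: "u \<in> L2"
  shows "\<exists>v. is_projection lam u v"
proof -
  obtain \<phi> where \<phi>: "\<And>k. test_fun (\<phi> k)" "L2_tendsto \<phi> u" using L2_test_dense[OF u] by blast
  have \<phi>_L2: "\<phi> k \<in> L2" for k by (rule test_fun_L2[OF \<phi>(1)])
  have "\<forall>k. \<exists>v. is_projection lam (\<phi> k) v" using projection_test_fun[OF lam \<phi>(1)] by metis
  from choice[OF this] obtain V where V: "\<And>k. is_projection lam (\<phi> k) (V k)" by blast
  have V_CR: "V k \<in> weakly_CR lam" for k using V by (simp add: is_projection_def)
  have V_L2: "V k \<in> L2" for k by (rule weakly_CR_L2[OF V_CR])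
  have "\<exists>N. \<forall>k\<ge>N. \<forall>l\<ge>N. L2_norm (\<lambda>x. V k x - V l x) < e" if "e > 0" for e
    using L2_tendsto_Cauchy[OF \<phi>_L2 u \<phi>(2) that] is_projection_contraction[OF \<phi>_L2 \<phi>_L2 V V] by (meson le_less_trans)
  from L2_complete[of V, OF V_L2 this] obtain v where v: "v \<in> L2" "L2_tendsto V v" by blast
  have "L2_inner u g = L2_inner v g" if g: "g \<in> weakly_CR lam" for g
  proof (rule LIMSEQ_unique)
    show "(\<lambda>k. L2_inner (\<phi> k) g) \<longlonglongrightarrow> L2_inner u g"
      by (rule L2_tendsto_inner[OF \<phi>_L2 u weakly_CR_L2[OF g] \<phi>(2)])
    have "(\<lambda>k. L2_inner (V k) g) \<longlonglongrightarrow> L2_inner v g"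
      by (rule L2_tendsto_inner[OF V_L2 v(1) weakly_CR_L2[OF g] v(2)])
    then show "(\<lambda>k. L2_inner (\<phi> k) g) \<longlonglongrightarrow> L2_inner v g"
      using V g by (simp add: is_projection_def)
  qed
  then show ?thesis
    using weakly_CR_closed[OF V_CR v] by (auto simp: is_projection_def)
qed

text \<open>\<open>szego\<close> chooses among the projections, so existence has to be known before
  the choice says anything.\<close>

lemma szego_is_projection:
  fixes lam :: "real ^ 'n::finite"
  assumes lam: "\<And>j. lam $ j > 0" and u: "u \<in> L2"
  shows "is_projection lam u (szego lam u)"
proof -
  have iff: "is_projection lam u v \<longleftrightarrow> v \<in> weakly_CR lam \<and> (\<forall>g\<in>weakly_CR lam. L2_inner (\<lambda>x. u x - v x) g = 0)"
    if "u \<in> L2" for u v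
    using that unfolding is_projection_def
    by (auto simp: L2_inner_diff_left weakly_CR_L2)
  obtain P where "\<And>u. u \<in> L2 \<Longrightarrow> is_projection lam u (P u)"
    using projection_exists[OF lam] by metis
  then have "orth_projection (ker_box_b lam) P"
    by (auto simp: orth_projection_def ker_box_b_eq iff)
  then have "orth_projection (ker_box_b lam) (szego lam)"
    unfolding szego_def by (rule someI[of "orth_projection (ker_box_b lam)"])
  then show ?thesis using u by (auto simp: orth_projection_def ker_box_b_eq iff)
qed

text \<open>Continuity is inherited from the contraction property of the projection instead of an
  estimate for the singular kernel.\<close>

lemma L2_continuous_extension_szego:
  fixes lam :: "real ^ 'n::finite"
  assumes lam: "\<And>j. lam $ j > 0"
  shows "L2_continuous_extension (I_phi_test lam) (\<lambda>u x. of_real (1 / szego_const lam) * szego lam u x)"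
  unfolding L2_continuous_extension_def
proof (intro conjI ballI allI impI)
  have S_L2: "szego lam u \<in> L2" if "u \<in> L2" for u
    using szego_is_projection[OF lam that] by (auto simp: is_projection_def weakly_CR_L2)
  have c: "szego_const lam > 0" by (rule szego_const_pos[OF lam])
  show "(\<lambda>x. of_real (1 / szego_const lam) * szego lam u x) \<in> L2" if "u \<in> L2" for u
    by (intro L2_scale S_L2 that)
  show "L2_tendsto (\<lambda>k x. of_real (1 / szego_const lam) * szego lam (U k) x) (\<lambda>x. of_real (1 / szego_const lam) * szego lam u x)"
    if "u \<in> L2" "(\<forall>k. U k \<in> L2) \<and> L2_tendsto U u" for U u
  proof -
    have U: "U k \<in> L2" for k using that by blast
    have lim: "(\<lambda>k. 1 / szego_const lam * L2_norm (\<lambda>x. U k x - u x)) \<longlonglongrightarrow> 1 / szego_const lam * 0"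
      using that unfolding L2_tendsto_def by (intro tendsto_intros) auto
    have le: "L2_norm (\<lambda>x. of_real (1 / szego_const lam) * szego lam (U k) x - of_real (1 / szego_const lam) * szego lam u x)
        \<le> 1 / szego_const lam * L2_norm (\<lambda>x. U k x - u x)" for k
    proof -
      have "L2_norm (\<lambda>x. of_real (1 / szego_const lam) * (szego lam (U k) x - szego lam u x)) = 1 / szego_const lam * L2_norm (\<lambda>x. szego lam (U k) x - szego lam u x)"
        unfolding L2_norm_scale using c by (simp add: norm_divide)
      also have "\<dots> \<le> 1 / szego_const lam * L2_norm (\<lambda>x. U k x - u x)"
        using c by (intro mult_left_mono is_projection_contraction[OF U that(1) szego_is_projection[OF lam U] szego_is_projection[OF lam that(1)]]) auto
      finally show ?thesis by (simp only: right_diff_distrib)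
    qed
    show ?thesis unfolding L2_tendsto_def
    proof (rule tendsto_sandwich[OF _ _ tendsto_const lim[unfolded mult_zero_right]])
      show "\<forall>\<^sub>F k in sequentially. L2_norm (\<lambda>x. of_real (1 / szego_const lam) * szego lam (U k) x - of_real (1 / szego_const lam) * szego lam u x)
          \<le> 1 / szego_const lam * L2_norm (\<lambda>x. U k x - u x)"
        by (rule always_eventually) (rule allI, rule le)
    qed simp
  qed
  show "AE x in heis_vol. of_real (1 / szego_const lam) * szego lam u x = I_phi_test lam u x" if u: "test_fun u" for u
  proof -
    obtain v where v: "is_projection lam u v" "AE x in heis_vol. v x = of_real (szego_const lam) * I_phi_test lam u x"
      using projection_test_fun[OF lam u] by blast
    show ?thesis
      using v(2) is_projection_unique[OF test_fun_L2[OF u] szego_is_projection[OF lam test_fun_L2[OF u]] v(1)]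
      by eventually_elim (use c in simp)
  qed
qed

text \<open>Density of the test functions. On these the two extensions agree only almost everywhere,
  a difference that \<open>L2_norm\<close> does not see.\<close>

lemma L2_continuous_extension_unique:
  assumes "L2_continuous_extension A0 A" "L2_continuous_extension A0 A'" and u: "u \<in> L2"
  shows "AE x in heis_vol. A u x = A' u x"
proof -
  obtain \<phi> where \<phi>: "\<And>k. test_fun (\<phi> k)" "L2_tendsto \<phi> u" using L2_test_dense[OF u] by blast
  have \<phi>_L2: "\<phi> k \<in> L2" for k by (rule test_fun_L2[OF \<phi>(1)])
  have A: "\<And>v. v \<in> L2 \<Longrightarrow> A v \<in> L2" "\<And>v. v \<in> L2 \<Longrightarrow> A' v \<in> L2"
    "L2_tendsto (\<lambda>k. A (\<phi> k)) (A u)" "L2_tendsto (\<lambda>k. A' (\<phi> k)) (A' u)"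
    using assms \<phi> \<phi>_L2 unfolding L2_continuous_extension_def by auto
  have ae: "AE x in heis_vol. A' (\<phi> k) x - A' u x = A (\<phi> k) x - A' u x" for k
  proof -
    have "AE x in heis_vol. A (\<phi> k) x = A0 (\<phi> k) x" "AE x in heis_vol. A' (\<phi> k) x = A0 (\<phi> k) x"
      using assms \<phi>(1) unfolding L2_continuous_extension_def by auto
    then show ?thesis by eventually_elim simp
  qed
  have "L2_norm (\<lambda>x. A' (\<phi> k) x - A' u x) = L2_norm (\<lambda>x. A (\<phi> k) x - A' u x)" for k
    by (intro L2_norm_cong_AE borel_measurable_diff L2_measurable A \<phi>_L2 u ae)
  then have "L2_tendsto (\<lambda>k. A (\<phi> k)) (A' u)" using A(4) by (simp add: L2_tendsto_def)
  from L2_tendsto_unique[OF _ _ _ A(3) this] show ?thesis using A(1,2) \<phi>_L2 u by blast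
qed

theorem theorem1p2:
  fixes lam :: "real ^ 'n::finite"
  assumes "\<And>j. lam $ j > 0"
  shows "\<forall>u\<in>L2. AE x in heis_vol.
           szego lam u x =
             of_real ((\<Prod>j\<in>UNIV. \<bar>lam $ j\<bar>) / (2 * pi ^ (CARD('n) + 1)) * fact CARD('n))
             * I_phi lam u x"
proof
  fix u :: "'n heis \<Rightarrow> complex" assume u: "u \<in> L2"
  note ext = L2_continuous_extension_szego[OF assms]
  \<comment> \<open>The scaled projection witnesses that an extension exists, so the choice in
    \<open>I_phi\<close> is one as well.\<close>
  have "L2_continuous_extension (I_phi_test lam) (I_phi lam)"
    unfolding I_phi_def using ext by (rule someI[of "L2_continuous_extension (I_phi_test lam)"])
  from L2_continuous_extension_unique[OF ext this u]
  show "AE x in heis_vol. szego lam u x =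
      of_real ((\<Prod>j\<in>UNIV. \<bar>lam $ j\<bar>) / (2 * pi ^ (CARD('n) + 1)) * fact CARD('n)) * I_phi lam u x"
    unfolding szego_const_def[symmetric]
  proof eventually_elim
    fix x assume "of_real (1 / szego_const lam) * szego lam u x = I_phi lam u x"
    from this[symmetric] show "szego lam u x = of_real (szego_const lam) * I_phi lam u x"
      using szego_const_pos[OF assms] by simp
  qed
qed

end
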